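(* Fix $\boldsymbol\omega\in\Omega$ and write $\lambda_n(\mathbf B)=\lambda_n(\boldsymbol\omega,\mathbf B)$. Let $K\subset\{1,\dots,2d\}$ and $n\ge1$. (i) The restriction of $\lambda_n$ to $\mathcal O_\emptyset^{\mathbb C}$ is continuous. (ii) Let $K$ be nonempty and let $n^0,n^+,n^-,n_0^0,n_0^+,n_0^-$ be nonnegative integers with $n^0+n^++n^-=n_0^0+n_0^++n_0^-=\sharp(K)$, $0\le n^0<n_0^0\le\sharp(K)$, $n^+\ge n_0^+$ and $n^-\ge n_0^-$. Then for any $\mathbf A\in J^{(n_0^0,n_0^+,n_0^-)}_{\mathcal O_K^{\mathbb C}}$, $$\lim_{J^{(n^0,n^+,n^-)}_{\mathcal O_K^{\mathbb C}}\ni\mathbf B\to\mathbf A}\lambda_n(\mathbf B)=-\infty\quad (n\le n^+-n_0^+),\qquad \lim_{J^{(n^0,n^+,n^-)}_{\mathcal O_K^{\mathbb C}}\ni\mathbf B\to\mathbf A}\lambda_n(\mathbf B)=\lambda_{n-(n^+-n_0^+)}(\mathbf A)\quad (n>n^+-n_0^+).$$ Consequently, the singular set is $\Sigma^{\mathbb C}=\{[A\,|\,B]\in\mathcal B^{\mathbb C}: n^0(B)>0\}$.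
   Context: Let $d\ge2$, $[a,b]$ compact. $\Omega$ is the set of triples $(P,Q,W)$ of $d\times d$ real symmetric matrix-valued functions in $L^\infty([a,b],\mathbb R^{d\times d})$ with $P(t)\ge\mu_1I_d$, $W(t)\ge\mu_2I_d$ a.e. for some $\mu_1,\mu_2>0$. $\mathcal B^{\mathbb C}$ is the quotient of the set of complex $2d\times4d$ matrices $(A\,|\,B)$ with $\operatorname{rank}(A\,|\,B)=2d$, $AB^*=BA^*$ (topology from $\mathbb C^{8d^2}$) by the left action of $GL(2d,\mathbb C)$, with quotient topology. The problem $(\boldsymbol\omega,[A\,|\,B])$ is $-(Py')'+Qy=\lambda Wy$ with $(A\,|\,B)(-y(a)^T,y(b)^T,(Py')(a)^T,(Py')(b)^T)^T=0$; its eigenvalues (real, discrete, bounded below) are $\lambda_1\le\lambda_2\le\cdots$ counted with multiplicity. For $K\subset\{1,\dots,2d\}$, $\mathcal O_K^{\mathbb C}$ is the set of $[A\,|\,B]$ having a representative whose columns are $a_i=-e_i$, $b_i=s_i$ for $i\in K$ and $a_i=s_i$, $b_i=e_i$ for $i\notin K$, where $S=(s_1,\dots,s_{2d})=(s_{lj})$ is a $2d\times2d$ Hermitian matrix (uniquely determined, denoted $S(\mathbf A)$) and $e_i$ are standard basis vectors; $\mathcal O_K^{\mathbb C}$ has the topology from $\mathcal B^{\mathbb C}$. For nonempty $K=\{n_1<\dots<n_{m_0}\}$, $S_K(\mathbf A)=(s_{n_in_j})_{i,j=1}^{m_0}$. For nonnegative integers with $n^0+n^++n^-=\sharp(K)$,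 $J^{(n^0,n^+,n^-)}_{\mathcal O_K^{\mathbb C}}$ is the set of $\mathbf A\in\mathcal O_K^{\mathbb C}$ such that $S_K(\mathbf A)$ has exactly $n^0$ zero, $n^+$ positive and $n^-$ negative eigenvalues counted with multiplicity. For $[A\,|\,B]$, $n^0(B)=\dim\ker B$. The singular set $\Sigma^{\mathbb C}$ is the set of $\mathbf A\in\mathcal B^{\mathbb C}$ at which, for some $n\ge1$, the map $\mathbf B\mapsto\lambda_n(\boldsymbol\omega,\mathbf B)$ on $\mathcal B^{\mathbb C}$ is not continuous. *)

theory Defs
  imports "HOL-Analysis.Analysis"
    "Jordan_Normal_Form.Schur_Decomposition"
    "Jordan_Normal_Form.DL_Rank"
    "Jordan_Normal_Form.Matrix_Kernel"
    "Jordan_Normal_Form.Char_Poly"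
begin

text \<open>Matrix-valued functions on [a,b] are represented entrywise:
  P t i j is the (i,j) entry (0-based, i,j < d) of P(t).\<close>

definition Linf_entry :: "real \<Rightarrow> real \<Rightarrow> (real \<Rightarrow> real) \<Rightarrow> bool" where
  "Linf_entry a b f \<longleftrightarrow> set_borel_measurable lebesgue {a..b} f \<and>
     (\<exists>C. AE t in lebesgue. t \<in> {a..b} \<longrightarrow> \<bar>f t\<bar> \<le> C)"

definition sym_Linf :: "nat \<Rightarrow> real \<Rightarrow> real \<Rightarrow> (real \<Rightarrow> nat \<Rightarrow> nat \<Rightarrow> real) \<Rightarrow> bool" where
  "sym_Linf d a b P \<longleftrightarrow> (\<forall>i<d. \<forall>j<d. Linf_entry a b (\<lambda>t. P t i j)) \<and>
     (AE t in lebesgue. t \<in> {a..b} \<longrightarrow> (\<forall>i<d. \<forall>j<d. P t i j = P t j i))"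

definition loewner_ge :: "nat \<Rightarrow> (nat \<Rightarrow> nat \<Rightarrow> real) \<Rightarrow> real \<Rightarrow> bool" where
  "loewner_ge d M mu \<longleftrightarrow>
     (\<forall>x :: nat \<Rightarrow> real. (\<Sum>i<d. \<Sum>j<d. x i * M i j * x j) \<ge> mu * (\<Sum>i<d. (x i)\<^sup>2))"

definition in_Omega :: "nat \<Rightarrow> real \<Rightarrow> real \<Rightarrow> (real \<Rightarrow> nat \<Rightarrow> nat \<Rightarrow> real)
    \<Rightarrow> (real \<Rightarrow> nat \<Rightarrow> nat \<Rightarrow> real) \<Rightarrow> (real \<Rightarrow> nat \<Rightarrow> nat \<Rightarrow> real) \<Rightarrow> bool" where
  "in_Omega d a b P Q W \<longleftrightarrow> sym_Linf d a b P \<and> sym_Linf d a b Q \<and> sym_Linf d a b W \<and>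
     (\<exists>mu1>0. \<exists>mu2>0.
        (AE t in lebesgue. t \<in> {a..b} \<longrightarrow> loewner_ge d (P t) mu1) \<and>
        (AE t in lebesgue. t \<in> {a..b} \<longrightarrow> loewner_ge d (W t) mu2))"

definition Ablk :: "nat \<Rightarrow> complex mat \<Rightarrow> complex mat" where
  "Ablk d M = mat (2*d) (2*d) (\<lambda>(i,j). M $$ (i, j))"

definition Bblk :: "nat \<Rightarrow> complex mat \<Rightarrow> complex mat" where
  "Bblk d M = mat (2*d) (2*d) (\<lambda>(i,j). M $$ (i, j + 2*d))"

definition bc_reps :: "nat \<Rightarrow> complex mat set" where
  "bc_reps d = {M \<in> carrier_mat (2*d) (4*d).
      vec_space.rank (2*d) M = 2*d \<and>
      Ablk d M * mat_adjoint (Bblk d M) = Bblk d M * mat_adjoint (Ablk d M)}"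

definition GL_orbit :: "nat \<Rightarrow> complex mat \<Rightarrow> complex mat set" where
  "GL_orbit d M = {G * M | G. G \<in> carrier_mat (2*d) (2*d) \<and> invertible_mat G}"

definition bc_space :: "nat \<Rightarrow> complex mat set set" where
  "bc_space d = GL_orbit d ` bc_reps d"

definition reps_top :: "nat \<Rightarrow> complex mat topology" where
  "reps_top d = topology (\<lambda>U. U \<subseteq> bc_reps d \<and>
     (\<forall>M\<in>U. \<exists>e>0. \<forall>N\<in>bc_reps d.
        (\<forall>i<2*d. \<forall>j<4*d. cmod (N $$ (i,j) - M $$ (i,j)) < e) \<longrightarrow> N \<in> U))"

definition bc_top :: "nat \<Rightarrow> complex mat set topology" where
  "bc_top d = topology (\<lambda>V. V \<subseteq> bc_space d \<and>
     openin (reps_top d) {M \<in> bc_reps d. GL_orbit d M \<in> V})"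

text \<open>y is an eigenfunction of (omega, [A|B]) for lambda: y and u = P y' are absolutely
  continuous on [a,b] (indefinite integrals of integrable functions y', u'),
  u = P y' and u' = (Q - lambda W) y a.e. (i.e. -(P y')' + Q y = lambda W y), and the boundary
  condition (A|B)(-y(a), y(b), (Py')(a), (Py')(b)) = 0 holds.\<close>
definition bd_vec :: "nat \<Rightarrow> real \<Rightarrow> real \<Rightarrow> (real \<Rightarrow> nat \<Rightarrow> complex)
     \<Rightarrow> (real \<Rightarrow> nat \<Rightarrow> complex) \<Rightarrow> complex vec" where
  "bd_vec d a b y u = vec (4*d) (\<lambda>k. if k < d then - y a k
       else if k < 2*d then y b (k - d)
       else if k < 3*d then u a (k - 2*d) else u b (k - 3*d))"

definition eigfun :: "nat \<Rightarrow> real \<Rightarrow> real \<Rightarrow> (real \<Rightarrow> nat \<Rightarrow> nat \<Rightarrow> real)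
    \<Rightarrow> (real \<Rightarrow> nat \<Rightarrow> nat \<Rightarrow> real) \<Rightarrow> (real \<Rightarrow> nat \<Rightarrow> nat \<Rightarrow> real)
    \<Rightarrow> complex mat set \<Rightarrow> complex \<Rightarrow> (real \<Rightarrow> nat \<Rightarrow> complex) \<Rightarrow> bool" where
  "eigfun d a b P Q W A lam y \<longleftrightarrow>
     (\<exists>y' u u'.
        (\<forall>i<d. set_integrable lborel {a..b} (\<lambda>s. y' s i) \<and>
               set_integrable lborel {a..b} (\<lambda>s. u' s i) \<and>
               (\<forall>t\<in>{a..b}. y t i = y a i + (LINT s:{a..t}|lborel. y' s i) \<and>
                            u t i = u a i + (LINT s:{a..t}|lborel. u' s i))) \<and>
        (AE s in lborel. s \<in> {a..b} \<longrightarrow>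
           (\<forall>i<d. u s i = (\<Sum>j<d. complex_of_real (P s i j) * y' s j) \<and>
                  u' s i = (\<Sum>j<d. (complex_of_real (Q s i j) - lam * complex_of_real (W s i j)) * y s j))) \<and>
        (\<forall>M\<in>A. M *\<^sub>v bd_vec d a b y u = 0\<^sub>v (2*d)))"

definition lin_indep_on :: "nat \<Rightarrow> real \<Rightarrow> real \<Rightarrow> (real \<Rightarrow> nat \<Rightarrow> complex) set \<Rightarrow> bool" where
  "lin_indep_on d a b F \<longleftrightarrow>
     (\<forall>c :: (real \<Rightarrow> nat \<Rightarrow> complex) \<Rightarrow> complex.
        (\<forall>t\<in>{a..b}. \<forall>i<d. (\<Sum>f\<in>F. c f * f t i) = 0) \<longrightarrow> (\<forall>f\<in>F. c f = 0))"

definition eig_mult :: "nat \<Rightarrow> real \<Rightarrow> real \<Rightarrow> (real \<Rightarrow> nat \<Rightarrow> nat \<Rightarrow> real)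
    \<Rightarrow> (real \<Rightarrow> nat \<Rightarrow> nat \<Rightarrow> real) \<Rightarrow> (real \<Rightarrow> nat \<Rightarrow> nat \<Rightarrow> real)
    \<Rightarrow> complex mat set \<Rightarrow> complex \<Rightarrow> nat" where
  "eig_mult d a b P Q W A lam = Sup {card F | F. finite F \<and>
      F \<subseteq> {y. eigfun d a b P Q W A lam y} \<and> lin_indep_on d a b F}"

definition eig_count :: "nat \<Rightarrow> real \<Rightarrow> real \<Rightarrow> (real \<Rightarrow> nat \<Rightarrow> nat \<Rightarrow> real)
    \<Rightarrow> (real \<Rightarrow> nat \<Rightarrow> nat \<Rightarrow> real) \<Rightarrow> (real \<Rightarrow> nat \<Rightarrow> nat \<Rightarrow> real)
    \<Rightarrow> complex mat set \<Rightarrow> real \<Rightarrow> nat" where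
  "eig_count d a b P Q W A mu =
     (\<Sum>lam \<in> {lam :: real. 0 < eig_mult d a b P Q W A (complex_of_real lam) \<and> lam \<le> mu}.
        eig_mult d a b P Q W A (complex_of_real lam))"

definition eigval :: "nat \<Rightarrow> real \<Rightarrow> real \<Rightarrow> (real \<Rightarrow> nat \<Rightarrow> nat \<Rightarrow> real)
    \<Rightarrow> (real \<Rightarrow> nat \<Rightarrow> nat \<Rightarrow> real) \<Rightarrow> (real \<Rightarrow> nat \<Rightarrow> nat \<Rightarrow> real)
    \<Rightarrow> nat \<Rightarrow> complex mat set \<Rightarrow> real" where
  "eigval d a b P Q W n A = Inf {mu. n \<le> eig_count d a b P Q W A mu}"

definition hermitian_mat :: "complex mat \<Rightarrow> bool" where
  "hermitian_mat S \<longleftrightarrow> mat_adjoint S = S"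

text \<open>K \<subseteq> {1..2d} (1-based indices as in the paper). Column i of the representative's
  A-part is column i-1 of the matrix, column i of the B-part is column 2d+i-1.\<close>
definition rep_K :: "nat \<Rightarrow> nat set \<Rightarrow> complex mat \<Rightarrow> complex mat" where
  "rep_K d K S = mat (2*d) (4*d) (\<lambda>(r,c).
      if c < 2*d then
        (if c + 1 \<in> K then - (if r = c then 1 else 0) else S $$ (r, c))
      else
        (if c - 2*d + 1 \<in> K then S $$ (r, c - 2*d) else (if r = c - 2*d then 1 else 0)))"

definition O_K :: "nat \<Rightarrow> nat set \<Rightarrow> complex mat set set" where
  "O_K d K = {A \<in> bc_space d. \<exists>S \<in> carrier_mat (2*d) (2*d). hermitian_mat S \<and>
                   rep_K d K S \<in> A}"

definition sub_K :: "nat set \<Rightarrow> complex mat \<Rightarrow> complex mat" where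
  "sub_K K S = (let ks = sorted_list_of_set K in
      mat (card K) (card K) (\<lambda>(i,j). S $$ (ks ! i - 1, ks ! j - 1)))"

definition inertia :: "complex mat \<Rightarrow> nat \<times> nat \<times> nat" where
  "inertia M = (let p = char_poly M in
     (Polynomial.order 0 p,
      \<Sum>x\<in>{x. poly p x = 0 \<and> Im x = 0 \<and> 0 < Re x}. Polynomial.order x p,
      \<Sum>x\<in>{x. poly p x = 0 \<and> Im x = 0 \<and> Re x < 0}. Polynomial.order x p))"

definition J_K :: "nat \<Rightarrow> nat set \<Rightarrow> nat \<Rightarrow> nat \<Rightarrow> nat \<Rightarrow> complex mat set set" where
  "J_K d K n0 np nm = {A \<in> O_K d K. \<exists>S \<in> carrier_mat (2*d) (2*d). hermitian_mat S \<and>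
        rep_K d K S \<in> A \<and> inertia (sub_K K S) = (n0, np, nm)}"

definition singular_set :: "nat \<Rightarrow> real \<Rightarrow> real \<Rightarrow> (real \<Rightarrow> nat \<Rightarrow> nat \<Rightarrow> real)
    \<Rightarrow> (real \<Rightarrow> nat \<Rightarrow> nat \<Rightarrow> real) \<Rightarrow> (real \<Rightarrow> nat \<Rightarrow> nat \<Rightarrow> real) \<Rightarrow> complex mat set set" where
  "singular_set d a b P Q W = {A \<in> bc_space d. \<exists>n\<ge>1.
      \<not> limitin euclideanreal (eigval d a b P Q W n) (eigval d a b P Q W n A) (atin (bc_top d) A)}"

text \<open>n^0(B) = dim ker B for the class [A|B] (independent of the representative).\<close>
definition n0B :: "nat \<Rightarrow> complex mat set \<Rightarrow> nat" where
  "n0B d A = kernel_dim (Bblk d (SOME M. M \<in> A))"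

end

theory Submission
  imports Defs
begin

text \<open>For a boundary condition in a chart \<open>\<O>\<^sub>K\<close> with Hermitian coordinate \<open>S\<close> consider the pairs of a
  function \<open>y\<close> and a vector \<open>x \<in> \<complex>\<^sup>2\<^sup>d\<close> with \<open>x\<^sub>i = Y1\<^sub>i\<close> for \<open>i \<notin> K\<close>, where \<open>Y1 = (- y(a), y(b))\<close>, and on them the
  Hermitian form
  \<open>H\<^sub>\<mu> = \<integral> (y'\<^sup>* P y' + y\<^sup>* (Q - \<mu> W) y) + x\<^sup>* S x - 2 Re (\<Sum>i\<in>K. x\<^sub>i\<^sup>* Y1\<^sub>i)\<close>.
  Its radical is the eigenspace for \<open>\<mu>\<close>. On functions that vanish at the nodes of a fine partition the form
  is positive, and the broken extremals (solutions between the nodes) are a finite-dimensional orthogonal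
  complement. Hence the index of \<open>H\<^sub>\<mu>\<close> is finite, jumps at the eigenvalues by their multiplicities, and is
  locally constant in \<open>S\<close> as long as \<open>\<mu>\<close> is not an eigenvalue. For \<open>\<mu> \<rightarrow> -\<infinity>\<close> the index is the number of
  nonpositive eigenvalues of \<open>S\<^sub>K\<close>, so the number of eigenvalues below \<open>\<mu>\<close> is the index minus
  \<open>#K - n\<^sup>+(S\<^sub>K)\<close>. If \<open>n\<^sup>+\<close> is larger by \<open>k\<close> near a boundary condition, then so is the number of eigenvalues
  below \<open>\<mu>\<close>: \<open>k\<close> of them come from \<open>-\<infinity>\<close>. Finally, a boundary condition with \<open>ker B \<noteq> 0\<close> lies in a chart in
  which \<open>S\<^sub>K = 0\<close>, and replacing \<open>S\<^sub>K\<close> by \<open>\<epsilon> I\<close> sends the first eigenvalue to \<open>-\<infinity>\<close>.\<close>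

section \<open>Hermitian forms and their index\<close>

text \<open>Eliminating \<open>x\<close> from the boundary conditions would require an inverse of
  \<open>S\<^sub>K\<close>, or a form domain that shrinks with the kernel of
  \<open>S\<^sub>K\<close>; both degenerate exactly where eigenvalues jump. With \<open>x\<close>
  kept as an independent variable the domain is the same for the whole chart and the form is affine
  in \<open>S\<close>, so the index survives the degeneration. All discontinuity is thereby moved
  into one integer, the index near -\<infinity>. There a null vector of \<open>S\<^sub>K\<close>
  counts as negative: the pairing with \<open>Y1\<close> is linear in \<open>y\<close> while the
  energy is quadratic, so a small multiple of a suitable \<open>y\<close> makes the form negative. A
  positive eigenvalue, however small, does not count, since for \<mu> close to -\<infinity> it
  outweighs the pairing. No operator, resolvent or compact embedding is used: multiplicities are
  dimensions of radicals, and the index is computed by linear algebra on finitely many nodal values.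
  The price is that the partition has to be refined with the bound on \<mu>; the index itself does
  not refer to it.\<close>

lemma homogeneous_system_nontrivial:
  fixes A :: "'i \<Rightarrow> 'j \<Rightarrow> 'a::field"
  assumes "finite I" "finite J" "card I < card J"
  shows "\<exists>c. (\<exists>j\<in>J. c j \<noteq> 0) \<and> (\<forall>i\<in>I. (\<Sum>j\<in>J. A i j * c j) = 0)"
  using assms
proof (induction I arbitrary: J A rule: finite_induct)
  case empty
  then obtain j where "j \<in> J" by (metis card.empty less_irrefl card_gt_0_iff equals0I)
  then show ?case by (intro exI[of _ "\<lambda>_. 1"]) auto
next
  case (insert i I)
  show ?case
  proof (cases "\<forall>j\<in>J. A i j = 0")
    case True
    have "card I < card J" using insert.hyps insert.prems by simp
    from insert.IH[OF insert.prems(1) this, of A] obtain c where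
      "\<exists>j\<in>J. c j \<noteq> 0" "\<forall>i\<in>I. (\<Sum>j\<in>J. A i j * c j) = 0" by blast
    then show ?thesis using True by (intro exI[of _ c]) (auto simp: sum.neutral)
  next
    case False
    then obtain p where p: "p \<in> J" "A i p \<noteq> 0" by blast
    define J' where "J' = J - {p}"
    have J': "finite J'" "card I < card J'" "p \<notin> J'" "J = insert p J'"
      using insert p unfolding J'_def by auto
    \<comment> \<open>Row operations with pivot \<open>A i p\<close>: the unknown \<open>p\<close>
      is eliminated from all other equations, and its value in \<open>c'\<close> is recovered from
      equation \<open>i\<close>.\<close>
    define B where "B = (\<lambda>l j. A l j - A l p * A i j / A i p)"
    from insert.IH[OF J'(1,2), of B] obtain c where c:
      "\<exists>j\<in>J'. c j \<noteq> 0" "\<And>l. l\<in>I \<Longrightarrow> (\<Sum>j\<in>J'. B l j * c j) = 0" by blast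
    define s where "s = (\<Sum>j\<in>J'. A i j * c j)"
    define c' where "c' = c(p := - s / A i p)"
    have sum: "(\<Sum>j\<in>J. A l j * c' j) = (\<Sum>j\<in>J'. A l j * c j) - A l p * s / A i p" for l
    proof -
      have "(\<Sum>j\<in>J'. A l j * c' j) = (\<Sum>j\<in>J'. A l j * c j)"
        by (rule sum.cong) (use J' in \<open>auto simp: c'_def\<close>)
      then show ?thesis using J' by (simp add: c'_def)
    qed
    have "(\<Sum>j\<in>J. A l j * c' j) = 0" if "l \<in> I" for l
    proof -
      have "(\<Sum>j\<in>J'. B l j * c j) = (\<Sum>j\<in>J'. A l j * c j) - A l p * s / A i p"
        unfolding B_def s_def by (simp add: algebra_simps sum_subtractf sum_distrib_left sum_divide_distrib)
      then show ?thesis using c(2)[OF that] sum[of l] by simp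
    qed
    moreover have "(\<Sum>j\<in>J. A i j * c' j) = 0" using sum[of i] p by (simp add: s_def)
    moreover have "\<exists>j\<in>J. c' j \<noteq> 0" using c(1) J' by (auto simp: c'_def)
    ultimately show ?thesis by (intro exI[of _ c']) auto
  qed
qed

text \<open>Adjoin the right-hand side as one more column, indexed by \<open>None\<close>: the
  homogeneous system then has more unknowns than equations, and injectivity forces the coefficient
  of that column to be nonzero.\<close>

lemma square_system_solvable:
  fixes A :: "'i \<Rightarrow> 'i \<Rightarrow> 'a::field"
  assumes "finite I" and inj: "\<And>c. (\<And>i. i \<in> I \<Longrightarrow> (\<Sum>j\<in>I. A i j * c j) = 0) \<Longrightarrow> \<forall>j\<in>I. c j = 0"
  shows "\<exists>c. \<forall>i\<in>I. (\<Sum>j\<in>I. A i j * c j) = b i"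
proof -
  define B where "B = (\<lambda>i j. case j of None \<Rightarrow> b i | Some j \<Rightarrow> A i j)"
  define J where "J = insert None (Some ` I)"
  have "card I < card J" using assms(1) by (simp add: J_def card_image)
  then obtain c where c: "\<exists>j\<in>J. c j \<noteq> 0" "\<And>i. i\<in>I \<Longrightarrow> (\<Sum>j\<in>J. B i j * c j) = 0"
    using homogeneous_system_nontrivial[of I J B] assms(1) by (auto simp: J_def)
  have s: "(\<Sum>j\<in>J. B i j * c j) = b i * c None + (\<Sum>j\<in>I. A i j * c (Some j))" for i
    unfolding J_def using assms(1) by (simp add: sum.reindex B_def)
  have n: "c None \<noteq> 0"
  proof
    assume 0: "c None = 0"
    have "\<forall>j\<in>I. c (Some j) = 0" by (rule inj) (use c(2) s 0 in simp)
    then show False using c(1) 0 by (auto simp: J_def)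
  qed
  have "(\<Sum>j\<in>I. A i j * (- c (Some j) / c None)) = b i" if "i \<in> I" for i
  proof -
    have "(\<Sum>j\<in>I. A i j * (- c (Some j) / c None)) = - (\<Sum>j\<in>I. A i j * c (Some j)) / c None"
      by (simp add: sum_negf sum_divide_distrib)
    also have "\<dots> = b i" using c(2)[OF that] s[of i] n by (simp add: field_simps add_eq_0_iff)
    finally show ?thesis .
  qed
  then show ?thesis by (intro exI[of _ "\<lambda>j. - c (Some j) / c None"]) auto
qed

section \<open>Subspaces of function spaces and linear functionals\<close>

definition lc :: "'j set \<Rightarrow> ('j \<Rightarrow> complex) \<Rightarrow> ('j \<Rightarrow> 'p \<Rightarrow> complex) \<Rightarrow> 'p \<Rightarrow> complex" where
  "lc J c v = (\<lambda>p. \<Sum>j\<in>J. c j * v j p)"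

definition linfun :: "('p \<Rightarrow> complex) set \<Rightarrow> (('p \<Rightarrow> complex) \<Rightarrow> complex) \<Rightarrow> bool" where
  "linfun X f \<longleftrightarrow> (\<forall>x\<in>X. \<forall>y\<in>X. f (\<lambda>p. x p + y p) = f x + f y) \<and>
     (\<forall>c. \<forall>x\<in>X. f (\<lambda>p. c * x p) = c * f x)"

lemma linfun_add: "linfun X f \<Longrightarrow> x \<in> X \<Longrightarrow> y \<in> X \<Longrightarrow> f (\<lambda>p. x p + y p) = f x + f y"
  and linfun_scale: "linfun X f \<Longrightarrow> x \<in> X \<Longrightarrow> f (\<lambda>p. c * x p) = c * f x"
  unfolding linfun_def by simp_all

text \<open>Subspaces are sets of complex functions on a type of points rather than a vector space
  type, because the domain of the form depends on \<open>d\<close>, the interval and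
  \<open>K\<close>.\<close>

locale vsubspace =
  fixes X :: "('p \<Rightarrow> complex) set"
  assumes zero_in: "(\<lambda>p. 0) \<in> X"
    and add_in: "\<And>x y. x \<in> X \<Longrightarrow> y \<in> X \<Longrightarrow> (\<lambda>p. x p + y p) \<in> X"
    and scale_in: "\<And>c x. x \<in> X \<Longrightarrow> (\<lambda>p. c * x p) \<in> X"
begin

lemma lc_in: "finite J \<Longrightarrow> (\<And>j. j \<in> J \<Longrightarrow> v j \<in> X) \<Longrightarrow> lc J c v \<in> X"
proof (induction J rule: finite_induct)
  case empty then show ?case using zero_in by (simp add: lc_def)
next
  case (insert j J)
  then show ?case using add_in[OF scale_in[of "v j" "c j"], of "lc J c v"] by (simp add: lc_def)
qed

lemma diff_in: "x \<in> X \<Longrightarrow> y \<in> X \<Longrightarrow> (\<lambda>p. x p - y p) \<in> X"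
  using add_in[of x "\<lambda>p. (-1) * y p"] scale_in[of y "-1"] by simp

lemma linfun_lc:
  assumes f: "linfun X f" and "finite J" "\<And>j. j \<in> J \<Longrightarrow> v j \<in> X"
  shows "f (lc J c v) = (\<Sum>j\<in>J. c j * f (v j))"
  using assms(2,3)
proof (induction J rule: finite_induct)
  case empty
  have "f (\<lambda>p. 0 * 0) = 0 * f (\<lambda>p. 0)" by (rule linfun_scale[OF f zero_in])
  then show ?case by (simp add: lc_def)
next
  case (insert j J)
  have "lc (insert j J) c v = (\<lambda>p. c j * v j p + lc J c v p)" using insert by (simp add: lc_def)
  moreover have "f (\<lambda>p. c j * v j p + lc J c v p) = f (\<lambda>p. c j * v j p) + f (lc J c v)"
    by (rule linfun_add[OF f scale_in lc_in]) (use insert in auto)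
  moreover have "f (\<lambda>p. c j * v j p) = c j * f (v j)"
    by (rule linfun_scale[OF f]) (use insert in auto)
  ultimately show ?case using insert by simp
qed

lemma linfun_diff:
  assumes f: "linfun X f" and "x \<in> X" "y \<in> X"
  shows "f (\<lambda>p. x p - y p) = f x - f y"
proof -
  have "f (\<lambda>p. x p + (-1) * y p) = f x + f (\<lambda>p. (-1) * y p)"
    by (rule linfun_add[OF f _ scale_in]) (use assms in auto)
  also have "f (\<lambda>p. (-1) * y p) = (-1) * f y" by (rule linfun_scale[OF f assms(3)])
  finally show ?thesis by simp
qed

end

locale herm_form = vsubspace X for X :: "('p \<Rightarrow> complex) set" +
  fixes H :: "('p \<Rightarrow> complex) \<Rightarrow> ('p \<Rightarrow> complex) \<Rightarrow> complex"
  assumes H_add: "\<And>x y z. x \<in> X \<Longrightarrow> y \<in> X \<Longrightarrow> z \<in> X \<Longrightarrow> H (\<lambda>p. x p + y p) z = H x z + H y z"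
    and H_scale: "\<And>c x z. x \<in> X \<Longrightarrow> z \<in> X \<Longrightarrow> H (\<lambda>p. c * x p) z = c * H x z"
    and H_sym: "\<And>x z. x \<in> X \<Longrightarrow> z \<in> X \<Longrightarrow> H z x = cnj (H x z)"
begin

lemma H_linfun: "z \<in> X \<Longrightarrow> linfun X (\<lambda>x. H x z)"
  unfolding linfun_def by (simp add: H_add H_scale)

lemma H_lc_left: "finite J \<Longrightarrow> (\<And>j. j \<in> J \<Longrightarrow> v j \<in> X) \<Longrightarrow> z \<in> X \<Longrightarrow>
    H (lc J c v) z = (\<Sum>j\<in>J. c j * H (v j) z)"
  using linfun_lc[OF H_linfun] by blast

lemma H_lc_right: "finite J \<Longrightarrow> (\<And>j. j \<in> J \<Longrightarrow> v j \<in> X) \<Longrightarrow> z \<in> X \<Longrightarrow>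
    H z (lc J c v) = (\<Sum>j\<in>J. cnj (c j) * H z (v j))"
  by (subst H_sym[OF lc_in]; (simp add: H_lc_left)?)
    (rule sum.cong, auto simp: H_sym[of _ z])

lemma H_diff_left: "x \<in> X \<Longrightarrow> y \<in> X \<Longrightarrow> z \<in> X \<Longrightarrow> H (\<lambda>p. x p - y p) z = H x z - H y z"
  using linfun_diff[OF H_linfun] by blast

lemma H_diff_right: "x \<in> X \<Longrightarrow> y \<in> X \<Longrightarrow> z \<in> X \<Longrightarrow> H z (\<lambda>p. x p - y p) = H z x - H z y"
  by (subst H_sym[OF diff_in]) (auto simp: H_diff_left H_sym[of _ z])

lemma H_add_right: "x \<in> X \<Longrightarrow> y \<in> X \<Longrightarrow> z \<in> X \<Longrightarrow> H z (\<lambda>p. x p + y p) = H z x + H z y"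
  by (subst H_sym[OF add_in]) (auto simp: H_add H_sym[of _ z])

lemma H_scale_right: "x \<in> X \<Longrightarrow> z \<in> X \<Longrightarrow> H z (\<lambda>p. c * x p) = cnj c * H z x"
  by (subst H_sym[OF scale_in]) (auto simp: H_scale H_sym[of _ z])

text \<open>The choice of multiplier \<open>t\<close> is the usual one in the proof of Cauchy--Schwarz.\<close>

lemma nonneg_form_isotropic_radical:
  assumes pos: "\<And>x. x \<in> X \<Longrightarrow> 0 \<le> Re (H x x)" and x: "x \<in> X" "Re (H x x) = 0" and y: "y \<in> X"
  shows "H x y = 0"
proof (rule ccontr)
  assume ne: "H x y \<noteq> 0"
  define g where "g = cmod (H x y) ^ 2"
  have g: "g > 0" using ne by (simp add: g_def)
  have g_eq: "g = (Re (H x y))\<^sup>2 + (Im (H x y))\<^sup>2" by (simp add: g_def cmod_power2)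
  define M where "M = Re (H y y)"
  have M: "M \<ge> 0" using pos y by (simp add: M_def)
  define t where "t = 1 / (M + 1)"
  define c where "c = - complex_of_real t * cnj (H x y)"
  have cx: "(\<lambda>p. cnj c * y p) \<in> X" using y by (rule scale_in)
  define z where "z = (\<lambda>p. x p + cnj c * y p)"
  have zX: "z \<in> X" unfolding z_def using x cx add_in by blast
  have "H z z = H x x + c * H x y + (cnj c * H y x + cnj c * c * H y y)"
    unfolding z_def using x y cx add_in[OF x(1) cx]
    by (simp add: H_add H_add_right H_scale H_scale_right algebra_simps)
  moreover have "Re (c * H x y) = - t * g"
    unfolding c_def g_eq by (simp add: power2_eq_square algebra_simps)
  moreover have "Re (cnj c * H y x) = - t * g"
    using H_sym[OF x(1) y] unfolding c_def g_eq by (simp add: power2_eq_square algebra_simps)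
  moreover have "Re (cnj c * c * H y y) = t\<^sup>2 * g * M"
  proof -
    have "cnj c * c = complex_of_real (t\<^sup>2 * g)"
      unfolding c_def g_eq by (simp add: complex_eq_iff power2_eq_square algebra_simps)
    then show ?thesis by (simp add: M_def)
  qed
  ultimately have "Re (H z z) = t * g * (t * M - 2)" using x(2)
    by (simp add: algebra_simps power2_eq_square)
  moreover have "t * M < 1" "t > 0" using M by (auto simp: t_def)
  then have "t * g * (t * M - 2) < 0" using g by (intro mult_pos_neg) auto
  ultimately show False using pos[OF zX] by simp
qed

end

section \<open>The index of a form\<close>

text \<open>Strict negativity for every nonzero coefficient vector already makes the
  \<open>v j\<close> independent, so this asks for a \<open>k\<close>-dimensional subspace on which
  the form is negative definite.\<close>

definition negdim :: "('p \<Rightarrow> complex) set \<Rightarrow> (('p \<Rightarrow> complex) \<Rightarrow> ('p \<Rightarrow> complex) \<Rightarrow> complex) \<Rightarrow> nat \<Rightarrow> bool" where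
  "negdim X H k \<longleftrightarrow> (\<exists>v::nat \<Rightarrow> 'p \<Rightarrow> complex. (\<forall>j<k. v j \<in> X) \<and>
     (\<forall>c. (\<exists>j<k. c j \<noteq> 0) \<longrightarrow> Re (H (lc {..<k} c v) (lc {..<k} c v)) < 0))"

text \<open>The maximum is meaningful only after a bound on such \<open>k\<close> is established;
  \<open>k = 0\<close> always occurs.\<close>

definition negindex where "negindex X H = Max {k. negdim X H k}"

lemma negindex_eqI:
  assumes "negdim X H n" "\<And>k. negdim X H k \<Longrightarrow> k \<le> n"
  shows "negindex X H = n"
proof -
  have "finite {k. negdim X H k}" by (rule finite_subset[of _ "{..n}"]) (use assms(2) in auto)
  then show ?thesis unfolding negindex_def using assms by (intro Max_eqI) auto
qed

lemma lc_reindex: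
  assumes "bij_betw f J' J"
  shows "lc J c v = lc J' (c \<circ> f) (v \<circ> f)"
  unfolding lc_def using sum.reindex_bij_betw[OF assms] by (intro ext) (simp add: sum.reindex_bij_betw[OF assms, symmetric])

lemma negdimI:
  assumes J: "finite J" and v: "\<And>j. j \<in> J \<Longrightarrow> v j \<in> X"
    and neg: "\<And>c. (\<exists>j\<in>J. c j \<noteq> 0) \<Longrightarrow> Re (H (lc J c v) (lc J c v)) < 0"
  shows "negdim X H (card J)"
proof -
  obtain f where f: "bij_betw f {..<card J} J"
    using ex_bij_betw_nat_finite[OF J] by (auto simp: atLeast0LessThan)
  define g where "g = the_inv_into {..<card J} f"
  have g: "\<And>k. k < card J \<Longrightarrow> g (f k) = k" "\<And>j. j \<in> J \<Longrightarrow> f (g j) = j \<and> g j < card J"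
    using f unfolding g_def
    by (auto simp: bij_betw_def the_inv_into_f_f f_the_inv_into_f)
     (metis lessThan_iff order_refl the_inv_into_into)
  show ?thesis unfolding negdim_def
  proof (intro exI[of _ "v \<circ> f"] conjI allI impI)
    fix j assume "j < card J" then show "(v \<circ> f) j \<in> X" using v f by (auto simp: bij_betw_def)
  next
    fix c :: "nat \<Rightarrow> complex" assume c: "\<exists>j<card J. c j \<noteq> 0"
    have e: "lc J (c \<circ> g) v = lc {..<card J} c (v \<circ> f)"
      using lc_reindex[OF f, of "c \<circ> g" v] g by (simp add: lc_def)
    obtain j where j: "j < card J" "c j \<noteq> 0" using c by blast
    then have "f j \<in> J" "(c \<circ> g) (f j) \<noteq> 0" using g(1)[of j] f by (auto simp: bij_betw_def)
    then have "\<exists>j\<in>J. (c \<circ> g) j \<noteq> 0" by blast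
    from neg[OF this] show "Re (H (lc {..<card J} c (v \<circ> f)) (lc {..<card J} c (v \<circ> f))) < 0"
      unfolding e .
  qed
qed

text \<open>A negative subspace of dimension above \<open>card L\<close> would contain a nonzero
  vector annihilated by all the functionals, where the form is nonnegative.\<close>

lemma negdim_le_card:
  assumes X: "vsubspace X" and k: "negdim X H k" and L: "finite L" "\<And>l. l \<in> L \<Longrightarrow> linfun X (\<phi> l)"
    and pos: "\<And>x. x \<in> X \<Longrightarrow> (\<And>l. l \<in> L \<Longrightarrow> \<phi> l x = 0) \<Longrightarrow> 0 \<le> Re (H x x)"
  shows "k \<le> card L"
proof (rule ccontr)
  interpret vsubspace X by fact
  assume "\<not> k \<le> card L"
  then have lt: "card L < card {..<k}" by simp
  obtain v where v: "\<And>j. j<k \<Longrightarrow> v j \<in> X"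
    "\<And>c. (\<exists>j<k. c j \<noteq> 0) \<Longrightarrow> Re (H (lc {..<k} c v) (lc {..<k} c v)) < 0"
    using k unfolding negdim_def by blast
  obtain c where c: "\<exists>j\<in>{..<k}. c j \<noteq> 0" "\<forall>l\<in>L. (\<Sum>j<k. \<phi> l (v j) * c j) = 0"
    using homogeneous_system_nontrivial[OF L(1) finite_lessThan lt, of "\<lambda>l j. \<phi> l (v j)"] by blast
  have "\<phi> l (lc {..<k} c v) = 0" if "l \<in> L" for l
    using linfun_lc[OF L(2)[OF that], of "{..<k}" v c] v(1) c(2) that by (simp add: mult.commute)
  then have "0 \<le> Re (H (lc {..<k} c v) (lc {..<k} c v))" using v(1) by (intro pos lc_in) auto
  then show False using v(2)[of c] c(1) by (meson lessThan_iff not_less)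
qed

lemma negdim_mono:
  assumes "negdim X H k" "vsubspace X" "\<And>x. x \<in> X \<Longrightarrow> Re (H' x x) \<le> Re (H x x)"
  shows "negdim X H' k"
proof -
  interpret vsubspace X by fact
  obtain v where v: "\<And>j. j<k \<Longrightarrow> v j \<in> X"
    "\<And>c. (\<exists>j<k. c j \<noteq> 0) \<Longrightarrow> Re (H (lc {..<k} c v) (lc {..<k} c v)) < 0"
    using assms(1) unfolding negdim_def by blast
  show ?thesis unfolding negdim_def
    by (intro exI[of _ v] conjI allI impI v(1) le_less_trans[OF assms(3) v(2)] lc_in) (auto simp: v(1))
qed

section \<open>Orthonormal eigenbases of Hermitian matrices\<close>

definition cdot :: "'i set \<Rightarrow> ('i \<Rightarrow> complex) \<Rightarrow> ('i \<Rightarrow> complex) \<Rightarrow> complex" where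
  "cdot I x y = (\<Sum>i\<in>I. x i * cnj (y i))"

lemma cdot_self: "cdot I x x = complex_of_real (\<Sum>i\<in>I. (cmod (x i))\<^sup>2)"
  unfolding cdot_def of_real_sum complex_norm_square ..

lemma cdot_sym: "cdot I y x = cnj (cdot I x y)"
  unfolding cdot_def by (simp add: mult.commute)

lemma cdot_lc_left: "finite J \<Longrightarrow> cdot I (lc J c v) y = (\<Sum>j\<in>J. c j * cdot I (v j) y)"
  unfolding cdot_def lc_def by (simp add: sum_distrib_left sum_distrib_right mult.assoc) (rule sum.swap)

definition orthonormal_family :: "'i set \<Rightarrow> nat \<Rightarrow> (nat \<Rightarrow> 'i \<Rightarrow> complex) \<Rightarrow> bool" where
  "orthonormal_family I n e \<longleftrightarrow> (\<forall>k<n. \<forall>l<n. cdot I (e k) (e l) = (if k = l then 1 else 0))"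

lemma exists_orthogonal_vector:
  assumes "finite I" "n < card I"
  shows "\<exists>x. (\<Sum>i\<in>I. (cmod (x i))\<^sup>2) = 1 \<and> (\<forall>k<n. cdot I x (e k) = 0)"
proof -
  obtain c where c: "\<exists>j\<in>I. c j \<noteq> 0" "\<forall>k\<in>{..<n}. (\<Sum>j\<in>I. cnj (e k j) * c j) = 0"
    using homogeneous_system_nontrivial[of "{..<n}" I "\<lambda>k j. cnj (e k j)"] assms by auto
  define N where "N = (\<Sum>i\<in>I. (cmod (c i))\<^sup>2)"
  have N: "N > 0" unfolding N_def using c(1) assms(1) by (auto intro!: sum_pos2)
  define x where "x = (\<lambda>i. c i / complex_of_real (sqrt N))"
  have "(\<Sum>i\<in>I. (cmod (x i))\<^sup>2) = (\<Sum>i\<in>I. (cmod (c i))\<^sup>2 / N)"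
    using N by (simp add: x_def norm_divide power_divide)
  also have "\<dots> = 1" using N by (simp add: sum_divide_distrib[symmetric] N_def[symmetric])
  finally have 1: "(\<Sum>i\<in>I. (cmod (x i))\<^sup>2) = 1" .
  have "cdot I x (e k) = 0" if "k < n" for k
  proof -
    have "cdot I x (e k) = (\<Sum>j\<in>I. cnj (e k j) * c j) / complex_of_real (sqrt N)"
      unfolding cdot_def x_def by (simp add: sum_divide_distrib mult.commute)
    then show ?thesis using c(2) that by simp
  qed
  then show ?thesis using 1 by blast
qed

text \<open>A nonzero remainder would give \<open>card I + 1\<close> pairwise orthogonal nonzero
  vectors in a space of dimension \<open>card I\<close>; such vectors are independent, which
  contradicts \<open>homogeneous_system_nontrivial\<close>.\<close>

lemma orthonormal_expansion:
  assumes I: "finite I" and on: "orthonormal_family I (card I) e" and i: "i \<in> I"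
  shows "x i = (\<Sum>k<card I. cdot I x (e k) * e k i)"
proof (rule ccontr)
  define n where "n = card I"
  define r where "r = (\<lambda>i. x i - (\<Sum>k<n. cdot I x (e k) * e k i))"
  assume "\<not> ?thesis"
  then have ri: "r i \<noteq> 0" by (simp add: r_def n_def)
  have ro: "cdot I r (e l) = 0" if "l < n" for l
  proof -
    have "cdot I r (e l) = cdot I x (e l) - cdot I (lc {..<n} (\<lambda>k. cdot I x (e k)) e) (e l)"
      unfolding r_def lc_def cdot_def by (simp add: sum_subtractf algebra_simps)
    also have "cdot I (lc {..<n} (\<lambda>k. cdot I x (e k)) e) (e l) = (\<Sum>k<n. cdot I x (e k) * (if k = l then 1 else 0))"
      using on that by (simp add: cdot_lc_left orthonormal_family_def n_def)
    also have "\<dots> = cdot I x (e l)" using that by (simp add: if_distrib sum.delta cong: if_cong)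
    finally show ?thesis by simp
  qed
  define E where "E = (\<lambda>k. if k < n then e k else r)"
  obtain c where c: "\<exists>j\<in>{..n}. c j \<noteq> 0" "\<forall>i\<in>I. (\<Sum>j\<in>{..n}. E j i * c j) = 0"
    using homogeneous_system_nontrivial[OF I, of "{..n}" "\<lambda>i j. E j i"] by (auto simp: n_def)
  have rr: "cdot I r r \<noteq> 0"
    unfolding cdot_self using ri i I by (auto simp: sum_nonneg_eq_0_iff simp del: of_real_sum)
  have EE: "cdot I (E j) (E l) = (if j = l then cdot I (E l) (E l) else 0)" if "j \<le> n" "l \<le> n" for j l
  proof -
    have ro': "cdot I (e k) r = 0" if "k < n" for k using ro[OF that] cdot_sym[of I "e k" r] by simp
    have on': "cdot I (e j) (e l) = (if j = l then 1 else 0)" if "j < n" "l < n" for j l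
      using on that unfolding orthonormal_family_def n_def by blast
    consider "j < n" "l < n" | "j < n" "l = n" | "j = n" "l < n" | "j = n" "l = n" using \<open>j \<le> n\<close> \<open>l \<le> n\<close> by linarith
    then show ?thesis by cases (simp_all add: E_def on' ro ro')
  qed
  have "c l = 0" if l: "l \<le> n" for l
  proof -
    have "0 = cdot I (lc {..n} c E) (E l)" using c(2) by (simp add: cdot_def lc_def mult.commute)
    also have "\<dots> = (\<Sum>j\<le>n. c j * (if j = l then cdot I (E l) (E l) else 0))"
      unfolding cdot_lc_left[OF finite_atMost] using EE[OF _ l] by (intro sum.cong refl arg_cong2[where f="(*)"]) blast+
    also have "\<dots> = c l * cdot I (E l) (E l)" using l by (simp add: if_distrib sum.delta cong: if_cong)
    finally have "c l * cdot I (E l) (E l) = 0" by simp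
    moreover have "cdot I (E l) (E l) \<noteq> 0"
    proof (cases "l < n")
      case True
      then have "cdot I (e l) (e l) = 1" using on unfolding orthonormal_family_def n_def by simp
      then show ?thesis using True by (simp add: E_def)
    qed (use rr l in \<open>simp add: E_def\<close>)
    ultimately show ?thesis by simp
  qed
  then show False using c(1) by auto
qed

lemma orthonormal_parseval:
  assumes I: "finite I" and on: "orthonormal_family I (card I) e"
  shows "(\<Sum>k<card I. (cmod (cdot I x (e k)))\<^sup>2) = (\<Sum>i\<in>I. (cmod (x i))\<^sup>2)"
proof -
  have "cdot I x x = cdot I (lc {..<card I} (\<lambda>k. cdot I x (e k)) e) x"
    unfolding cdot_def[of I x x] cdot_def[of I "lc _ _ _"] unfolding lc_def
    using orthonormal_expansion[OF assms, of _ x] by (intro sum.cong) auto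
  also have "\<dots> = (\<Sum>k<card I. cdot I x (e k) * cdot I (e k) x)" by (simp add: cdot_lc_left)
  also have "\<dots> = (\<Sum>k<card I. complex_of_real ((cmod (cdot I x (e k)))\<^sup>2))"
    unfolding complex_norm_square by (intro sum.cong refl arg_cong2[where f="(*)"] cdot_sym)
  finally have "complex_of_real (\<Sum>i\<in>I. (cmod (x i))\<^sup>2) = complex_of_real (\<Sum>k<card I. (cmod (cdot I x (e k)))\<^sup>2)"
    unfolding cdot_self by simp
  then show ?thesis by (metis of_real_eq_iff)
qed

text \<open>The next eigenvector minimises the Rayleigh quotient on the orthogonal complement of the
  previous ones.\<close>

lemma hermitian_next_eigenvector:
  fixes h :: "'i \<Rightarrow> 'i \<Rightarrow> complex"
  assumes I: "finite I" and herm: "\<And>i j. i \<in> I \<Longrightarrow> j \<in> I \<Longrightarrow> h j i = cnj (h i j)"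
    and n: "n < card I"
    and eig: "\<And>k i. k < n \<Longrightarrow> i \<in> I \<Longrightarrow> (\<Sum>j\<in>I. h i j * e k j) = complex_of_real (ev k) * e k i"
  shows "\<exists>x \<mu>. cdot I x x = 1 \<and> (\<forall>k<n. cdot I x (e k) = 0) \<and>
     (\<forall>i\<in>I. (\<Sum>j\<in>I. h i j * x j) = complex_of_real \<mu> * x i)"
proof -
  define T where "T = (\<lambda>x i. \<Sum>j\<in>I. h i j * x j)"
  have T_sym: "cdot I (T x) y = cdot I x (T y)" for x y
  proof -
    have "cdot I (T x) y = (\<Sum>i\<in>I. \<Sum>j\<in>I. h i j * x j * cnj (y i))"
      unfolding cdot_def T_def by (simp add: sum_distrib_right)
    also have "\<dots> = (\<Sum>j\<in>I. \<Sum>i\<in>I. h i j * x j * cnj (y i))" by (rule sum.swap)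
    also have "\<dots> = (\<Sum>j\<in>I. \<Sum>i\<in>I. x j * cnj (h j i * y i))"
    proof (intro sum.cong refl)
      fix i j assume "j \<in> I" "i \<in> I"
      from herm[OF this] show "h i j * x j * cnj (y i) = x j * cnj (h j i * y i)" by simp
    qed
    finally show ?thesis unfolding cdot_def T_def by (simp add: sum_distrib_left)
  qed
  \<comment> \<open>The coordinates outside \<open>I\<close> are frozen at 0, so that
    \<open>S\<close> is a closed subset of a product of closed unit discs, compact by Tychonoff
    whatever the index type.\<close>
  define S where "S = {x. (\<forall>i. i \<notin> I \<longrightarrow> x i = 0) \<and> (\<Sum>i\<in>I. (cmod (x i))\<^sup>2) = 1 \<and> (\<forall>k<n. cdot I x (e k) = 0)}"
  define R where "R = (\<lambda>x. Re (cdot I (T x) x))"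
  have cont: "continuous_on UNIV (\<lambda>x::'i\<Rightarrow>complex. x i)" for i
    by (rule continuous_on_product_coordinates)
  have "compact S"
  proof (rule compact_Int_closed[of "Pi\<^sub>E UNIV (\<lambda>i::'i. cball (0::complex) 1)", THEN subst[of _ _ compact, rotated]])
    show "compact (Pi\<^sub>E UNIV (\<lambda>i::'i. cball (0::complex) 1))" 
      using compactin_PiE[of "\<lambda>_. euclidean" UNIV "\<lambda>i::'i. cball (0::complex) 1"]
      by (simp add: euclidean_product_topology)
    have S_eq: "S = (\<Inter>i\<in>-I. {x. x i = 0}) \<inter> {x. (\<Sum>i\<in>I. (cmod (x i))\<^sup>2) = 1} \<inter> (\<Inter>k\<in>{..<n}. {x. cdot I x (e k) = 0})"
      unfolding S_def by auto
    show "closed S" unfolding S_eq cdot_def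
      by (intro closed_Int closed_INT ballI closed_Collect_eq continuous_intros cont)
    have "cmod (x i) \<le> 1" if "x \<in> S" for x i
    proof (cases "i \<in> I")
      case True
      have "(cmod (x i))\<^sup>2 \<le> (\<Sum>i\<in>I. (cmod (x i))\<^sup>2)" using True I by (intro member_le_sum) auto
      then have "(cmod (x i))\<^sup>2 \<le> 1" using that unfolding S_def by simp
      then show ?thesis using power2_le_imp_le[of "cmod (x i)" 1] by simp
    qed (use that in \<open>auto simp: S_def\<close>)
    then show "Pi\<^sub>E UNIV (\<lambda>i::'i. cball (0::complex) 1) \<inter> S = S" by (auto simp: PiE_UNIV_domain Pi_def)
  qed
  moreover have "S \<noteq> {}"
  proof -
    obtain x where x: "(\<Sum>i\<in>I. (cmod (x i))\<^sup>2) = 1" "\<forall>k<n. cdot I x (e k) = 0"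
      using exists_orthogonal_vector[OF I n] by blast
    have "(\<lambda>i. if i \<in> I then x i else 0) \<in> S" using x unfolding S_def cdot_def by (auto cong: sum.cong)
    then show ?thesis by blast
  qed
  moreover have "continuous_on S R"
    unfolding R_def T_def cdot_def
    by (intro continuous_intros continuous_on_subset[OF cont subset_UNIV])
  ultimately obtain x where x: "x \<in> S" "\<And>y. y \<in> S \<Longrightarrow> R x \<le> R y"
    using continuous_attains_inf[of S R] by blast
  define \<mu> where "\<mu> = R x"
  have xx: "cdot I x x = 1" "\<And>k. k < n \<Longrightarrow> cdot I x (e k) = 0" using x(1) unfolding S_def cdot_self by auto
  define X where "X = {y. \<forall>k<n. cdot I y (e k) = 0}"
  \<comment> \<open>\<open>G\<close> is nonnegative on the complement of the eigenvectors already
    found and vanishes at the minimiser, so the minimiser lies in its radical; no derivative of the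
    Rayleigh quotient is taken.\<close>
  define G where "G = (\<lambda>y z. cdot I (T y) z - complex_of_real \<mu> * cdot I y z)"
  interpret G: herm_form X G
  proof unfold_locales
    show "(\<lambda>p. 0) \<in> X" by (simp add: X_def cdot_def)
    fix x y z :: "'i \<Rightarrow> complex" and c :: complex
    { assume "x \<in> X" "y \<in> X" then show "(\<lambda>p. x p + y p) \<in> X"
        by (simp add: X_def cdot_def distrib_right sum.distrib) }
    { assume "x \<in> X" then show "(\<lambda>p. c * x p) \<in> X"
        by (simp add: X_def cdot_def mult.assoc sum_distrib_left[symmetric]) }
    show "G (\<lambda>p. x p + y p) z = G x z + G y z"
      by (simp add: G_def cdot_def T_def distrib_left distrib_right sum.distrib algebra_simps)
    have "T (\<lambda>p. c * x p) = (\<lambda>p. c * T x p)" by (simp add: T_def sum_distrib_left mult_ac)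
    then show "G (\<lambda>p. c * x p) z = c * G x z"
      by (simp add: G_def cdot_def sum_distrib_left algebra_simps)
    show "G z x = cnj (G x z)"
      unfolding G_def using T_sym[of z x] cdot_sym[of I "T x" z] cdot_sym[of I x z] by simp
  qed
  have pos: "0 \<le> Re (G y y)" if y: "y \<in> X" for y
  proof (cases "(\<Sum>i\<in>I. (cmod (y i))\<^sup>2) = 0")
    case True
    then have "\<forall>i\<in>I. y i = 0" using I by (simp add: sum_nonneg_eq_0_iff)
    then show ?thesis by (simp add: G_def cdot_def)
  next
    case False
    define N where "N = (\<Sum>i\<in>I. (cmod (y i))\<^sup>2)"
    have N: "N > 0" using False by (simp add: N_def less_le sum_nonneg)
    define s where "s = complex_of_real (1 / sqrt N)"
    have s2: "s * cnj s = complex_of_real (1 / N)"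
      using N by (simp add: s_def flip: of_real_mult)
    define z where "z = (\<lambda>i. if i \<in> I then s * y i else 0)"
    have cz: "cdot I z w = s * cdot I y w" for w
      unfolding cdot_def z_def by (simp add: sum_distrib_left mult.assoc cong: sum.cong)
    have Tz: "T z i = s * T y i" for i
      unfolding T_def z_def by (simp add: sum_distrib_left mult_ac cong: sum.cong)
    have "cmod s ^ 2 = 1 / N" using N by (simp add: s_def norm_divide power_divide)
    then have "(\<Sum>i\<in>I. (cmod (z i))\<^sup>2) = 1"
      using N by (simp add: z_def norm_mult power_mult_distrib sum_divide_distrib[symmetric] N_def[symmetric] cong: sum.cong)
    moreover have "\<forall>k<n. cdot I z (e k) = 0" using y by (simp add: cz X_def)
    moreover have "\<forall>i. i \<notin> I \<longrightarrow> z i = 0" by (simp add: z_def)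
    ultimately have "z \<in> S" unfolding S_def by blast
    then have "\<mu> \<le> R z" using x(2) unfolding \<mu>_def by blast
    also have "R z = Re (cdot I z (T z))" unfolding R_def T_sym ..
    also have "cdot I z (T z) = s * cnj s * cdot I (T y) y"
      unfolding cz T_sym by (simp add: cdot_def Tz sum_distrib_left mult_ac)
    also have "Re \<dots> = Re (cdot I (T y) y) / N" unfolding s2 by (simp del: of_real_divide)
    finally have "\<mu> * N \<le> Re (cdot I (T y) y)" using N by (simp add: field_simps)
    then show ?thesis unfolding G_def cdot_self by (simp add: N_def del: of_real_sum)
  qed
  have xX: "x \<in> X" using xx by (simp add: X_def)
  have x0: "Re (G x x) = 0" unfolding G_def using xx by (simp add: R_def \<mu>_def)
  define r where "r = (\<lambda>i. T x i - complex_of_real \<mu> * x i)"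
  have re: "cdot I r y = G x y" for y
    unfolding r_def G_def cdot_def by (simp add: algebra_simps sum_subtractf sum_distrib_left)
  \<comment> \<open>The complement is invariant under the matrix because the \<open>e k\<close> are
    eigenvectors; hence the residual of \<open>x\<close> may be tested against itself.\<close>
  have "r \<in> X" unfolding X_def
  proof (intro CollectI allI impI)
    fix k assume k: "k < n"
    have "cdot I (T x) (e k) = cdot I x (T (e k))" by (rule T_sym)
    also have "\<dots> = complex_of_real (ev k) * cdot I x (e k)"
      unfolding cdot_def T_def using eig[OF k] by (simp add: sum_distrib_left mult_ac cong: sum.cong)
    finally show "cdot I r (e k) = 0" unfolding re G_def using xx(2)[OF k] by simp
  qed
  then have "cdot I r r = 0" unfolding re using G.nonneg_form_isotropic_radical[OF pos xX x0] by blast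
  then have "\<forall>i\<in>I. r i = 0" unfolding cdot_self using I
    by (simp add: sum_nonneg_eq_0_iff del: of_real_sum)
  then have "\<forall>i\<in>I. (\<Sum>j\<in>I. h i j * x j) = complex_of_real \<mu> * x i" unfolding r_def T_def by simp
  then show ?thesis using xx by blast
qed

theorem hermitian_orthonormal_eigenbasis:
  fixes h :: "'i \<Rightarrow> 'i \<Rightarrow> complex"
  assumes I: "finite I" and herm: "\<And>i j. i \<in> I \<Longrightarrow> j \<in> I \<Longrightarrow> h j i = cnj (h i j)"
  shows "\<exists>e ev. orthonormal_family I (card I) e \<and>
     (\<forall>k<card I. \<forall>i\<in>I. (\<Sum>j\<in>I. h i j * e k j) = complex_of_real (ev k) * e k i)"
proof -
  have "\<exists>e ev. orthonormal_family I n e \<and>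
     (\<forall>k<n. \<forall>i\<in>I. (\<Sum>j\<in>I. h i j * e k j) = complex_of_real (ev k) * e k i)" if "n \<le> card I" for n
    using that
  proof (induction n)
    case 0 then show ?case by (simp add: orthonormal_family_def)
  next
    case (Suc n)
    then obtain e ev where e: "orthonormal_family I n e"
      "\<And>k i. k < n \<Longrightarrow> i \<in> I \<Longrightarrow> (\<Sum>j\<in>I. h i j * e k j) = complex_of_real (ev k) * e k i" by auto
    obtain x \<mu> where x: "cdot I x x = 1" "\<forall>k<n. cdot I x (e k) = 0"
     "\<forall>i\<in>I. (\<Sum>j\<in>I. h i j * x j) = complex_of_real \<mu> * x i"
      using hermitian_next_eigenvector[OF I herm _ e(2), of n "\<lambda>k. k"] Suc.prems by auto
    have x': "\<forall>k<n. cdot I (e k) x = 0" using x(2) cdot_sym[of I _ x] by simp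
    show ?case
      by (intro exI[of _ "e(n := x)"] exI[of _ "ev(n := \<mu>)"])
        (use e x x' in \<open>auto simp: orthonormal_family_def less_Suc_eq\<close>)
  qed
  then show ?thesis by blast
qed

section \<open>Forms with a finite-dimensional negative part\<close>

text \<open>\<open>e\<close> diagonalises the form on a space of dimension \<open>N\<close> with
  coordinates \<phi>; \<open>H_ge\<close> is an inequality because the rest of \<open>X\<close> adds
  a nonnegative amount. \<open>parseval\<close> relates the coordinates to the concrete functionals
  \<nu>, in which perturbations can be estimated.\<close>

locale diag_form = herm_form X H for X :: "('p \<Rightarrow> complex) set" and H +
  fixes I :: "'i set" and \<nu> :: "'i \<Rightarrow> ('p \<Rightarrow> complex) \<Rightarrow> complex"
    and N :: nat and e :: "nat \<Rightarrow> 'p \<Rightarrow> complex" and ev :: "nat \<Rightarrow> real"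
    and \<phi> :: "nat \<Rightarrow> ('p \<Rightarrow> complex) \<Rightarrow> complex"
  assumes e_in: "\<And>k. k < N \<Longrightarrow> e k \<in> X"
    and \<phi>_lin: "\<And>k. k < N \<Longrightarrow> linfun X (\<phi> k)"
    and \<phi>_e: "\<And>k l. k < N \<Longrightarrow> l < N \<Longrightarrow> \<phi> k (e l) = (if k = l then 1 else 0)"
    and H_e: "\<And>k z. k < N \<Longrightarrow> z \<in> X \<Longrightarrow> H (e k) z = complex_of_real (ev k) * cnj (\<phi> k z)"
    and parseval: "\<And>z. z \<in> X \<Longrightarrow> (\<Sum>k<N. (cmod (\<phi> k z))\<^sup>2) = (\<Sum>i\<in>I. (cmod (\<nu> i z))\<^sup>2)"
    and H_ge: "\<And>z. z \<in> X \<Longrightarrow> (\<Sum>k<N. ev k * (cmod (\<phi> k z))\<^sup>2) \<le> Re (H z z)"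
begin

lemma \<phi>_lc:
  assumes "finite J" "J \<subseteq> {..<N}" "k < N"
  shows "\<phi> k (lc J c e) = (if k \<in> J then c k else 0)"
proof -
  have "\<phi> k (lc J c e) = (\<Sum>j\<in>J. c j * \<phi> k (e j))"
    using assms e_in by (intro linfun_lc \<phi>_lin) auto
  also have "\<dots> = (\<Sum>j\<in>J. c j * (if k = j then 1 else 0))"
    using assms by (intro sum.cong refl) (auto simp: \<phi>_e)
  also have "\<dots> = (if k \<in> J then c k else 0)"
    using assms(1) by (simp add: if_distrib sum.delta cong: if_cong)
  finally show ?thesis .
qed

lemma lc_e_in: "J \<subseteq> {..<N} \<Longrightarrow> lc J c e \<in> X"
  using e_in finite_subset[of J "{..<N}"] by (intro lc_in) auto

lemma H_lc:
  assumes "J \<subseteq> {..<N}"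
  shows "Re (H (lc J c e) (lc J c e)) = (\<Sum>j\<in>J. ev j * (cmod (c j))\<^sup>2)"
proof -
  have fin: "finite J" using assms finite_subset by blast
  have "H (lc J c e) (lc J c e) = (\<Sum>j\<in>J. c j * H (e j) (lc J c e))"
    using assms e_in fin lc_e_in[OF assms] by (intro H_lc_left) auto
  also have "\<dots> = (\<Sum>j\<in>J. complex_of_real (ev j * (cmod (c j))\<^sup>2))"
  proof (intro sum.cong refl)
    fix j assume j: "j \<in> J"
    then have "H (e j) (lc J c e) = complex_of_real (ev j) * cnj (c j)"
      using H_e[of j "lc J c e"] lc_e_in[OF assms] \<phi>_lc[OF fin assms, of j c] assms by auto
    then show "c j * H (e j) (lc J c e) = complex_of_real (ev j * (cmod (c j))\<^sup>2)"
      unfolding of_real_mult complex_norm_square by (simp add: mult_ac)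
  qed
  finally show ?thesis by simp
qed

lemma sum_\<phi>_lc:
  assumes "J \<subseteq> {..<N}"
  shows "(\<Sum>i\<in>I. (cmod (\<nu> i (lc J c e)))\<^sup>2) = (\<Sum>j\<in>J. (cmod (c j))\<^sup>2)"
proof -
  have fin: "finite J" using assms finite_subset by blast
  have "(\<Sum>k<N. (cmod (\<phi> k (lc J c e)))\<^sup>2) = (\<Sum>k<N. if k \<in> J then (cmod (c k))\<^sup>2 else 0)"
    using fin assms by (intro sum.cong) (auto simp: \<phi>_lc)
  also have "\<dots> = (\<Sum>j\<in>J. (cmod (c j))\<^sup>2)"
    using assms by (simp add: sum.If_cases Int_absorb1)
  finally show ?thesis using parseval[OF lc_e_in[OF assms]] by simp
qed

definition "Neg = {k. k < N \<and> ev k < 0}"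
definition "Nonpos = {k. k < N \<and> ev k \<le> 0}"
definition "Nul = {k. k < N \<and> ev k = 0}"

lemma sets_sub: "Neg \<subseteq> {..<N}" "Nonpos \<subseteq> {..<N}" "Nul \<subseteq> {..<N}"
  "finite Neg" "finite Nonpos" "finite Nul" "card Nonpos = card Neg + card Nul"
proof -
  show 1: "Neg \<subseteq> {..<N}" "Nonpos \<subseteq> {..<N}" "Nul \<subseteq> {..<N}" unfolding Neg_def Nonpos_def Nul_def by auto
  show 2: "finite Neg" "finite Nonpos" "finite Nul" using 1 finite_subset by blast+
  have "Nonpos = Neg \<union> Nul" "Neg \<inter> Nul = {}" unfolding Neg_def Nonpos_def Nul_def by auto
  then show "card Nonpos = card Neg + card Nul" using 2 card_Un_disjoint by metis
qed

lemma spectral_gap: "\<exists>g>0. \<forall>k<N. ev k \<noteq> 0 \<longrightarrow> g \<le> \<bar>ev k\<bar>"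
proof (cases "{k. k < N \<and> ev k \<noteq> 0} = {}")
  case False
  let ?S = "(\<lambda>k. \<bar>ev k\<bar>) ` {k. k < N \<and> ev k \<noteq> 0}"
  have f: "finite ?S" by auto
  have "Min ?S > 0" using f False by (subst Min_gr_iff) auto
  moreover have "\<forall>k<N. ev k \<noteq> 0 \<longrightarrow> Min ?S \<le> \<bar>ev k\<bar>" using f by (auto intro!: Min_le)
  ultimately show ?thesis by blast
qed (auto intro!: exI[of _ 1])

text \<open>The negative eigenvectors span a negative space, and the form is nonnegative where their
  coordinates vanish.\<close>

lemma negindex_eq: "negindex X H = card Neg"
proof (rule negindex_eqI)
  show "negdim X H (card Neg)"
  proof (rule negdimI[where v = e])
    fix c :: "nat \<Rightarrow> complex" assume c: "\<exists>j\<in>Neg. c j \<noteq> 0"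
    have "(\<Sum>j\<in>Neg. - (ev j * (cmod (c j))\<^sup>2)) > 0"
    proof -
      obtain j where j: "j \<in> Neg" "c j \<noteq> 0" using c by blast
      have "- (ev j * (cmod (c j))\<^sup>2) > 0" using j unfolding Neg_def by (simp add: mult_neg_pos)
      then show ?thesis
        using j sets_sub by (intro sum_pos2[of _ j]) (auto simp: Neg_def mult_nonpos_nonneg)
    qed
    then show "Re (H (lc Neg c e) (lc Neg c e)) < 0" using H_lc sets_sub by (simp add: sum_negf)
  qed (use sets_sub e_in in auto)
next
  fix k assume k: "negdim X H k"
  show "k \<le> card Neg"
  proof (rule negdim_le_card[OF vsubspace_axioms k, where \<phi> = \<phi>])
    fix x assume x: "x \<in> X" "\<And>l. l \<in> Neg \<Longrightarrow> \<phi> l x = 0"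
    have "0 \<le> (\<Sum>k<N. ev k * (cmod (\<phi> k x))\<^sup>2)"
    proof (rule sum_nonneg)
      fix k assume "k \<in> {..<N}"
      then show "0 \<le> ev k * (cmod (\<phi> k x))\<^sup>2"
        using x(2)[of k] by (cases "ev k < 0") (auto simp: Neg_def)
    qed
    then show "0 \<le> Re (H x x)" using H_ge[OF x(1)] by linarith
  qed (use sets_sub \<phi>_lin in auto)
qed

text \<open>Upper semicontinuity of the index: a loss of at most \<open>g\<close> times the squared
  coordinates cannot make directions negative whose eigenvalue is at least \<open>g\<close>, so only
  the nonpositive ones are left.\<close>

lemma negindex_le:
  assumes "herm_form X H'" "g > 0" "\<And>k. k < N \<Longrightarrow> ev k > 0 \<Longrightarrow> g \<le> ev k"
    and "\<And>x. x \<in> X \<Longrightarrow> (\<Sum>k<N. ev k * (cmod (\<phi> k x))\<^sup>2) - g * (\<Sum>i\<in>I. (cmod (\<nu> i x))\<^sup>2) \<le> Re (H' x x)"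
    and k: "negdim X H' k"
  shows "k \<le> card Nonpos"
proof (rule negdim_le_card[OF vsubspace_axioms k, where \<phi> = \<phi>])
  fix x assume x: "x \<in> X" "\<And>l. l \<in> Nonpos \<Longrightarrow> \<phi> l x = 0"
  have "g * (\<Sum>k<N. (cmod (\<phi> k x))\<^sup>2) \<le> (\<Sum>k<N. ev k * (cmod (\<phi> k x))\<^sup>2)"
    unfolding sum_distrib_left
  proof (rule sum_mono)
    fix k assume "k \<in> {..<N}"
    then show "g * (cmod (\<phi> k x))\<^sup>2 \<le> ev k * (cmod (\<phi> k x))\<^sup>2"
      using x(2)[of k] assms(3)[of k] by (cases "ev k > 0") (auto simp: Nonpos_def intro!: mult_right_mono)
  qed
  then show "0 \<le> Re (H' x x)" using assms(4)[OF x(1)] parseval[OF x(1)] by simp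
qed (use sets_sub \<phi>_lin in auto)

text \<open>Lower semicontinuity: a gain of less than \<open>g\<close> leaves the span of the
  negative eigenvectors negative. The trivial combination is exempted because the estimate is
  strict.\<close>

lemma negdim_perturbed:
  assumes "g > 0" "\<And>k. k < N \<Longrightarrow> ev k < 0 \<Longrightarrow> g \<le> - ev k"
    and "\<And>c. Re (H' (lc Neg c e) (lc Neg c e)) < Re (H (lc Neg c e) (lc Neg c e)) + g * (\<Sum>j\<in>Neg. (cmod (c j))\<^sup>2)
      \<or> (\<forall>j\<in>Neg. c j = 0)"
  shows "negdim X H' (card Neg)"
proof (rule negdimI[where v = e])
  fix c :: "nat \<Rightarrow> complex" assume c: "\<exists>j\<in>Neg. c j \<noteq> 0"
  have "g * (\<Sum>j\<in>Neg. (cmod (c j))\<^sup>2) \<le> (\<Sum>j\<in>Neg. - (ev j * (cmod (c j))\<^sup>2))"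
    unfolding sum_distrib_left
  proof (rule sum_mono)
    fix k assume "k \<in> Neg"
    then have "g \<le> - ev k" using assms(2) unfolding Neg_def by auto
    from mult_right_mono[OF this, of "(cmod (c k))\<^sup>2"]
    show "g * (cmod (c k))\<^sup>2 \<le> - (ev k * (cmod (c k))\<^sup>2)" by simp
  qed
  also have "\<dots> = - Re (H (lc Neg c e) (lc Neg c e))" using H_lc sets_sub by (simp add: sum_negf)
  finally show "Re (H' (lc Neg c e) (lc Neg c e)) < 0" using assms(3)[of c] c by fastforce
qed (use sets_sub e_in in auto)

end

text \<open>The vectors \<open>E i\<close> span the \<open>H\<close>-orthogonal complement of the common kernel of the \<open>\<nu> i\<close>,
  on which the form is nonnegative; the form is diagonalised on this complement.\<close>

lemma diagonalization:
  assumes "herm_form X H" and I: "finite I"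
    and \<nu>: "\<And>i. i \<in> I \<Longrightarrow> linfun X (\<nu> i)"
    and E: "\<And>i. i \<in> I \<Longrightarrow> E i \<in> X" "\<And>i j. i \<in> I \<Longrightarrow> j \<in> I \<Longrightarrow> \<nu> i (E j) = (if i = j then 1 else 0)"
    and orth: "\<And>i z. i \<in> I \<Longrightarrow> z \<in> X \<Longrightarrow> (\<And>j. j \<in> I \<Longrightarrow> \<nu> j z = 0) \<Longrightarrow> H (E i) z = 0"
    and pos: "\<And>z. z \<in> X \<Longrightarrow> (\<And>j. j \<in> I \<Longrightarrow> \<nu> j z = 0) \<Longrightarrow> 0 \<le> Re (H z z)"
  shows "\<exists>e ev \<phi>. diag_form X H I \<nu> (card I) e ev \<phi>"
proof -
  interpret herm_form X H by fact
  define h where "h = (\<lambda>i j. H (E j) (E i))"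
  have "h j i = cnj (h i j)" if "i \<in> I" "j \<in> I" for i j unfolding h_def using H_sym E that by blast
  then obtain u ev where u: "orthonormal_family I (card I) u"
     "\<And>k i. k<card I \<Longrightarrow> i\<in>I \<Longrightarrow> (\<Sum>j\<in>I. h i j * u k j) = complex_of_real (ev k) * u k i"
    using hermitian_orthonormal_eigenbasis[OF I, of h] by metis
  define N where "N = card I"
  define e where "e = (\<lambda>k. lc I (u k) E)"
  define \<phi> where "\<phi> = (\<lambda>k z. cdot I (\<lambda>i. \<nu> i z) (u k))"
  \<comment> \<open>\<open>pr\<close> is the \<open>H\<close>-orthogonal projection onto the span of
    the \<open>E i\<close>; \<open>z - pr z\<close> lies in the common kernel of the
    \<open>\<nu> i\<close>.\<close>
  define pr where "pr = (\<lambda>z. lc I (\<lambda>i. \<nu> i z) E)"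
  have eX: "e k \<in> X" for k unfolding e_def using E I by (intro lc_in) auto
  have prX: "pr z \<in> X" for z unfolding pr_def using E I by (intro lc_in) auto
  have \<nu>_lc: "\<nu> i (lc I c E) = c i" if "i \<in> I" for i c
    using linfun_lc[OF \<nu>[OF that] I, of E c] E that I
    by (simp add: if_distrib sum.delta cong: if_cong)
  have nX: "(\<lambda>p. z p - pr z p) \<in> X" if "z \<in> X" for z using that prX by (rule diff_in)
  have \<nu>n: "\<nu> i (\<lambda>p. z p - pr z p) = 0" if "z \<in> X" "i \<in> I" for z i
    using linfun_diff[OF \<nu>[OF that(2)] that(1) prX[of z]] \<nu>_lc[OF that(2)] by (simp add: pr_def)
  have HEz: "H (E i) z = (\<Sum>j\<in>I. cnj (\<nu> j z) * h j i)" if "i \<in> I" "z \<in> X" for i z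
  proof -
    have "H (E i) z - H (E i) (pr z) = H (E i) (\<lambda>p. z p - pr z p)"
      using H_diff_right[OF that(2) prX E(1)[OF that(1)]] by simp
    also have "\<dots> = 0" using that nX \<nu>n by (intro orth) auto
    also have "H (E i) (pr z) = (\<Sum>j\<in>I. cnj (\<nu> j z) * h j i)"
      unfolding pr_def h_def using I E that by (intro H_lc_right) auto
    finally show ?thesis by simp
  qed
  have He: "H (e k) z = complex_of_real (ev k) * cnj (\<phi> k z)" if k: "k < N" and z: "z \<in> X" for k z
  proof -
    have "H (e k) z = (\<Sum>i\<in>I. u k i * (\<Sum>j\<in>I. cnj (\<nu> j z) * h j i))"
      unfolding e_def using I E z by (subst H_lc_left) (auto simp: HEz)
    also have "\<dots> = (\<Sum>i\<in>I. \<Sum>j\<in>I. cnj (\<nu> j z) * (h j i * u k i))"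
      by (simp add: sum_distrib_left mult_ac)
    also have "\<dots> = (\<Sum>j\<in>I. \<Sum>i\<in>I. cnj (\<nu> j z) * (h j i * u k i))" by (rule sum.swap)
    also have "\<dots> = (\<Sum>j\<in>I. cnj (\<nu> j z) * (complex_of_real (ev k) * u k j))"
      using u(2)[of k] k by (simp add: sum_distrib_left[symmetric] N_def)
    finally show ?thesis unfolding \<phi>_def cdot_def by (simp add: sum_distrib_left mult_ac)
  qed
  have \<phi>e: "\<phi> k (e l) = (if k = l then 1 else 0)" if "k < N" "l < N" for k l
  proof -
    have "\<phi> k (e l) = cdot I (u l) (u k)" unfolding \<phi>_def e_def cdot_def using \<nu>_lc by (intro sum.cong) auto
    then show ?thesis using u(1) that unfolding orthonormal_family_def N_def by auto
  qed
  have par: "(\<Sum>k<N. (cmod (\<phi> k z))\<^sup>2) = (\<Sum>i\<in>I. (cmod (\<nu> i z))\<^sup>2)" for z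
    unfolding \<phi>_def N_def by (rule orthonormal_parseval[OF I u(1)])
  have pre: "pr z = lc {..<N} (\<lambda>k. \<phi> k z) e" for z
  proof
    fix p
    have "pr z p = (\<Sum>i\<in>I. (\<Sum>k<N. \<phi> k z * u k i) * E i p)"
      unfolding pr_def lc_def \<phi>_def N_def
      by (intro sum.cong refl arg_cong2[where f="(*)"]) (rule orthonormal_expansion[OF I u(1)])
    also have "\<dots> = (\<Sum>i\<in>I. \<Sum>k<N. \<phi> k z * u k i * E i p)" by (simp add: sum_distrib_right)
    also have "\<dots> = (\<Sum>k<N. \<Sum>i\<in>I. \<phi> k z * u k i * E i p)" by (rule sum.swap)
    finally show "pr z p = lc {..<N} (\<lambda>k. \<phi> k z) e p"
      unfolding lc_def e_def by (simp add: sum_distrib_left mult.assoc)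
  qed
  have ge: "(\<Sum>k<N. ev k * (cmod (\<phi> k z))\<^sup>2) \<le> Re (H z z)" if z: "z \<in> X" for z
  proof -
    define n where "n = (\<lambda>p. z p - pr z p)"
    have n: "n \<in> X" "\<And>i. i \<in> I \<Longrightarrow> \<nu> i n = 0" unfolding n_def using nX \<nu>n z by auto
    have zd: "z = (\<lambda>p. pr z p + n p)" by (simp add: n_def)
    have 0: "H (pr z) n = 0" unfolding pr_def using E I n orth by (subst H_lc_left) auto
    have 1: "H n (pr z) = 0" using H_sym[OF prX[of z] n(1)] 0 by simp
    have "H z z = H (\<lambda>p. pr z p + n p) (\<lambda>p. pr z p + n p)" by (simp flip: zd)
    also have "\<dots> = H (pr z) (pr z) + H n n"
      using add_in[OF prX[of z] n(1)] prX n(1) 0 1 by (simp add: H_add H_add_right)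
    finally have "Re (H (pr z) (pr z)) \<le> Re (H z z)" using pos[OF n] by simp
    moreover have "H (pr z) (pr z) = (\<Sum>k<N. \<phi> k z * H (e k) (pr z))"
      by (subst (1) pre, subst H_lc_left) (auto simp: eX prX)
    moreover have "\<dots> = (\<Sum>k<N. complex_of_real (ev k * (cmod (\<phi> k z))\<^sup>2))"
    proof (intro sum.cong refl)
      fix k assume k: "k \<in> {..<N}"
      have "\<phi> k (pr z) = \<phi> k z" unfolding \<phi>_def cdot_def pr_def using \<nu>_lc by (intro sum.cong) auto
      then show "\<phi> k z * H (e k) (pr z) = complex_of_real (ev k * (cmod (\<phi> k z))\<^sup>2)"
        using He[OF _ prX, of k z] k unfolding of_real_mult complex_norm_square by (simp add: mult_ac)
    qed
    ultimately show ?thesis by simp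
  qed
  have \<phi>lin: "linfun X (\<phi> k)" for k
    using \<nu> unfolding linfun_def \<phi>_def cdot_def
    by (simp add: distrib_right sum.distrib sum_distrib_left mult.assoc)
  have "diag_form X H I \<nu> N e ev \<phi>"
    by unfold_locales (use eX \<phi>lin \<phi>e He par ge in auto)
  then show ?thesis unfolding N_def by blast
qed

section \<open>Pencils of forms\<close>

lemma (in herm_form) lc_bound:
  assumes J: "finite J" and v: "\<And>j. j \<in> J \<Longrightarrow> v j \<in> X"
  shows "\<exists>C>0. \<forall>c. Re (H (lc J c v) (lc J c v)) \<le> C * (\<Sum>j\<in>J. (cmod (c j))\<^sup>2)"
proof (intro exI conjI allI)
  define C where "C = 1 + (\<Sum>k\<in>J. \<Sum>l\<in>J. cmod (H (v k) (v l)))"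
  show "C > 0" unfolding C_def by (simp add: add_pos_nonneg sum_nonneg)
  fix c
  define s where "s = (\<Sum>j\<in>J. (cmod (c j))\<^sup>2)"
  have le: "cmod (c k) * cmod (c l) \<le> s" if "k \<in> J" "l \<in> J" for k l
  proof -
    have "(cmod (c k))\<^sup>2 \<le> s" "(cmod (c l))\<^sup>2 \<le> s"
      unfolding s_def using that J by (intro member_le_sum; simp)+
    moreover have "2 * (cmod (c k) * cmod (c l)) \<le> (cmod (c k))\<^sup>2 + (cmod (c l))\<^sup>2"
      using sum_squares_bound[of "cmod (c k)" "cmod (c l)"] by simp
    ultimately show ?thesis by simp
  qed
  have s0: "0 \<le> s" by (simp add: s_def sum_nonneg)
  have "H (lc J c v) (lc J c v) = (\<Sum>k\<in>J. c k * H (v k) (lc J c v))"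
    using J v lc_in by (intro H_lc_left) auto
  also have "\<dots> = (\<Sum>k\<in>J. \<Sum>l\<in>J. c k * (cnj (c l) * H (v k) (v l)))"
    using J v by (simp add: H_lc_right sum_distrib_left)
  finally have eq: "H (lc J c v) (lc J c v) = (\<Sum>k\<in>J. \<Sum>l\<in>J. c k * (cnj (c l) * H (v k) (v l)))" .
  have "Re (H (lc J c v) (lc J c v)) \<le> cmod (\<Sum>k\<in>J. \<Sum>l\<in>J. c k * (cnj (c l) * H (v k) (v l)))"
    unfolding eq by (rule complex_Re_le_cmod)
  also have "\<dots> \<le> (\<Sum>k\<in>J. \<Sum>l\<in>J. cmod (c k * (cnj (c l) * H (v k) (v l))))"
    by (rule order.trans[OF norm_sum sum_mono[OF norm_sum]])
  also have "\<dots> \<le> (\<Sum>k\<in>J. \<Sum>l\<in>J. s * cmod (H (v k) (v l)))"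
    using le by (intro sum_mono) (auto simp: norm_mult mult.assoc[symmetric] intro!: mult_right_mono)
  also have "\<dots> \<le> C * s" using s0 unfolding C_def by (simp add: sum_distrib_left[symmetric] algebra_simps)
  finally show "Re (H (lc J c v) (lc J c v)) \<le> C * (\<Sum>j\<in>J. (cmod (c j))\<^sup>2)" unfolding s_def .
qed

locale pencil = A: herm_form X A + B: herm_form X B
  for X :: "('p \<Rightarrow> complex) set" and A B +
  assumes B_nonneg: "\<And>x. x \<in> X \<Longrightarrow> 0 \<le> Re (B x x)"
begin

definition Hm :: "real \<Rightarrow> ('p \<Rightarrow> complex) \<Rightarrow> ('p \<Rightarrow> complex) \<Rightarrow> complex" where
  "Hm \<mu> x y = A x y - complex_of_real \<mu> * B x y"

lemma Hm_herm: "herm_form X (Hm \<mu>)"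
proof unfold_locales
  fix x y z c
  show "x \<in> X \<Longrightarrow> y \<in> X \<Longrightarrow> z \<in> X \<Longrightarrow> Hm \<mu> (\<lambda>p. x p + y p) z = Hm \<mu> x z + Hm \<mu> y z"
    by (simp add: Hm_def A.H_add B.H_add algebra_simps)
  show "x \<in> X \<Longrightarrow> z \<in> X \<Longrightarrow> Hm \<mu> (\<lambda>p. c * x p) z = c * Hm \<mu> x z"
    by (simp add: Hm_def A.H_scale B.H_scale algebra_simps)
  show "x \<in> X \<Longrightarrow> z \<in> X \<Longrightarrow> Hm \<mu> z x = cnj (Hm \<mu> x z)"
    unfolding Hm_def by (subst A.H_sym, assumption+, subst B.H_sym, assumption+) simp
qed

lemma Re_Hm: "Re (Hm \<mu> x x) = Re (A x x) - \<mu> * Re (B x x)"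
  by (simp add: Hm_def)

text \<open>Independence is measured by \<open>B\<close>: radical vectors that \<open>B\<close> does
  not see, such as functions changed only outside of the interval, must not count.\<close>

definition raddim :: "real \<Rightarrow> nat \<Rightarrow> bool" where
  "raddim \<mu> k \<longleftrightarrow> (\<exists>v::nat \<Rightarrow> 'p \<Rightarrow> complex. (\<forall>j<k. v j \<in> X \<and> (\<forall>z\<in>X. Hm \<mu> (v j) z = 0)) \<and>
     (\<forall>c. (\<exists>j<k. c j \<noteq> 0) \<longrightarrow> Re (B (lc {..<k} c v) (lc {..<k} c v)) \<noteq> 0))"

definition nul :: "real \<Rightarrow> nat" where "nul \<mu> = Max {k. raddim \<mu> k}"

definition ind :: "real \<Rightarrow> nat" where "ind \<mu> = negindex X (Hm \<mu>)"

end

text \<open>The form is nonnegative on the common kernel of the functionals \<open>\<nu> i\<close>, and the vectors \<open>E i\<close> of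
  the assumption \<open>compl\<close> span a complement orthogonal to it; this makes the index finite.\<close>

locale bounded_pencil = pencil X A B for X :: "('p \<Rightarrow> complex) set" and A B +
  fixes I :: "'i set" and \<nu> :: "'i \<Rightarrow> ('p \<Rightarrow> complex) \<Rightarrow> complex" and M :: real
  assumes fin_I: "finite I"
    and \<nu>_lin: "\<And>i. i \<in> I \<Longrightarrow> linfun X (\<nu> i)"
    and compl: "\<And>\<mu>. \<mu> < M \<Longrightarrow> \<exists>E. (\<forall>i\<in>I. E i \<in> X) \<and>
        (\<forall>i\<in>I. \<forall>j\<in>I. \<nu> i (E j) = (if i = j then 1 else 0)) \<and>
        (\<forall>i\<in>I. \<forall>z\<in>X. (\<forall>j\<in>I. \<nu> j z = 0) \<longrightarrow> Hm \<mu> (E i) z = 0)"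
    and pos: "\<And>\<mu> z. \<mu> < M \<Longrightarrow> z \<in> X \<Longrightarrow> (\<And>j. j \<in> I \<Longrightarrow> \<nu> j z = 0) \<Longrightarrow> 0 \<le> Re (Hm \<mu> z z)"
    and pos_def: "\<And>\<mu> z. \<mu> < M \<Longrightarrow> z \<in> X \<Longrightarrow> (\<And>j. j \<in> I \<Longrightarrow> \<nu> j z = 0) \<Longrightarrow> Re (Hm \<mu> z z) = 0 \<Longrightarrow> Re (B z z) = 0"
    and nondeg: "\<And>\<mu> z i. z \<in> X \<Longrightarrow> Re (B z z) = 0 \<Longrightarrow> (\<And>y. y \<in> X \<Longrightarrow> Hm \<mu> z y = 0) \<Longrightarrow> i \<in> I \<Longrightarrow> \<nu> i z = 0"
begin

abbreviation "N \<equiv> card I"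

lemma diag: "\<mu> < M \<Longrightarrow> \<exists>e ev \<phi>. diag_form X (Hm \<mu>) I \<nu> N e ev \<phi>"
proof -
  assume \<mu>: "\<mu> < M"
  obtain E where "\<forall>i\<in>I. E i \<in> X" "\<forall>i\<in>I. \<forall>j\<in>I. \<nu> i (E j) = (if i = j then 1 else 0)"
    "\<forall>i\<in>I. \<forall>z\<in>X. (\<forall>j\<in>I. \<nu> j z = 0) \<longrightarrow> Hm \<mu> (E i) z = 0" using compl[OF \<mu>] by blast
  then show ?thesis by (intro diagonalization[OF Hm_herm fin_I \<nu>_lin, where E = E] pos[OF \<mu>]) auto
qed

text \<open>The radical modulo \<open>B\<close>-null vectors is spanned by the \<open>e k\<close>
  with \<open>ev k = 0\<close>. A radical vector without such components has no components at all,
  hence lies in the common kernel of the \<open>\<nu> i\<close>, where \<open>pos_def\<close> makes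
  its \<open>B\<close>-value vanish.\<close>

lemma nul_card:
  assumes \<mu>: "\<mu> < M" and d: "diag_form X (Hm \<mu>) I \<nu> N e ev \<phi>"
  shows "raddim \<mu> (card (diag_form.Nul N ev))" "nul \<mu> = card (diag_form.Nul N ev)"
    "\<And>k. raddim \<mu> k \<Longrightarrow> k \<le> nul \<mu>"
proof -
  interpret D: diag_form X "Hm \<mu>" I \<nu> N e ev \<phi> by fact
  let ?n = "card D.Nul"
  show 1: "raddim \<mu> ?n"
  proof -
    obtain f where f: "bij_betw f {..<?n} D.Nul"
      using ex_bij_betw_nat_finite[OF D.sets_sub(6)] by (auto simp: atLeast0LessThan)
    have fN: "f j \<in> D.Nul" "f j < N" "ev (f j) = 0" if "j < ?n" for j
      using f that by (auto simp: bij_betw_def D.Nul_def)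
    have rad: "Hm \<mu> (e (f j)) z = 0" if "j < ?n" "z \<in> X" for j z using D.H_e fN that by simp
    show ?thesis unfolding raddim_def
    proof (intro exI[of _ "e \<circ> f"] conjI allI impI ballI)
      fix c :: "nat \<Rightarrow> complex" assume c: "\<exists>j<?n. c j \<noteq> 0"
      define \<xi> where "\<xi> = lc {..<?n} c (e \<circ> f)"
      have \<xi>X: "\<xi> \<in> X" unfolding \<xi>_def using D.e_in fN by (intro A.lc_in) auto
      show "Re (B (lc {..<?n} c (e \<circ> f)) (lc {..<?n} c (e \<circ> f))) \<noteq> 0"
      proof
        assume "Re (B (lc {..<?n} c (e \<circ> f)) (lc {..<?n} c (e \<circ> f))) = 0"
        then have B0: "Re (B \<xi> \<xi>) = 0" unfolding \<xi>_def .
        have "Hm \<mu> \<xi> y = 0" if "y \<in> X" for y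
          unfolding \<xi>_def using D.e_in fN that rad by (subst D.H_lc_left) auto
        then have "\<forall>i\<in>I. \<nu> i \<xi> = 0" using nondeg[OF \<xi>X B0] by blast
        then have "(\<Sum>k<N. (cmod (\<phi> k \<xi>))\<^sup>2) = 0" using D.parseval[OF \<xi>X] by simp
        then have \<phi>0: "\<phi> k \<xi> = 0" if "k < N" for k using that by (simp add: sum_nonneg_eq_0_iff)
        have "c j = 0" if j: "j < ?n" for j
        proof -
          have "\<phi> (f j) \<xi> = (\<Sum>l<?n. c l * \<phi> (f j) (e (f l)))"
            unfolding \<xi>_def using A.linfun_lc[OF D.\<phi>_lin[OF fN(2)[OF j]], of "{..<?n}" "e \<circ> f" c] D.e_in fN by auto
          also have "\<dots> = (\<Sum>l<?n. c l * (if j = l then 1 else 0))"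
            using D.\<phi>_e fN j f by (intro sum.cong refl) (auto simp: bij_betw_def inj_on_def)
          also have "\<dots> = c j" using j by (simp add: if_distrib sum.delta cong: if_cong)
          finally show ?thesis using \<phi>0 fN(2)[OF j] by simp
        qed
        then show False using c by blast
      qed
    qed (use fN D.e_in rad in auto)
  qed
  have 2: "k \<le> ?n" if k: "raddim \<mu> k" for k
  proof (rule ccontr)
    assume "\<not> k \<le> ?n"
    then have lt: "?n < card {..<k}" by simp
    obtain v where v: "\<And>j. j < k \<Longrightarrow> v j \<in> X" "\<And>j z. j < k \<Longrightarrow> z \<in> X \<Longrightarrow> Hm \<mu> (v j) z = 0"
      "\<And>c. (\<exists>j<k. c j \<noteq> 0) \<Longrightarrow> Re (B (lc {..<k} c v) (lc {..<k} c v)) \<noteq> 0"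
      using k unfolding raddim_def by blast
    obtain c where c: "\<exists>j\<in>{..<k}. c j \<noteq> 0" "\<forall>l\<in>D.Nul. (\<Sum>j<k. \<phi> l (v j) * c j) = 0"
      using homogeneous_system_nontrivial[OF D.sets_sub(6) finite_lessThan lt, of "\<lambda>l j. \<phi> l (v j)"] by blast
    define \<xi> where "\<xi> = lc {..<k} c v"
    have \<xi>X: "\<xi> \<in> X" unfolding \<xi>_def using v by (intro A.lc_in) auto
    have rad: "Hm \<mu> \<xi> y = 0" if "y \<in> X" for y
      unfolding \<xi>_def using v that by (subst D.H_lc_left) auto
    have "\<phi> l \<xi> = 0" if l: "l < N" for l
    proof (cases "ev l = 0")
      case True
      then show ?thesis unfolding \<xi>_def using A.linfun_lc[OF D.\<phi>_lin[OF l], of "{..<k}" v c] c(2) v l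
        by (simp add: D.Nul_def mult.commute)
    next
      case False
      have "Hm \<mu> (e l) \<xi> = 0" using rad[OF D.e_in[OF l]] D.H_sym[OF \<xi>X D.e_in[OF l]] by simp
      then show ?thesis using D.H_e[OF l \<xi>X] False by simp
    qed
    then have "(\<Sum>i\<in>I. (cmod (\<nu> i \<xi>))\<^sup>2) = 0" using D.parseval[OF \<xi>X] by simp
    then have "\<forall>i\<in>I. \<nu> i \<xi> = 0" using fin_I by (simp add: sum_nonneg_eq_0_iff)
    then have "Re (B \<xi> \<xi>) = 0" using pos_def[OF \<mu> \<xi>X] rad[OF \<xi>X] by simp
    then show False using v(3)[of c] c(1) unfolding \<xi>_def by blast
  qed
  show 3: "nul \<mu> = ?n" unfolding nul_def
  proof (rule Max_eqI)
    show "finite {k. raddim \<mu> k}" by (rule finite_subset[of _ "{..?n}"]) (use 2 in auto)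
  qed (use 1 2 in auto)
  show "\<And>k. raddim \<mu> k \<Longrightarrow> k \<le> nul \<mu>" using 2 3 by simp
qed

lemma raddim_nul: "\<mu> < M \<Longrightarrow> raddim \<mu> (nul \<mu>)"
  and raddim_le_nul: "\<mu> < M \<Longrightarrow> raddim \<mu> k \<Longrightarrow> k \<le> nul \<mu>"
  using diag nul_card by metis+

lemma negdim_ind: "\<mu> < M \<Longrightarrow> negdim X (Hm \<mu>) (ind \<mu>)"
  and negdim_le_ind: "\<mu> < M \<Longrightarrow> negdim X (Hm \<mu>) k \<Longrightarrow> k \<le> ind \<mu>"
proof -
  assume \<mu>: "\<mu> < M"
  obtain e ev \<phi> where "diag_form X (Hm \<mu>) I \<nu> N e ev \<phi>" using diag[OF \<mu>] by blast
  then interpret D: diag_form X "Hm \<mu>" I \<nu> N e ev \<phi> .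
  have "k \<le> card D.Neg" if "negdim X (Hm \<mu>) k" for k
  proof (rule negdim_le_card[OF A.vsubspace_axioms that, where \<phi> = \<phi>])
    fix x assume x: "x \<in> X" "\<And>l. l \<in> D.Neg \<Longrightarrow> \<phi> l x = 0"
    have "0 \<le> (\<Sum>k<N. ev k * (cmod (\<phi> k x))\<^sup>2)"
    proof (rule sum_nonneg)
      fix k assume "k \<in> {..<N}"
      then show "0 \<le> ev k * (cmod (\<phi> k x))\<^sup>2"
        using x(2)[of k] by (cases "ev k < 0") (auto simp: D.Neg_def)
    qed
    then show "0 \<le> Re (Hm \<mu> x x)" using D.H_ge[OF x(1)] by linarith
  qed (use D.sets_sub D.\<phi>_lin in auto)
  moreover have "ind \<mu> = card D.Neg" unfolding ind_def by (rule D.negindex_eq)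
  ultimately show *: "negdim X (Hm \<mu>) k \<Longrightarrow> k \<le> ind \<mu>" for k by simp
  have "finite {k. negdim X (Hm \<mu>) k}" by (rule finite_subset[of _ "{..ind \<mu>}"]) (use * in auto)
  moreover have "negdim X (Hm \<mu>) 0" unfolding negdim_def by simp
  ultimately show "negdim X (Hm \<mu>) (ind \<mu>)" unfolding ind_def negindex_def
    using Max_in[of "{k. negdim X (Hm \<mu>) k}"] by blast
qed

lemma ind_mono: "\<mu> \<le> \<mu>' \<Longrightarrow> \<mu>' < M \<Longrightarrow> ind \<mu> \<le> ind \<mu>'"
  by (rule negdim_le_ind, assumption, rule negdim_mono[OF negdim_ind A.vsubspace_axioms])
    (auto simp: Re_Hm intro!: mult_right_mono B_nonneg)

text \<open>Raising the parameter subtracts a multiple of \<open>B\<close>. A combination of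
  nonpositive eigenvectors that does not become negative has zero form and zero
  \<open>B\<close>-value, so it is radical and \<open>nondeg\<close> makes it trivial.\<close>

lemma ind_right_ge:
  assumes "\<mu> < \<mu>'" "\<mu>' < M"
  shows "ind \<mu> + nul \<mu> \<le> ind \<mu>'"
proof (rule negdim_le_ind[OF assms(2)])
  have \<mu>: "\<mu> < M" using assms by simp
  obtain e ev \<phi> where d: "diag_form X (Hm \<mu>) I \<nu> N e ev \<phi>" using diag[OF \<mu>] by blast
  then interpret D: diag_form X "Hm \<mu>" I \<nu> N e ev \<phi> .
  have card: "ind \<mu> + nul \<mu> = card D.Nonpos"
    using nul_card[OF \<mu> d] D.negindex_eq D.sets_sub by (simp add: ind_def)
  show "negdim X (Hm \<mu>') (ind \<mu> + nul \<mu>)" unfolding card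
  proof (rule negdimI[where v = e])
    fix c :: "nat \<Rightarrow> complex" assume c: "\<exists>j\<in>D.Nonpos. c j \<noteq> 0"
    define \<xi> where "\<xi> = lc D.Nonpos c e"
    have \<xi>X: "\<xi> \<in> X" unfolding \<xi>_def by (rule D.lc_e_in[OF D.sets_sub(2)])
    have H\<xi>: "Re (Hm \<mu> \<xi> \<xi>) = (\<Sum>j\<in>D.Nonpos. ev j * (cmod (c j))\<^sup>2)"
      unfolding \<xi>_def by (rule D.H_lc[OF D.sets_sub(2)])
    have le: "Re (Hm \<mu> \<xi> \<xi>) \<le> 0" unfolding H\<xi>
      by (intro sum_nonpos) (auto simp: D.Nonpos_def mult_nonpos_nonneg)
    have "Re (Hm \<mu>' \<xi> \<xi>) < 0"
    proof (rule ccontr)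
      assume "\<not> Re (Hm \<mu>' \<xi> \<xi>) < 0"
      moreover have "Re (Hm \<mu>' \<xi> \<xi>) = Re (Hm \<mu> \<xi> \<xi>) - (\<mu>' - \<mu>) * Re (B \<xi> \<xi>)"
        by (simp add: Re_Hm algebra_simps)
      moreover have "(\<mu>' - \<mu>) * Re (B \<xi> \<xi>) \<ge> 0" using assms B_nonneg[OF \<xi>X] by simp
      ultimately have 0: "Re (Hm \<mu> \<xi> \<xi>) = 0" "(\<mu>' - \<mu>) * Re (B \<xi> \<xi>) = 0" using le by linarith+
      then have B0: "Re (B \<xi> \<xi>) = 0" using assms by simp
      have "(\<Sum>j\<in>D.Nonpos. - (ev j * (cmod (c j))\<^sup>2)) = 0" using 0 H\<xi> by (simp add: sum_negf)
      then have cz: "ev j * (cmod (c j))\<^sup>2 = 0" if "j \<in> D.Nonpos" for j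
        using that D.sets_sub(5) by (subst (asm) sum_nonneg_eq_0_iff) (auto simp: D.Nonpos_def mult_nonpos_nonneg)
      have "Hm \<mu> \<xi> y = 0" if y: "y \<in> X" for y
      proof -
        have "Hm \<mu> \<xi> y = (\<Sum>j\<in>D.Nonpos. c j * Hm \<mu> (e j) y)"
          unfolding \<xi>_def using D.sets_sub D.e_in y by (intro D.H_lc_left) auto
        also have "\<dots> = 0"
        proof (intro sum.neutral ballI)
          fix j assume j: "j \<in> D.Nonpos"
          then show "c j * Hm \<mu> (e j) y = 0" using cz[OF j] D.H_e[of j y] y by (auto simp: D.Nonpos_def)
        qed
        finally show ?thesis .
      qed
      then have "\<forall>i\<in>I. \<nu> i \<xi> = 0" using nondeg[OF \<xi>X B0] by blast
      then have "(\<Sum>j\<in>D.Nonpos. (cmod (c j))\<^sup>2) = 0"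
        using D.sum_\<phi>_lc[OF D.sets_sub(2), of c] by (simp add: \<xi>_def)
      then show False using c D.sets_sub(5) by (simp add: sum_nonneg_eq_0_iff)
    qed
    then show "Re (Hm \<mu>' (lc D.Nonpos c e) (lc D.Nonpos c e)) < 0" unfolding \<xi>_def .
  qed (use D.sets_sub D.e_in in auto)
qed

text \<open>The form is affine in the spectral parameter, so between two parameters it dominates a
  convex combination.\<close>

lemma ind_right_le:
  assumes \<mu>: "\<mu> < M"
  shows "\<exists>\<delta>>0. \<mu> + \<delta> \<le> M \<and> (\<forall>\<mu>'. \<mu> < \<mu>' \<and> \<mu>' < \<mu> + \<delta> \<longrightarrow> ind \<mu>' \<le> ind \<mu> + nul \<mu>)"
proof -
  obtain e ev \<phi> where d: "diag_form X (Hm \<mu>) I \<nu> N e ev \<phi>" using diag[OF \<mu>] by blast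
  then interpret D: diag_form X "Hm \<mu>" I \<nu> N e ev \<phi> .
  have card: "ind \<mu> + nul \<mu> = card D.Nonpos"
    using nul_card[OF \<mu> d] D.negindex_eq D.sets_sub by (simp add: ind_def)
  define \<mu>1 where "\<mu>1 = (\<mu> + M) / 2"
  have \<mu>1: "\<mu> < \<mu>1" "\<mu>1 < M" using \<mu> by (auto simp: \<mu>1_def)
  obtain e1 ev1 \<phi>1 where "diag_form X (Hm \<mu>1) I \<nu> N e1 ev1 \<phi>1" using diag[OF \<mu>1(2)] by blast
  then interpret D1: diag_form X "Hm \<mu>1" I \<nu> N e1 ev1 \<phi>1 .
  define C where "C = 1 + (\<Sum>k<N. \<bar>ev1 k\<bar>) + (\<Sum>k<N. \<bar>ev k\<bar>)"
  have C: "C > 0" unfolding C_def by (simp add: add_pos_nonneg sum_nonneg)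
  have mem: "\<bar>ev1 k\<bar> \<le> (\<Sum>k<N. \<bar>ev1 k\<bar>)" "\<bar>ev k\<bar> \<le> (\<Sum>k<N. \<bar>ev k\<bar>)" if "k < N" for k
    using that by (intro member_le_sum; simp)+
  have evC: "- C \<le> ev1 k" "ev k \<le> C" if "k < N" for k
  proof -
    have "0 \<le> (\<Sum>k<N. \<bar>ev1 k\<bar>)" "0 \<le> (\<Sum>k<N. \<bar>ev k\<bar>)" by (simp_all add: sum_nonneg)
    then show "- C \<le> ev1 k" "ev k \<le> C" using mem[OF that] unfolding C_def by linarith+
  qed
  obtain g where g: "g > 0" "\<And>k. k < N \<Longrightarrow> ev k \<noteq> 0 \<Longrightarrow> g \<le> \<bar>ev k\<bar>" using D.spectral_gap by blast
  \<comment> \<open>With weight \<theta> on \<mu>1, the lost amount \<open>\<theta> * q\<close> and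
    the value at \<mu>1 each cost at most \<open>\<theta> * C * s\<close>, and this \<delta> makes
    that at most half of the allowed \<open>g * s\<close>.\<close>
  define \<delta> where "\<delta> = min (g / (2 * C)) 1 * (\<mu>1 - \<mu>)"
  have \<delta>: "\<delta> > 0" "\<delta> \<le> \<mu>1 - \<mu>" using g C \<mu>1 by (auto simp: \<delta>_def mult_le_cancel_right2)
  have "ind \<mu>' \<le> ind \<mu> + nul \<mu>" if \<mu>': "\<mu> < \<mu>'" "\<mu>' < \<mu> + \<delta>" for \<mu>'
  proof -
    define \<theta> where "\<theta> = (\<mu>' - \<mu>) / (\<mu>1 - \<mu>)"
    have \<theta>: "0 < \<theta>" "\<theta> \<le> 1" "\<theta> * C \<le> g / 2"
    proof -
      show "0 < \<theta>" using \<mu>' \<mu>1 by (simp add: \<theta>_def)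
      have *: "\<mu>' - \<mu> \<le> min (g / (2 * C)) 1 * (\<mu>1 - \<mu>)" using \<mu>' unfolding \<delta>_def by linarith
      have "\<theta> \<le> min (g / (2 * C)) 1" unfolding \<theta>_def
        by (subst pos_divide_le_eq) (use \<mu>1 in simp, rule *)
      then show "\<theta> \<le> 1" "\<theta> * C \<le> g / 2" using C by (auto simp: field_simps)
    qed
    have "\<mu>' < M" using \<mu>' \<delta> \<mu>1 by simp
    have "ind \<mu>' \<le> card D.Nonpos"
    proof (rule D.negindex_le[OF Hm_herm g(1) _ _ negdim_ind[OF \<open>\<mu>' < M\<close>]])
      fix k assume "k < N" "ev k > 0" then show "g \<le> ev k" using g(2)[of k] by simp
    next
      fix x assume x: "x \<in> X"
      define s where "s = (\<Sum>i\<in>I. (cmod (\<nu> i x))\<^sup>2)"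
      define q where "q = (\<Sum>k<N. ev k * (cmod (\<phi> k x))\<^sup>2)"
      have "\<mu>' = \<mu> + \<theta> * (\<mu>1 - \<mu>)" using \<mu>1 by (simp add: \<theta>_def)
      then have conv: "Re (Hm \<mu>' x x) = (1 - \<theta>) * Re (Hm \<mu> x x) + \<theta> * Re (Hm \<mu>1 x x)"
        unfolding Re_Hm by (simp only:) (simp add: algebra_simps)
      have "- C * s \<le> Re (Hm \<mu>1 x x)"
      proof -
        have "- C * s = (\<Sum>k<N. - C * (cmod (\<phi>1 k x))\<^sup>2)"
          unfolding s_def D1.parseval[OF x, symmetric] by (simp add: sum_distrib_left sum_negf)
        also have "\<dots> \<le> (\<Sum>k<N. ev1 k * (cmod (\<phi>1 k x))\<^sup>2)" using evC by (intro sum_mono mult_right_mono) auto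
        finally show ?thesis using D1.H_ge[OF x] by simp
      qed
      then have 1: "\<theta> * (- C * s) \<le> \<theta> * Re (Hm \<mu>1 x x)" using \<theta> by (intro mult_left_mono) auto
      have 2: "(1 - \<theta>) * q \<le> (1 - \<theta>) * Re (Hm \<mu> x x)"
        using D.H_ge[OF x] \<theta> unfolding q_def by (intro mult_left_mono) auto
      have "q \<le> C * s"
        unfolding q_def s_def D.parseval[OF x, symmetric] sum_distrib_left using evC by (intro sum_mono mult_right_mono) auto
      then have 3: "\<theta> * q \<le> \<theta> * (C * s)" using \<theta> by (intro mult_left_mono) auto
      have "\<theta> * C * s \<le> g / 2 * s" using \<theta> by (intro mult_right_mono) (auto simp: s_def sum_nonneg)
      then have "q - g * s \<le> Re (Hm \<mu>' x x)" using 1 2 3 unfolding conv by (simp add: algebra_simps)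
      then show "(\<Sum>k<N. ev k * (cmod (\<phi> k x))\<^sup>2) - g * (\<Sum>i\<in>I. (cmod (\<nu> i x))\<^sup>2) \<le> Re (Hm \<mu>' x x)"
        unfolding q_def s_def .
    qed
    then show ?thesis using card by simp
  qed
  then show ?thesis using \<delta> \<mu>1 by (intro exI[of _ \<delta>]) auto
qed

text \<open>\<open>B\<close> is bounded on the finite-dimensional negative space, so the form stays
  negative there for slightly smaller parameters; the other inequality is monotonicity.\<close>

lemma ind_left:
  assumes \<mu>: "\<mu> < M"
  shows "\<exists>\<delta>>0. \<forall>\<mu>'. \<mu> - \<delta> < \<mu>' \<and> \<mu>' \<le> \<mu> \<longrightarrow> ind \<mu>' = ind \<mu>"
proof -
  obtain e ev \<phi> where d: "diag_form X (Hm \<mu>) I \<nu> N e ev \<phi>" using diag[OF \<mu>] by blast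
  then interpret D: diag_form X "Hm \<mu>" I \<nu> N e ev \<phi> .
  have card: "ind \<mu> = card D.Neg" using D.negindex_eq by (simp add: ind_def)
  obtain g where g: "g > 0" "\<And>k. k < N \<Longrightarrow> ev k \<noteq> 0 \<Longrightarrow> g \<le> \<bar>ev k\<bar>" using D.spectral_gap by blast
  have eX: "e j \<in> X" if "j \<in> D.Neg" for j using that D.e_in D.Neg_def by auto
  obtain C where C: "C > 0" and Ble: "\<And>c. Re (B (lc D.Neg c e) (lc D.Neg c e)) \<le> C * (\<Sum>j\<in>D.Neg. (cmod (c j))\<^sup>2)"
    using B.lc_bound[of D.Neg e] D.sets_sub eX by blast
  define \<delta> where "\<delta> = g / (2 * C)"
  have \<delta>: "\<delta> > 0" using g C by (simp add: \<delta>_def)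
  have "ind \<mu>' = ind \<mu>" if \<mu>': "\<mu> - \<delta> < \<mu>'" "\<mu>' \<le> \<mu>" for \<mu>'
  proof (rule antisym)
    show "ind \<mu>' \<le> ind \<mu>" using ind_mono \<mu>' \<mu> by simp
    have "negdim X (Hm \<mu>') (card D.Neg)"
    proof (rule D.negdim_perturbed[OF g(1)])
      fix k assume "k < N" "ev k < 0" then show "g \<le> - ev k" using g(2)[of k] by simp
    next
      fix c
      define s where "s = (\<Sum>j\<in>D.Neg. (cmod (c j))\<^sup>2)"
      let ?x = "lc D.Neg c e"
      show "Re (Hm \<mu>' ?x ?x) < Re (Hm \<mu> ?x ?x) + g * (\<Sum>j\<in>D.Neg. (cmod (c j))\<^sup>2) \<or> (\<forall>j\<in>D.Neg. c j = 0)"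
      proof (cases "s = 0")
        case True then show ?thesis using D.sets_sub unfolding s_def by (simp add: sum_nonneg_eq_0_iff)
      next
        case False
        then have s: "s > 0" unfolding s_def by (simp add: less_le sum_nonneg)
        have "Re (Hm \<mu>' ?x ?x) = Re (Hm \<mu> ?x ?x) + (\<mu> - \<mu>') * Re (B ?x ?x)" by (simp add: Re_Hm algebra_simps)
        also have "(\<mu> - \<mu>') * Re (B ?x ?x) \<le> \<delta> * (C * s)"
          using Ble[of c] \<mu>' B_nonneg[OF D.lc_e_in[OF D.sets_sub(1)], of c] unfolding s_def by (intro mult_mono) auto
        also have "\<dots> < g * s" using C s g by (simp add: \<delta>_def)
        finally show ?thesis unfolding s_def by simp
      qed
    qed
    then show "ind \<mu> \<le> ind \<mu>'" using negdim_le_ind[of \<mu>'] \<mu>' \<mu> card by simp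
  qed
  then show ?thesis using \<delta> by blast
qed

text \<open>Without zero eigenvalues the gap \<open>g\<close> separates both signs, and a
  perturbation of at most \<open>g / 2\<close> moves none across. It is measured by the
  \<open>\<nu> i\<close> only, which is adequate because a change of the boundary condition acts on
  finitely many values.\<close>

theorem ind_stable:
  assumes \<mu>: "\<mu> < M" and nul: "nul \<mu> = 0"
  shows "\<exists>\<delta>>0. \<forall>A'. herm_form X A' \<and>
     (\<forall>x\<in>X. \<bar>Re (A' x x) - Re (A x x)\<bar> \<le> \<delta> * (\<Sum>i\<in>I. (cmod (\<nu> i x))\<^sup>2)) \<longrightarrow>
     negindex X (\<lambda>x y. A' x y - complex_of_real \<mu> * B x y) = ind \<mu>"
proof -
  obtain e ev \<phi> where d: "diag_form X (Hm \<mu>) I \<nu> N e ev \<phi>" using diag[OF \<mu>] by blast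
  then interpret D: diag_form X "Hm \<mu>" I \<nu> N e ev \<phi> .
  have card: "ind \<mu> = card D.Neg" using D.negindex_eq by (simp add: ind_def)
  have card': "card D.Nonpos = card D.Neg" using nul_card(2)[OF \<mu> d] nul D.sets_sub(7) by simp
  obtain g where g: "g > 0" "\<And>k. k < N \<Longrightarrow> ev k \<noteq> 0 \<Longrightarrow> g \<le> \<bar>ev k\<bar>" using D.spectral_gap by blast
  show ?thesis
  proof (intro exI[of _ "g/2"] conjI allI impI)
    show "g / 2 > 0" using g by simp
    fix A' assume A': "herm_form X A' \<and>
     (\<forall>x\<in>X. \<bar>Re (A' x x) - Re (A x x)\<bar> \<le> g / 2 * (\<Sum>i\<in>I. (cmod (\<nu> i x))\<^sup>2))"
    let ?H' = "\<lambda>x y. A' x y - complex_of_real \<mu> * B x y"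
    interpret A': herm_form X A' using A' by blast
    interpret P: pencil X A' B by unfold_locales (rule B_nonneg)
    have H': "?H' = P.Hm \<mu>" by (intro ext) (simp add: P.Hm_def)
    have close: "\<bar>Re (?H' x x) - Re (Hm \<mu> x x)\<bar> \<le> g / 2 * (\<Sum>i\<in>I. (cmod (\<nu> i x))\<^sup>2)" if "x \<in> X" for x
      using A' that by (simp add: Hm_def)
    show "negindex X ?H' = ind \<mu>"
    proof (rule negindex_eqI)
      show "negdim X ?H' (ind \<mu>)" unfolding card
      proof (rule D.negdim_perturbed[OF g(1)])
        fix k assume "k < N" "ev k < 0" then show "g \<le> - ev k" using g(2)[of k] by simp
      next
        fix c
        define s where "s = (\<Sum>j\<in>D.Neg. (cmod (c j))\<^sup>2)"
        let ?x = "lc D.Neg c e"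
        show "Re (?H' ?x ?x) < Re (Hm \<mu> ?x ?x) + g * (\<Sum>j\<in>D.Neg. (cmod (c j))\<^sup>2) \<or> (\<forall>j\<in>D.Neg. c j = 0)"
        proof (cases "s = 0")
          case True then show ?thesis using D.sets_sub unfolding s_def by (simp add: sum_nonneg_eq_0_iff)
        next
          case False
          then have s: "s > 0" unfolding s_def by (simp add: less_le sum_nonneg)
          have "\<bar>Re (?H' ?x ?x) - Re (Hm \<mu> ?x ?x)\<bar> \<le> g / 2 * s"
            using close[OF D.lc_e_in[OF D.sets_sub(1)], of c] D.sum_\<phi>_lc[OF D.sets_sub(1), of c] by (simp add: s_def)
          also have "\<dots> < g * s" using s g by simp
          finally show ?thesis unfolding s_def by linarith
        qed
      qed
    next
      fix k assume k: "negdim X ?H' k"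
      have "k \<le> card D.Nonpos"
      proof (rule D.negindex_le[OF _ g(1) _ _ k])
        show "herm_form X ?H'" unfolding H' by (rule P.Hm_herm)
        fix k assume "k < N" "ev k > 0" then show "g \<le> ev k" using g(2)[of k] by simp
      next
        fix x assume x: "x \<in> X"
        have "0 \<le> (\<Sum>i\<in>I. (cmod (\<nu> i x))\<^sup>2)" by (simp add: sum_nonneg)
        then have "g / 2 * (\<Sum>i\<in>I. (cmod (\<nu> i x))\<^sup>2) \<le> g * (\<Sum>i\<in>I. (cmod (\<nu> i x))\<^sup>2)"
          using g by (intro mult_right_mono) auto
        then show "(\<Sum>k<N. ev k * (cmod (\<phi> k x))\<^sup>2) - g * (\<Sum>i\<in>I. (cmod (\<nu> i x))\<^sup>2) \<le> Re (?H' x x)"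
          using close[OF x] D.H_ge[OF x] by linarith
      qed
      then show "k \<le> ind \<mu>" using card card' by simp
    qed
  qed
qed

lemma sum_nul_le:
  assumes "\<And>\<mu>. \<mu> \<le> \<mu>0 \<Longrightarrow> ind \<mu> = c0" and "finite F" "\<And>l. l \<in> F \<Longrightarrow> l < \<mu>" "\<mu> < M"
  shows "c0 + (\<Sum>l\<in>F. nul l) \<le> ind \<mu>"
  using assms(2-4)
proof (induction F arbitrary: \<mu> rule: finite_linorder_max_induct)
  case empty
  have "ind (min \<mu> \<mu>0) \<le> ind \<mu>" using empty by (intro ind_mono) auto
  then show ?case using assms(1)[of "min \<mu> \<mu>0"] by simp
next
  case (insert b F)
  have "c0 + (\<Sum>l\<in>F. nul l) \<le> ind b" using insert by force
  moreover have "ind b + nul b \<le> ind \<mu>" using insert by (intro ind_right_ge) auto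
  moreover have "b \<notin> F" using insert by blast
  ultimately show ?case using insert by simp
qed

text \<open>The difference \<open>g\<close> of the index and the accumulated nullities is locally
  constant on the half-line below \<open>M\<close>, since the jumps on the right cancel and there
  are none on the left. Connectedness carries its value over from far left, where the index is
  \<open>c0\<close>. It is integer valued to avoid truncated subtraction.\<close>

theorem ind_count:
  assumes c0: "\<And>\<mu>. \<mu> \<le> \<mu>0 \<Longrightarrow> ind \<mu> = c0" and "\<mu> < M"
  shows "finite {l. l < \<mu> \<and> 0 < nul l}" "c0 + (\<Sum>l\<in>{l. l < \<mu> \<and> 0 < nul l}. nul l) = ind \<mu>"
proof -
  define Z where "Z = (\<lambda>\<mu>. {l. l < \<mu> \<and> 0 < nul l})"
  have Zfin: "finite (Z \<mu>)" if \<mu>: "\<mu> < M" for \<mu>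
  proof (rule ccontr)
    assume "infinite (Z \<mu>)"
    then obtain F where F: "finite F" "card F = Suc (ind \<mu>)" "F \<subseteq> Z \<mu>"
      using infinite_arbitrarily_large by blast
    have "card F = (\<Sum>l\<in>F. 1)" by simp
    also have "\<dots> \<le> (\<Sum>l\<in>F. nul l)" using F by (intro sum_mono) (auto simp: Z_def Suc_le_eq)
    also have "\<dots> \<le> ind \<mu>" using sum_nul_le[OF c0 F(1) _ \<mu>] F by (force simp: Z_def)
    finally show False using F by simp
  qed
  define g where "g = (\<lambda>\<mu>. int (ind \<mu>) - int (\<Sum>l\<in>Z \<mu>. nul l))"
  have nul0: "nul l = 0" if "l < m" "m < M" "ind m = ind l" for l m
    using ind_right_ge[OF that(1,2)] that(3) by simp
  have loc: "eventually (\<lambda>y. g x = g y) (at x within {..<M})" if x: "x \<in> {..<M}" for x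
  proof -
    have xM: "x < M" using x by simp
    obtain d1 where d1: "d1 > 0" "x + d1 \<le> M" "\<And>y. x < y \<Longrightarrow> y < x + d1 \<Longrightarrow> ind y \<le> ind x + nul x"
      using ind_right_le[OF xM] by blast
    obtain d2 where d2: "d2 > 0" "\<And>y. x - d2 < y \<Longrightarrow> y \<le> x \<Longrightarrow> ind y = ind x"
      using ind_left[OF xM] by blast
    have r: "g y = g x" if y: "x < y" "y < x + d1" for y
    proof -
      have eq: "ind z = ind x + nul x" if "x < z" "z < x + d1" for z
        using ind_right_ge[of x z] d1(2,3) that by (intro antisym) auto
      have "nul l = 0" if "x < l" "l < y" for l using nul0[of l y] eq[of l] eq[of y] that y d1 by auto
      then have Zy: "Z y = Z x \<union> (if nul x > 0 then {x} else {})"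
        using y unfolding Z_def by auto (metis linorder_neqE_linordered_idom less_irrefl)+
      have "(\<Sum>l\<in>Z y. nul l) = (\<Sum>l\<in>Z x. nul l) + nul x"
        unfolding Zy using Zfin[OF xM] by (auto simp: Z_def)
      then show ?thesis using eq[OF y] by (simp add: g_def del: of_nat_sum)
    qed
    have l: "g y = g x" if y: "x - d2 < y" "y < x" for y
    proof -
      have "nul l = 0" if "y \<le> l" "l < x" for l using nul0[of l x] d2(2)[of l] that y xM by auto
      then have "Z y = Z x" using y unfolding Z_def by auto (metis less_irrefl not_le)
      then show ?thesis using d2(2)[of y] y by (simp add: g_def)
    qed
    have "g x = g y" if "dist y x < min d1 d2" for y
      using r[of y] l[of y] that by (cases y x rule: linorder_cases) (auto simp: dist_real_def abs_if split: if_splits)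
    then show ?thesis unfolding eventually_at using d1(1) d2(1) by (intro exI[of _ "min d1 d2"]) auto
  qed
  define m0 where "m0 = min \<mu>0 (min \<mu> (M - 1))"
  have "nul l = 0" if "l < m0" for l using nul0[of l m0] c0 that by (simp add: m0_def)
  then have "Z m0 = {}" unfolding Z_def by auto
  then have "g m0 = int c0" using c0[of m0] by (simp add: g_def m0_def)
  moreover have "g m0 = g \<mu>"
    by (rule connected_local_const[of "{..<M}"]) (use loc assms(2) in \<open>auto simp: m0_def\<close>)
  ultimately have "int (ind \<mu>) = int (c0 + (\<Sum>l\<in>Z \<mu>. nul l))" by (simp add: g_def)
  then show "c0 + (\<Sum>l\<in>{l. l < \<mu> \<and> 0 < nul l}. nul l) = ind \<mu>" unfolding Z_def by linarith
  show "finite {l. l < \<mu> \<and> 0 < nul l}" using Zfin[OF assms(2)] unfolding Z_def .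
qed

end

section \<open>Absolutely continuous functions\<close>

text \<open>Absolute continuity in the form in which \<open>eigfun\<close> states it. The derivative
  is carried along as data because it is determined only almost everywhere.\<close>

definition primitive_on :: "real \<Rightarrow> real \<Rightarrow> (real \<Rightarrow> complex) \<Rightarrow> (real \<Rightarrow> complex) \<Rightarrow> bool" where
  "primitive_on a b f f' \<longleftrightarrow> set_integrable lborel {a..b} f' \<and>
     (\<forall>t\<in>{a..b}. f t = f a + (LINT s:{a..t}|lborel. f' s))"

lemma primitive_onI:
  "set_integrable lborel {a..b} f' \<Longrightarrow> (\<And>t. a \<le> t \<Longrightarrow> t \<le> b \<Longrightarrow> f t = f a + (LINT s:{a..t}|lborel. f' s)) \<Longrightarrow>
    primitive_on a b f f'"
  unfolding primitive_on_def by (metis atLeastAtMost_iff)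

lemma primitive_on_integrable:
  "primitive_on a b f f' \<Longrightarrow> a \<le> c \<Longrightarrow> e \<le> b \<Longrightarrow> set_integrable lborel {c..e} f'"
  by (rule set_integrable_subset[of _ "{a..b}"]) (auto simp: primitive_on_def)

lemma primitive_on_eq:
  "primitive_on a b f f' \<Longrightarrow> a \<le> t \<Longrightarrow> t \<le> b \<Longrightarrow> f t = f a + (LINT s:{a..t}|lborel. f' s)"
  unfolding primitive_on_def by (metis atLeastAtMost_iff)

lemma set_integral_combine:
  fixes f :: "real \<Rightarrow> complex"
  assumes "set_integrable lborel {a..b} f" "a \<le> c" "c \<le> b"
  shows "(LINT s:{a..b}|lborel. f s) = (LINT s:{a..c}|lborel. f s) + (LINT s:{c..b}|lborel. f s)"
proof -
  have "set_integrable lborel {a..c} f" "set_integrable lborel {c..b} f"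
    using assms by (auto intro: set_integrable_subset)
  then show ?thesis
    using set_borel_integral_eq_integral[of "{a..b}" f] set_borel_integral_eq_integral[of "{a..c}" f]
      set_borel_integral_eq_integral[of "{c..b}" f] assms Henstock_Kurzweil_Integration.integral_combine[OF assms(2,3), of f]
    by simp
qed

lemma primitive_onD:
  assumes f: "primitive_on a b f f'" and "a \<le> s" "s \<le> t" "t \<le> b"
  shows "f t = f s + (LINT r:{s..t}|lborel. f' r)"
proof -
  have 1: "f t = f a + (LINT s:{a..t}|lborel. f' s)" "f s = f a + (LINT s:{a..s}|lborel. f' s)"
    by (rule primitive_on_eq[OF f]; use assms(2-4) in simp)+
  have 2: "(LINT r:{a..t}|lborel. f' r) = (LINT r:{a..s}|lborel. f' r) + (LINT r:{s..t}|lborel. f' r)"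
    using assms(2-4) by (intro set_integral_combine primitive_on_integrable[OF f]) auto
  show ?thesis unfolding 1 2 by (rule add.assoc[symmetric])
qed

lemma primitive_on_subinterval:
  assumes "primitive_on a b f f'" "a \<le> c" "e \<le> b"
  shows "primitive_on c e f f'"
proof (rule primitive_onI)
  show "set_integrable lborel {c..e} f'" by (rule primitive_on_integrable[OF assms])
  show "f t = f c + (LINT s:{c..t}|lborel. f' s)" if "c \<le> t" "t \<le> e" for t
    by (rule primitive_onD[OF assms(1)]; use assms(2,3) that in simp)
qed

lemma primitive_on_continuous:
  assumes f: "primitive_on a b f f'"
  shows "continuous_on {a..b} f"
proof -
  have "continuous_on {a..b} (\<lambda>t. f a + integral {a..t} f')"
    by (intro continuous_intros indefinite_integral_continuous_1 set_borel_integral_eq_integral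
        primitive_on_integrable[OF f]) auto
  moreover have "f t = f a + integral {a..t} f'" if "t \<in> {a..b}" for t
    using primitive_on_eq[OF f, of t] that
      set_borel_integral_eq_integral(2)[OF primitive_on_integrable[OF f, of a t]] by simp
  ultimately show ?thesis by (metis (no_types, lifting) continuous_on_cong)
qed

lemma primitive_on_add:
  assumes f: "primitive_on a b f f'" and g: "primitive_on a b g g'"
  shows "primitive_on a b (\<lambda>t. f t + g t) (\<lambda>t. f' t + g' t)"
proof (rule primitive_onI)
  show "set_integrable lborel {a..b} (\<lambda>t. f' t + g' t)"
    using primitive_on_integrable[OF f] primitive_on_integrable[OF g] by simp
  fix t assume t: "a \<le> t" "t \<le> b"
  have "(LINT s:{a..t}|lborel. f' s + g' s) = (LINT s:{a..t}|lborel. f' s) + (LINT s:{a..t}|lborel. g' s)"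
    using primitive_on_integrable[OF f] primitive_on_integrable[OF g] t by simp
  then show "f t + g t = f a + g a + (LINT s:{a..t}|lborel. f' s + g' s)"
    by (subst primitive_on_eq[OF f t], subst primitive_on_eq[OF g t]) simp
qed

lemma primitive_on_scale:
  assumes f: "primitive_on a b f f'"
  shows "primitive_on a b (\<lambda>t. c * f t) (\<lambda>t. c * f' t)"
proof (rule primitive_onI)
  show "set_integrable lborel {a..b} (\<lambda>t. c * f' t)" using primitive_on_integrable[OF f] by simp
  fix t assume t: "a \<le> t" "t \<le> b"
  show "c * f t = c * f a + (LINT s:{a..t}|lborel. c * f' s)"
    by (subst primitive_on_eq[OF f t]) (simp add: distrib_left)
qed

lemma primitive_on_const: "primitive_on a b (\<lambda>t. c) (\<lambda>t. 0)"
  by (rule primitive_onI) (simp_all add: set_integrable_def)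

lemma primitive_on_sum:
  "finite J \<Longrightarrow> (\<And>j. j \<in> J \<Longrightarrow> primitive_on a b (f j) (f' j)) \<Longrightarrow>
    primitive_on a b (\<lambda>t. \<Sum>j\<in>J. f j t) (\<lambda>t. \<Sum>j\<in>J. f' j t)"
  by (induction J rule: finite_induct) (auto simp: primitive_on_const intro: primitive_on_add)

lemma set_integral_cnj: "(LINT s:A|M. cnj (f s)) = cnj (LINT s:A|M. f s)"
proof -
  have "(\<lambda>s. indicator A s *\<^sub>R cnj (f s)) = (\<lambda>s. cnj (indicator A s *\<^sub>R f s))" by auto
  then show ?thesis unfolding set_lebesgue_integral_def by (simp del: complex_cnj_scaleR)
qed

lemma set_integrable_cnj: "set_integrable M A f \<Longrightarrow> set_integrable M A (\<lambda>s. cnj (f s))"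
proof -
  have "(\<lambda>s. indicator A s *\<^sub>R cnj (f s)) = (\<lambda>s. cnj (indicator A s *\<^sub>R f s))" by auto
  then show "set_integrable M A f \<Longrightarrow> ?thesis" unfolding set_integrable_def by (simp del: complex_cnj_scaleR)
qed

lemma primitive_on_cnj:
  assumes f: "primitive_on a b f f'"
  shows "primitive_on a b (\<lambda>t. cnj (f t)) (\<lambda>t. cnj (f' t))"
proof (rule primitive_onI)
  show "set_integrable lborel {a..b} (\<lambda>t. cnj (f' t))"
    by (intro set_integrable_cnj primitive_on_integrable[OF f]) auto
  fix t assume t: "a \<le> t" "t \<le> b"
  show "cnj (f t) = cnj (f a) + (LINT s:{a..t}|lborel. cnj (f' s))"
    by (subst primitive_on_eq[OF f t]) (simp add: set_integral_cnj)
qed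

text \<open>The derivative may be altered on a null set; measurability of the new one is a
  hypothesis because \<open>lborel\<close> is not complete.\<close>

lemma primitive_on_cong_AE:
  assumes "primitive_on a b f f'" "AE s in lborel. s \<in> {a..b} \<longrightarrow> f' s = g' s"
    "set_borel_measurable lborel {a..b} g'" "\<And>t. t \<in> {a..b} \<Longrightarrow> f t = g t"
  shows "primitive_on a b g g'"
proof (rule primitive_onI)
  have i: "set_integrable lborel {a..b} f'" using primitive_on_integrable[OF assms(1)] by simp
  show g: "set_integrable lborel {a..b} g'"
    unfolding set_integrable_def
  proof (rule integrable_cong_AE_imp[OF i[unfolded set_integrable_def]])
    show "AE x in lborel. indicat_real {a..b} x *\<^sub>R f' x = indicat_real {a..b} x *\<^sub>R g' x"
      using assms(2) by eventually_elim (auto simp: indicator_def)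
  qed (use assms(3) in \<open>simp add: set_borel_measurable_def\<close>)
  fix t assume t': "a \<le> t" "t \<le> b"
  then have t: "t \<in> {a..b}" "a \<in> {a..b}" by auto
  have "(LINT s:{a..t}|lborel. f' s) = (LINT s:{a..t}|lborel. g' s)"
    unfolding set_lebesgue_integral_def
  proof (rule integral_cong_AE)
    have "set_integrable lborel {a..t} f'" "set_integrable lborel {a..t} g'"
      using i g t by (auto intro: set_integrable_subset)
    then show "(\<lambda>x. indicat_real {a..t} x *\<^sub>R f' x) \<in> borel_measurable lborel"
      "(\<lambda>x. indicat_real {a..t} x *\<^sub>R g' x) \<in> borel_measurable lborel"
      by (simp_all add: set_integrable_def)
    show "AE x in lborel. indicat_real {a..t} x *\<^sub>R f' x = indicat_real {a..t} x *\<^sub>R g' x"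
      using assms(2) by eventually_elim (use t in \<open>auto simp: indicator_def\<close>)
  qed
  then show "g t = g a + (LINT s:{a..t}|lborel. g' s)"
    using primitive_on_eq[OF assms(1) t'] assms(4)[OF t(1)] assms(4)[OF t(2)] by simp
qed

lemma set_integrable_mult_bounded:
  fixes f g :: "real \<Rightarrow> complex"
  assumes "set_integrable lborel {a..b} f" "set_borel_measurable lborel {a..b} g"
    "\<And>t. t \<in> {a..b} \<Longrightarrow> cmod (g t) \<le> C"
  shows "set_integrable lborel {a..b} (\<lambda>t. f t * g t)"
  unfolding set_integrable_def
proof (rule Bochner_Integration.integrable_bound)
  show "integrable lborel (\<lambda>t. complex_of_real C * (indicat_real {a..b} t *\<^sub>R f t))"
    using assms(1) unfolding set_integrable_def by (rule integrable_mult_right)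
  have "(\<lambda>t. (indicat_real {a..b} t *\<^sub>R f t) * (indicat_real {a..b} t *\<^sub>R g t)) \<in> borel_measurable lborel"
    using assms(1,2) unfolding set_integrable_def set_borel_measurable_def by measurable
  moreover have "(\<lambda>t. (indicat_real {a..b} t *\<^sub>R f t) * (indicat_real {a..b} t *\<^sub>R g t)) =
     (\<lambda>t. indicat_real {a..b} t *\<^sub>R (f t * g t))" by (auto simp: indicator_def)
  ultimately show "(\<lambda>t. indicat_real {a..b} t *\<^sub>R (f t * g t)) \<in> borel_measurable lborel" by simp
  show "AE x in lborel. cmod (indicat_real {a..b} x *\<^sub>R (f x * g x)) \<le> cmod (complex_of_real C * (indicat_real {a..b} x *\<^sub>R f x))"
  proof (intro AE_I2)
    fix x
    show "cmod (indicat_real {a..b} x *\<^sub>R (f x * g x)) \<le> cmod (complex_of_real C * (indicat_real {a..b} x *\<^sub>R f x))"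
    proof (cases "x \<in> {a..b}")
      case True
      have "cmod (f x) * cmod (g x) \<le> cmod (f x) * \<bar>C\<bar>" using assms(3)[OF True] by (intro mult_left_mono) auto
      then show ?thesis using True by (simp add: norm_mult mult.commute)
    qed simp
  qed
qed

lemma set_measurable_continuous:
  fixes g :: "real \<Rightarrow> complex"
  shows "continuous_on {a..b} g \<Longrightarrow> set_borel_measurable lborel {a..b} g"
  using borel_measurable_continuous_on_indicator[of "{a..b}" g] by (simp add: set_borel_measurable_def)

lemma continuous_on_Icc_bounded:
  fixes g :: "real \<Rightarrow> complex"
  assumes "continuous_on {a..b} g"
  obtains C where "C \<ge> 0" "\<And>t. t \<in> {a..b} \<Longrightarrow> cmod (g t) \<le> C"
proof -
  have "bounded (g ` {a..b})" by (intro compact_imp_bounded compact_continuous_image assms) auto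
  then obtain C where "\<forall>x\<in>g ` {a..b}. cmod x \<le> C" unfolding bounded_iff by blast
  then show ?thesis by (intro that[of "max C 0"]) (auto simp: le_max_iff_disj)
qed

lemma set_integrable_mult_continuous:
  fixes f g :: "real \<Rightarrow> complex"
  assumes "set_integrable lborel {a..b} f" "continuous_on {a..b} g"
  shows "set_integrable lborel {a..b} (\<lambda>t. f t * g t)"
  using continuous_on_Icc_bounded[OF assms(2)] set_integrable_mult_bounded[OF assms(1) set_measurable_continuous[OF assms(2)]] by metis

text \<open>The square \<open>[a,t]\<^sup>2\<close> is split along its diagonal and the two halves are integrated in
  opposite orders.\<close>

lemma integral_mult_primitives:
  fixes f g :: "real \<Rightarrow> complex"
  assumes f: "set_integrable lborel {a..t} f" and g: "set_integrable lborel {a..t} g"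
  shows "(LINT s:{a..t}|lborel. f s) * (LINT s:{a..t}|lborel. g s) =
     (LINT s:{a..t}|lborel. f s * (LINT r:{a..s}|lborel. g r)) +
     (LINT s:{a..t}|lborel. (LINT r:{a..s}|lborel. f r) * g s)"
proof -
  define F where "F = (\<lambda>s. indicat_real {a..t} s *\<^sub>R f s)"
  define G where "G = (\<lambda>s. indicat_real {a..t} s *\<^sub>R g s)"
  have Fi: "integrable lborel F" and Gi: "integrable lborel G"
    using f g unfolding F_def G_def set_integrable_def by auto
  have [measurable]: "F \<in> borel_measurable borel" "G \<in> borel_measurable borel" using Fi Gi by auto
  define K where "K = (\<lambda>s r. F s * G r)"
  have K: "integrable (lborel \<Otimes>\<^sub>M lborel) (case_prod K)"
  proof (rule lborel_pair.Fubini_integrable)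
    show "case_prod K \<in> borel_measurable (lborel \<Otimes>\<^sub>M lborel)" unfolding K_def by measurable
    have "(\<lambda>x. LINT y|lborel. cmod (case (x, y) of (s, r) \<Rightarrow> K s r)) = (\<lambda>x. cmod (F x) * (LINT y|lborel. cmod (G y)))"
      by (simp add: K_def norm_mult)
    then show "integrable lborel (\<lambda>x. LINT y|lborel. cmod (case (x, y) of (s, r) \<Rightarrow> K s r))"
      using Fi by simp
    show "AE x in lborel. integrable lborel (\<lambda>y. case (x, y) of (s, r) \<Rightarrow> K s r)" using Gi by (simp add: K_def)
  qed
  have Krest: "integrable (lborel \<Otimes>\<^sub>M lborel) (\<lambda>(s,r). if P s r then K s r else 0)"
    if [measurable]: "Measurable.pred (borel \<Otimes>\<^sub>M borel) (\<lambda>(s,r). P s r)" for P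
  proof (rule Bochner_Integration.integrable_bound[OF K])
    have "Measurable.pred (lborel \<Otimes>\<^sub>M lborel) (\<lambda>x. P (fst x) (snd x))"
      using that by (simp add: case_prod_beta' cong: measurable_cong_sets sets_pair_measure_cong)
    then show "(\<lambda>(s,r). if P s r then K s r else 0) \<in> borel_measurable (lborel \<Otimes>\<^sub>M lborel)"
      unfolding K_def case_prod_beta' by measurable
  qed (auto split: prod.splits)
  have P1: "Measurable.pred (borel \<Otimes>\<^sub>M borel) (\<lambda>(s::real,r). r \<le> s)"
    and P2: "Measurable.pred (borel \<Otimes>\<^sub>M borel) (\<lambda>(s::real,r). s < r)" by measurable
  have in1: "AE s in lborel. integrable lborel (\<lambda>r. if r \<le> s then K s r else 0)"
    and in2: "AE s in lborel. integrable lborel (\<lambda>r. if s < r then K s r else 0)"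
    using lborel_pair.AE_integrable_fst[OF Krest[OF P1]] lborel_pair.AE_integrable_fst[OF Krest[OF P2]] by simp_all
  have i1: "integrable lborel (\<lambda>s. LINT r|lborel. (if r \<le> s then K s r else 0))"
    and i2: "integrable lborel (\<lambda>s. LINT r|lborel. (if s < r then K s r else 0))"
    using lborel_pair.integrable_fst[OF Krest[OF P1]] lborel_pair.integrable_fst[OF Krest[OF P2]] by simp_all
  have "(LINT s|lborel. F s) * (LINT r|lborel. G r) = (LINT s|lborel. LINT r|lborel. K s r)"
    by (simp add: K_def)
  also have "\<dots> = (LINT s|lborel. (LINT r|lborel. (if r \<le> s then K s r else 0)) + (LINT r|lborel. (if s < r then K s r else 0)))"
  proof (rule integral_cong_AE)
    show "AE s in lborel. (LINT r|lborel. K s r) = (LINT r|lborel. (if r \<le> s then K s r else 0)) + (LINT r|lborel. (if s < r then K s r else 0))"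
      using in1 in2
    proof eventually_elim
      case (elim s)
      show ?case by (subst Bochner_Integration.integral_add[OF elim, symmetric]) (intro Bochner_Integration.integral_cong refl, auto)
    qed
  qed (use i1 i2 in \<open>auto simp: K_def\<close>)
  also have "\<dots> = (LINT s|lborel. LINT r|lborel. (if r \<le> s then K s r else 0)) + (LINT s|lborel. LINT r|lborel. (if s < r then K s r else 0))"
    using i1 i2 by simp
  also have "(LINT s|lborel. LINT r|lborel. (if s < r then K s r else 0)) = (LINT r|lborel. LINT s|lborel. (if s < r then K s r else 0))"
    using lborel_pair.Fubini_integral[OF Krest[OF P2]] by simp
  also have "(LINT s|lborel. LINT r|lborel. (if r \<le> s then K s r else 0)) = (LINT s:{a..t}|lborel. f s * (LINT r:{a..s}|lborel. g r))"
    unfolding set_lebesgue_integral_def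
  proof (intro Bochner_Integration.integral_cong refl)
    fix s
    have "(\<lambda>r. if r \<le> s then K s r else 0) = (\<lambda>r. F s * (indicat_real {a..s} r *\<^sub>R g r))" if "s \<in> {a..t}"
      using that by (auto simp: K_def F_def G_def indicator_def)
    then show "(LINT r|lborel. (if r \<le> s then K s r else 0)) = indicat_real {a..t} s *\<^sub>R (f s * (LINT r|lborel. indicat_real {a..s} r *\<^sub>R g r))"
    proof (cases "s \<in> {a..t}")
      case True
      have "(LINT r|lborel. F s * (indicat_real {a..s} r *\<^sub>R g r)) = F s * (LINT r|lborel. indicat_real {a..s} r *\<^sub>R g r)"
        by (rule integral_mult_right_zero)
      then show ?thesis using True \<open>_ \<Longrightarrow> _ = (\<lambda>r. F s * (indicat_real {a..s} r *\<^sub>R g r))\<close> by (simp add: F_def)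
    next
      case False
      then have "(\<lambda>r. if r \<le> s then K s r else 0) = (\<lambda>r. 0)" by (auto simp: K_def F_def)
      then show ?thesis using False by simp
    qed
  qed
  also have "(LINT r|lborel. LINT s|lborel. (if s < r then K s r else 0)) = (LINT s:{a..t}|lborel. (LINT r:{a..s}|lborel. f r) * g s)"
    unfolding set_lebesgue_integral_def
  proof (intro Bochner_Integration.integral_cong refl)
    fix r
    have "(LINT s|lborel. (if s < r then K s r else 0)) = (LINT s|lborel. (indicat_real {a..r} s *\<^sub>R f s) * G r)" if r: "r \<in> {a..t}"
    proof (rule integral_cong_AE)
      \<comment> \<open>The strict and the weak inequality differ only on the diagonal, a single
        point for each \<open>r\<close>.\<close>
      have "AE s in lborel. s \<noteq> r" by (rule AE_lborel_singleton)
      then show "AE s in lborel. (if s < r then K s r else 0) = (indicat_real {a..r} s *\<^sub>R f s) * G r"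
        by eventually_elim (use r in \<open>auto simp: K_def F_def G_def indicator_def\<close>)
      have "set_integrable lborel {a..r} f" using f r by (auto intro: set_integrable_subset)
      then have "(\<lambda>s. indicat_real {a..r} s *\<^sub>R f s) \<in> borel_measurable lborel"
        unfolding set_integrable_def by auto
      then show "(\<lambda>s. (indicat_real {a..r} s *\<^sub>R f s) * G r) \<in> borel_measurable lborel"
        by (intro borel_measurable_times borel_measurable_const)
      show "(\<lambda>s. if s < r then K s r else 0) \<in> borel_measurable lborel"
        unfolding K_def by measurable
    qed
    then show "(LINT s|lborel. (if s < r then K s r else 0)) = indicat_real {a..t} r *\<^sub>R ((LINT s|lborel. indicat_real {a..r} s *\<^sub>R f s) * g r)"
    proof (cases "r \<in> {a..t}")
      case True
      have "(LINT s|lborel. (indicat_real {a..r} s *\<^sub>R f s) * G r) = (LINT s|lborel. indicat_real {a..r} s *\<^sub>R f s) * G r"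
        by (rule integral_mult_left_zero)
      then show ?thesis using True \<open>_ \<Longrightarrow> _ = (LINT s|lborel. (indicat_real {a..r} s *\<^sub>R f s) * G r)\<close> by (simp add: G_def)
    next
      case False
      then have "(\<lambda>s. if s < r then K s r else 0) = (\<lambda>s. 0)" by (auto simp: K_def G_def)
      then show ?thesis using False by simp
    qed
  qed
  finally show ?thesis unfolding F_def G_def set_lebesgue_integral_def .
qed

text \<open>After subtracting the values at \<open>a\<close> both factors are plain primitives, for
  which the product rule is \<open>integral_mult_primitives\<close>.\<close>

lemma primitive_on_mult:
  assumes f: "primitive_on a b f f'" and g: "primitive_on a b g g'"
  shows "primitive_on a b (\<lambda>t. f t * g t) (\<lambda>t. f' t * g t + f t * g' t)"
proof -
  have fi: "set_integrable lborel {a..t} f'" and gi: "set_integrable lborel {a..t} g'" if "t \<le> b" for t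
    using that by (auto intro: primitive_on_integrable[OF f] primitive_on_integrable[OF g])
  have cf: "continuous_on {a..t} f" and cg: "continuous_on {a..t} g" if "t \<le> b" for t
    using primitive_on_continuous[OF f] primitive_on_continuous[OF g] that by (auto elim: continuous_on_subset)
  have i1: "set_integrable lborel {a..t} (\<lambda>s. f' s * g s)" if "t \<le> b" for t
    using set_integrable_mult_continuous[OF fi cg] that by blast
  have i2: "set_integrable lborel {a..t} (\<lambda>s. f s * g' s)" if "t \<le> b" for t
    using set_integrable_mult_continuous[OF gi cf, of t] that by (simp add: mult.commute)
  show ?thesis
  proof (rule primitive_onI)
    show "set_integrable lborel {a..b} (\<lambda>t. f' t * g t + f t * g' t)" using i1 i2 by auto
    fix t assume t: "a \<le> t" "t \<le> b"
    then have tb: "t \<le> b" by simp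
    define F where "F = (\<lambda>t. LINT s:{a..t}|lborel. f' s)"
    define G where "G = (\<lambda>t. LINT s:{a..t}|lborel. g' s)"
    have F: "F s = f s - f a" and G: "G s = g s - g a" if "s \<in> {a..t}" for s
      using primitive_on_eq[OF f, of s] primitive_on_eq[OF g, of s] that t unfolding F_def G_def by simp_all
    have "(LINT s:{a..t}|lborel. f' s * g s) = (LINT s:{a..t}|lborel. f' s * G s + g a * f' s)"
      by (intro set_lebesgue_integral_cong) (auto simp: G algebra_simps)
    also have "\<dots> = (LINT s:{a..t}|lborel. f' s * G s) + g a * F t"
    proof (subst set_integral_add(2))
      have "set_integrable lborel {a..t} (\<lambda>s. f' s * g s - g a * f' s)" using i1[OF tb] fi[OF tb] by auto
      also have "?this \<longleftrightarrow> set_integrable lborel {a..t} (\<lambda>s. f' s * G s)"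
        by (intro set_integrable_cong) (auto simp: G algebra_simps)
      finally show "set_integrable lborel {a..t} (\<lambda>s. f' s * G s)" .
    qed (use fi[OF tb] in \<open>auto simp: F_def\<close>)
    finally have e1: "(LINT s:{a..t}|lborel. f' s * g s) = (LINT s:{a..t}|lborel. f' s * G s) + g a * F t" .
    have "(LINT s:{a..t}|lborel. f s * g' s) = (LINT s:{a..t}|lborel. F s * g' s + f a * g' s)"
      by (intro set_lebesgue_integral_cong) (auto simp: F algebra_simps)
    also have "\<dots> = (LINT s:{a..t}|lborel. F s * g' s) + f a * G t"
    proof (subst set_integral_add(2))
      have "set_integrable lborel {a..t} (\<lambda>s. f s * g' s - f a * g' s)" using i2[OF tb] gi[OF tb] by auto
      also have "?this \<longleftrightarrow> set_integrable lborel {a..t} (\<lambda>s. F s * g' s)"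
        by (intro set_integrable_cong) (auto simp: F algebra_simps)
      finally show "set_integrable lborel {a..t} (\<lambda>s. F s * g' s)" .
    qed (use gi[OF tb] in \<open>auto simp: G_def\<close>)
    finally have e2: "(LINT s:{a..t}|lborel. f s * g' s) = (LINT s:{a..t}|lborel. F s * g' s) + f a * G t" .
    have "(LINT s:{a..t}|lborel. f' s * g s + f s * g' s) = F t * G t + g a * F t + f a * G t"
      using integral_mult_primitives[OF fi[OF tb] gi[OF tb]] i1[OF tb] i2[OF tb]
      by (simp add: set_integral_add(2) e1 e2 F_def G_def)
    then show "f t * g t = f a * g a + (LINT s:{a..t}|lborel. f' s * g s + f s * g' s)"
      using F[of t] G[of t] t by (simp add: algebra_simps)
  qed
qed

section \<open>Bounded measurable functions\<close>

text \<open>Bounded at every point of the interval, not only essentially, which keeps null sets out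
  of the estimates. The coefficients are brought into this form by
  \<open>in_Omega_regular_version\<close>.\<close>

definition bdd_meas :: "real \<Rightarrow> real \<Rightarrow> (real \<Rightarrow> complex) \<Rightarrow> bool" where
  "bdd_meas a b f \<longleftrightarrow> set_borel_measurable lborel {a..b} f \<and> (\<exists>C. \<forall>t\<in>{a..b}. cmod (f t) \<le> C)"

lemma bdd_meas_const: "bdd_meas a b (\<lambda>t. c)"
  unfolding bdd_meas_def set_borel_measurable_def by auto

lemma bdd_meas_add: "bdd_meas a b f \<Longrightarrow> bdd_meas a b g \<Longrightarrow> bdd_meas a b (\<lambda>t. f t + g t)"
proof -
  assume f: "bdd_meas a b f" and g: "bdd_meas a b g"
  then obtain C D where C: "\<And>t. t\<in>{a..b} \<Longrightarrow> cmod (f t) \<le> C" "\<And>t. t\<in>{a..b} \<Longrightarrow> cmod (g t) \<le> D"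
    unfolding bdd_meas_def by metis
  have "\<forall>t\<in>{a..b}. cmod (f t + g t) \<le> C + D" using C norm_triangle_mono by blast
  moreover have "set_borel_measurable lborel {a..b} (\<lambda>t. f t + g t)"
    using f g unfolding bdd_meas_def set_borel_measurable_def by (auto simp: scaleR_add_right)
  ultimately show ?thesis unfolding bdd_meas_def by blast
qed

lemma bdd_meas_mult: "bdd_meas a b f \<Longrightarrow> bdd_meas a b g \<Longrightarrow> bdd_meas a b (\<lambda>t. f t * g t)"
proof -
  assume f: "bdd_meas a b f" and g: "bdd_meas a b g"
  then obtain C D where C: "\<And>t. t\<in>{a..b} \<Longrightarrow> cmod (f t) \<le> C" "\<And>t. t\<in>{a..b} \<Longrightarrow> cmod (g t) \<le> D"
    unfolding bdd_meas_def by metis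
  have "\<forall>t\<in>{a..b}. cmod (f t * g t) \<le> C * D"
    using C unfolding norm_mult by (meson mult_mono' norm_ge_zero)
  moreover have "set_borel_measurable lborel {a..b} (\<lambda>t. f t * g t)"
  proof -
    have "(\<lambda>t. (indicat_real {a..b} t *\<^sub>R f t) * (indicat_real {a..b} t *\<^sub>R g t)) \<in> borel_measurable lborel"
      using f g unfolding bdd_meas_def set_borel_measurable_def by (intro borel_measurable_times) auto
    moreover have "(\<lambda>t. (indicat_real {a..b} t *\<^sub>R f t) * (indicat_real {a..b} t *\<^sub>R g t)) =
       (\<lambda>t. indicat_real {a..b} t *\<^sub>R (f t * g t))" by (auto simp: indicator_def)
    ultimately show ?thesis unfolding set_borel_measurable_def by simp
  qed
  ultimately show ?thesis unfolding bdd_meas_def by blast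
qed

lemma bdd_meas_cnj: "bdd_meas a b f \<Longrightarrow> bdd_meas a b (\<lambda>t. cnj (f t))"
proof -
  assume f: "bdd_meas a b f"
  have "(\<lambda>t. cnj (indicat_real {a..b} t *\<^sub>R f t)) \<in> borel_measurable lborel"
    using f unfolding bdd_meas_def set_borel_measurable_def
    by (auto intro!: borel_measurable_continuous_on[of cnj] continuous_on_cnj continuous_on_id simp del: complex_cnj_scaleR)
  then show ?thesis using f unfolding bdd_meas_def set_borel_measurable_def by (simp add: complex_cnj_scaleR)
qed

lemma bdd_meas_sum: "finite J \<Longrightarrow> (\<And>j. j \<in> J \<Longrightarrow> bdd_meas a b (f j)) \<Longrightarrow> bdd_meas a b (\<lambda>t. \<Sum>j\<in>J. f j t)"
  by (induction J rule: finite_induct) (auto intro: bdd_meas_add bdd_meas_const)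

lemma bdd_meas_uminus: "bdd_meas a b f \<Longrightarrow> bdd_meas a b (\<lambda>t. - f t)"
  using bdd_meas_mult[OF bdd_meas_const[of a b "-1"]] by simp

lemma bdd_meas_diff: "bdd_meas a b f \<Longrightarrow> bdd_meas a b g \<Longrightarrow> bdd_meas a b (\<lambda>t. f t - g t)"
  using bdd_meas_add[OF _ bdd_meas_uminus, of a b f g] by simp

lemma bdd_meas_continuous: "continuous_on {a..b} f \<Longrightarrow> bdd_meas a b f"
  unfolding bdd_meas_def using set_measurable_continuous continuous_on_Icc_bounded by metis

lemma integrable_indicator_Icc: "integrable lborel (indicat_real {a..b::real})"
  by (rule integrable_real_indicator) (auto simp: emeasure_lborel_Icc_eq)

lemma set_integral_Icc_same: "(LINT s:{a..a::real}|lborel. f s) = (0::complex)"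
  unfolding set_lebesgue_integral_def
proof (rule integral_eq_zero_AE)
  have "AE s in lborel. s \<noteq> a" by (rule AE_lborel_singleton)
  then show "AE s in lborel. indicat_real {a..a} s *\<^sub>R f s = 0" 
  proof eventually_elim
    case (elim s)
    then have "s \<notin> {a..a}" by auto
    then show ?case by simp
  qed
qed

lemma bdd_meas_integrable: "bdd_meas a b f \<Longrightarrow> set_integrable lborel {a..b} f"
proof -
  assume f: "bdd_meas a b f"
  then obtain C where C: "\<And>t. t\<in>{a..b} \<Longrightarrow> cmod (f t) \<le> C" unfolding bdd_meas_def by metis
  have "set_integrable lborel {a..b} (\<lambda>_. 1 :: complex)"
    using integrable_indicator_Icc unfolding set_integrable_def by (intro integrable_scaleR_left)
  from set_integrable_mult_bounded[OF this _ C] show ?thesis using f by (simp add: bdd_meas_def)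
qed

lemma bdd_meas_primitive: "primitive_on a b f f' \<Longrightarrow> bdd_meas a b f"
  by (intro bdd_meas_continuous primitive_on_continuous)

lemma bdd_meas_subinterval:
  assumes f: "bdd_meas a b f" and "a \<le> c" "e \<le> b"
  shows "bdd_meas c e f"
proof -
  have "set_borel_measurable lborel {c..e} f"
    by (rule set_borel_measurable_subset[of _ "{a..b}"]) (use assms in \<open>auto simp: bdd_meas_def\<close>)
  then show ?thesis using assms unfolding bdd_meas_def by (meson atLeastAtMost_iff order_trans)
qed

lemma bdd_meas_of_real:
  assumes [measurable]: "f \<in> borel_measurable borel" and "\<And>t. \<bar>f t\<bar> \<le> C"
  shows "bdd_meas a b (\<lambda>t. complex_of_real (f t))"
proof -
  have "(\<lambda>t. indicat_real {a..b} t *\<^sub>R complex_of_real (f t)) \<in> borel_measurable lborel" by measurable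
  then show ?thesis using assms(2) unfolding bdd_meas_def set_borel_measurable_def by auto
qed

lemmas bdd_meas_intros = bdd_meas_const bdd_meas_add bdd_meas_mult bdd_meas_cnj bdd_meas_uminus bdd_meas_diff

lemma primitive_on_integral:
  "set_integrable lborel {a..b} f \<Longrightarrow> primitive_on a b (\<lambda>t. c + (LINT s:{a..t}|lborel. f s)) f"
  by (rule primitive_onI) (simp_all only: set_integral_Icc_same, simp)

lemma set_integral_norm_le:
  fixes f :: "real \<Rightarrow> complex"
  assumes "set_integrable lborel S f" "set_integrable lborel S g" "\<And>t. t \<in> S \<Longrightarrow> cmod (f t) \<le> g t"
  shows "cmod (LINT s:S|lborel. f s) \<le> (LINT s:S|lborel. g s)"
  unfolding set_lebesgue_integral_def
  by (rule Bochner_Integration.integral_norm_bound_integral) (use assms in \<open>auto simp: set_integrable_def indicator_def\<close>)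

section \<open>Linear systems of differential equations\<close>

lemma integral_exp_Icc:
  fixes c :: real
  assumes "c \<noteq> 0" "\<alpha> \<le> t"
  shows "set_integrable lborel {\<alpha>..t} (\<lambda>s. exp (c * (s - \<alpha>)))"
    "(LINT s:{\<alpha>..t}|lborel. exp (c * (s - \<alpha>))) = (exp (c * (t - \<alpha>)) - 1) / c"
proof -
  show i: "set_integrable lborel {\<alpha>..t} (\<lambda>s. exp (c * (s - \<alpha>)))"
    by (rule borel_integrable_atLeastAtMost') (intro continuous_intros)
  have "((\<lambda>s. exp (c * (s - \<alpha>))) has_integral exp (c * (t - \<alpha>)) / c - exp (c * (\<alpha> - \<alpha>)) / c) {\<alpha>..t}"
    using assms by (intro fundamental_theorem_of_calculus)
      (auto intro!: derivative_eq_intros simp flip: has_real_derivative_iff_has_vector_derivative)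
  then show "(LINT s:{\<alpha>..t}|lborel. exp (c * (s - \<alpha>))) = (exp (c * (t - \<alpha>)) - 1) / c"
    using set_borel_integral_eq_integral(2)[OF i] by (simp add: integral_unique diff_divide_distrib)
qed

text \<open>Picard iteration; the weight \<open>exp (2 L (t - \<alpha>))\<close> makes the terms of the series decay
  geometrically on the whole interval.\<close>

primrec picard :: "nat \<Rightarrow> (real \<Rightarrow> nat \<Rightarrow> nat \<Rightarrow> complex) \<Rightarrow> real \<Rightarrow> (nat \<Rightarrow> complex) \<Rightarrow> nat \<Rightarrow> real \<Rightarrow> nat \<Rightarrow> complex" where
  "picard n A \<alpha> z 0 = (\<lambda>t i. z i)"
| "picard n A \<alpha> z (Suc k) = (\<lambda>t i. LINT s:{\<alpha>..t}|lborel. (\<Sum>j<n. A s i j * picard n A \<alpha> z k s j))"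

theorem linear_ode_exists:
  fixes A :: "real \<Rightarrow> nat \<Rightarrow> nat \<Rightarrow> complex"
  assumes A: "\<And>i j. i < n \<Longrightarrow> j < n \<Longrightarrow> bdd_meas \<alpha> \<beta> (\<lambda>t. A t i j)" and "\<alpha> \<le> \<beta>"
  shows "\<exists>Z. (\<forall>i<n. primitive_on \<alpha> \<beta> (\<lambda>t. Z t i) (\<lambda>t. \<Sum>j<n. A t i j * Z t j)) \<and> (\<forall>i<n. Z \<alpha> i = z i)"
proof -
  have "\<exists>C. \<forall>t\<in>{\<alpha>..\<beta>}. cmod (A t i j) \<le> C" if "i < n" "j < n" for i j
    using A[OF that] unfolding bdd_meas_def by blast
  then obtain C where C: "\<And>i j t. i < n \<Longrightarrow> j < n \<Longrightarrow> t \<in> {\<alpha>..\<beta>} \<Longrightarrow> cmod (A t i j) \<le> C i j" by metis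
  define K where "K = (\<Sum>i<n. \<Sum>j<n. \<bar>C i j\<bar>)"
  have K: "cmod (A t i j) \<le> K" if "i < n" "j < n" "t \<in> {\<alpha>..\<beta>}" for i j t
  proof -
    have "\<bar>C i j\<bar> \<le> (\<Sum>j<n. \<bar>C i j\<bar>)" using that by (intro member_le_sum) auto
    also have "\<dots> \<le> K" unfolding K_def using that by (intro member_le_sum) (auto intro: sum_nonneg)
    finally show ?thesis using C[OF that] by linarith
  qed
  have K0: "K \<ge> 0" unfolding K_def by (intro sum_nonneg) auto
  \<comment> \<open>The \<open>+ 1\<close> keeps \<open>L\<close> positive, as \<open>2 * L\<close>
    becomes a divisor: integrating the weight gains the factor \<open>1 / (2 * L)\<close>, the
    coefficients lose at most \<open>L\<close>, which leaves one half per iteration.\<close>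
  define L where "L = real n * K + 1"
  have L: "L > 0" "real n * K \<le> L" unfolding L_def using K0 by (auto intro: add_nonneg_pos)
  define M where "M = (\<Sum>i<n. cmod (z i))"
  have M0: "M \<ge> 0" unfolding M_def by (intro sum_nonneg) auto
  define D where "D = picard n A \<alpha> z"
  define w where "w = (\<lambda>t. exp (2 * L * (t - \<alpha>)))"
  have wle: "w t \<le> w \<beta>" if "t \<in> {\<alpha>..\<beta>}" for t using that L unfolding w_def by simp
  have D: "\<forall>i<n. continuous_on {\<alpha>..\<beta>} (\<lambda>t. D k t i) \<and> (\<forall>t\<in>{\<alpha>..\<beta>}. cmod (D k t i) \<le> M * (1/2)^k * w t)" for k
  proof (induction k)
    case 0
    show ?case
    proof (intro allI impI conjI ballI)
      fix i t assume i: "i < n" and t: "t \<in> {\<alpha>..\<beta>}"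
      have "cmod (z i) \<le> M" unfolding M_def using i by (intro member_le_sum) auto
      moreover have "M * 1 \<le> M * w t" using t L M0 unfolding w_def by (intro mult_left_mono) auto
      ultimately show "cmod (D 0 t i) \<le> M * (1/2)^0 * w t" by (simp add: D_def)
    qed (simp add: D_def)
  next
    case (Suc k)
    have int: "set_integrable lborel {\<alpha>..t} (\<lambda>s. \<Sum>j<n. A s i j * D k s j)" if "i < n" "t \<le> \<beta>" for i t
      by (rule bdd_meas_integrable, rule bdd_meas_subinterval[of \<alpha> \<beta>], rule bdd_meas_sum, simp, rule bdd_meas_mult)
        (use that Suc A in \<open>auto intro!: bdd_meas_continuous\<close>)
    show ?case
    proof (intro allI impI conjI ballI)
      fix i assume i: "i < n"
      have "primitive_on \<alpha> \<beta> (\<lambda>t. 0 + (LINT s:{\<alpha>..t}|lborel. (\<Sum>j<n. A s i j * D k s j))) (\<lambda>s. \<Sum>j<n. A s i j * D k s j)"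
        by (rule primitive_on_integral) (use int[OF i] in auto)
      from primitive_on_continuous[OF this] show "continuous_on {\<alpha>..\<beta>} (\<lambda>t. D (Suc k) t i)" by (simp add: D_def)
      fix t assume t: "t \<in> {\<alpha>..\<beta>}"
      define m where "m = L * (M * (1/2)^k)"
      have "cmod (D (Suc k) t i) \<le> (LINT s:{\<alpha>..t}|lborel. m * w s)"
        unfolding D_def picard.simps
      proof (rule set_integral_norm_le)
        show "set_integrable lborel {\<alpha>..t} (\<lambda>s. \<Sum>j<n. A s i j * picard n A \<alpha> z k s j)" using int[OF i] t by (simp add: D_def)
        show "set_integrable lborel {\<alpha>..t} (\<lambda>s. m * w s)" unfolding w_def using integral_exp_Icc(1)[of "2*L" \<alpha> t] t L by auto
        fix s assume s: "s \<in> {\<alpha>..t}"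
        have "cmod (\<Sum>j<n. A s i j * D k s j) \<le> (\<Sum>j<n. K * (M * (1/2)^k * w s))"
        proof (rule order.trans[OF norm_sum sum_mono])
          fix j assume "j \<in> {..<n}"
          then show "cmod (A s i j * D k s j) \<le> K * (M * (1/2)^k * w s)"
            unfolding norm_mult using K[OF i, of j s] Suc s t K0 by (intro mult_mono) auto
        qed
        also have "\<dots> = (real n * K) * (M * (1/2)^k * w s)" by simp
        also have "\<dots> \<le> L * (M * (1/2)^k * w s)" using L M0 by (intro mult_right_mono) (auto simp: w_def)
        finally show "cmod (\<Sum>j<n. A s i j * picard n A \<alpha> z k s j) \<le> m * w s" by (simp add: D_def m_def)
      qed
      also have "\<dots> = m * ((w t - 1) / (2 * L))"
        using integral_exp_Icc(2)[of "2*L" \<alpha> t] t L by (simp add: w_def)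
      also have "\<dots> \<le> m * (w t / (2 * L))" using L M0 unfolding m_def by (intro mult_left_mono divide_right_mono) auto
      also have "\<dots> = M * (1/2)^Suc k * w t" using L by (simp add: m_def)
      finally show "cmod (D (Suc k) t i) \<le> M * (1/2)^Suc k * w t" .
    qed
  qed
  have Dle: "cmod (D k t i) \<le> M * w \<beta> * (1/2)^k" if "i < n" "t \<in> {\<alpha>..\<beta>}" for k t i
  proof -
    have "cmod (D k t i) \<le> M * (1/2)^k * w t" using D that by blast
    also have "\<dots> \<le> M * (1/2)^k * w \<beta>" using wle[OF that(2)] M0 by (intro mult_left_mono) auto
    finally show ?thesis by (simp add: mult_ac)
  qed
  have sg: "summable (\<lambda>k. c * (1/2)^k :: real)" for c by (intro summable_mult summable_geometric) auto
  have sumD: "summable (\<lambda>k. cmod (D k t i))" if "i < n" "t \<in> {\<alpha>..\<beta>}" for t i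
    by (rule summable_comparison_test[OF _ sg[of "M * w \<beta>"]]) (use Dle[OF that] in auto)
  have sumD': "summable (\<lambda>k. D k t i)" if "i < n" "t \<in> {\<alpha>..\<beta>}" for t i
    using summable_norm_cancel[OF sumD[OF that]] .
  define Z where "Z = (\<lambda>t i. \<Sum>k. D k t i)"
  have Zc: "continuous_on {\<alpha>..\<beta>} (\<lambda>t. Z t i)" if i: "i < n" for i
    unfolding Z_def
  proof (rule uniform_limit_theorem)
    show "uniform_limit {\<alpha>..\<beta>} (\<lambda>m t. \<Sum>k<m. D k t i) (\<lambda>t. \<Sum>k. D k t i) sequentially"
      by (rule Weierstrass_m_test[OF Dle[OF i] sg])
    show "\<forall>\<^sub>F m in sequentially. continuous_on {\<alpha>..\<beta>} (\<lambda>t. \<Sum>k<m. D k t i)"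
      using D i by (intro always_eventually allI continuous_on_sum) auto
  qed simp
  have AZ: "set_integrable lborel {\<alpha>..\<beta>} (\<lambda>s. \<Sum>j<n. A s i j * Z s j)" if "i < n" for i
    by (rule bdd_meas_integrable, rule bdd_meas_sum, simp, rule bdd_meas_mult)
      (use that Zc A in \<open>auto intro!: bdd_meas_continuous\<close>)
  have eq: "Z t i = z i + (LINT s:{\<alpha>..t}|lborel. (\<Sum>j<n. A s i j * Z s j))" if i: "i < n" and t: "t \<in> {\<alpha>..\<beta>}" for t i
  proof -
    define F where "F = (\<lambda>k s. indicat_real {\<alpha>..t} s *\<^sub>R (\<Sum>j<n. A s i j * D k s j))"
    define c where "c = real n * (K * (M * w \<beta>))"
    have Fi: "integrable lborel (F k)" for k
    proof -
      have "set_integrable lborel {\<alpha>..t} (\<lambda>s. \<Sum>j<n. A s i j * D k s j)"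
        by (rule bdd_meas_integrable, rule bdd_meas_subinterval[of \<alpha> \<beta>], rule bdd_meas_sum, simp, rule bdd_meas_mult)
          (use i t D A in \<open>auto intro!: bdd_meas_continuous\<close>)
      then show ?thesis unfolding F_def set_integrable_def .
    qed
    have Fle: "norm (F k s) \<le> indicat_real {\<alpha>..t} s * (c * (1/2)^k)" for k s
    proof (cases "s \<in> {\<alpha>..t}")
      case True
      have "cmod (\<Sum>j<n. A s i j * D k s j) \<le> (\<Sum>j<n. K * (M * w \<beta> * (1/2)^k))"
      proof (rule order.trans[OF norm_sum sum_mono])
        fix j assume "j \<in> {..<n}"
        then show "cmod (A s i j * D k s j) \<le> K * (M * w \<beta> * (1/2)^k)"
          unfolding norm_mult using K[OF i, of j s] Dle[of j s k] True t K0 by (intro mult_mono) auto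
      qed
      then show ?thesis using True by (simp add: F_def c_def mult_ac)
    qed (simp add: F_def)
    have int0: "integrable lborel (\<lambda>s. indicat_real {\<alpha>..t} s * (c * (1/2)^k))" for k
      by (intro integrable_mult_left integrable_indicator_Icc)
    have "(\<Sum>k. LINT s|lborel. F k s) = (LINT s|lborel. (\<Sum>k. F k s))"
    proof (rule integral_suminf[symmetric, OF Fi])
      show "AE s in lborel. summable (\<lambda>k. norm (F k s))"
      proof (intro AE_I2)
        fix s
        show "summable (\<lambda>k. norm (F k s))"
          by (rule summable_comparison_test[OF _ sg[of "indicat_real {\<alpha>..t} s * c"]])
            (use Fle[of _ s] in \<open>auto simp: mult.assoc\<close>)
      qed
      show "summable (\<lambda>k. LINT s|lborel. norm (F k s))"
      proof (rule summable_comparison_test[OF _ sg[of "(t - \<alpha>) * c"]], intro exI allI impI)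
        fix k
        have "(LINT s|lborel. norm (F k s)) \<le> (LINT s|lborel. indicat_real {\<alpha>..t} s * (c * (1/2)^k))"
          by (rule integral_mono[OF integrable_norm[OF Fi] int0 Fle])
        also have "\<dots> = (t - \<alpha>) * c * (1/2)^k" using t by simp
        finally show "norm (LINT s|lborel. norm (F k s)) \<le> (t - \<alpha>) * c * (1/2)^k"
          by (simp add: integral_nonneg_AE)
      qed
    qed
    moreover have "(\<Sum>k. F k s) = indicat_real {\<alpha>..t} s *\<^sub>R (\<Sum>j<n. A s i j * Z s j)" for s
    proof (cases "s \<in> {\<alpha>..t}")
      case True
      then have s: "s \<in> {\<alpha>..\<beta>}" using t by auto
      have "(\<Sum>k. \<Sum>j<n. A s i j * D k s j) = (\<Sum>j<n. \<Sum>k. A s i j * D k s j)"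
        by (rule suminf_sum) (use sumD'[OF _ s] in \<open>auto intro: summable_mult\<close>)
      also have "\<dots> = (\<Sum>j<n. A s i j * Z s j)"
        unfolding Z_def by (intro sum.cong refl suminf_mult sumD'[OF _ s]) auto
      finally show ?thesis using True by (simp add: F_def)
    qed (simp add: F_def)
    moreover have "(LINT s|lborel. F k s) = D (Suc k) t i" for k
      by (simp add: D_def F_def set_lebesgue_integral_def)
    ultimately have "(\<Sum>k. D (Suc k) t i) = (LINT s:{\<alpha>..t}|lborel. (\<Sum>j<n. A s i j * Z s j))"
      by (simp add: set_lebesgue_integral_def)
    moreover have "Z t i = D 0 t i + (\<Sum>k. D (Suc k) t i)"
      unfolding Z_def using suminf_split_head[OF sumD'[OF i t]] by simp
    ultimately show ?thesis by (simp add: D_def)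
  qed
  have z: "Z \<alpha> i = z i" if "i < n" for i
    using eq[OF that, of \<alpha>] assms(2) by (simp add: set_integral_Icc_same del: atLeastAtMost_singleton)
  have "primitive_on \<alpha> \<beta> (\<lambda>t. Z t i) (\<lambda>t. \<Sum>j<n. A t i j * Z t j)" if "i < n" for i
    by (rule primitive_onI[OF AZ[OF that]]) (use eq[OF that] z[OF that] in auto)
  then show ?thesis using z by blast
qed

section \<open>Trace and Poincare inequalities\<close>

definition sqint :: "real \<Rightarrow> real \<Rightarrow> (real \<Rightarrow> complex) \<Rightarrow> real" where
  "sqint a b f = (LINT t:{a..b}|lborel. (cmod (f t))\<^sup>2)"

lemma bdd_meas_cmod2_integrable:
  assumes "bdd_meas a b f"
  shows "set_integrable lborel {a..b} (\<lambda>t. (cmod (f t))\<^sup>2)"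
proof -
  have "set_integrable lborel {a..b} (\<lambda>t. f t * cnj (f t))"
    using assms by (intro bdd_meas_integrable bdd_meas_intros)
  then have "integrable lborel (\<lambda>t. Re (indicat_real {a..b} t *\<^sub>R (f t * cnj (f t))))"
    unfolding set_integrable_def by (rule integrable_Re)
  moreover have "(\<lambda>t. Re (indicat_real {a..b} t *\<^sub>R (f t * cnj (f t)))) = (\<lambda>t. indicat_real {a..b} t *\<^sub>R (cmod (f t))\<^sup>2)"
    by (simp add: cmod_power2) (simp add: power2_eq_square)
  ultimately show ?thesis unfolding set_integrable_def by simp
qed

lemma sqint_nonneg: "0 \<le> sqint a b f"
  unfolding sqint_def set_lebesgue_integral_def by (intro integral_nonneg_AE) auto

lemma Re_set_integral:
  assumes "set_integrable lborel S f"
  shows "set_integrable lborel S (\<lambda>t. Re (f t))" "Re (LINT t:S|lborel. f t) = (LINT t:S|lborel. Re (f t))"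
  using integrable_Re[OF assms[unfolded set_integrable_def]] integral_Re[OF assms[unfolded set_integrable_def]]
  unfolding set_integrable_def set_lebesgue_integral_def by simp_all

lemma sqint_combine:
  assumes "bdd_meas a b f" "a \<le> c" "c \<le> b"
  shows "sqint a b f = sqint a c f + sqint c b f"
proof -
  have i: "set_integrable lborel {a..b} (\<lambda>t. complex_of_real ((cmod (f t))\<^sup>2))"
  proof -
    have "(\<lambda>t. indicat_real {a..b} t *\<^sub>R complex_of_real ((cmod (f t))\<^sup>2)) =
        (\<lambda>t. complex_of_real (indicat_real {a..b} t *\<^sub>R (cmod (f t))\<^sup>2))" by (simp add: scaleR_conv_of_real)
    then show ?thesis using bdd_meas_cmod2_integrable[OF assms(1)]
      unfolding set_integrable_def by (simp only: complex_of_real_integrable_eq)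
  qed
  have "complex_of_real (sqint a b f) = complex_of_real (sqint a c f + sqint c b f)"
    unfolding sqint_def of_real_add set_integral_complex_of_real[symmetric]
    by (rule set_integral_combine[OF i assms(2,3)])
  then show ?thesis by (metis of_real_eq_iff)
qed

lemma sqint_mono:
  assumes "bdd_meas a b f" "a \<le> c" "e \<le> b"
  shows "sqint c e f \<le> sqint a b f"
proof (cases "c \<le> e")
  case True
  have "sqint a b f = sqint a c f + (sqint c e f + sqint e b f)"
    using sqint_combine[OF assms(1,2)] sqint_combine[OF bdd_meas_subinterval[OF assms(1,2) order_refl], of e] True assms by simp
  then show ?thesis using sqint_nonneg[of a c f] sqint_nonneg[of e b f] by simp
next
  case False
  then show ?thesis using sqint_nonneg[of a b f] by (simp add: sqint_def set_lebesgue_integral_def)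
qed

text \<open>A substitute for the Sobolev embedding: \<open>|f|\<^sup>2\<close> has derivative at most
  \<open>\<epsilon> |f'|\<^sup>2 + |f|\<^sup>2 / \<epsilon>\<close>.\<close>

lemma pointwise_bound:
  assumes f: "primitive_on a b f f'" and f': "bdd_meas a b f'" and e: "\<epsilon> > 0"
    and st: "s \<in> {a..b}" "t \<in> {a..b}"
  shows "(cmod (f t))\<^sup>2 \<le> (cmod (f s))\<^sup>2 + \<epsilon> * sqint a b f' + sqint a b f / \<epsilon>"
proof -
  have fb: "bdd_meas a b f" by (rule bdd_meas_primitive[OF f])
  define g where "g = (\<lambda>t. f t * cnj (f t))"
  define g' where "g' = (\<lambda>t. f' t * cnj (f t) + f t * cnj (f' t))"
  have g: "primitive_on a b g g'"
    unfolding g_def g'_def by (intro primitive_on_mult primitive_on_cnj f)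
  have gg: "g t = complex_of_real ((cmod (f t))\<^sup>2)" for t
    unfolding g_def complex_norm_square ..
  have key: "\<bar>(cmod (f q))\<^sup>2 - (cmod (f p))\<^sup>2\<bar> \<le> \<epsilon> * sqint a b f' + sqint a b f / \<epsilon>" if "a \<le> p" "p \<le> q" "q \<le> b" for p q
  proof -
    have sub: "bdd_meas p q f" "bdd_meas p q f'" using bdd_meas_subinterval fb f' that by blast+
    have i: "set_integrable lborel {p..q} (\<lambda>t. (cmod (f' t))\<^sup>2)" "set_integrable lborel {p..q} (\<lambda>t. (cmod (f t))\<^sup>2)"
      using bdd_meas_cmod2_integrable sub by blast+
    have "g q - g p = (LINT t:{p..q}|lborel. g' t)" using primitive_onD[OF g that] by simp
    moreover have "cmod (g q - g p) = \<bar>(cmod (f q))\<^sup>2 - (cmod (f p))\<^sup>2\<bar>"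
      unfolding gg by (metis norm_of_real of_real_diff)
    moreover have "cmod (LINT t:{p..q}|lborel. g' t) \<le> (LINT t:{p..q}|lborel. \<epsilon> * (cmod (f' t))\<^sup>2 + (1/\<epsilon>) * (cmod (f t))\<^sup>2)"
    proof (rule set_integral_norm_le)
      show "set_integrable lborel {p..q} g'" using primitive_on_integrable[OF g] that by simp
      show "set_integrable lborel {p..q} (\<lambda>t. \<epsilon> * (cmod (f' t))\<^sup>2 + (1/\<epsilon>) * (cmod (f t))\<^sup>2)"
        using i by (intro set_integral_add(1) set_integrable_mult_right)
      fix t
      define A where "A = cmod (f' t)" define B where "B = cmod (f t)"
      have "cmod (g' t) \<le> 2 * (A * B)"
        unfolding g'_def A_def B_def by (rule order.trans[OF norm_triangle_ineq]) (simp add: norm_mult mult.commute)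
      also have "\<dots> \<le> \<epsilon> * A\<^sup>2 + (1/\<epsilon>) * B\<^sup>2"
      proof -
        have "0 \<le> (1/\<epsilon>) * (\<epsilon> * A - B)\<^sup>2" using e by simp
        also have "\<dots> = \<epsilon> * A\<^sup>2 + (1/\<epsilon>) * B\<^sup>2 - 2 * (A * B)" using e by (simp add: power2_eq_square field_simps)
        finally show ?thesis by simp
      qed
      finally show "cmod (g' t) \<le> \<epsilon> * (cmod (f' t))\<^sup>2 + (1/\<epsilon>) * (cmod (f t))\<^sup>2" unfolding A_def B_def .
    qed
    moreover have "\<dots> = \<epsilon> * sqint p q f' + (1/\<epsilon>) * sqint p q f"
      using i unfolding sqint_def by (subst set_integral_add(2)) (auto intro: set_integrable_mult_right)
    moreover have "\<epsilon> * sqint p q f' \<le> \<epsilon> * sqint a b f'" "(1/\<epsilon>) * sqint p q f \<le> (1/\<epsilon>) * sqint a b f"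
      using e that by (intro mult_left_mono sqint_mono fb f'; simp)+
    ultimately show ?thesis by simp
  qed
  have "\<bar>(cmod (f t))\<^sup>2 - (cmod (f s))\<^sup>2\<bar> \<le> \<epsilon> * sqint a b f' + sqint a b f / \<epsilon>"
    using key[of s t] key[of t s] st by (cases "s \<le> t") auto
  then show ?thesis by linarith
qed

text \<open>Averaging \<open>pointwise_bound\<close> over the reference point removes it.\<close>

lemma trace_bound:
  assumes f: "primitive_on a b f f'" and f': "bdd_meas a b f'" and e: "\<epsilon> > 0"
    and s: "s \<in> {a..b}"
  shows "(b - a) * (cmod (f s))\<^sup>2 \<le> sqint a b f + (b - a) * (\<epsilon> * sqint a b f' + sqint a b f / \<epsilon>)"
proof -
  define c where "c = \<epsilon> * sqint a b f' + sqint a b f / \<epsilon>"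
  have ic: "set_integrable lborel {a..b} (\<lambda>t. k::real)" for k
    using integrable_indicator_Icc unfolding set_integrable_def by (intro integrable_scaleR_left)
  have i: "set_integrable lborel {a..b} (\<lambda>t. (cmod (f t))\<^sup>2)"
    by (intro bdd_meas_cmod2_integrable bdd_meas_primitive[OF f])
  have "(LINT t:{a..b}|lborel. (cmod (f s))\<^sup>2) \<le> (LINT t:{a..b}|lborel. (cmod (f t))\<^sup>2 + c)"
    using pointwise_bound[OF f f' e _ s] ic i by (intro set_integral_mono) (auto simp: c_def algebra_simps)
  also have "\<dots> = sqint a b f + (LINT t:{a..b}|lborel. c)"
    unfolding sqint_def using ic i by (intro set_integral_add)
  finally show ?thesis using s by (simp add: c_def set_integral_const)
qed

lemma trace_bound':
  assumes f: "primitive_on a b f f'" and f': "bdd_meas a b f'" and e: "\<epsilon> > 0"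
    and s: "s \<in> {a..b}" and z: "f s = 0"
  shows "sqint a b f \<le> (b - a) * (\<epsilon> * sqint a b f' + sqint a b f / \<epsilon>)"
proof -
  define c where "c = \<epsilon> * sqint a b f' + sqint a b f / \<epsilon>"
  have ic: "set_integrable lborel {a..b} (\<lambda>t. k::real)" for k
    using integrable_indicator_Icc unfolding set_integrable_def by (intro integrable_scaleR_left)
  have i: "set_integrable lborel {a..b} (\<lambda>t. (cmod (f t))\<^sup>2)"
    by (intro bdd_meas_cmod2_integrable bdd_meas_primitive[OF f])
  have "sqint a b f \<le> (LINT t:{a..b}|lborel. c)"
    unfolding sqint_def using pointwise_bound[OF f f' e s] z ic i by (intro set_integral_mono) (auto simp: c_def)
  then show ?thesis using s by (simp add: c_def set_integral_const)
qed

lemma poincare: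
  assumes f: "primitive_on a b f f'" and f': "bdd_meas a b f'" and "a \<le> b" and z: "f a = 0"
  shows "sqint a b f \<le> 4 * (b - a)\<^sup>2 * sqint a b f'"
proof (cases "a = b")
  case True
  have "sqint a b f \<le> (b - a) * (1 * sqint a b f' + sqint a b f / 1)"
    by (rule trace_bound'[OF f f', of 1 a]) (use True z in auto)
  then show ?thesis using True by simp
next
  case False
  then have l: "b - a > 0" using assms by simp
  \<comment> \<open>With this \<epsilon> the square integral of \<open>f\<close> has weight exactly
    one half on the right and is absorbed.\<close>
  have "sqint a b f \<le> (b - a) * (2 * (b - a) * sqint a b f' + sqint a b f / (2 * (b - a)))"
    by (rule trace_bound'[OF f f', of "2 * (b - a)" a]) (use l z in auto)
  also have "\<dots> = 2 * (b - a)\<^sup>2 * sqint a b f' + sqint a b f / 2"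
    using l by (simp add: field_simps power2_eq_square)
  finally show ?thesis by simp
qed

lemma poincare_zero:
  assumes f: "primitive_on a b f f'" and f': "bdd_meas a b f'" and t: "t \<in> {a..b}" and z: "f a = 0"
    and 0: "sqint a b f' = 0"
  shows "f t = 0"
proof -
  have "sqint a b f \<le> 0" using poincare[OF f f' _ z] t 0 by simp
  then have "sqint a b f = 0" using sqint_nonneg[of a b f] by simp
  then have "(cmod (f t))\<^sup>2 \<le> 0" using pointwise_bound[OF f f', of 1 a t] t z 0 by simp
  then show ?thesis by simp
qed

lemma sqint_zero_AE:
  assumes "bdd_meas a b f" "sqint a b f = 0"
  shows "AE t in lborel. t \<in> {a..b} \<longrightarrow> f t = 0"
proof -
  have "AE t in lborel. indicat_real {a..b} t *\<^sub>R (cmod (f t))\<^sup>2 = 0"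
    using integral_nonneg_eq_0_iff_AE[of lborel "\<lambda>t. indicat_real {a..b} t *\<^sub>R (cmod (f t))\<^sup>2"]
      bdd_meas_cmod2_integrable[OF assms(1)] assms(2)
    unfolding sqint_def set_lebesgue_integral_def set_integrable_def by simp
  then show ?thesis by eventually_elim auto
qed

text \<open>This is \<open>trace_bound\<close> with small \<epsilon>: the square integral of
  \<open>f\<close> is gone, and \<epsilon> is chosen so that the derivative term stays below half of
  the alleged positive value. The \<open>+ 1\<close> in its denominator covers a vanishing
  derivative.\<close>

lemma sqint_zero_continuous:
  assumes f: "primitive_on a b f f'" and f': "bdd_meas a b f'" and "a < b" "t \<in> {a..b}" and 0: "sqint a b f = 0"
  shows "f t = 0"
proof (rule ccontr)
  assume "f t \<noteq> 0"
  define c where "c = (cmod (f t))\<^sup>2"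
  have c: "c > 0" using \<open>f t \<noteq> 0\<close> by (simp add: c_def)
  have N: "sqint a b f' \<ge> 0" by (rule sqint_nonneg)
  define \<epsilon> where "\<epsilon> = c / (2 * (sqint a b f' + 1))"
  have e: "\<epsilon> > 0" using c N by (simp add: \<epsilon>_def)
  have "(b - a) * c \<le> (b - a) * (\<epsilon> * sqint a b f')"
    using trace_bound[OF f f' e assms(4)] 0 by (simp add: c_def)
  then have "c \<le> \<epsilon> * sqint a b f'" using assms(3) by simp
  also have "\<dots> \<le> \<epsilon> * (sqint a b f' + 1)" using e by simp
  also have "\<dots> = c / 2" using N by (simp add: \<epsilon>_def field_simps)
  finally show False using c by simp
qed

section \<open>The energy form\<close>

lemma loewner_ge_complex:
  assumes L: "loewner_ge d G c"
  shows "c * (\<Sum>i<d. (cmod (z i))\<^sup>2) \<le> Re (\<Sum>i<d. \<Sum>j<d. complex_of_real (G i j) * z j * cnj (z i))"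
proof -
  have "Re (complex_of_real (G i j) * z j * cnj (z i)) =
      Re (z i) * G i j * Re (z j) + Im (z i) * G i j * Im (z j)" for i j
    by (simp add: algebra_simps)
  then have "Re (\<Sum>i<d. \<Sum>j<d. complex_of_real (G i j) * z j * cnj (z i)) =
    (\<Sum>i<d. \<Sum>j<d. Re (z i) * G i j * Re (z j)) + (\<Sum>i<d. \<Sum>j<d. Im (z i) * G i j * Im (z j))"
    by (simp add: sum.distrib del: Re_complex_of_real)
  moreover have "c * (\<Sum>i<d. (Re (z i))\<^sup>2) \<le> (\<Sum>i<d. \<Sum>j<d. Re (z i) * G i j * Re (z j))"
    "c * (\<Sum>i<d. (Im (z i))\<^sup>2) \<le> (\<Sum>i<d. \<Sum>j<d. Im (z i) * G i j * Im (z j))"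
    using L[unfolded loewner_ge_def, rule_format, of "\<lambda>i. Re (z i)"]
      L[unfolded loewner_ge_def, rule_format, of "\<lambda>i. Im (z i)"] by simp_all
  moreover have "c * (\<Sum>i<d. (cmod (z i))\<^sup>2) = c * (\<Sum>i<d. (Re (z i))\<^sup>2) + c * (\<Sum>i<d. (Im (z i))\<^sup>2)"
    by (simp add: cmod_power2 sum.distrib distrib_left)
  ultimately show ?thesis by linarith
qed

lemma quadratic_form_bound:
  fixes G :: "nat \<Rightarrow> nat \<Rightarrow> complex"
  assumes "\<And>i j. i < d \<Longrightarrow> j < d \<Longrightarrow> cmod (G i j) \<le> C"
  shows "cmod (\<Sum>i<d. \<Sum>j<d. G i j * z j * cnj (z i)) \<le> C * real d * (\<Sum>i<d. (cmod (z i))\<^sup>2)"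
proof -
  have "cmod (\<Sum>i<d. \<Sum>j<d. G i j * z j * cnj (z i)) \<le> (\<Sum>i<d. \<Sum>j<d. cmod (G i j * z j * cnj (z i)))"
    by (rule order.trans[OF norm_sum sum_mono[OF norm_sum]])
  also have "\<dots> \<le> (\<Sum>i<d. \<Sum>j<d. C * (((cmod (z j))\<^sup>2 + (cmod (z i))\<^sup>2) / 2))"
  proof (intro sum_mono)
    fix i j assume "i \<in> {..<d}" "j \<in> {..<d}"
    then have C: "cmod (G i j) \<le> C" using assms by simp
    have "cmod (z j) * cmod (z i) \<le> ((cmod (z j))\<^sup>2 + (cmod (z i))\<^sup>2) / 2"
      using sum_squares_bound[of "cmod (z j)" "cmod (z i)"] by simp
    then have "cmod (G i j) * (cmod (z j) * cmod (z i)) \<le> C * (((cmod (z j))\<^sup>2 + (cmod (z i))\<^sup>2) / 2)"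
      using C by (intro mult_mono) (auto intro: order.trans[OF norm_ge_zero])
    then show "cmod (G i j * z j * cnj (z i)) \<le> C * (((cmod (z j))\<^sup>2 + (cmod (z i))\<^sup>2) / 2)"
      by (simp add: norm_mult mult.assoc)
  qed
  also have "\<dots> = C * (((\<Sum>i<d. \<Sum>j<d. (cmod (z j))\<^sup>2) + (\<Sum>i<d. \<Sum>j<d. (cmod (z i))\<^sup>2)) / 2)"
    by (simp only: sum_distrib_left[symmetric] sum_divide_distrib[symmetric] sum.distrib)
  also have "\<dots> = C * real d * (\<Sum>i<d. (cmod (z i))\<^sup>2)"
    by (simp add: sum_distrib_left[symmetric])
  finally show ?thesis .
qed

text \<open>\<open>R\<close> is the inverse of \<open>P\<close>, and \<kappa> a common lower bound
  of \<open>P\<close> and \<open>W\<close>. The properties hold for all \<open>t\<close>, and the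
  bounds and symmetries for all indices, so the estimates below carry no almost-everywhere clauses
  for the coefficients.\<close>

locale sl_coeffs =
  fixes d :: nat and a b :: real and P Q W R :: "real \<Rightarrow> nat \<Rightarrow> nat \<Rightarrow> real" and C \<kappa> :: real
  assumes ab: "a < b" and \<kappa>: "\<kappa> > 0"
    and meas: "\<And>i j. (\<lambda>t. P t i j) \<in> borel_measurable borel" "\<And>i j. (\<lambda>t. Q t i j) \<in> borel_measurable borel"
      "\<And>i j. (\<lambda>t. W t i j) \<in> borel_measurable borel" "\<And>i j. (\<lambda>t. R t i j) \<in> borel_measurable borel"
    and bound: "\<And>t i j. \<bar>P t i j\<bar> \<le> C" "\<And>t i j. \<bar>Q t i j\<bar> \<le> C" "\<And>t i j. \<bar>W t i j\<bar> \<le> C" "\<And>t i j. \<bar>R t i j\<bar> \<le> C"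
    and sym: "\<And>t i j. P t j i = P t i j" "\<And>t i j. Q t j i = Q t i j" "\<And>t i j. W t j i = W t i j"
    and P_ge: "\<And>t. loewner_ge d (P t) \<kappa>" and W_ge: "\<And>t. loewner_ge d (W t) \<kappa>"
    and PR: "\<And>t i k. i < d \<Longrightarrow> k < d \<Longrightarrow> (\<Sum>j<d. P t i j * R t j k) = (if i = k then 1 else 0)"
    and RP: "\<And>t i k. i < d \<Longrightarrow> k < d \<Longrightarrow> (\<Sum>j<d. R t i j * P t j k) = (if i = k then 1 else 0)"
begin

lemma C_nonneg: "0 \<le> C"
  using bound(1)[of undefined undefined undefined] by linarith

lemma bdd_meas_coeff: "bdd_meas \<alpha> \<beta> (\<lambda>t. complex_of_real (P t i j))" "bdd_meas \<alpha> \<beta> (\<lambda>t. complex_of_real (Q t i j))"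
  "bdd_meas \<alpha> \<beta> (\<lambda>t. complex_of_real (W t i j))" "bdd_meas \<alpha> \<beta> (\<lambda>t. complex_of_real (R t i j))"
  by (rule bdd_meas_of_real[OF meas(1) bound(1)] bdd_meas_of_real[OF meas(2) bound(2)]
    bdd_meas_of_real[OF meas(3) bound(3)] bdd_meas_of_real[OF meas(4) bound(4)])+

definition V :: "real \<Rightarrow> real \<Rightarrow> nat \<Rightarrow> nat \<Rightarrow> complex" where
  "V \<mu> t i j = complex_of_real (Q t i j) - complex_of_real \<mu> * complex_of_real (W t i j)"

lemma bdd_meas_V: "bdd_meas \<alpha> \<beta> (\<lambda>t. V \<mu> t i j)"
  unfolding V_def by (intro bdd_meas_intros bdd_meas_coeff)

lemma mult_P_R:
  assumes "i < d" shows "(\<Sum>j<d. complex_of_real (P t i j) * (\<Sum>k<d. complex_of_real (R t j k) * u k)) = u i"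
proof -
  have "(\<Sum>j<d. complex_of_real (P t i j) * (\<Sum>k<d. complex_of_real (R t j k) * u k)) =
     (\<Sum>j<d. \<Sum>k<d. complex_of_real (P t i j * R t j k) * u k)" by (simp add: sum_distrib_left mult.assoc)
  also have "\<dots> = (\<Sum>k<d. \<Sum>j<d. complex_of_real (P t i j * R t j k) * u k)" by (rule sum.swap)
  also have "\<dots> = (\<Sum>k<d. complex_of_real (\<Sum>j<d. P t i j * R t j k) * u k)" by (simp add: sum_distrib_right)
  also have "\<dots> = (\<Sum>k<d. (if i = k then 1 else 0) * u k)" using PR assms by (intro sum.cong) auto
  also have "\<dots> = u i" using assms by (simp add: if_distrib[of "\<lambda>x. x * _"] sum.delta cong: if_cong)
  finally show ?thesis .
qed

lemma mult_R_P:
  assumes "i < d" shows "(\<Sum>j<d. complex_of_real (R t i j) * (\<Sum>k<d. complex_of_real (P t j k) * u k)) = u i"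
proof -
  have "(\<Sum>j<d. complex_of_real (R t i j) * (\<Sum>k<d. complex_of_real (P t j k) * u k)) =
     (\<Sum>j<d. \<Sum>k<d. complex_of_real (R t i j * P t j k) * u k)" by (simp add: sum_distrib_left mult.assoc)
  also have "\<dots> = (\<Sum>k<d. \<Sum>j<d. complex_of_real (R t i j * P t j k) * u k)" by (rule sum.swap)
  also have "\<dots> = (\<Sum>k<d. complex_of_real (\<Sum>j<d. R t i j * P t j k) * u k)" by (simp add: sum_distrib_right)
  also have "\<dots> = (\<Sum>k<d. (if i = k then 1 else 0) * u k)" using RP assms by (intro sum.cong) auto
  also have "\<dots> = u i" using assms by (simp add: if_distrib[of "\<lambda>x. x * _"] sum.delta cong: if_cong)
  finally show ?thesis .
qed

definition en :: "real \<Rightarrow> (real \<Rightarrow> nat \<Rightarrow> complex) \<Rightarrow> (real \<Rightarrow> nat \<Rightarrow> complex) \<Rightarrow>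
    (real \<Rightarrow> nat \<Rightarrow> complex) \<Rightarrow> (real \<Rightarrow> nat \<Rightarrow> complex) \<Rightarrow> real \<Rightarrow> complex" where
  "en \<mu> y y' z z' t = (\<Sum>i<d. \<Sum>j<d. complex_of_real (P t i j) * y' t j * cnj (z' t i)) +
     (\<Sum>i<d. \<Sum>j<d. V \<mu> t i j * y t j * cnj (z t i))"

text \<open>Derivatives are bounded rather than square integrable. This class contains all
  solutions, whose derivative is \<open>R u\<close> with continuous \<open>u\<close>, and it makes
  every integrand bounded.\<close>

definition adm :: "real \<Rightarrow> real \<Rightarrow> (real \<Rightarrow> nat \<Rightarrow> complex) \<Rightarrow> (real \<Rightarrow> nat \<Rightarrow> complex) \<Rightarrow> bool" where
  "adm \<alpha> \<beta> y y' \<longleftrightarrow> (\<forall>i<d. primitive_on \<alpha> \<beta> (\<lambda>t. y t i) (\<lambda>t. y' t i) \<and> bdd_meas \<alpha> \<beta> (\<lambda>t. y' t i))"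

lemma admD: "adm \<alpha> \<beta> y y' \<Longrightarrow> i < d \<Longrightarrow> primitive_on \<alpha> \<beta> (\<lambda>t. y t i) (\<lambda>t. y' t i)"
  "adm \<alpha> \<beta> y y' \<Longrightarrow> i < d \<Longrightarrow> bdd_meas \<alpha> \<beta> (\<lambda>t. y' t i)"
  "adm \<alpha> \<beta> y y' \<Longrightarrow> i < d \<Longrightarrow> bdd_meas \<alpha> \<beta> (\<lambda>t. y t i)"
  unfolding adm_def using bdd_meas_primitive by blast+

lemma adm_subinterval: "adm \<alpha> \<beta> y y' \<Longrightarrow> \<alpha> \<le> \<gamma> \<Longrightarrow> \<delta> \<le> \<beta> \<Longrightarrow> adm \<gamma> \<delta> y y'"
  unfolding adm_def using primitive_on_subinterval bdd_meas_subinterval by blast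

lemma bdd_meas_en: "adm \<alpha> \<beta> y y' \<Longrightarrow> adm \<alpha> \<beta> z z' \<Longrightarrow> bdd_meas \<alpha> \<beta> (en \<mu> y y' z z')"
  unfolding en_def
  by (intro bdd_meas_add bdd_meas_sum bdd_meas_mult bdd_meas_cnj bdd_meas_coeff bdd_meas_V) (auto intro: admD)

definition nsq :: "real \<Rightarrow> real \<Rightarrow> (real \<Rightarrow> nat \<Rightarrow> complex) \<Rightarrow> real" where
  "nsq \<alpha> \<beta> y = (\<Sum>i<d. sqint \<alpha> \<beta> (\<lambda>t. y t i))"

lemma nsq_nonneg: "0 \<le> nsq \<alpha> \<beta> y" unfolding nsq_def by (intro sum_nonneg sqint_nonneg)

lemma nsq_eq:
  assumes "\<And>i. i < d \<Longrightarrow> bdd_meas \<alpha> \<beta> (\<lambda>t. y t i)"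
  shows "nsq \<alpha> \<beta> y = (LINT t:{\<alpha>..\<beta>}|lborel. (\<Sum>i<d. (cmod (y t i))\<^sup>2))"
    "set_integrable lborel {\<alpha>..\<beta>} (\<lambda>t. \<Sum>i<d. (cmod (y t i))\<^sup>2)"
proof -
  have "set_integrable lborel {\<alpha>..\<beta>} (\<lambda>t. \<Sum>i\<in>J. (cmod (y t i))\<^sup>2) \<and>
    (\<Sum>i\<in>J. sqint \<alpha> \<beta> (\<lambda>t. y t i)) = (LINT t:{\<alpha>..\<beta>}|lborel. (\<Sum>i\<in>J. (cmod (y t i))\<^sup>2))"
    if "J \<subseteq> {..<d}" "finite J" for J
    using that(2,1)
  proof (induction J rule: finite_induct)
    case empty then show ?case by (simp add: set_integrable_def)
  next
    case (insert i J)
    then have "set_integrable lborel {\<alpha>..\<beta>} (\<lambda>t. (cmod (y t i))\<^sup>2)"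
      by (intro bdd_meas_cmod2_integrable assms) auto
    then show ?case using insert by (simp add: sqint_def)
  qed
  from this[of "{..<d}"] show "nsq \<alpha> \<beta> y = (LINT t:{\<alpha>..\<beta>}|lborel. (\<Sum>i<d. (cmod (y t i))\<^sup>2))"
    "set_integrable lborel {\<alpha>..\<beta>} (\<lambda>t. \<Sum>i<d. (cmod (y t i))\<^sup>2)" by (auto simp: nsq_def)
qed

text \<open>Bounds the negative part of the form of \<open>Q - \<mu> W\<close> for \<mu> \<le>
  \<open>M\<close>: entries of size \<open>C\<close> give a quadratic form of size at most
  \<open>C * real d\<close>, and \<open>W\<close> can contribute negatively only for positive
  \<mu>.\<close>

definition \<Lambda> :: "real \<Rightarrow> real" where "\<Lambda> M = C * real d * (1 + \<bar>M\<bar>)"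

lemma \<Lambda>_nonneg: "0 \<le> \<Lambda> M" unfolding \<Lambda>_def using C_nonneg by simp

text \<open>For negative \<mu> the weight is an asset. Its contribution is kept as a separate term,
  because it is what dominates the boundary terms as \<mu> tends to -\<infinity>.\<close>

lemma Re_V_ge:
  assumes "\<mu> \<le> M"
  shows "- \<Lambda> M * (\<Sum>i<d. (cmod (z i))\<^sup>2) + (if \<mu> < 0 then - \<mu> * \<kappa> * (\<Sum>i<d. (cmod (z i))\<^sup>2) else 0)
    \<le> Re (\<Sum>i<d. \<Sum>j<d. V \<mu> t i j * z j * cnj (z i))"
proof -
  define s where "s = (\<Sum>i<d. (cmod (z i))\<^sup>2)"
  have s: "s \<ge> 0" unfolding s_def by (intro sum_nonneg) auto
  define q where "q = (\<Sum>i<d. \<Sum>j<d. complex_of_real (Q t i j) * z j * cnj (z i))"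
  define w where "w = (\<Sum>i<d. \<Sum>j<d. complex_of_real (W t i j) * z j * cnj (z i))"
  have e: "(\<Sum>i<d. \<Sum>j<d. V \<mu> t i j * z j * cnj (z i)) = q - complex_of_real \<mu> * w"
    unfolding V_def q_def w_def by (simp add: algebra_simps sum_subtractf sum_distrib_left)
  have "cmod q \<le> C * real d * s" "cmod w \<le> C * real d * s"
    unfolding q_def w_def s_def by (rule quadratic_form_bound; simp add: bound)+
  then have q: "Re q \<ge> - (C * real d * s)" "Re w \<le> C * real d * s"
    using abs_Re_le_cmod[of q] abs_Re_le_cmod[of w] by linarith+
  have w: "Re w \<ge> \<kappa> * s" unfolding w_def s_def by (rule loewner_ge_complex[OF W_ge])
  have cds: "C * real d * s \<ge> 0" using C_nonneg s by simp
  define p where "p = (if \<mu> < 0 then - \<mu> * \<kappa> * s else 0)"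
  have M0: "C * real d * s * \<bar>M\<bar> \<ge> 0" using cds by simp
  have "p - C * real d * s * \<bar>M\<bar> \<le> - (\<mu> * Re w)"
  proof (cases "\<mu> < 0")
    case True
    then have "(- \<mu>) * (\<kappa> * s) \<le> (- \<mu>) * Re w" using w by (intro mult_left_mono) auto
    then have "p \<le> - (\<mu> * Re w)" using True by (simp add: p_def mult.assoc)
    then show ?thesis using M0 by linarith
  next
    case False
    have "Re w \<ge> 0" using w mult_nonneg_nonneg[of \<kappa> s] \<kappa> s by linarith
    then have "\<mu> * Re w \<le> \<bar>M\<bar> * (C * real d * s)" using q(2) assms cds False
      by (intro mult_mono) auto
    then show ?thesis using False by (simp add: p_def mult_ac)
  qed
  moreover have "\<Lambda> M * s = C * real d * s + C * real d * s * \<bar>M\<bar>" unfolding \<Lambda>_def by (simp add: algebra_simps)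
  ultimately have "- (\<Lambda> M * s) + p \<le> Re q - \<mu> * Re w" using q(1) by linarith
  then have "- \<Lambda> M * s + (if \<mu> < 0 then - \<mu> * \<kappa> * s else 0) \<le> Re q - \<mu> * Re w" unfolding p_def by simp
  then show ?thesis unfolding e s_def by simp
qed

lemma energy_ge:
  assumes y: "adm \<alpha> \<beta> y y'" and \<mu>: "\<mu> \<le> M"
  shows "\<kappa> * nsq \<alpha> \<beta> y' + ((if \<mu> < 0 then - \<mu> * \<kappa> else 0) - \<Lambda> M) * nsq \<alpha> \<beta> y
     \<le> Re (LINT t:{\<alpha>..\<beta>}|lborel. en \<mu> y y' y y' t)"
proof -
  define e where "e = (if \<mu> < 0 then - \<mu> * \<kappa> else 0) - \<Lambda> M"
  have i: "set_integrable lborel {\<alpha>..\<beta>} (\<lambda>t. \<kappa> * (\<Sum>i<d. (cmod (y' t i))\<^sup>2))"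
    "set_integrable lborel {\<alpha>..\<beta>} (\<lambda>t. e * (\<Sum>i<d. (cmod (y t i))\<^sup>2))"
    using nsq_eq(2)[of \<alpha> \<beta> y'] nsq_eq(2)[of \<alpha> \<beta> y] admD[OF y] by auto
  have en: "set_integrable lborel {\<alpha>..\<beta>} (en \<mu> y y' y y')" by (intro bdd_meas_integrable bdd_meas_en y)
  have "\<kappa> * nsq \<alpha> \<beta> y' + e * nsq \<alpha> \<beta> y =
     (LINT t:{\<alpha>..\<beta>}|lborel. \<kappa> * (\<Sum>i<d. (cmod (y' t i))\<^sup>2) + e * (\<Sum>i<d. (cmod (y t i))\<^sup>2))"
    using i nsq_eq(1)[of \<alpha> \<beta> y'] nsq_eq(1)[of \<alpha> \<beta> y] admD[OF y] by (simp add: set_integral_add(2))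
  also have "\<dots> \<le> (LINT t:{\<alpha>..\<beta>}|lborel. Re (en \<mu> y y' y y' t))"
  proof (rule set_integral_mono)
    fix t
    have "e * (\<Sum>i<d. (cmod (y t i))\<^sup>2) \<le> Re (\<Sum>i<d. \<Sum>j<d. V \<mu> t i j * y t j * cnj (y t i))"
      using Re_V_ge[OF \<mu>, of "y t" t] unfolding e_def by (auto simp: algebra_simps split: if_splits)
    then show "\<kappa> * (\<Sum>i<d. (cmod (y' t i))\<^sup>2) + e * (\<Sum>i<d. (cmod (y t i))\<^sup>2) \<le> Re (en \<mu> y y' y y' t)"
      using loewner_ge_complex[OF P_ge, of "y' t" t] unfolding en_def by simp
  qed (use i Re_set_integral(1)[OF en] in auto)
  also have "\<dots> = Re (LINT t:{\<alpha>..\<beta>}|lborel. en \<mu> y y' y y' t)" using Re_set_integral(2)[OF en] by simp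
  finally show ?thesis unfolding e_def .
qed

text \<open>On a short interval the Poincare inequality pays for the potential: its constant 4,
  doubled so that half of \<kappa> is left over, gives the 8.\<close>

lemma energy_coercive:
  assumes y: "adm \<alpha> \<beta> y y'" and \<mu>: "\<mu> \<le> M" and "\<alpha> \<le> \<beta>" "\<And>i. i < d \<Longrightarrow> y \<alpha> i = 0"
    and l: "8 * \<Lambda> M * (\<beta> - \<alpha>)\<^sup>2 \<le> \<kappa>"
  shows "\<kappa> / 2 * nsq \<alpha> \<beta> y' \<le> Re (LINT t:{\<alpha>..\<beta>}|lborel. en \<mu> y y' y y' t)"
proof -
  have "nsq \<alpha> \<beta> y \<le> 4 * (\<beta> - \<alpha>)\<^sup>2 * nsq \<alpha> \<beta> y'"
    unfolding nsq_def sum_distrib_left using assms admD[OF y] by (intro sum_mono poincare) auto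
  then have "\<Lambda> M * nsq \<alpha> \<beta> y \<le> \<Lambda> M * (4 * (\<beta> - \<alpha>)\<^sup>2 * nsq \<alpha> \<beta> y')"
    using \<Lambda>_nonneg by (intro mult_left_mono)
  also have "\<dots> = (8 * \<Lambda> M * (\<beta> - \<alpha>)\<^sup>2) * (nsq \<alpha> \<beta> y' / 2)" by simp
  also have "\<dots> \<le> \<kappa> * (nsq \<alpha> \<beta> y' / 2)" using l nsq_nonneg by (intro mult_right_mono) auto
  finally have 1: "\<Lambda> M * nsq \<alpha> \<beta> y \<le> \<kappa> / 2 * nsq \<alpha> \<beta> y'" by simp
  have "0 \<le> (if \<mu> < 0 then - \<mu> * \<kappa> else 0) * nsq \<alpha> \<beta> y"
    using \<kappa> nsq_nonneg[of \<alpha> \<beta> y] by (auto intro!: mult_nonneg_nonneg mult_nonpos_nonneg)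
  then have "\<kappa> * nsq \<alpha> \<beta> y' - \<Lambda> M * nsq \<alpha> \<beta> y \<le> Re (LINT t:{\<alpha>..\<beta>}|lborel. en \<mu> y y' y y' t)"
    using energy_ge[OF y \<mu>] by (simp add: left_diff_distrib)
  then show ?thesis using 1 by simp
qed

lemma en_integral_combine:
  assumes "adm \<alpha> \<beta> y y'" "adm \<alpha> \<beta> z z'" "\<alpha> \<le> \<gamma>" "\<gamma> \<le> \<beta>"
  shows "(LINT t:{\<alpha>..\<beta>}|lborel. en \<mu> y y' z z' t) =
    (LINT t:{\<alpha>..\<gamma>}|lborel. en \<mu> y y' z z' t) + (LINT t:{\<gamma>..\<beta>}|lborel. en \<mu> y y' z z' t)"
  by (rule set_integral_combine[OF bdd_meas_integrable[OF bdd_meas_en] assms(3,4)]) (use assms in auto)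

text \<open>The equation as a first-order system for \<open>y\<close> and the quasi-derivative
  \<open>u = P y'\<close>. Its coefficients are bounded although \<open>P\<close> need not be
  differentiable.\<close>

definition sol :: "real \<Rightarrow> real \<Rightarrow> real \<Rightarrow> (real \<Rightarrow> nat \<Rightarrow> complex) \<Rightarrow> (real \<Rightarrow> nat \<Rightarrow> complex) \<Rightarrow> bool" where
  "sol \<mu> \<alpha> \<beta> y u \<longleftrightarrow> (\<forall>i<d. primitive_on \<alpha> \<beta> (\<lambda>t. y t i) (\<lambda>t. \<Sum>j<d. complex_of_real (R t i j) * u t j) \<and>
     primitive_on \<alpha> \<beta> (\<lambda>t. u t i) (\<lambda>t. \<Sum>j<d. V \<mu> t i j * y t j))"

lemma sol_adm:
  assumes "sol \<mu> \<alpha> \<beta> y u"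
  shows "adm \<alpha> \<beta> y (\<lambda>t i. \<Sum>j<d. complex_of_real (R t i j) * u t j)"
  unfolding adm_def
  by (intro allI impI conjI bdd_meas_sum bdd_meas_mult bdd_meas_coeff)
    (use assms in \<open>auto simp: sol_def intro: bdd_meas_primitive\<close>)

text \<open>Integration by parts of \<open>u\<close> against \<open>z\<close>. The relation
  \<open>u = P y'\<close> is required almost everywhere, which admits glued functions whose
  derivative is ambiguous at a node.\<close>

lemma green:
  assumes u: "\<And>i. i < d \<Longrightarrow> primitive_on \<alpha> \<beta> (\<lambda>t. u t i) (\<lambda>t. \<Sum>j<d. V \<mu> t i j * y t j)"
    and y: "adm \<alpha> \<beta> y y'" and z: "adm \<alpha> \<beta> z z'" and "\<alpha> \<le> \<beta>"
    and uy: "AE t in lborel. t \<in> {\<alpha>..\<beta>} \<longrightarrow> (\<forall>i<d. u t i = (\<Sum>j<d. complex_of_real (P t i j) * y' t j))"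
  shows "(LINT t:{\<alpha>..\<beta>}|lborel. en \<mu> y y' z z' t) = (\<Sum>i<d. u \<beta> i * cnj (z \<beta> i)) - (\<Sum>i<d. u \<alpha> i * cnj (z \<alpha> i))"
proof -
  define g' where "g' = (\<lambda>t. \<Sum>i<d. (\<Sum>j<d. V \<mu> t i j * y t j) * cnj (z t i) + u t i * cnj (z' t i))"
  have g: "primitive_on \<alpha> \<beta> (\<lambda>t. \<Sum>i<d. u t i * cnj (z t i)) g'"
    unfolding g'_def using u admD(1)[OF z]
    by (intro primitive_on_sum primitive_on_mult primitive_on_cnj) auto
  have "primitive_on \<alpha> \<beta> (\<lambda>t. \<Sum>i<d. u t i * cnj (z t i)) (en \<mu> y y' z z')"
  proof (rule primitive_on_cong_AE[OF g])
    show "AE s in lborel. s \<in> {\<alpha>..\<beta>} \<longrightarrow> g' s = en \<mu> y y' z z' s"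
      using uy by eventually_elim
        (auto simp: g'_def en_def sum_distrib_right sum.distrib add.commute)
    show "set_borel_measurable lborel {\<alpha>..\<beta>} (en \<mu> y y' z z')" using bdd_meas_en[OF y z] by (simp add: bdd_meas_def)
  qed simp
  from primitive_onD[OF this order_refl assms(4) order_refl] show ?thesis by simp
qed

lemma sol_green:
  assumes s: "sol \<mu> \<alpha> \<beta> y u" and z: "adm \<alpha> \<beta> z z'" and "\<alpha> \<le> \<beta>"
  shows "(LINT t:{\<alpha>..\<beta>}|lborel. en \<mu> y (\<lambda>t i. \<Sum>j<d. complex_of_real (R t i j) * u t j) z z' t) =
    (\<Sum>i<d. u \<beta> i * cnj (z \<beta> i)) - (\<Sum>i<d. u \<alpha> i * cnj (z \<alpha> i))"
  by (rule green[OF _ sol_adm[OF s] z assms(3)]) (use s in \<open>auto simp: sol_def mult_P_R\<close>)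

end

lemma primitive_on_cong:
  assumes f: "primitive_on a b f f'" and eq: "\<And>t. t \<in> {a..b} \<Longrightarrow> f t = g t" "\<And>t. t \<in> {a..b} \<Longrightarrow> f' t = g' t"
  shows "primitive_on a b g g'"
proof (rule primitive_onI)
  show "set_integrable lborel {a..b} g'"
    using primitive_on_integrable[OF f order_refl order_refl] by (subst set_integrable_cong[OF refl]) (auto simp: eq(2)[symmetric])
  fix t assume t: "a \<le> t" "t \<le> b"
  have "(LINT s:{a..t}|lborel. f' s) = (LINT s:{a..t}|lborel. g' s)"
    using t eq(2) by (intro set_lebesgue_integral_cong) auto
  then show "g t = g a + (LINT s:{a..t}|lborel. g' s)"
    using primitive_on_eq[OF f t] eq(1)[of t] eq(1)[of a] t by simp
qed

lemma bdd_meas_glue: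
  assumes f: "bdd_meas a c f" and g: "bdd_meas c e g" and "a \<le> c" "c \<le> e"
  shows "bdd_meas a e (\<lambda>t. if t \<le> c then f t else g t)"
proof -
  have f': "(\<lambda>t. indicat_real {a..c} t *\<^sub>R f t) \<in> borel_measurable borel"
    and g': "(\<lambda>t. indicat_real {c..e} t *\<^sub>R g t) \<in> borel_measurable borel"
    using f g unfolding bdd_meas_def set_borel_measurable_def by auto
  have "(\<lambda>t. if t \<le> c then indicat_real {a..c} t *\<^sub>R f t else indicat_real {c..e} t *\<^sub>R g t) \<in> borel_measurable borel"
    using f' g' by (intro measurable_If) auto
  moreover have "(\<lambda>t. if t \<le> c then indicat_real {a..c} t *\<^sub>R f t else indicat_real {c..e} t *\<^sub>R g t) =
    (\<lambda>t. indicat_real {a..e} t *\<^sub>R (if t \<le> c then f t else g t))"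
    using assms(3,4) by (auto simp: indicator_def)
  ultimately have "set_borel_measurable lborel {a..e} (\<lambda>t. if t \<le> c then f t else g t)"
    unfolding set_borel_measurable_def by simp
  moreover obtain B1 B2 where "\<And>t. t\<in>{a..c} \<Longrightarrow> cmod (f t) \<le> B1" "\<And>t. t\<in>{c..e} \<Longrightarrow> cmod (g t) \<le> B2"
    using f g unfolding bdd_meas_def by metis
  then have "\<forall>t\<in>{a..e}. cmod (if t \<le> c then f t else g t) \<le> max B1 B2"
    by (auto simp: le_max_iff_disj)
  ultimately show ?thesis unfolding bdd_meas_def by blast
qed

lemma primitive_on_glue:
  assumes f: "primitive_on a c f f'" and g: "primitive_on c e g g'" and c: "f c = g c" "a \<le> c" "c \<le> e"
    and h': "bdd_meas a e (\<lambda>t. if t \<le> c then f' t else g' t)"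
  shows "primitive_on a e (\<lambda>t. if t \<le> c then f t else g t) (\<lambda>t. if t \<le> c then f' t else g' t)"
proof (rule primitive_onI)
  let ?h = "\<lambda>t. if t \<le> c then f' t else g' t"
  show i: "set_integrable lborel {a..e} ?h" by (rule bdd_meas_integrable[OF h'])
  have 1: "(LINT s:{a..t}|lborel. ?h s) = (LINT s:{a..t}|lborel. f' s)" if "t \<le> c" for t
    using that by (intro set_lebesgue_integral_cong) auto
  fix t assume t: "a \<le> t" "t \<le> e"
  show "(if t \<le> c then f t else g t) = (if a \<le> c then f a else g a) + (LINT s:{a..t}|lborel. ?h s)"
  proof (cases "t \<le> c")
    case True
    then show ?thesis using primitive_on_eq[OF f t(1) True] 1 c by simp
  next
    case False
    have it: "set_integrable lborel {a..t} ?h" by (rule set_integrable_subset[OF i]) (use t in auto)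
    have ict: "set_integrable lborel {c..t} ?h" by (rule set_integrable_subset[OF i]) (use t c in auto)
    have igt: "set_integrable lborel {c..t} g'" using primitive_on_integrable[OF g, of c t] t by simp
    have "(LINT s:{c..t}|lborel. ?h s) = (LINT s:{c..t}|lborel. g' s)"
      unfolding set_lebesgue_integral_def
    proof (rule integral_cong_AE)
      have "AE s in lborel. s \<noteq> c" by (rule AE_lborel_singleton)
      then show "AE s in lborel. indicat_real {c..t} s *\<^sub>R ?h s = indicat_real {c..t} s *\<^sub>R g' s"
        by eventually_elim (auto simp: indicator_def)
    qed (use ict igt in \<open>auto simp: set_integrable_def\<close>)
    then show ?thesis
      using set_integral_combine[OF it, of c] 1[of c] primitive_on_eq[OF f, of c] primitive_on_eq[OF g, of t] c t False by simp
  qed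
qed

lemma sum_lessThan_double: "(\<Sum>j<2*d. g j) = (\<Sum>j<d. g j) + (\<Sum>j<d. g (d + j))" for g :: "nat \<Rightarrow> 'a::comm_monoid_add"
proof -
  have "{..<2*d} = {..<d} \<union> {d..<2*d}" by auto
  then have "sum g {..<2*d} = sum g {..<d} + sum g {d..<2*d}" by (simp add: sum.union_disjoint ivl_disj_int)
  also have "sum g {d..<2*d} = (\<Sum>j<d. g (d + j))"
    by (rule sum.reindex_bij_witness[of _ "\<lambda>j. d + j" "\<lambda>j. j - d"]) auto
  finally show ?thesis .
qed

lemma nodes_mono:
  fixes \<tau> :: "nat \<Rightarrow> real"
  assumes "\<And>k. k < m \<Longrightarrow> \<tau> k < \<tau> (Suc k)" "l \<le> k" "k \<le> m"
  shows "\<tau> l \<le> \<tau> k"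
  using assms(2,3)
proof (induction k)
  case (Suc k)
  then show ?case using assms(1)[of k] by (cases "l \<le> k") (auto simp: le_Suc_eq)
qed simp

section \<open>Initial and boundary value problems, broken extremals\<close>

context sl_coeffs
begin

lemma ivp_exists:
  assumes "\<alpha> \<le> \<beta>"
  shows "\<exists>y u. sol \<mu> \<alpha> \<beta> y u \<and> (\<forall>i<d. y \<alpha> i = y0 i \<and> u \<alpha> i = u0 i)"
proof -
  define A where "A = (\<lambda>t i j. if i < d then (if j < d then 0 else complex_of_real (R t i (j - d)))
      else (if j < d then V \<mu> t (i - d) j else 0))"
  have "bdd_meas \<alpha> \<beta> (\<lambda>t. A t i j)" for i j
    unfolding A_def by (cases "i < d"; cases "j < d") (auto intro: bdd_meas_coeff bdd_meas_V bdd_meas_const)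
  then have "\<exists>Z. (\<forall>i<2*d. primitive_on \<alpha> \<beta> (\<lambda>t. Z t i) (\<lambda>t. \<Sum>j<2*d. A t i j * Z t j)) \<and>
      (\<forall>i<2*d. Z \<alpha> i = (if i < d then y0 i else u0 (i - d)))"
    by (intro linear_ode_exists assms)
  then obtain Z where Z: "\<And>i. i<2*d \<Longrightarrow> primitive_on \<alpha> \<beta> (\<lambda>t. Z t i) (\<lambda>t. \<Sum>j<2*d. A t i j * Z t j)"
      "\<And>i. i<2*d \<Longrightarrow> Z \<alpha> i = (if i < d then y0 i else u0 (i - d))" by blast
  have "primitive_on \<alpha> \<beta> (\<lambda>t. Z t i) (\<lambda>t. \<Sum>j<d. complex_of_real (R t i j) * Z t (d + j))" if "i < d" for i
    by (rule primitive_on_cong[OF Z(1)]) (use that in \<open>auto simp: sum_lessThan_double A_def\<close>)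
  moreover have "primitive_on \<alpha> \<beta> (\<lambda>t. Z t (d + i)) (\<lambda>t. \<Sum>j<d. V \<mu> t i j * Z t j)" if "i < d" for i
    by (rule primitive_on_cong[OF Z(1)]) (use that in \<open>auto simp: sum_lessThan_double A_def\<close>)
  ultimately have "sol \<mu> \<alpha> \<beta> Z (\<lambda>t i. Z t (d + i))" unfolding sol_def by blast
  then show ?thesis using Z(2) by (intro exI[of _ Z] exI[of _ "\<lambda>t i. Z t (d + i)"]) auto
qed

lemma sol_lc:
  assumes "finite J" "\<And>j. j \<in> J \<Longrightarrow> sol \<mu> \<alpha> \<beta> (Y j) (U j)"
  shows "sol \<mu> \<alpha> \<beta> (\<lambda>t i. \<Sum>j\<in>J. c j * Y j t i) (\<lambda>t i. \<Sum>j\<in>J. c j * U j t i)"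
  unfolding sol_def
proof (intro allI impI conjI)
  fix i assume i: "i < d"
  have swap: "(\<Sum>j\<in>J. c j * (\<Sum>k<d. G t k * F j t k)) = (\<Sum>k<d. G t k * (\<Sum>j\<in>J. c j * F j t k))"
    for G :: "real \<Rightarrow> nat \<Rightarrow> complex" and F t
    by (simp add: sum_distrib_left mult.left_commute) (rule sum.swap)
  show "primitive_on \<alpha> \<beta> (\<lambda>t. \<Sum>j\<in>J. c j * Y j t i) (\<lambda>t. \<Sum>k<d. complex_of_real (R t i k) * (\<Sum>j\<in>J. c j * U j t k))"
    unfolding swap[where G="\<lambda>t k. complex_of_real (R t i k)" and F="U", symmetric]
    by (intro primitive_on_sum primitive_on_scale) (use assms i in \<open>auto simp: sol_def\<close>)
  show "primitive_on \<alpha> \<beta> (\<lambda>t. \<Sum>j\<in>J. c j * U j t i) (\<lambda>t. \<Sum>k<d. V \<mu> t i k * (\<Sum>j\<in>J. c j * Y j t k))"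
    unfolding swap[where G="\<lambda>t k. V \<mu> t i k" and F="Y", symmetric]
    by (intro primitive_on_sum primitive_on_scale) (use assms i in \<open>auto simp: sol_def\<close>)
qed

lemma nsq_zeroD:
  assumes "nsq \<alpha> \<beta> y = 0" "i < d"
  shows "sqint \<alpha> \<beta> (\<lambda>t. y t i) = 0"
  using assms unfolding nsq_def by (subst (asm) sum_nonneg_eq_0_iff) (auto simp: sqint_nonneg)

text \<open>By Green's formula such a solution has zero energy; coercivity then makes
  \<open>y' = R u\<close> vanish almost everywhere, hence also \<open>u = P y'\<close>, and
  \<open>u\<close> is continuous.\<close>

lemma sol_dirichlet_trivial:
  assumes s: "sol \<mu> \<alpha> \<beta> y u" and "\<alpha> < \<beta>" and \<mu>: "\<mu> \<le> M" and l: "8 * \<Lambda> M * (\<beta> - \<alpha>)\<^sup>2 \<le> \<kappa>"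
    and z: "\<And>i. i < d \<Longrightarrow> y \<alpha> i = 0" "\<And>i. i < d \<Longrightarrow> y \<beta> i = 0" and i: "i < d"
  shows "u \<alpha> i = 0"
proof -
  define y' where "y' = (\<lambda>t i. \<Sum>j<d. complex_of_real (R t i j) * u t j)"
  have y: "adm \<alpha> \<beta> y y'" unfolding y'_def by (rule sol_adm[OF s])
  have "(LINT t:{\<alpha>..\<beta>}|lborel. en \<mu> y y' y y' t) = 0"
    using sol_green[OF s y] z assms(2) unfolding y'_def by simp
  then have "\<kappa> / 2 * nsq \<alpha> \<beta> y' \<le> 0" using energy_coercive[OF y \<mu> _ z(1) l] assms(2) by simp
  then have n0: "nsq \<alpha> \<beta> y' = 0" using \<kappa> nsq_nonneg[of \<alpha> \<beta> y'] by (simp add: mult_le_0_iff)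
  have "AE t in lborel. \<forall>j\<in>{..<d}. t \<in> {\<alpha>..\<beta>} \<longrightarrow> y' t j = 0"
    by (rule AE_finite_allI) (use sqint_zero_AE[OF admD(2)[OF y] nsq_zeroD[OF n0]] in auto)
  then have ae: "AE t in lborel. t \<in> {\<alpha>..\<beta>} \<longrightarrow> u t i = 0"
  proof eventually_elim
    case (elim t)
    then show ?case using mult_P_R[OF i, of t "u t"] by (auto simp: y'_def)
  qed
  have "sqint \<alpha> \<beta> (\<lambda>t. u t i) = 0"
    unfolding sqint_def set_lebesgue_integral_def
    by (rule integral_eq_zero_AE) (use ae in \<open>eventually_elim, auto simp: indicator_def\<close>)
  then show ?thesis
    by (intro sqint_zero_continuous[of \<alpha> \<beta> "\<lambda>t. u t i" "\<lambda>t. \<Sum>j<d. V \<mu> t i j * y t j"])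
      (use s i assms(2) admD(3)[OF y] in \<open>auto simp: sol_def intro!: bdd_meas_sum bdd_meas_mult bdd_meas_V\<close>)
qed

text \<open>Shooting: uniqueness makes the linear map from initial slopes to end values injective,
  hence surjective by \<open>square_system_solvable\<close>.\<close>

lemma bvp_exists:
  assumes "\<alpha> < \<beta>" and \<mu>: "\<mu> \<le> M" and l: "8 * \<Lambda> M * (\<beta> - \<alpha>)\<^sup>2 \<le> \<kappa>"
  shows "\<exists>y u. sol \<mu> \<alpha> \<beta> y u \<and> (\<forall>i<d. y \<alpha> i = \<zeta>0 i \<and> y \<beta> i = \<zeta>1 i)"
proof -
  have ab: "\<alpha> \<le> \<beta>" using assms by simp
  obtain y0 u0 where 0: "sol \<mu> \<alpha> \<beta> y0 u0" "\<And>i. i<d \<Longrightarrow> y0 \<alpha> i = \<zeta>0 i"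
    using ivp_exists[OF ab, of \<mu> \<zeta>0 "\<lambda>_. 0"] by blast
  have "\<exists>y u. sol \<mu> \<alpha> \<beta> y u \<and> (\<forall>i<d. y \<alpha> i = 0 \<and> u \<alpha> i = (if i = j then 1 else 0))" for j
    using ivp_exists[OF ab, of \<mu> "\<lambda>_. 0" "\<lambda>i. if i = j then 1 else 0"] by blast
  then obtain Y U where YU: "\<And>j. sol \<mu> \<alpha> \<beta> (Y j) (U j)" "\<And>i j. i < d \<Longrightarrow> Y j \<alpha> i = 0"
    "\<And>i j. i < d \<Longrightarrow> U j \<alpha> i = (if i = j then 1 else 0)" by metis
  have "\<exists>c. \<forall>i\<in>{..<d}. (\<Sum>j<d. Y j \<beta> i * c j) = \<zeta>1 i - y0 \<beta> i"
  proof (rule square_system_solvable)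
    fix c assume c: "\<And>i. i \<in> {..<d} \<Longrightarrow> (\<Sum>j<d. Y j \<beta> i * c j) = 0"
    have s: "sol \<mu> \<alpha> \<beta> (\<lambda>t i. \<Sum>j<d. c j * Y j t i) (\<lambda>t i. \<Sum>j<d. c j * U j t i)"
      by (rule sol_lc) (use YU in auto)
    show "\<forall>j\<in>{..<d}. c j = 0"
    proof
      fix i assume i: "i \<in> {..<d}"
      then have "(\<Sum>j<d. c j * U j \<alpha> i) = 0"
        using c YU by (intro sol_dirichlet_trivial[OF s assms]) (auto simp: mult.commute)
      moreover have "(\<Sum>j<d. c j * U j \<alpha> i) = (\<Sum>j<d. c j * (if i = j then 1 else 0))"
        using YU(3) i by (intro sum.cong refl arg_cong2[where f="(*)"]) auto
      moreover have "\<dots> = c i" using i by (simp add: if_distrib sum.delta cong: if_cong)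
      ultimately show "c i = 0" by simp
    qed
  qed simp
  then obtain c where c: "\<And>i. i < d \<Longrightarrow> (\<Sum>j<d. Y j \<beta> i * c j) = \<zeta>1 i - y0 \<beta> i" by auto
  \<comment> \<open>Index \<open>d\<close> is reserved for the particular solution with the
    prescribed initial value, taken with coefficient 1.\<close>
  define Y' where "Y' = (\<lambda>j. if j < d then Y j else y0)"
  define U' where "U' = (\<lambda>j. if j < d then U j else u0)"
  define c' where "c' = c(d := 1)"
  have "sol \<mu> \<alpha> \<beta> (\<lambda>t i. \<Sum>j<Suc d. c' j * Y' j t i) (\<lambda>t i. \<Sum>j<Suc d. c' j * U' j t i)"
    by (rule sol_lc) (use YU 0 in \<open>auto simp: Y'_def U'_def\<close>)
  moreover have "(\<Sum>j<Suc d. c' j * Y' j t i) = (\<Sum>j<d. Y j t i * c j) + y0 t i" for t i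
    by (simp add: c'_def Y'_def mult.commute)
  ultimately show ?thesis using c YU(2) 0(2) by (intro exI conjI) (assumption, simp)
qed

text \<open>Solutions of boundary value problems on the pieces are glued. The boundary terms of
  Green's formula sit at the nodes, where the test functions vanish, so the jumps of
  \<open>P y'\<close> do no harm.\<close>

lemma extremal_exists:
  fixes \<tau> :: "nat \<Rightarrow> real"
  assumes \<tau>: "\<tau> 0 = a" "\<And>k. k < m \<Longrightarrow> \<tau> k < \<tau> (Suc k)" "\<And>k. k < m \<Longrightarrow> 8 * \<Lambda> M * (\<tau> (Suc k) - \<tau> k)\<^sup>2 \<le> \<kappa>"
    and \<mu>: "\<mu> \<le> M" and "k \<le> m"
  shows "\<exists>y y'. adm a (\<tau> k) y y' \<and> (\<forall>l\<le>k. \<forall>i<d. y (\<tau> l) i = \<zeta> l i) \<and>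
     (\<forall>z z'. adm a (\<tau> k) z z' \<and> (\<forall>l\<le>k. \<forall>i<d. z (\<tau> l) i = 0) \<longrightarrow> (LINT t:{a..\<tau> k}|lborel. en \<mu> y y' z z' t) = 0)"
  using assms(5)
proof (induction k)
  case 0
  show ?case
    by (intro exI[of _ "\<lambda>t. \<zeta> 0"] exI[of _ "\<lambda>t i. 0"])
      (auto simp: \<tau> set_integral_Icc_same adm_def primitive_on_const bdd_meas_const simp del: atLeastAtMost_singleton)
next
  case (Suc k)
  then have km: "k < m" by simp
  obtain y y' where y: "adm a (\<tau> k) y y'" "\<And>l i. l\<le>k \<Longrightarrow> i<d \<Longrightarrow> y (\<tau> l) i = \<zeta> l i"
    "\<And>z z'. adm a (\<tau> k) z z' \<Longrightarrow> (\<And>l i. l\<le>k \<Longrightarrow> i<d \<Longrightarrow> z (\<tau> l) i = 0) \<Longrightarrow> (LINT t:{a..\<tau> k}|lborel. en \<mu> y y' z z' t) = 0"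
    using Suc by auto
  obtain w u where w: "sol \<mu> (\<tau> k) (\<tau> (Suc k)) w u" "\<And>i. i<d \<Longrightarrow> w (\<tau> k) i = \<zeta> k i" "\<And>i. i<d \<Longrightarrow> w (\<tau> (Suc k)) i = \<zeta> (Suc k) i"
    using bvp_exists[OF \<tau>(2)[OF km] \<mu> \<tau>(3)[OF km], of "\<zeta> k" "\<zeta> (Suc k)"] by blast
  have le: "\<tau> l \<le> \<tau> k" if "l \<le> k" "k < m" for l k
    using nodes_mono[of m \<tau> l k] \<tau>(2) that by simp
  have ak: "a \<le> \<tau> k" "\<tau> k < \<tau> (Suc k)" using le[of 0 k] km \<tau> by auto
  define Y where "Y = (\<lambda>t i. if t \<le> \<tau> k then y t i else w t i)"
  define w' where "w' = (\<lambda>t i. \<Sum>j<d. complex_of_real (R t i j) * u t j)"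
  define Y' where "Y' = (\<lambda>t i. if t \<le> \<tau> k then y' t i else w' t i)"
  have w': "adm (\<tau> k) (\<tau> (Suc k)) w w'" unfolding w'_def by (rule sol_adm[OF w(1)])
  have Yb: "bdd_meas a (\<tau> (Suc k)) (\<lambda>t. Y' t i)" if "i < d" for i
    unfolding Y'_def using admD(2)[OF y(1) that] admD(2)[OF w' that] ak by (intro bdd_meas_glue) auto
  have Y: "adm a (\<tau> (Suc k)) Y Y'"
    unfolding adm_def
  proof (intro allI impI conjI Yb)
    fix i assume i: "i < d"
    show "primitive_on a (\<tau> (Suc k)) (\<lambda>t. Y t i) (\<lambda>t. Y' t i)"
      using Yb[OF i] unfolding Y_def Y'_def
      by (intro primitive_on_glue admD(1)[OF y(1) i] admD(1)[OF w' i]) (use y(2) w(2) i ak in auto)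
  qed
  have Yw: "Y t i = w t i" if "t \<in> {\<tau> k..\<tau> (Suc k)}" "i < d" for t i
    using that y(2)[of k i] w(2)[of i] by (auto simp: Y_def)
  have "(LINT t:{a..\<tau> (Suc k)}|lborel. en \<mu> Y Y' z z' t) = 0"
    if z: "adm a (\<tau> (Suc k)) z z'" and z0: "\<And>l i. l\<le>Suc k \<Longrightarrow> i<d \<Longrightarrow> z (\<tau> l) i = 0" for z z'
  proof -
    have zk: "adm a (\<tau> k) z z'" "adm (\<tau> k) (\<tau> (Suc k)) z z'" using adm_subinterval[OF z] ak by auto
    have "(LINT t:{a..\<tau> k}|lborel. en \<mu> Y Y' z z' t) = (LINT t:{a..\<tau> k}|lborel. en \<mu> y y' z z' t)"
      by (intro set_lebesgue_integral_cong) (auto simp: en_def Y_def Y'_def)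
    also have "\<dots> = 0" using y(3)[OF zk(1)] z0 by auto
    finally have 1: "(LINT t:{a..\<tau> k}|lborel. en \<mu> Y Y' z z' t) = 0" .
    have "(LINT t:{\<tau> k..\<tau> (Suc k)}|lborel. en \<mu> Y Y' z z' t) =
       (\<Sum>i<d. u (\<tau> (Suc k)) i * cnj (z (\<tau> (Suc k)) i)) - (\<Sum>i<d. u (\<tau> k) i * cnj (z (\<tau> k) i))"
    proof (rule green[OF _ _ zk(2)])
      show "adm (\<tau> k) (\<tau> (Suc k)) Y Y'" using adm_subinterval[OF Y] ak by simp
      fix i assume i: "i < d"
      show "primitive_on (\<tau> k) (\<tau> (Suc k)) (\<lambda>t. u t i) (\<lambda>t. \<Sum>j<d. V \<mu> t i j * Y t j)"
        by (rule primitive_on_cong[of _ _ "\<lambda>t. u t i" "\<lambda>t. \<Sum>j<d. V \<mu> t i j * w t j"])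
          (use w(1) i Yw in \<open>auto simp: sol_def intro!: sum.cong\<close>)
    next
      \<comment> \<open>At the node itself \<open>Y'\<close> is the derivative of the left piece; a
        single point is negligible.\<close>
      have "AE t in lborel. t \<noteq> \<tau> k" by (rule AE_lborel_singleton)
      then show "AE t in lborel. t \<in> {\<tau> k..\<tau> (Suc k)} \<longrightarrow> (\<forall>i<d. u t i = (\<Sum>j<d. complex_of_real (P t i j) * Y' t j))"
        by eventually_elim (auto simp: Y'_def w'_def mult_P_R)
    qed (use ak in simp)
    also have "\<dots> = 0" using z0 by simp
    finally show ?thesis using 1 en_integral_combine[OF Y z ak(1)] ak by simp
  qed
  moreover have "\<forall>l\<le>Suc k. \<forall>i<d. Y (\<tau> l) i = \<zeta> l i"
  proof (intro allI impI)
    fix l i assume l: "l \<le> Suc k" and i: "i < d"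
    show "Y (\<tau> l) i = \<zeta> l i"
    proof (cases "l = Suc k")
      case True then show ?thesis using w(3)[OF i] ak(2) by (simp add: Y_def)
    next
      case False then show ?thesis using l le[of l k] km y(2)[of l i] i by (simp add: Y_def)
    qed
  qed
  ultimately show ?case by (intro exI[of _ Y] exI[of _ Y'] conjI allI impI Y) simp_all
qed

lemma energy_nodal:
  fixes \<tau> :: "nat \<Rightarrow> real"
  assumes \<tau>: "\<tau> 0 = a" "\<And>k. k < m \<Longrightarrow> \<tau> k < \<tau> (Suc k)" "\<And>k. k < m \<Longrightarrow> 8 * \<Lambda> M * (\<tau> (Suc k) - \<tau> k)\<^sup>2 \<le> \<kappa>"
    and \<mu>: "\<mu> \<le> M" and z: "adm a (\<tau> m) z z'" and z0: "\<And>l i. l \<le> m \<Longrightarrow> i<d \<Longrightarrow> z (\<tau> l) i = 0"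
    and "k \<le> m"
  shows "\<kappa> / 2 * nsq a (\<tau> k) z' \<le> Re (LINT t:{a..\<tau> k}|lborel. en \<mu> z z' z z' t)"
  using assms(7)
proof (induction k)
  case 0
  have "sqint a a f = 0" for f unfolding sqint_def set_lebesgue_integral_def
  proof (rule integral_eq_zero_AE)
    have "AE s in lborel. s \<noteq> a" by (rule AE_lborel_singleton)
    then show "AE s in lborel. indicat_real {a..a} s *\<^sub>R (cmod (f s))\<^sup>2 = 0"
      by eventually_elim (auto simp: indicator_def)
  qed
  then show ?case by (simp add: \<tau> set_integral_Icc_same nsq_def del: atLeastAtMost_singleton)
next
  case (Suc k)
  then have km: "k < m" by simp
  have le: "\<tau> l \<le> \<tau> k" if "l \<le> k" "k \<le> m" for l k
    using nodes_mono[of m \<tau> l k] \<tau>(2) that by simp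
  have ak: "a \<le> \<tau> k" "\<tau> k < \<tau> (Suc k)" "\<tau> (Suc k) \<le> \<tau> m" using le[of 0 k] le[of "Suc k" m] km \<tau> by auto
  have zk: "adm a (\<tau> (Suc k)) z z'" "adm (\<tau> k) (\<tau> (Suc k)) z z'" using adm_subinterval[OF z] ak by auto
  have "\<kappa> / 2 * nsq (\<tau> k) (\<tau> (Suc k)) z' \<le> Re (LINT t:{\<tau> k..\<tau> (Suc k)}|lborel. en \<mu> z z' z z' t)"
    by (rule energy_coercive[OF zk(2) \<mu> _ _ \<tau>(3)[OF km]]) (use ak z0 km in auto)
  moreover have "nsq a (\<tau> (Suc k)) z' = nsq a (\<tau> k) z' + nsq (\<tau> k) (\<tau> (Suc k)) z'"
    unfolding nsq_def sum.distrib[symmetric] using ak admD(2)[OF zk(1)] by (intro sum.cong refl sqint_combine) auto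
  ultimately show ?case using Suc en_integral_combine[OF zk(1) zk(1) ak(1)] ak by (simp add: distrib_left)
qed

end

section \<open>The form of a self-adjoint boundary value problem\<close>

text \<open>A pair consisting of a function with its derivative and of a boundary vector is coded as one
  complex-valued function, so that linear combinations can be taken pointwise.\<close>

datatype pt = PY real nat | PD real nat | PX nat

abbreviation yf :: "(pt \<Rightarrow> complex) \<Rightarrow> real \<Rightarrow> nat \<Rightarrow> complex" where "yf \<xi> \<equiv> \<lambda>t i. \<xi> (PY t i)"
abbreviation df :: "(pt \<Rightarrow> complex) \<Rightarrow> real \<Rightarrow> nat \<Rightarrow> complex" where "df \<xi> \<equiv> \<lambda>t i. \<xi> (PD t i)"

context sl_coeffs
begin

definition Y1 :: "(pt \<Rightarrow> complex) \<Rightarrow> nat \<Rightarrow> complex" where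
  "Y1 \<xi> i = (if i < d then - \<xi> (PY a i) else \<xi> (PY b (i - d)))"

definition XK :: "nat set \<Rightarrow> (pt \<Rightarrow> complex) set" where
  "XK K = {\<xi>. adm a b (yf \<xi>) (df \<xi>) \<and> (\<forall>i<2*d. Suc i \<notin> K \<longrightarrow> \<xi> (PX i) = Y1 \<xi> i)}"

definition Kidx :: "nat set \<Rightarrow> nat set" where "Kidx K = {i. i < 2*d \<and> Suc i \<in> K}"

text \<open>With \<open>Y1 = (- y(a), y(b))\<close> and \<open>Y2 = ((P y')(a), (P y')(b))\<close>, the representative \<open>rep_K\<close> reads
  \<open>Y1\<^sub>i = (S x)\<^sub>i\<close> for \<open>i \<in> K\<close> and \<open>Y2\<^sub>i = - (S x)\<^sub>i\<close> for \<open>i \<notin> K\<close>, where \<open>x\<^sub>i\<close> is \<open>Y2\<^sub>i\<close> or \<open>Y1\<^sub>i\<close>,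
  respectively; these are the natural boundary conditions of the following form.\<close>

definition bform :: "nat set \<Rightarrow> (nat \<Rightarrow> nat \<Rightarrow> complex) \<Rightarrow> (pt \<Rightarrow> complex) \<Rightarrow> (pt \<Rightarrow> complex) \<Rightarrow> complex" where
  "bform K S \<xi> \<eta> = (\<Sum>i<2*d. \<Sum>j<2*d. S i j * \<xi> (PX j) * cnj (\<eta> (PX i))) -
     (\<Sum>i\<in>Kidx K. \<xi> (PX i) * cnj (Y1 \<eta> i) + Y1 \<xi> i * cnj (\<eta> (PX i)))"

definition eform :: "real \<Rightarrow> (pt \<Rightarrow> complex) \<Rightarrow> (pt \<Rightarrow> complex) \<Rightarrow> complex" where
  "eform \<mu> \<xi> \<eta> = (LINT t:{a..b}|lborel. en \<mu> (yf \<xi>) (df \<xi>) (yf \<eta>) (df \<eta>) t)"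

definition Aform :: "nat set \<Rightarrow> (nat \<Rightarrow> nat \<Rightarrow> complex) \<Rightarrow> (pt \<Rightarrow> complex) \<Rightarrow> (pt \<Rightarrow> complex) \<Rightarrow> complex" where
  "Aform K S \<xi> \<eta> = eform 0 \<xi> \<eta> + bform K S \<xi> \<eta>"

definition Wform :: "(pt \<Rightarrow> complex) \<Rightarrow> (pt \<Rightarrow> complex) \<Rightarrow> complex" where
  "Wform \<xi> \<eta> = (LINT t:{a..b}|lborel. (\<Sum>i<d. \<Sum>j<d. complex_of_real (W t i j) * \<xi> (PY t j) * cnj (\<eta> (PY t i))))"

lemma Y1_add: "Y1 (\<lambda>p. x p + y p) i = Y1 x i + Y1 y i" and Y1_scale: "Y1 (\<lambda>p. c * x p) i = c * Y1 x i"
  by (auto simp: Y1_def)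

lemma adm_add: "adm \<alpha> \<beta> y y' \<Longrightarrow> adm \<alpha> \<beta> z z' \<Longrightarrow> adm \<alpha> \<beta> (\<lambda>t i. y t i + z t i) (\<lambda>t i. y' t i + z' t i)"
  unfolding adm_def by (simp add: primitive_on_add bdd_meas_add)

lemma adm_scale: "adm \<alpha> \<beta> y y' \<Longrightarrow> adm \<alpha> \<beta> (\<lambda>t i. c * y t i) (\<lambda>t i. c * y' t i)"
  unfolding adm_def by (simp add: primitive_on_scale bdd_meas_mult bdd_meas_const)

lemma XK_adm: "\<xi> \<in> XK K \<Longrightarrow> adm a b (yf \<xi>) (df \<xi>)"
  unfolding XK_def by blast

sublocale X: vsubspace "XK K" for K
proof unfold_locales
  show "(\<lambda>p. 0) \<in> XK K"
    by (auto simp: XK_def Y1_def adm_def primitive_on_const bdd_meas_const)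
  show "x \<in> XK K \<Longrightarrow> y \<in> XK K \<Longrightarrow> (\<lambda>p. x p + y p) \<in> XK K" for x y
    using adm_add[of a b "yf x" "df x" "yf y" "df y"] by (auto simp: XK_def Y1_add)
  show "x \<in> XK K \<Longrightarrow> (\<lambda>p. c * x p) \<in> XK K" for x c
    using adm_scale[of a b "yf x" "df x" c] by (auto simp: XK_def Y1_scale)
qed

lemma V_sym: "V \<mu> t j i = V \<mu> t i j" and V_cnj: "cnj (V \<mu> t i j) = V \<mu> t i j"
  unfolding V_def by (simp_all add: sym)

lemma en_sym: "en \<mu> z z' y y' t = cnj (en \<mu> y y' z z' t)"
proof -
  have 1: "(\<Sum>i<d. \<Sum>j<d. G i j * f j * cnj (g i)) = cnj (\<Sum>i<d. \<Sum>j<d. G i j * g j * cnj (f i))"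
    if "\<And>i j. G j i = G i j" "\<And>i j. cnj (G i j) = G i j" for G :: "nat \<Rightarrow> nat \<Rightarrow> complex" and f g
  proof -
    have "cnj (\<Sum>i<d. \<Sum>j<d. G i j * g j * cnj (f i)) = (\<Sum>i<d. \<Sum>j<d. G j i * f i * cnj (g j))"
      using that(2) that(1) by (simp add: mult_ac)
    also have "\<dots> = (\<Sum>i<d. \<Sum>j<d. G i j * f j * cnj (g i))" by (rule sum.swap)
    finally show ?thesis ..
  qed
  show ?thesis unfolding en_def complex_cnj_add
    by (intro arg_cong2[where f="(+)"] 1) (auto simp: V_sym V_cnj sym)
qed

lemma en_add: "en \<mu> (\<lambda>t i. x t i + y t i) (\<lambda>t i. x' t i + y' t i) z z' t = en \<mu> x x' z z' t + en \<mu> y y' z z' t"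
  and en_scale: "en \<mu> (\<lambda>t i. c * x t i) (\<lambda>t i. c * x' t i) z z' t = c * en \<mu> x x' z z' t"
  unfolding en_def by (simp_all add: distrib_left distrib_right sum.distrib sum_distrib_left mult_ac)

lemma eform_herm: "herm_form (XK K) (eform \<mu>)"
proof unfold_locales
  fix x y z c assume x: "x \<in> XK K" and z: "z \<in> XK K"
  note i = bdd_meas_integrable[OF bdd_meas_en[OF XK_adm[of _ K] XK_adm[of _ K]]]
  show "eform \<mu> (\<lambda>p. c * x p) z = c * eform \<mu> x z" unfolding eform_def en_scale by simp
  show "eform \<mu> z x = cnj (eform \<mu> x z)" unfolding eform_def set_integral_cnj[symmetric]
    by (intro set_lebesgue_integral_cong) (auto simp: en_sym[of _ "yf z" "df z"])
  assume y: "y \<in> XK K"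
  show "eform \<mu> (\<lambda>p. x p + y p) z = eform \<mu> x z + eform \<mu> y z"
    unfolding eform_def en_add by (intro set_integral_add i x y z)
qed

lemma bform_herm:
  assumes S: "\<And>i j. i < 2*d \<Longrightarrow> j < 2*d \<Longrightarrow> S j i = cnj (S i j)"
  shows "herm_form (XK K) (bform K S)"
proof unfold_locales
  fix x y z :: "pt \<Rightarrow> complex" and c :: complex
  show "bform K S (\<lambda>p. x p + y p) z = bform K S x z + bform K S y z"
    unfolding bform_def Y1_add by (simp add: distrib_left distrib_right sum.distrib)
  show "bform K S (\<lambda>p. c * x p) z = c * bform K S x z"
    unfolding bform_def Y1_scale by (simp add: right_diff_distrib sum_distrib_left distrib_left mult_ac)
  have "(\<Sum>i<2*d. \<Sum>j<2*d. S i j * z (PX j) * cnj (x (PX i))) = cnj (\<Sum>i<2*d. \<Sum>j<2*d. S i j * x (PX j) * cnj (z (PX i)))"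
  proof -
    have "cnj (\<Sum>i<2*d. \<Sum>j<2*d. S i j * x (PX j) * cnj (z (PX i))) = (\<Sum>i<2*d. \<Sum>j<2*d. S j i * z (PX i) * cnj (x (PX j)))"
      unfolding cnj_sum
    proof (intro sum.cong refl)
      fix i j assume "i \<in> {..<2*d}" "j \<in> {..<2*d}"
      then have "S j i = cnj (S i j)" by (intro S) auto
      then show "cnj (S i j * x (PX j) * cnj (z (PX i))) = S j i * z (PX i) * cnj (x (PX j))" by simp
    qed
    also have "\<dots> = (\<Sum>i<2*d. \<Sum>j<2*d. S i j * z (PX j) * cnj (x (PX i)))" by (rule sum.swap)
    finally show ?thesis ..
  qed
  then show "bform K S z x = cnj (bform K S x z)"
    unfolding bform_def by (simp add: add.commute mult.commute)
qed

lemma Wform_herm: "herm_form (XK K) Wform"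
proof unfold_locales
  fix x y z c assume x: "x \<in> XK K" and z: "z \<in> XK K"
  have i: "set_integrable lborel {a..b} (\<lambda>t. \<Sum>i<d. \<Sum>j<d. complex_of_real (W t i j) * x (PY t j) * cnj (y (PY t i)))"
    if "x \<in> XK K" "y \<in> XK K" for x y
    by (intro bdd_meas_integrable bdd_meas_sum bdd_meas_mult bdd_meas_cnj bdd_meas_coeff)
      (use admD(3)[OF XK_adm[OF that(1)]] admD(3)[OF XK_adm[OF that(2)]] in auto)
  show "Wform (\<lambda>p. c * x p) z = c * Wform x z"
    unfolding Wform_def set_integral_mult_right[symmetric]
    by (intro set_lebesgue_integral_cong) (auto simp: sum_distrib_left mult_ac)
  have "(\<Sum>i<d. \<Sum>j<d. complex_of_real (W t i j) * z (PY t j) * cnj (x (PY t i))) =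
     cnj (\<Sum>i<d. \<Sum>j<d. complex_of_real (W t i j) * x (PY t j) * cnj (z (PY t i)))" for t
  proof -
    have "cnj (\<Sum>i<d. \<Sum>j<d. complex_of_real (W t i j) * x (PY t j) * cnj (z (PY t i))) =
      (\<Sum>i<d. \<Sum>j<d. complex_of_real (W t j i) * z (PY t i) * cnj (x (PY t j)))" by (simp add: mult_ac sym)
    also have "\<dots> = (\<Sum>i<d. \<Sum>j<d. complex_of_real (W t i j) * z (PY t j) * cnj (x (PY t i)))" by (rule sum.swap)
    finally show ?thesis ..
  qed
  then show "Wform z x = cnj (Wform x z)" unfolding Wform_def set_integral_cnj[symmetric] by simp
  assume y: "y \<in> XK K"
  have "Wform (\<lambda>p. x p + y p) z = (LINT t:{a..b}|lborel. (\<Sum>i<d. \<Sum>j<d. complex_of_real (W t i j) * x (PY t j) * cnj (z (PY t i)))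
    + (\<Sum>i<d. \<Sum>j<d. complex_of_real (W t i j) * y (PY t j) * cnj (z (PY t i))))"
    unfolding Wform_def by (simp add: distrib_left distrib_right sum.distrib)
  also have "\<dots> = Wform x z + Wform y z" unfolding Wform_def by (intro set_integral_add i x y z)
  finally show "Wform (\<lambda>p. x p + y p) z = Wform x z + Wform y z" .
qed

lemma eform_shift:
  assumes "\<xi> \<in> XK K" "\<eta> \<in> XK K"
  shows "eform 0 \<xi> \<eta> - complex_of_real \<mu> * Wform \<xi> \<eta> = eform \<mu> \<xi> \<eta>"
proof -
  let ?w = "\<lambda>t. \<Sum>i<d. \<Sum>j<d. complex_of_real (W t i j) * \<xi> (PY t j) * cnj (\<eta> (PY t i))"
  have i: "set_integrable lborel {a..b} ?w"
    by (intro bdd_meas_integrable bdd_meas_sum bdd_meas_mult bdd_meas_cnj bdd_meas_coeff)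
      (use admD(3)[OF XK_adm[OF assms(1)]] admD(3)[OF XK_adm[OF assms(2)]] in auto)
  have "eform \<mu> \<xi> \<eta> = (LINT t:{a..b}|lborel. en 0 (yf \<xi>) (df \<xi>) (yf \<eta>) (df \<eta>) t - complex_of_real \<mu> * ?w t)"
    unfolding eform_def
    by (intro set_lebesgue_integral_cong)
      (auto simp: en_def V_def algebra_simps sum_subtractf sum_distrib_left)
  also have "\<dots> = eform 0 \<xi> \<eta> - (LINT t:{a..b}|lborel. complex_of_real \<mu> * ?w t)"
    unfolding eform_def
    using i bdd_meas_integrable[OF bdd_meas_en[OF XK_adm XK_adm, OF assms]] by (intro set_integral_diff) auto
  finally show ?thesis unfolding Wform_def by simp
qed

lemma Wform_ge:
  assumes "\<xi> \<in> XK K"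
  shows "\<kappa> * nsq a b (yf \<xi>) \<le> Re (Wform \<xi> \<xi>)"
proof -
  let ?w = "\<lambda>t. \<Sum>i<d. \<Sum>j<d. complex_of_real (W t i j) * \<xi> (PY t j) * cnj (\<xi> (PY t i))"
  note y = admD(3)[OF XK_adm[OF assms]]
  have i: "set_integrable lborel {a..b} ?w"
    by (intro bdd_meas_integrable bdd_meas_sum bdd_meas_mult bdd_meas_cnj bdd_meas_coeff) (use y in auto)
  have n: "nsq a b (yf \<xi>) = (LINT t:{a..b}|lborel. (\<Sum>i<d. (cmod (\<xi> (PY t i)))\<^sup>2))"
    "set_integrable lborel {a..b} (\<lambda>t. \<Sum>i<d. (cmod (\<xi> (PY t i)))\<^sup>2)"
    using nsq_eq[of a b "yf \<xi>"] y by auto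
  have "\<kappa> * nsq a b (yf \<xi>) = (LINT t:{a..b}|lborel. \<kappa> * (\<Sum>i<d. (cmod (\<xi> (PY t i)))\<^sup>2))" unfolding n(1) by simp
  also have "\<dots> \<le> (LINT t:{a..b}|lborel. Re (?w t))"
  proof (rule set_integral_mono)
    show "set_integrable lborel {a..b} (\<lambda>t. Re (?w t))" by (rule Re_set_integral(1)[OF i])
    show "\<kappa> * (\<Sum>i<d. (cmod (\<xi> (PY t i)))\<^sup>2) \<le> Re (?w t)" for t
      using loewner_ge_complex[OF W_ge, of "\<lambda>i. \<xi> (PY t i)" t] .
  qed (use n(2) in auto)
  also have "\<dots> = Re (Wform \<xi> \<xi>)" unfolding Wform_def using Re_set_integral(2)[OF i] by simp
  finally show ?thesis .
qed

lemma Wform_zero: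
  assumes "\<xi> \<in> XK K" "Re (Wform \<xi> \<xi>) = 0" "t \<in> {a..b}" "i < d"
  shows "\<xi> (PY t i) = 0"
proof -
  have "\<kappa> * nsq a b (yf \<xi>) \<le> 0" using Wform_ge[OF assms(1)] assms(2) by simp
  then have "nsq a b (yf \<xi>) = 0" using \<kappa> nsq_nonneg[of a b "yf \<xi>"] by (simp add: mult_le_0_iff)
  from nsq_zeroD[OF this assms(4)] have "sqint a b (\<lambda>t. \<xi> (PY t i)) = 0" .
  from sqint_zero_continuous[OF admD(1,2)[OF XK_adm[OF assms(1)] assms(4)] ab assms(3) this] show ?thesis .
qed

lemma Wform_zeroI:
  assumes "\<And>t i. t \<in> {a..b} \<Longrightarrow> i < d \<Longrightarrow> \<xi> (PY t i) = 0"
  shows "Wform \<xi> \<eta> = 0"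
proof -
  have "Wform \<xi> \<eta> = (LINT t:{a..b}|lborel. 0)"
    unfolding Wform_def using assms by (intro set_lebesgue_integral_cong) auto
  then show ?thesis by simp
qed

end

locale sl_problem = sl_coeffs +
  fixes K :: "nat set" and S :: "nat \<Rightarrow> nat \<Rightarrow> complex"
  assumes S: "\<And>i j. i < 2*d \<Longrightarrow> j < 2*d \<Longrightarrow> S j i = cnj (S i j)"
begin

lemma Aform_herm: "herm_form (XK K) (Aform K S)"
proof -
  interpret E: herm_form "XK K" "eform 0" by (rule eform_herm)
  interpret F: herm_form "XK K" "bform K S" by (rule bform_herm[OF S])
  show ?thesis
  proof unfold_locales
    fix x y z c
    show "x \<in> XK K \<Longrightarrow> y \<in> XK K \<Longrightarrow> z \<in> XK K \<Longrightarrow> Aform K S (\<lambda>p. x p + y p) z = Aform K S x z + Aform K S y z"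
      by (simp add: Aform_def E.H_add F.H_add)
    show "x \<in> XK K \<Longrightarrow> z \<in> XK K \<Longrightarrow> Aform K S (\<lambda>p. c * x p) z = c * Aform K S x z"
      by (simp add: Aform_def E.H_scale F.H_scale distrib_left)
    show "x \<in> XK K \<Longrightarrow> z \<in> XK K \<Longrightarrow> Aform K S z x = cnj (Aform K S x z)"
      unfolding Aform_def by (subst E.H_sym, assumption+, subst F.H_sym, assumption+) simp
  qed
qed

sublocale P: pencil "XK K" "Aform K S" Wform
proof -
  interpret A: herm_form "XK K" "Aform K S" by (rule Aform_herm)
  interpret B: herm_form "XK K" Wform by (rule Wform_herm)
  show "pencil (XK K) (Aform K S) Wform"
  proof unfold_locales
    fix x assume "x \<in> XK K"
    from Wform_ge[OF this] show "0 \<le> Re (Wform x x)"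
      using \<kappa> nsq_nonneg[of a b "yf x"] by (meson less_imp_le mult_nonneg_nonneg order_trans)
  qed
qed

lemma Hm_eq: "\<xi> \<in> XK K \<Longrightarrow> \<eta> \<in> XK K \<Longrightarrow> P.Hm \<mu> \<xi> \<eta> = eform \<mu> \<xi> \<eta> + bform K S \<xi> \<eta>"
  unfolding P.Hm_def Aform_def using eform_shift[of \<xi> K \<eta> \<mu>] by (simp add: algebra_simps)

end

section \<open>Radical elements and natural boundary conditions\<close>

lemma primitive_on_linear: "primitive_on a b (\<lambda>t. c + complex_of_real (t - a) * k) (\<lambda>_. k)"
  by (rule primitive_onI)
    (auto simp: set_integral_const scaleR_conv_of_real intro!: bdd_meas_integrable bdd_meas_const)

lemma sqint_zeroI:
  assumes "AE t in lborel. t \<in> {a..b} \<longrightarrow> f t = 0"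
  shows "sqint a b f = 0"
  unfolding sqint_def set_lebesgue_integral_def
  by (rule integral_eq_zero_AE) (use assms in \<open>eventually_elim, auto simp: indicator_def\<close>)

context sl_coeffs
begin

definition Y2 :: "(real \<Rightarrow> nat \<Rightarrow> complex) \<Rightarrow> nat \<Rightarrow> complex" where
  "Y2 u i = (if i < d then u a i else u b (i - d))"

lemma sum_Y2_Y1:
  "(\<Sum>i<2*d. Y2 u i * cnj (Y1 \<eta> i)) = (\<Sum>i<d. u b i * cnj (\<eta> (PY b i))) - (\<Sum>i<d. u a i * cnj (\<eta> (PY a i)))"
  by (simp add: sum_lessThan_double Y1_def Y2_def sum_negf)

lemma eform_green:
  assumes "\<And>i. i < d \<Longrightarrow> primitive_on a b (\<lambda>t. u t i) (\<lambda>t. \<Sum>j<d. V \<mu> t i j * \<xi> (PY t j))"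
    and "AE t in lborel. t \<in> {a..b} \<longrightarrow> (\<forall>i<d. u t i = (\<Sum>j<d. complex_of_real (P t i j) * \<xi> (PD t j)))"
    and "\<xi> \<in> XK K" "\<eta> \<in> XK K"
  shows "eform \<mu> \<xi> \<eta> = (\<Sum>i<2*d. Y2 u i * cnj (Y1 \<eta> i))"
  unfolding eform_def sum_Y2_Y1
  by (rule green[where y = "yf \<xi>" and z = "yf \<eta>"]) (use assms ab XK_adm in auto)

text \<open>An affine function attains any two end values, and \<open>x\<close> is free on
  \<open>K\<close>; so the boundary terms can be tested one index at a time.\<close>

lemma test_exists:
  "\<exists>\<eta>\<in>XK K. (\<forall>i<2*d. Y1 \<eta> i = g i) \<and> (\<forall>i<2*d. \<eta> (PX i) = (if Suc i \<in> K then w i else g i))"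
proof -
  define k where "k = (\<lambda>i. (g (d + i) + g i) / complex_of_real (b - a))"
  define \<eta> where "\<eta> = (\<lambda>p. case p of PY t i \<Rightarrow> - g i + complex_of_real (t - a) * k i | PD t i \<Rightarrow> k i
     | PX i \<Rightarrow> if Suc i \<in> K then w i else g i)"
  have "primitive_on a b (\<lambda>t. - g i + complex_of_real (t - a) * k i) (\<lambda>t. k i)" for i
    by (rule primitive_on_linear)
  then have "adm a b (yf \<eta>) (df \<eta>)" unfolding adm_def \<eta>_def by (simp add: bdd_meas_const)
  moreover have Y: "Y1 \<eta> i = g i" if "i < 2*d" for i
  proof (cases "i < d")
    case True then show ?thesis by (simp add: Y1_def \<eta>_def)
  next
    case False
    have "complex_of_real (b - a) * k (i - d) = g i + g (i - d)" using ab False by (simp add: k_def flip: of_real_diff)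
    then show ?thesis using False by (simp add: Y1_def \<eta>_def)
  qed
  moreover have x: "\<eta> (PX i) = (if Suc i \<in> K then w i else g i)" for i by (simp add: \<eta>_def)
  ultimately have "\<eta> \<in> XK K" unfolding XK_def by simp
  then show ?thesis using Y x by (intro bexI[of _ \<eta>]) auto
qed

lemma bform_eq:
  "bform K S \<xi> \<eta> = (\<Sum>i<2*d. (\<Sum>j<2*d. S i j * \<xi> (PX j)) * cnj (\<eta> (PX i)) -
     (if Suc i \<in> K then \<xi> (PX i) * cnj (Y1 \<eta> i) + Y1 \<xi> i * cnj (\<eta> (PX i)) else 0))"
proof -
  have "(\<Sum>i\<in>Kidx K. F i) = (\<Sum>i<2*d. if Suc i \<in> K then F i else 0)" for F :: "nat \<Rightarrow> complex"
  proof -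
    have "Kidx K = {i \<in> {..<2*d}. Suc i \<in> K}" by (auto simp: Kidx_def)
    then show ?thesis by (simp only: sum.inter_filter[OF finite_lessThan])
  qed
  then show ?thesis unfolding bform_def by (simp add: sum_subtractf sum_distrib_right)
qed

end

context sl_problem
begin

definition eigpair :: "real \<Rightarrow> (pt \<Rightarrow> complex) \<Rightarrow> (real \<Rightarrow> nat \<Rightarrow> complex) \<Rightarrow> bool" where
  "eigpair \<mu> \<xi> u \<longleftrightarrow> (\<forall>i<d. primitive_on a b (\<lambda>t. u t i) (\<lambda>t. \<Sum>j<d. V \<mu> t i j * \<xi> (PY t j))) \<and>
    (AE t in lborel. t \<in> {a..b} \<longrightarrow> (\<forall>i<d. u t i = (\<Sum>j<d. complex_of_real (P t i j) * \<xi> (PD t j)))) \<and>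
    (\<forall>i<2*d. if Suc i \<in> K then \<xi> (PX i) = Y2 u i \<and> (\<Sum>j<2*d. S i j * \<xi> (PX j)) = Y1 \<xi> i
       else (\<Sum>j<2*d. S i j * \<xi> (PX j)) = - Y2 u i)"

lemma eigpair_radical:
  assumes \<xi>: "\<xi> \<in> XK K" and e: "eigpair \<mu> \<xi> u" and \<eta>: "\<eta> \<in> XK K"
  shows "P.Hm \<mu> \<xi> \<eta> = 0"
proof -
  have "eform \<mu> \<xi> \<eta> = (\<Sum>i<2*d. Y2 u i * cnj (Y1 \<eta> i))"
    using e by (intro eform_green[OF _ _ \<xi> \<eta>]) (auto simp: eigpair_def)
  then have "P.Hm \<mu> \<xi> \<eta> = (\<Sum>i<2*d. Y2 u i * cnj (Y1 \<eta> i) + ((\<Sum>j<2*d. S i j * \<xi> (PX j)) * cnj (\<eta> (PX i)) -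
     (if Suc i \<in> K then \<xi> (PX i) * cnj (Y1 \<eta> i) + Y1 \<xi> i * cnj (\<eta> (PX i)) else 0)))"
    unfolding Hm_eq[OF \<xi> \<eta>] bform_eq by (simp add: sum.distrib)
  also have "\<dots> = 0"
  proof (intro sum.neutral ballI)
    fix i assume "i \<in> {..<2*d}"
    then have i: "i < 2*d" by simp
    show "Y2 u i * cnj (Y1 \<eta> i) + ((\<Sum>j<2*d. S i j * \<xi> (PX j)) * cnj (\<eta> (PX i)) -
     (if Suc i \<in> K then \<xi> (PX i) * cnj (Y1 \<eta> i) + Y1 \<xi> i * cnj (\<eta> (PX i)) else 0)) = 0"
    proof (cases "Suc i \<in> K")
      case True
      then have "\<xi> (PX i) = Y2 u i" "(\<Sum>j<2*d. S i j * \<xi> (PX j)) = Y1 \<xi> i" using e i unfolding eigpair_def by auto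
      then show ?thesis using True by simp
    next
      case False
      then have "(\<Sum>j<2*d. S i j * \<xi> (PX j)) = - Y2 u i" "\<eta> (PX i) = Y1 \<eta> i" using e i \<eta> unfolding eigpair_def XK_def by auto
      then show ?thesis using False by simp
    qed
  qed
  finally show ?thesis .
qed

text \<open>Du Bois-Reymond: testing with functions vanishing at both end points shows that
  \<open>P y'\<close> differs from a primitive of \<open>(Q - \<mu> W) y\<close> by a constant.\<close>

lemma radical_eigpair:
  assumes \<xi>: "\<xi> \<in> XK K" and rad: "\<And>\<eta>. \<eta> \<in> XK K \<Longrightarrow> P.Hm \<mu> \<xi> \<eta> = 0"
  shows "\<exists>u. eigpair \<mu> \<xi> u"
proof -
  note y = XK_adm[OF \<xi>]
  define U where "U = (\<lambda>t i. 0 + (LINT s:{a..t}|lborel. (\<Sum>j<d. V \<mu> s i j * \<xi> (PY s j))))"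
  have U: "primitive_on a b (\<lambda>t. U t i) (\<lambda>t. \<Sum>j<d. V \<mu> t i j * \<xi> (PY t j))" for i
    unfolding U_def using admD(3)[OF y]
    by (intro primitive_on_integral bdd_meas_integrable bdd_meas_sum bdd_meas_mult bdd_meas_V) auto
  define g where "g = (\<lambda>t i. (\<Sum>j<d. complex_of_real (P t i j) * \<xi> (PD t j)) - U t i)"
  have g: "bdd_meas a b (\<lambda>t. g t i)" for i
    unfolding g_def using admD(2)[OF y]
    by (intro bdd_meas_diff bdd_meas_sum bdd_meas_mult bdd_meas_coeff bdd_meas_primitive[OF U]) auto
  \<comment> \<open>The mean of \<open>g\<close> is subtracted so that \<open>z\<close> vanishes at
    \<open>b\<close> as well as at \<open>a\<close>.\<close>
  define c where "c = (\<lambda>i. (LINT t:{a..b}|lborel. g t i) / complex_of_real (b - a))"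
  define z' where "z' = (\<lambda>t i. g t i - c i)"
  define z where "z = (\<lambda>t i. 0 + (LINT s:{a..t}|lborel. z' s i))"
  have z'b: "bdd_meas a b (\<lambda>t. z' t i)" for i unfolding z'_def by (intro bdd_meas_diff g bdd_meas_const)
  have zp: "primitive_on a b (\<lambda>t. z t i) (\<lambda>t. z' t i)" for i
    unfolding z_def by (intro primitive_on_integral bdd_meas_integrable z'b)
  have za: "z a i = 0" for i unfolding z_def using set_integral_Icc_same[of a "\<lambda>s. z' s i"] by simp
  have zb: "z b i = 0" for i
  proof -
    have "z b i = (LINT t:{a..b}|lborel. g t i) - (LINT t:{a..b}|lborel. c i)"
      unfolding z_def z'_def by (simp add: set_integral_diff(2)[OF bdd_meas_integrable[OF g] bdd_meas_integrable[OF bdd_meas_const]])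
    also have "(LINT t:{a..b}|lborel. c i) = complex_of_real (b - a) * c i"
      using ab by (simp add: set_integral_const scaleR_conv_of_real)
    finally show ?thesis using ab by (simp add: c_def flip: of_real_diff)
  qed
  define \<eta> where "\<eta> = (\<lambda>p. case p of PY t i \<Rightarrow> z t i | PD t i \<Rightarrow> z' t i | PX i \<Rightarrow> 0)"
  have Y1\<eta>: "Y1 \<eta> i = 0" for i unfolding Y1_def \<eta>_def by (simp add: za zb)
  have \<eta>: "\<eta> \<in> XK K"
    unfolding XK_def adm_def using zp z'b by (simp add: Y1\<eta>) (simp add: \<eta>_def)
  have "bform K S \<xi> \<eta> = 0" unfolding bform_def by (simp add: Y1\<eta>) (simp add: \<eta>_def)
  then have "eform \<mu> \<xi> \<eta> = 0" using rad[OF \<eta>] Hm_eq[OF \<xi> \<eta>] by simp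
  then have e0: "(LINT t:{a..b}|lborel. en \<mu> (yf \<xi>) (df \<xi>) z z' t) = 0" unfolding eform_def \<eta>_def by simp
  have F1: "primitive_on a b (\<lambda>t. \<Sum>i<d. U t i * cnj (z t i)) (\<lambda>t. \<Sum>i<d. (\<Sum>j<d. V \<mu> t i j * \<xi> (PY t j)) * cnj (z t i) + U t i * cnj (z' t i))"
    by (intro primitive_on_sum primitive_on_mult primitive_on_cnj U zp) auto
  have F1': "(LINT t:{a..b}|lborel. (\<Sum>i<d. (\<Sum>j<d. V \<mu> t i j * \<xi> (PY t j)) * cnj (z t i) + U t i * cnj (z' t i))) = 0"
    using primitive_onD[OF F1 order_refl less_imp_le[OF ab] order_refl] za zb by simp
  have F2: "(LINT t:{a..b}|lborel. (\<Sum>i<d. c i * cnj (z' t i))) = 0"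
  proof -
    have F: "primitive_on a b (\<lambda>t. \<Sum>i<d. c i * cnj (z t i)) (\<lambda>t. \<Sum>i<d. c i * cnj (z' t i))"
      by (intro primitive_on_sum primitive_on_scale primitive_on_cnj zp) auto
    show ?thesis using primitive_onD[OF F order_refl less_imp_le[OF ab] order_refl] za zb by simp
  qed
  \<comment> \<open>For this test function the three integrals vanish separately, and combined they
    are the square integral of \<open>z'\<close>.\<close>
  have "complex_of_real (nsq a b z') = (LINT t:{a..b}|lborel. en \<mu> (yf \<xi>) (df \<xi>) z z' t -
     (\<Sum>i<d. (\<Sum>j<d. V \<mu> t i j * \<xi> (PY t j)) * cnj (z t i) + U t i * cnj (z' t i)) - (\<Sum>i<d. c i * cnj (z' t i)))"
    unfolding nsq_eq(1)[OF z'b] set_integral_complex_of_real[symmetric]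
  proof (intro set_lebesgue_integral_cong allI impI)
    fix t
    have "complex_of_real (\<Sum>i<d. (cmod (z' t i))\<^sup>2) = (\<Sum>i<d. ((\<Sum>j<d. complex_of_real (P t i j) * \<xi> (PD t j)) - U t i - c i) * cnj (z' t i))"
      unfolding of_real_sum complex_norm_square by (simp add: z'_def g_def)
    then show "complex_of_real (\<Sum>i<d. (cmod (z' t i))\<^sup>2) = en \<mu> (yf \<xi>) (df \<xi>) z z' t -
     (\<Sum>i<d. (\<Sum>j<d. V \<mu> t i j * \<xi> (PY t j)) * cnj (z t i) + U t i * cnj (z' t i)) - (\<Sum>i<d. c i * cnj (z' t i))"
      by (simp add: en_def left_diff_distrib sum_subtractf sum.distrib sum_distrib_right)
  qed simp
  also have "\<dots> = 0"
  proof -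
    have a1: "set_integrable lborel {a..b} (en \<mu> (yf \<xi>) (df \<xi>) z z')"
      using zp z'b by (intro bdd_meas_integrable bdd_meas_en y) (simp add: adm_def)
    have a2: "set_integrable lborel {a..b} (\<lambda>t. \<Sum>i<d. (\<Sum>j<d. V \<mu> t i j * \<xi> (PY t j)) * cnj (z t i) + U t i * cnj (z' t i))"
      using primitive_on_integrable[OF F1] by simp
    have a3: "set_integrable lborel {a..b} (\<lambda>t. \<Sum>i<d. c i * cnj (z' t i))"
      by (intro bdd_meas_integrable bdd_meas_sum bdd_meas_mult bdd_meas_const bdd_meas_cnj z'b) auto
    show ?thesis
      using set_integral_diff(2)[OF set_integral_diff(1)[OF a1 a2] a3] set_integral_diff(2)[OF a1 a2] e0 F1' F2 by simp
  qed
  finally have n0: "nsq a b z' = 0" by simp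
  define u where "u = (\<lambda>t i. U t i + c i)"
  have u: "primitive_on a b (\<lambda>t. u t i) (\<lambda>t. \<Sum>j<d. V \<mu> t i j * \<xi> (PY t j))" for i
    using primitive_on_add[OF U primitive_on_const, of i "c i"] by (simp add: u_def)
  have "AE t in lborel. \<forall>i\<in>{..<d}. t \<in> {a..b} \<longrightarrow> z' t i = 0"
    by (rule AE_finite_allI) (use sqint_zero_AE[OF z'b nsq_zeroD[OF n0]] in auto)
  then have uP: "AE t in lborel. t \<in> {a..b} \<longrightarrow> (\<forall>i<d. u t i = (\<Sum>j<d. complex_of_real (P t i j) * \<xi> (PD t j)))"
    by eventually_elim (auto simp: z'_def g_def u_def algebra_simps)
  have key: "(\<Sum>i<2*d. Y2 u i * cnj (Y1 \<eta> i) + ((\<Sum>j<2*d. S i j * \<xi> (PX j)) * cnj (\<eta> (PX i)) -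
     (if Suc i \<in> K then \<xi> (PX i) * cnj (Y1 \<eta> i) + Y1 \<xi> i * cnj (\<eta> (PX i)) else 0))) = 0" if \<eta>: "\<eta> \<in> XK K" for \<eta>
    using rad[OF \<eta>] eform_green[OF u uP \<xi> \<eta>] unfolding Hm_eq[OF \<xi> \<eta>] bform_eq by (simp add: sum.distrib)
  \<comment> \<open>The boundary data \<open>g\<close> and \<open>w\<close> are arbitrary here; unit
    vectors for either of them yield the natural boundary conditions.\<close>
  have key2: "(\<Sum>i<2*d. Y2 u i * cnj (g i) + ((\<Sum>j<2*d. S i j * \<xi> (PX j)) * cnj (if Suc i \<in> K then w i else g i) -
     (if Suc i \<in> K then \<xi> (PX i) * cnj (g i) + Y1 \<xi> i * cnj (w i) else 0))) = 0" for g w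
  proof -
    obtain \<eta> where \<eta>: "\<eta> \<in> XK K" "\<And>i. i<2*d \<Longrightarrow> Y1 \<eta> i = g i" "\<And>i. i<2*d \<Longrightarrow> \<eta> (PX i) = (if Suc i \<in> K then w i else g i)"
      using test_exists[of K g w] by blast
    have "0 = (\<Sum>i<2*d. Y2 u i * cnj (Y1 \<eta> i) + ((\<Sum>j<2*d. S i j * \<xi> (PX j)) * cnj (\<eta> (PX i)) -
     (if Suc i \<in> K then \<xi> (PX i) * cnj (Y1 \<eta> i) + Y1 \<xi> i * cnj (\<eta> (PX i)) else 0)))" using key[OF \<eta>(1)] by simp
    also have "\<dots> = (\<Sum>i<2*d. Y2 u i * cnj (g i) + ((\<Sum>j<2*d. S i j * \<xi> (PX j)) * cnj (if Suc i \<in> K then w i else g i) -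
     (if Suc i \<in> K then \<xi> (PX i) * cnj (g i) + Y1 \<xi> i * cnj (w i) else 0)))"
      by (intro sum.cong refl) (simp add: \<eta>(2,3))
    finally show ?thesis by simp
  qed
  have single: "(\<Sum>i<2*d. F i) = F k" if "k < 2*d" "\<And>i. i \<noteq> k \<Longrightarrow> F i = 0" for F :: "nat \<Rightarrow> complex" and k
    using that by (subst sum.remove[of _ k]) (auto intro!: sum.neutral)
  have "if Suc k \<in> K then \<xi> (PX k) = Y2 u k \<and> (\<Sum>j<2*d. S k j * \<xi> (PX j)) = Y1 \<xi> k
       else (\<Sum>j<2*d. S k j * \<xi> (PX j)) = - Y2 u k" if k: "k < 2*d" for k
  proof (cases "Suc k \<in> K")
    case True
    have "\<xi> (PX k) = Y2 u k"
      using key2[of "\<lambda>i. if i = k then 1 else 0" "\<lambda>i. 0"] True by (subst (asm) single[OF k]) auto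
    moreover have "(\<Sum>j<2*d. S k j * \<xi> (PX j)) = Y1 \<xi> k"
      using key2[of "\<lambda>i. 0" "\<lambda>i. if i = k then 1 else 0"] True by (subst (asm) single[OF k]) auto
    ultimately show ?thesis using True by simp
  next
    case False
    have "(\<Sum>j<2*d. S k j * \<xi> (PX j)) = - Y2 u k"
      using key2[of "\<lambda>i. if i = k then 1 else 0" "\<lambda>i. 0"] False
      by (subst (asm) single[OF k]) (auto simp: eq_neg_iff_add_eq_0 add.commute)
    then show ?thesis using False by simp
  qed
  then show ?thesis using u uP unfolding eigpair_def by blast
qed

text \<open>A vanishing \<open>y\<close> forces \<open>P y'\<close>, and with it the free boundary
  coordinates \<open>x\<^sub>i = Y2\<^sub>i\<close>, to vanish. This supplies \<open>nondeg\<close>: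
  a radical element is determined by its function.\<close>

lemma radical_zero:
  assumes \<xi>: "\<xi> \<in> XK K" and rad: "\<And>\<eta>. \<eta> \<in> XK K \<Longrightarrow> P.Hm \<mu> \<xi> \<eta> = 0"
    and y0: "\<And>t i. t \<in> {a..b} \<Longrightarrow> i < d \<Longrightarrow> \<xi> (PY t i) = 0" and k: "k < 2*d"
  shows "\<xi> (PX k) = 0"
proof (cases "Suc k \<in> K")
  case False
  then have "\<xi> (PX k) = Y1 \<xi> k" using \<xi> k unfolding XK_def by auto
  then show ?thesis using y0 k ab by (auto simp: Y1_def)
next
  case True
  obtain u where u: "eigpair \<mu> \<xi> u" using radical_eigpair[OF \<xi> rad] by blast
  have Y10: "Y1 \<xi> i = 0" if "i < 2*d" for i using y0 that ab by (auto simp: Y1_def)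
  have "eform \<mu> \<xi> \<xi> = (\<Sum>i<2*d. Y2 u i * cnj (Y1 \<xi> i))"
    using u by (intro eform_green[OF _ _ \<xi> \<xi>]) (auto simp: eigpair_def)
  then have "eform \<mu> \<xi> \<xi> = 0" using Y10 by simp
  moreover have "nsq a b (yf \<xi>) = 0"
    unfolding nsq_def by (intro sum.neutral ballI sqint_zeroI) (use y0 in auto)
  ultimately have "\<kappa> * nsq a b (df \<xi>) \<le> 0"
    using energy_ge[OF XK_adm[OF \<xi>] order_refl, of \<mu>] unfolding eform_def by simp
  then have n0: "nsq a b (df \<xi>) = 0" using \<kappa> nsq_nonneg[of a b "df \<xi>"] by (simp add: mult_le_0_iff)
  have "AE t in lborel. \<forall>i\<in>{..<d}. t \<in> {a..b} \<longrightarrow> \<xi> (PD t i) = 0"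
    by (rule AE_finite_allI) (use sqint_zero_AE[OF admD(2)[OF XK_adm[OF \<xi>]] nsq_zeroD[OF n0]] in auto)
  moreover have "AE t in lborel. t \<in> {a..b} \<longrightarrow> (\<forall>i<d. u t i = (\<Sum>j<d. complex_of_real (P t i j) * \<xi> (PD t j)))"
    using u unfolding eigpair_def by blast
  ultimately have ae: "AE t in lborel. t \<in> {a..b} \<longrightarrow> (\<forall>i<d. u t i = 0)" by eventually_elim auto
  have u0: "u t i = 0" if "i < d" "t \<in> {a..b}" for t i
  proof (rule sqint_zero_continuous[OF _ _ ab that(2)])
    show "primitive_on a b (\<lambda>t. u t i) (\<lambda>t. \<Sum>j<d. V \<mu> t i j * \<xi> (PY t j))"
      using u that unfolding eigpair_def by blast
    show "bdd_meas a b (\<lambda>t. \<Sum>j<d. V \<mu> t i j * \<xi> (PY t j))"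
      using admD(3)[OF XK_adm[OF \<xi>]] by (intro bdd_meas_sum bdd_meas_mult bdd_meas_V) auto
    show "sqint a b (\<lambda>t. u t i) = 0" by (rule sqint_zeroI) (use ae that in auto)
  qed
  have "\<xi> (PX k) = Y2 u k" using u True k unfolding eigpair_def by auto
  then show ?thesis using u0 k ab by (auto simp: Y2_def)
qed

end

section \<open>Nodal functionals of a partition\<close>

context sl_coeffs
begin

lemma fine_partition: "\<exists>m::nat. m > 0 \<and> 8 * \<Lambda> M * ((b - a) / real m)\<^sup>2 \<le> \<kappa>"
proof -
  define c where "c = 8 * \<Lambda> M * (b - a)\<^sup>2"
  have c: "c \<ge> 0" unfolding c_def using \<Lambda>_nonneg[of M] by simp
  \<comment> \<open>\<open>Suc\<close> makes \<open>m\<close> positive; then \<open>m\<close> is at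
    most its square, so a choice linear in \<open>c / \<kappa>\<close> is large enough.\<close>
  define m where "m = Suc (nat \<lceil>c / \<kappa>\<rceil>)"
  have "c / \<kappa> \<le> real m" unfolding m_def by linarith
  also have "real m \<le> (real m)\<^sup>2" using self_le_power[of "real m" 2] by (simp add: m_def)
  finally have "c / (real m)\<^sup>2 \<le> \<kappa>" using \<kappa> by (simp add: m_def field_simps)
  then show ?thesis unfolding c_def by (intro exI[of _ m]) (simp add: m_def power_divide)
qed

definition \<tau> :: "nat \<Rightarrow> nat \<Rightarrow> real" where "\<tau> m k = a + real k * ((b - a) / real m)"

text \<open>Levels up to \<open>m\<close> stand for the components at the nodes, level
  \<open>Suc m\<close> for the free boundary coordinates, which are not values of the
  function.\<close>

definition nodes :: "nat set \<Rightarrow> nat \<Rightarrow> (nat \<times> nat) set" where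
  "nodes K m = {..m} \<times> {..<d} \<union> {Suc m} \<times> Kidx K"

definition nodal :: "nat \<Rightarrow> nat \<times> nat \<Rightarrow> (pt \<Rightarrow> complex) \<Rightarrow> complex" where
  "nodal m p \<xi> = (if fst p \<le> m then \<xi> (PY (\<tau> m (fst p)) (snd p)) else \<xi> (PX (snd p)))"

lemma \<tau>_props:
  assumes "m > 0" "8 * \<Lambda> M * ((b - a) / real m)\<^sup>2 \<le> \<kappa>"
  shows "\<tau> m 0 = a" "\<tau> m m = b" "\<tau> m k < \<tau> m (Suc k)" "8 * \<Lambda> M * (\<tau> m (Suc k) - \<tau> m k)\<^sup>2 \<le> \<kappa>"
proof -
  have "a + real (Suc k) * h - (a + real k * h) = h" for h by (simp add: algebra_simps)
  then have "\<tau> m (Suc k) - \<tau> m k = (b - a) / real m" unfolding \<tau>_def .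
  moreover have "(b - a) / real m > 0" using ab assms(1) by simp
  ultimately show "\<tau> m k < \<tau> m (Suc k)" "8 * \<Lambda> M * (\<tau> m (Suc k) - \<tau> m k)\<^sup>2 \<le> \<kappa>"
    using assms(2) by simp_all
qed (use assms in \<open>auto simp: \<tau>_def\<close>)

lemma finite_nodes: "finite (nodes K m)" unfolding nodes_def Kidx_def by auto

lemma nodal_linfun: "linfun (XK K) (nodal m p)"
  unfolding linfun_def nodal_def by auto

lemma nodal_zero_boundary:
  assumes "m > 0" "z \<in> XK K" "\<And>p. p \<in> nodes K m \<Longrightarrow> nodal m p z = 0"
  shows "\<And>l i. l \<le> m \<Longrightarrow> i < d \<Longrightarrow> z (PY (\<tau> m l) i) = 0" "\<And>i. i < 2*d \<Longrightarrow> Y1 z i = 0" "\<And>i. i < 2*d \<Longrightarrow> z (PX i) = 0"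
proof -
  show 1: "z (PY (\<tau> m l) i) = 0" if "l \<le> m" "i < d" for l i
    using assms(3)[of "(l, i)"] that by (auto simp: nodes_def nodal_def)
  show 2: "Y1 z i = 0" if "i < 2*d" for i
    using 1[of 0 i] 1[of m "i - d"] that assms(1) by (auto simp: Y1_def \<tau>_def)
  show "z (PX i) = 0" if "i < 2*d" for i
  proof (cases "Suc i \<in> K")
    case True
    then show ?thesis using assms(3)[of "(Suc m, i)"] that by (auto simp: nodes_def nodal_def Kidx_def)
  next
    case False
    then show ?thesis using assms(2) 2[OF that] that unfolding XK_def by auto
  qed
qed

text \<open>Each boundary coordinate is, up to sign, one of the functionals: a component at the
  first or last node, or a free coordinate. Hence a change of \<open>S\<close> is small in the sense
  of \<open>ind_stable\<close>.\<close>

lemma sum_PX_le_nodal: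
  assumes "m > 0" "z \<in> XK K"
  shows "(\<Sum>i<2*d. (cmod (z (PX i)))\<^sup>2) \<le> (\<Sum>p\<in>nodes K m. (cmod (nodal m p z))\<^sup>2)"
proof -
  define f where "f = (\<lambda>i. if Suc i \<in> K then (Suc m, i) else if i < d then (0, i) else (m, i - d))"
  have eq: "cmod (z (PX i)) = cmod (nodal m (f i) z)" if "i < 2*d" for i
    using assms that by (auto simp: f_def nodal_def XK_def Y1_def \<tau>_def)
  have inj: "inj_on f {..<2*d}" using assms(1) by (auto simp: inj_on_def f_def split: if_splits)
  have sub: "f ` {..<2*d} \<subseteq> nodes K m" by (auto simp: f_def nodes_def Kidx_def)
  have "(\<Sum>i<2*d. (cmod (z (PX i)))\<^sup>2) = (\<Sum>i<2*d. (cmod (nodal m (f i) z))\<^sup>2)" using eq by simp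
  also have "\<dots> = (\<Sum>p\<in>f ` {..<2*d}. (cmod (nodal m p z))\<^sup>2)" using inj by (simp add: sum.reindex)
  also have "\<dots> \<le> (\<Sum>p\<in>nodes K m. (cmod (nodal m p z))\<^sup>2)" using sub finite_nodes by (intro sum_mono2) auto
  finally show ?thesis .
qed

end

context sl_problem
begin

text \<open>The vector for \<open>(l, i)\<close> is the broken extremal with unit data there; the
  one for \<open>(Suc m, i)\<close> has a unit free coordinate and zero nodal data. Vectors
  annihilated by all functionals have no boundary terms, so orthogonality and positivity reduce to
  \<open>extremal_exists\<close> and \<open>energy_nodal\<close>.\<close>

theorem bounded_pencil_exists:
  assumes m: "m > 0" "8 * \<Lambda> M * ((b - a) / real m)\<^sup>2 \<le> \<kappa>"
  shows "bounded_pencil (XK K) (Aform K S) Wform (nodes K m) (nodal m) M"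
proof unfold_locales
  note \<tau> = \<tau>_props[OF m]
  show "finite (nodes K m)" by (rule finite_nodes)
  show "linfun (XK K) (nodal m p)" for p by (rule nodal_linfun)
  have bform0: "bform K S \<xi> z = 0" if "\<And>i. i < 2*d \<Longrightarrow> Y1 z i = 0" "\<And>i. i < 2*d \<Longrightarrow> z (PX i) = 0" for \<xi> z
    unfolding bform_eq by (intro sum.neutral) (use that in auto)
  fix \<mu> :: real
  { assume \<mu>: "\<mu> < M"
    have "\<exists>E. E \<in> XK K \<and> (\<forall>p\<in>nodes K m. nodal m p E = (if p = q then 1 else 0)) \<and>
        (\<forall>z\<in>XK K. (\<forall>p\<in>nodes K m. nodal m p z = 0) \<longrightarrow> P.Hm \<mu> E z = 0)" (is "\<exists>E. ?P q E") for q
    proof -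
      obtain y y' where y: "adm a b y y'" "\<And>l i. l \<le> m \<Longrightarrow> i < d \<Longrightarrow> y (\<tau> m l) i = (if (l, i) = q then 1 else 0)"
        "\<And>z z'. adm a b z z' \<Longrightarrow> (\<And>l i. l\<le>m \<Longrightarrow> i<d \<Longrightarrow> z (\<tau> m l) i = 0) \<Longrightarrow> (LINT t:{a..b}|lborel. en \<mu> y y' z z' t) = 0"
        using extremal_exists[of "\<tau> m" m M \<mu> m "\<lambda>l i. if (l, i) = q then 1 else 0"] \<tau> \<mu> by auto
      define E where "E = (\<lambda>p. case p of PY t i \<Rightarrow> y t i | PD t i \<Rightarrow> y' t i
        | PX i \<Rightarrow> if Suc i \<in> K then (if (Suc m, i) = q then 1 else 0) else if i < d then - y a i else y b (i - d))"
      have EX: "E (PX i) = (if Suc i \<in> K then (if (Suc m, i) = q then 1 else 0) else Y1 E i)" for i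
        by (simp add: E_def Y1_def)
      have Ey: "yf E = y" "df E = y'" by (simp_all add: E_def)
      have EK: "E \<in> XK K" unfolding XK_def using y(1) EX by (simp add: Ey)
      have "nodal m p E = (if p = q then 1 else 0)" if "p \<in> nodes K m" for p
      proof (cases "fst p \<le> m")
        case True
        then have "snd p < d" using that by (auto simp: nodes_def)
        then show ?thesis using y(2)[OF True] True by (simp add: nodal_def E_def)
      next
        case False
        then have "fst p = Suc m" "Suc (snd p) \<in> K" using that by (auto simp: nodes_def Kidx_def)
        then show ?thesis using EX[of "snd p"] by (auto simp: nodal_def prod_eq_iff)
      qed
      moreover have "P.Hm \<mu> E z = 0" if z: "z \<in> XK K" and z0: "\<And>p. p \<in> nodes K m \<Longrightarrow> nodal m p z = 0" for z
      proof -
        note nz = nodal_zero_boundary[OF m(1) z z0]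
        have "eform \<mu> E z = 0" unfolding eform_def Ey using XK_adm[OF z] nz(1) by (intro y(3)) auto
        then show ?thesis unfolding Hm_eq[OF EK z] using bform0 nz by simp
      qed
      ultimately show ?thesis using EK by blast
    qed
    then have "\<exists>E. \<forall>q. ?P q (E q)" by (intro choice allI)
    then obtain E where E: "\<And>q. ?P q (E q)" by blast
    then show "\<exists>E. (\<forall>i\<in>nodes K m. E i \<in> XK K) \<and> (\<forall>i\<in>nodes K m. \<forall>j\<in>nodes K m. nodal m i (E j) = (if i = j then 1 else 0)) \<and>
        (\<forall>i\<in>nodes K m. \<forall>z\<in>XK K. (\<forall>j\<in>nodes K m. nodal m j z = 0) \<longrightarrow> P.Hm \<mu> (E i) z = 0)"
      by (intro exI[of _ E] conjI ballI impI; use E in blast) }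
  { fix z assume \<mu>: "\<mu> < M" and z: "z \<in> XK K" and z0: "\<And>p. p \<in> nodes K m \<Longrightarrow> nodal m p z = 0"
    note nz = nodal_zero_boundary[OF m(1) z z0]
    have H: "P.Hm \<mu> z z = eform \<mu> z z" unfolding Hm_eq[OF z z] using bform0 nz by simp
    have ge: "\<kappa> / 2 * nsq a b (df z) \<le> Re (P.Hm \<mu> z z)"
      unfolding H eform_def using energy_nodal[of "\<tau> m" m M \<mu> "yf z" "df z" m] \<tau> \<mu> XK_adm[OF z] nz(1) by simp
    show "0 \<le> Re (P.Hm \<mu> z z)" using ge \<kappa> nsq_nonneg[of a b "df z"]
      by (meson half_gt_zero less_imp_le mult_nonneg_nonneg order_trans)
    assume "Re (P.Hm \<mu> z z) = 0"
    then have "nsq a b (df z) = 0" using ge \<kappa> nsq_nonneg[of a b "df z"] by (simp add: mult_le_0_iff)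
    from nsq_zeroD[OF this] have "z (PY t i) = 0" if "t \<in> {a..b}" "i < d" for t i
      using poincare_zero[OF admD(1,2)[OF XK_adm[OF z] that(2)] that(1)] nz(1)[of 0 i] that \<tau>(1) by simp
    then show "Re (Wform z z) = 0" using Wform_zeroI by simp }
  { fix z i assume z: "z \<in> XK K" and W0: "Re (Wform z z) = 0" and rad: "\<And>y. y \<in> XK K \<Longrightarrow> P.Hm \<mu> z y = 0" and i: "i \<in> nodes K m"
    have y0: "z (PY t j) = 0" if "t \<in> {a..b}" "j < d" for t j by (rule Wform_zero[OF z W0 that])
    show "nodal m i z = 0"
    proof (cases "fst i \<le> m")
      case True
      have "\<tau> m (fst i) \<in> {a..b}"
        using nodes_mono[of m "\<tau> m" 0 "fst i"] nodes_mono[of m "\<tau> m" "fst i" m] \<tau> True by simp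
      then show ?thesis using y0 True i by (auto simp: nodal_def nodes_def)
    next
      case False
      then show ?thesis using radical_zero[OF z rad y0] i by (auto simp: nodal_def nodes_def Kidx_def)
    qed }
qed

end

section \<open>Index and eigenvalues\<close>

context sl_problem
begin

lemma bounded_pencil_at: "\<exists>m. m > 0 \<and> bounded_pencil (XK K) (Aform K S) Wform (nodes K m) (nodal m) M"
  using fine_partition[of M] bounded_pencil_exists by blast

text \<open>Index and nullity do not refer to a partition; for each \<mu> one that is fine enough
  for the bound \<open>\<mu> + 1\<close> shows that the maxima exist.\<close>

lemma raddim_nul: "P.raddim \<mu> (P.nul \<mu>)" and raddim_le: "P.raddim \<mu> k \<Longrightarrow> k \<le> P.nul \<mu>"
  and negdim_ind: "negdim (XK K) (P.Hm \<mu>) (P.ind \<mu>)" and negdim_le_ind: "negdim (XK K) (P.Hm \<mu>) k \<Longrightarrow> k \<le> P.ind \<mu>"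
proof -
  obtain m where "bounded_pencil (XK K) (Aform K S) Wform (nodes K m) (nodal m) (\<mu> + 1)"
    using bounded_pencil_at by blast
  then interpret bounded_pencil "XK K" "Aform K S" Wform "nodes K m" "nodal m" "\<mu> + 1" .
  show "P.raddim \<mu> (P.nul \<mu>)" "P.raddim \<mu> k \<Longrightarrow> k \<le> P.nul \<mu>"
    "negdim (XK K) (P.Hm \<mu>) (P.ind \<mu>)" "negdim (XK K) (P.Hm \<mu>) k \<Longrightarrow> k \<le> P.ind \<mu>"
    using raddim_nul raddim_le_nul negdim_ind negdim_le_ind by simp_all
qed

lemma ind_stable_S:
  assumes nul: "P.nul \<mu> = 0"
  shows "\<exists>\<delta>>0. \<forall>S'. (\<forall>i<2*d. \<forall>j<2*d. S' j i = cnj (S' i j)) \<and> (\<forall>i<2*d. \<forall>j<2*d. cmod (S' i j - S i j) \<le> \<delta>) \<longrightarrow>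
     negindex (XK K) (\<lambda>x y. Aform K S' x y - complex_of_real \<mu> * Wform x y) = P.ind \<mu>"
proof -
  obtain m where m: "m > 0" "bounded_pencil (XK K) (Aform K S) Wform (nodes K m) (nodal m) (\<mu> + 1)"
    using bounded_pencil_at by blast
  then interpret bounded_pencil "XK K" "Aform K S" Wform "nodes K m" "nodal m" "\<mu> + 1" by simp
  obtain \<delta>0 where \<delta>0: "\<delta>0 > 0" "\<And>A'. herm_form (XK K) A' \<Longrightarrow>
     (\<And>x. x \<in> XK K \<Longrightarrow> \<bar>Re (A' x x) - Re (Aform K S x x)\<bar> \<le> \<delta>0 * (\<Sum>i\<in>nodes K m. (cmod (nodal m i x))\<^sup>2)) \<Longrightarrow>
     negindex (XK K) (\<lambda>x y. A' x y - complex_of_real \<mu> * Wform x y) = P.ind \<mu>"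
    using ind_stable[OF _ nul] by auto
  \<comment> \<open>\<open>quadratic_form_bound\<close> costs the factor \<open>2 * d\<close>; the
    \<open>+ 1\<close> keeps the divisor positive.\<close>
  define \<delta> where "\<delta> = \<delta>0 / (2 * real d + 1)"
  have \<delta>: "\<delta> > 0" "\<delta> * real (2*d) \<le> \<delta>0" unfolding \<delta>_def using \<delta>0(1) by (auto simp: field_simps)
  show ?thesis
  proof (intro exI[of _ \<delta>] conjI allI impI \<delta>(1))
    fix S' assume S': "(\<forall>i<2*d. \<forall>j<2*d. S' j i = cnj (S' i j)) \<and> (\<forall>i<2*d. \<forall>j<2*d. cmod (S' i j - S i j) \<le> \<delta>)"
    interpret S': sl_problem d a b P Q W R C \<kappa> K S' by unfold_locales (use S' in blast)
    show "negindex (XK K) (\<lambda>x y. Aform K S' x y - complex_of_real \<mu> * Wform x y) = P.ind \<mu>"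
    proof (rule \<delta>0(2)[OF S'.Aform_herm])
      fix x assume x: "x \<in> XK K"
      have "Aform K S' x x - Aform K S x x = (\<Sum>i<2*d. \<Sum>j<2*d. (S' i j - S i j) * x (PX j) * cnj (x (PX i)))"
        unfolding Aform_def bform_def by (simp add: sum_subtractf left_diff_distrib)
      moreover have "cmod \<dots> \<le> \<delta> * real (2*d) * (\<Sum>i<2*d. (cmod (x (PX i)))\<^sup>2)"
        by (rule quadratic_form_bound) (use S' in blast)
      moreover have "\<dots> \<le> \<delta>0 * (\<Sum>i\<in>nodes K m. (cmod (nodal m i x))\<^sup>2)"
        using \<delta> sum_PX_le_nodal[OF m(1) x] \<delta>0(1) by (intro mult_mono) (auto intro: sum_nonneg)
      ultimately have "\<bar>Re (Aform K S' x x - Aform K S x x)\<bar> \<le> \<delta>0 * (\<Sum>i\<in>nodes K m. (cmod (nodal m i x))\<^sup>2)"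
        using abs_Re_le_cmod[of "Aform K S' x x - Aform K S x x"] by simp
      then show "\<bar>Re (Aform K S' x x) - Re (Aform K S x x)\<bar> \<le> \<delta>0 * (\<Sum>i\<in>nodes K m. (cmod (nodal m i x))\<^sup>2)" by simp
    qed
  qed
qed

lemma Re_bform_diag:
  "Re (bform K S \<xi> \<xi>) = Re (\<Sum>i<2*d. \<Sum>j<2*d. S i j * \<xi> (PX j) * cnj (\<xi> (PX i))) -
     2 * Re (\<Sum>i\<in>Kidx K. \<xi> (PX i) * cnj (Y1 \<xi> i))"
proof -
  have "Re (\<Sum>i\<in>Kidx K. Y1 \<xi> i * cnj (\<xi> (PX i))) = Re (\<Sum>i\<in>Kidx K. \<xi> (PX i) * cnj (Y1 \<xi> i))"
    by (simp add: mult.commute)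
  then show ?thesis unfolding bform_def by (simp add: sum.distrib)
qed

end

section \<open>Growth of the index\<close>

definition bump :: "real \<Rightarrow> real \<Rightarrow> real \<Rightarrow> complex" where
  "bump s e t = (if t \<le> s then 0 else if t \<le> e then complex_of_real ((t - s) * (e - t)) else 0)"

definition bump' :: "real \<Rightarrow> real \<Rightarrow> real \<Rightarrow> complex" where
  "bump' s e t = (if t \<le> s then 0 else if t \<le> e then complex_of_real (s + e - 2 * t) else 0)"

lemma bump_primitive:
  assumes "a \<le> s" "s < e" "e \<le> b"
  shows "primitive_on a b (bump s e) (bump' s e)" "bdd_meas a b (bump' s e)"
proof -
  let ?p = "\<lambda>t. complex_of_real ((t - s) * (e - t))" and ?q = "\<lambda>t. complex_of_real (s + e - 2 * t)"
  have "primitive_on s e (\<lambda>t. (0 + complex_of_real (t - s) * 1) * (complex_of_real (e - s) + complex_of_real (t - s) * (-1)))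
     (\<lambda>t. 1 * (complex_of_real (e - s) + complex_of_real (t - s) * (-1)) + (0 + complex_of_real (t - s) * 1) * (-1))"
    by (intro primitive_on_mult primitive_on_linear)
  then have p: "primitive_on s e ?p ?q" by (rule primitive_on_cong) (auto simp: algebra_simps)
  have q: "bdd_meas s e ?q" by (intro bdd_meas_continuous continuous_intros)
  have b1: "bdd_meas s b (\<lambda>t. if t \<le> e then ?q t else 0)" using assms by (intro bdd_meas_glue q bdd_meas_const) auto
  have p1: "primitive_on s b (\<lambda>t. if t \<le> e then ?p t else 0) (\<lambda>t. if t \<le> e then ?q t else 0)"
    using assms by (intro primitive_on_glue p primitive_on_const b1) auto
  have b2: "bdd_meas a b (\<lambda>t. if t \<le> s then 0 else if t \<le> e then ?q t else 0)"
    using assms by (intro bdd_meas_glue[OF bdd_meas_const b1]) auto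
  show "bdd_meas a b (bump' s e)" using b2 unfolding bump'_def .
  have "primitive_on a b (\<lambda>t. if t \<le> s then 0 else if t \<le> e then ?p t else 0) (\<lambda>t. if t \<le> s then 0 else if t \<le> e then ?q t else 0)"
    using assms by (intro primitive_on_glue[OF primitive_on_const p1 _ _ _ b2]) auto
  then show "primitive_on a b (bump s e) (bump' s e)" unfolding bump_def bump'_def .
qed

context sl_problem
begin

text \<open>Bumps with disjoint supports are orthogonal for both forms.\<close>

lemma negdim_growth:
  assumes "d > 0"
  shows "\<exists>\<mu>0. \<forall>\<mu>\<ge>\<mu>0. negdim (XK K) (P.Hm \<mu>) n"
proof (cases "n = 0")
  case True then show ?thesis by (auto simp: negdim_def)
next
  case False
  define h where "h = (b - a) / real n"
  define s where "s = (\<lambda>j. a + real j * h)"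
  have h: "h > 0" using False ab by (simp add: h_def)
  have smono: "s j \<le> s k" if "j \<le> k" for j k unfolding s_def using that h by (simp add: mult_right_mono)
  have slt: "s j < s (Suc j)" for j unfolding s_def using h by (simp add: distrib_right)
  have s0: "s 0 = a" "s n = b" using False by (auto simp: s_def h_def)
  define v where "v = (\<lambda>j p. case p of PY t i \<Rightarrow> if i = 0 then bump (s j) (s (Suc j)) t else 0
     | PD t i \<Rightarrow> if i = 0 then bump' (s j) (s (Suc j)) t else 0 | PX i \<Rightarrow> 0)"
  have ends: "bump (s j) (s (Suc j)) a = 0" "bump (s j) (s (Suc j)) b = 0" if "j < n" for j
    using smono[of 0 j] smono[of "Suc j" n] slt[of j] that s0 by (auto simp: bump_def)
  have Y1v: "Y1 (v j) i = 0" if "j < n" for i j using ends[OF that] by (auto simp: Y1_def v_def)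
  have vX: "v j \<in> XK K" if j: "j < n" for j
  proof -
    have "primitive_on a b (bump (s j) (s (Suc j))) (bump' (s j) (s (Suc j)))" "bdd_meas a b (bump' (s j) (s (Suc j)))"
      using bump_primitive[of a "s j" "s (Suc j)" b] smono[of 0 j] smono[of "Suc j" n] slt[of j] j s0 by auto
    then have "adm a b (yf (v j)) (df (v j))"
      unfolding adm_def v_def
    proof (intro allI impI, goal_cases)
      case (1 i) then show ?case by (cases "i = 0") (auto simp: primitive_on_const bdd_meas_const)
    qed
    then show ?thesis unfolding XK_def using Y1v[OF j] by (simp add: v_def)
  qed
  have disj: "v j (PY t i) = 0 \<and> v j (PD t i) = 0 \<or> v k (PY t i') = 0 \<and> v k (PD t i') = 0" if "j \<noteq> k" for j k t i i'
  proof -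
    have "s (Suc j) \<le> s k \<or> s (Suc k) \<le> s j" using smono that by (metis Suc_leI linorder_neqE_nat)
    then show ?thesis by (auto simp: v_def bump_def bump'_def)
  qed
  have orth: "P.Hm \<mu> (v j) (v k) = 0" if "j < n" "k < n" "j \<noteq> k" for j k \<mu>
  proof -
    have z: "x * v j (PD t j') * cnj (v k (PD t i')) = 0" "x * v j (PY t j') * cnj (v k (PY t i')) = 0" for t i' j' x
      using disj[OF that(3), of t j' i'] by auto
    have "en \<mu> (yf (v j)) (df (v j)) (yf (v k)) (df (v k)) t = 0" for t
      unfolding en_def z by simp
    then have "eform \<mu> (v j) (v k) = 0" unfolding eform_def set_lebesgue_integral_def by simp
    moreover have "bform K S (v j) (v k) = 0" unfolding bform_def using Y1v that by (simp add: v_def)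
    ultimately show ?thesis unfolding Hm_eq[OF vX[OF that(1)] vX[OF that(2)]] by simp
  qed
  have Wpos: "Re (Wform (v j) (v j)) > 0" if j: "j < n" for j
  proof (rule ccontr)
    assume "\<not> ?thesis"
    then have "Re (Wform (v j) (v j)) = 0" using P.B_nonneg[OF vX[OF j]] by simp
    moreover define t where "t = (s j + s (Suc j)) / 2"
    have "t \<in> {a..b}" using smono[of 0 j] smono[of "Suc j" n] slt[of j] j s0 by (auto simp: t_def)
    ultimately have "v j (PY t 0) = 0" using Wform_zero[OF vX[OF j]] assms by blast
    moreover have "s j < t" "t < s (Suc j)" using slt[of j] by (auto simp: t_def)
    ultimately show False by (simp add: v_def bump_def)
  qed
  \<comment> \<open>Rayleigh quotients of the bumps: beyond all of them every bump is negative, and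
    by orthogonality so is every nontrivial combination.\<close>
  define q where "q = (\<lambda>j. Re (Aform K S (v j) (v j)) / Re (Wform (v j) (v j)))"
  define \<mu>0 where "\<mu>0 = 1 + (\<Sum>j<n. \<bar>q j\<bar>)"
  have neg: "Re (P.Hm \<mu> (v j) (v j)) < 0" if "j < n" "\<mu> \<ge> \<mu>0" for j \<mu>
  proof -
    have "\<bar>q j\<bar> \<le> (\<Sum>j<n. \<bar>q j\<bar>)" using that(1) by (intro member_le_sum) auto
    then have "q j < \<mu>" using that(2) unfolding \<mu>0_def by linarith
    then have "Re (Aform K S (v j) (v j)) / Re (Wform (v j) (v j)) < \<mu>" unfolding q_def .
    then show ?thesis unfolding P.Re_Hm using Wpos[OF that(1)] by (simp add: divide_less_eq)
  qed
  have "negdim (XK K) (P.Hm \<mu>) n" if \<mu>: "\<mu> \<ge> \<mu>0" for \<mu>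
    unfolding negdim_def
  proof (intro exI[of _ v] conjI allI impI vX)
    interpret Hm: herm_form "XK K" "P.Hm \<mu>" by (rule P.Hm_herm)
    fix c :: "nat \<Rightarrow> complex" assume c: "\<exists>j<n. c j \<noteq> 0"
    have "P.Hm \<mu> (lc {..<n} c v) (lc {..<n} c v) = (\<Sum>k<n. \<Sum>l<n. c k * (cnj (c l) * P.Hm \<mu> (v k) (v l)))"
    proof -
      have "lc {..<n} c v \<in> XK K" by (intro X.lc_in vX) auto
      then have "P.Hm \<mu> (lc {..<n} c v) (lc {..<n} c v) = (\<Sum>k<n. c k * P.Hm \<mu> (v k) (lc {..<n} c v))"
        using vX by (intro Hm.H_lc_left) auto
      also have "\<dots> = (\<Sum>k<n. c k * (\<Sum>l<n. cnj (c l) * P.Hm \<mu> (v k) (v l)))"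
        using vX by (intro sum.cong refl arg_cong2[where f="(*)"] Hm.H_lc_right) auto
      finally show ?thesis by (simp add: sum_distrib_left)
    qed
    also have "\<dots> = (\<Sum>k<n. \<Sum>l<n. if l = k then c k * (cnj (c k) * P.Hm \<mu> (v k) (v k)) else 0)"
      using orth by (intro sum.cong refl) auto
    also have "\<dots> = (\<Sum>k<n. complex_of_real ((cmod (c k))\<^sup>2) * P.Hm \<mu> (v k) (v k))"
      unfolding complex_norm_square by (simp add: sum.delta mult.assoc)
    finally have "Re (P.Hm \<mu> (lc {..<n} c v) (lc {..<n} c v)) = - (\<Sum>k<n. (cmod (c k))\<^sup>2 * - Re (P.Hm \<mu> (v k) (v k)))"
      by (simp add: sum_negf)
    moreover obtain j where "j < n" "c j \<noteq> 0" using c by blast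
    then have "(\<Sum>k<n. (cmod (c k))\<^sup>2 * - Re (P.Hm \<mu> (v k) (v k))) > 0"
    proof (intro sum_pos2[of _ j])
      show "0 \<le> (cmod (c k))\<^sup>2 * - Re (P.Hm \<mu> (v k) (v k))" if "k \<in> {..<n}" for k
        using neg[OF _ \<mu>, of k] that by (intro mult_nonneg_nonneg) auto
      show "0 < (cmod (c j))\<^sup>2 * - Re (P.Hm \<mu> (v j) (v j))"
        using neg[OF _ \<mu>, of j] \<open>j < n\<close> \<open>c j \<noteq> 0\<close> by (intro mult_pos_pos) auto
    qed (use \<open>j < n\<close> in auto)
    ultimately show "Re (P.Hm \<mu> (lc {..<n} c v) (lc {..<n} c v)) < 0" by simp
  qed
  then show ?thesis by blast
qed

end

section \<open>The index near -\<infinity>\<close>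

lemma mult_le_weighted:
  fixes x y \<epsilon> :: real
  assumes "\<epsilon> > 0"
  shows "x * y \<le> \<epsilon> * x\<^sup>2 + y\<^sup>2 / \<epsilon>"
proof -
  have "0 \<le> (\<epsilon> * x - y)\<^sup>2 / \<epsilon>" using assms by simp
  also have "\<dots> = \<epsilon> * x\<^sup>2 + y\<^sup>2 / \<epsilon> - 2 * (x * y)"
    using assms by (simp add: power2_eq_square field_simps)
  finally have 1: "2 * (x * y) \<le> \<epsilon> * x\<^sup>2 + y\<^sup>2 / \<epsilon>" by simp
  have "0 \<le> \<epsilon> * x\<^sup>2 + y\<^sup>2 / \<epsilon>" using assms by simp
  then show ?thesis using 1 by linarith
qed

context sl_coeffs
begin

text \<open>An arbitrarily small share of the derivative energy controls the boundary values; the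
  rest is paid by the square integral of \<open>y\<close>, which the weight dominates for very
  negative \<mu>.\<close>

lemma boundary_trace:
  assumes \<xi>: "\<xi> \<in> XK K" and e: "\<epsilon> > 0"
  shows "(\<Sum>i<2*d. (cmod (Y1 \<xi> i))\<^sup>2) \<le> 2 * (\<epsilon> * nsq a b (df \<xi>) + (1 / (b - a) + 1 / \<epsilon>) * nsq a b (yf \<xi>))"
proof -
  have tr: "(cmod (\<xi> (PY t i)))\<^sup>2 \<le> \<epsilon> * sqint a b (\<lambda>t. \<xi> (PD t i)) + (1 / (b - a) + 1 / \<epsilon>) * sqint a b (\<lambda>t. \<xi> (PY t i))"
    if "i < d" "t \<in> {a..b}" for i t
  proof -
    have l: "b - a > 0" using ab by simp
    have "(b - a) * (cmod (\<xi> (PY t i)))\<^sup>2 \<le> (b - a) * (\<epsilon> * sqint a b (\<lambda>t. \<xi> (PD t i)) + (1 / (b - a) + 1 / \<epsilon>) * sqint a b (\<lambda>t. \<xi> (PY t i)))"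
    proof -
      have "L * (\<epsilon> * D + (1 / L + 1 / \<epsilon>) * Y) = Y + L * (\<epsilon> * D + Y / \<epsilon>)" if "L > 0" for L D Y :: real
        using that e by (simp add: field_simps)
      then show ?thesis using trace_bound[OF admD(1,2)[OF XK_adm[OF \<xi>] that(1)] e that(2)] l by simp
    qed
    then show ?thesis using l by simp
  qed
  have "(\<Sum>i<2*d. (cmod (Y1 \<xi> i))\<^sup>2) = (\<Sum>i<d. (cmod (\<xi> (PY a i)))\<^sup>2) + (\<Sum>i<d. (cmod (\<xi> (PY b i)))\<^sup>2)"
    by (simp add: sum_lessThan_double Y1_def)
  also have "\<dots> \<le> (\<Sum>i<d. \<epsilon> * sqint a b (\<lambda>t. \<xi> (PD t i)) + (1 / (b - a) + 1 / \<epsilon>) * sqint a b (\<lambda>t. \<xi> (PY t i))) +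
     (\<Sum>i<d. \<epsilon> * sqint a b (\<lambda>t. \<xi> (PD t i)) + (1 / (b - a) + 1 / \<epsilon>) * sqint a b (\<lambda>t. \<xi> (PY t i)))"
    using ab by (intro add_mono sum_mono tr) auto
  also have "\<dots> = 2 * (\<epsilon> * nsq a b (df \<xi>) + (1 / (b - a) + 1 / \<epsilon>) * nsq a b (yf \<xi>))"
    unfolding nsq_def by (simp add: sum.distrib sum_distrib_left)
  finally show ?thesis .
qed

lemma finite_Kidx: "finite (Kidx K)" "Kidx K \<subseteq> {..<2*d}" unfolding Kidx_def by auto

end

locale sl_inertia = sl_problem +
  fixes e :: "nat \<Rightarrow> nat \<Rightarrow> complex" and ev :: "nat \<Rightarrow> real"
  assumes on: "orthonormal_family (Kidx K) (card (Kidx K)) e"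
    and eig: "\<And>k i. k < card (Kidx K) \<Longrightarrow> i \<in> Kidx K \<Longrightarrow> (\<Sum>j\<in>Kidx K. S i j * e k j) = complex_of_real (ev k) * e k i"
begin

definition "Kform x = (\<Sum>i\<in>Kidx K. \<Sum>j\<in>Kidx K. S i j * x j * cnj (x i))"

lemma Kform_eq:
  "Kform x = complex_of_real (\<Sum>k<card (Kidx K). ev k * (cmod (cdot (Kidx K) x (e k)))\<^sup>2)"
proof -
  let ?I = "Kidx K" and ?N = "card (Kidx K)"
  have ex: "x i = (\<Sum>k<?N. cdot ?I x (e k) * e k i)" if "i \<in> ?I" for i
    by (rule orthonormal_expansion[OF finite_Kidx(1) on that])
  have "(\<Sum>j\<in>?I. S i j * x j) = (\<Sum>k<?N. cdot ?I x (e k) * (complex_of_real (ev k) * e k i))" if "i \<in> ?I" for i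
  proof -
    have "(\<Sum>j\<in>?I. S i j * x j) = (\<Sum>j\<in>?I. \<Sum>k<?N. S i j * (cdot ?I x (e k) * e k j))"
      using ex by (intro sum.cong refl) (simp add: sum_distrib_left)
    also have "\<dots> = (\<Sum>k<?N. \<Sum>j\<in>?I. S i j * (cdot ?I x (e k) * e k j))" by (rule sum.swap)
    also have "\<dots> = (\<Sum>k<?N. cdot ?I x (e k) * (\<Sum>j\<in>?I. S i j * e k j))"
      by (simp add: sum_distrib_left mult.left_commute)
    finally show ?thesis using eig that by simp
  qed
  then have "Kform x = (\<Sum>i\<in>?I. (\<Sum>k<?N. cdot ?I x (e k) * (complex_of_real (ev k) * e k i)) * cnj (x i))"
    unfolding Kform_def by (intro sum.cong refl) (simp add: sum_distrib_right[symmetric])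
  also have "\<dots> = (\<Sum>k<?N. \<Sum>i\<in>?I. cdot ?I x (e k) * (complex_of_real (ev k) * e k i) * cnj (x i))"
    unfolding sum_distrib_right by (rule sum.swap)
  also have "\<dots> = (\<Sum>k<?N. complex_of_real (ev k) * (cdot ?I x (e k) * cdot ?I (e k) x))"
    unfolding cdot_def[of ?I "e _" x] by (simp add: sum_distrib_left mult_ac)
  also have "\<dots> = (\<Sum>k<?N. complex_of_real (ev k * (cmod (cdot ?I x (e k)))\<^sup>2))"
    unfolding of_real_mult complex_norm_square by (simp add: cdot_sym[of ?I "e _" x])
  finally show ?thesis by simp
qed

text \<open>The name abbreviates nonpositive: null eigenvalues are included, so that the cardinality
  is \<open>#K - n\<^sup>+(S\<^sub>K)\<close>.\<close>

definition "Npos = {k. k < card (Kidx K) \<and> ev k \<le> 0}"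

text \<open>On the span of the nonpositive eigenvectors of \<open>S\<^sub>K\<close> the boundary vector is paired with a
  function of small norm, which makes the form negative for every spectral parameter.\<close>

lemma negdim_ge: "negdim (XK K) (P.Hm \<mu>) (card Npos)"
proof -
  interpret Hm: herm_form "XK K" "P.Hm \<mu>" by (rule P.Hm_herm)
  let ?I = "Kidx K" and ?N = "card (Kidx K)"
  have fin: "finite Npos" unfolding Npos_def by auto
  define x where "x = (\<lambda>k i. if i \<in> ?I then e k i else 0)"
  \<comment> \<open>\<open>\<eta> k\<close> has boundary values \<open>x k\<close> and zero boundary
    vector; \<open>\<zeta> k\<close> has boundary vector \<open>x k\<close> and zero function. The
    two families interact only through the pairing.\<close>
  have "\<exists>\<eta>\<in>XK K. (\<forall>i<2*d. Y1 \<eta> i = x k i) \<and> (\<forall>i<2*d. \<eta> (PX i) = (if Suc i \<in> K then 0 else x k i))" for k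
    using test_exists[of K "x k" "\<lambda>i. 0"] by simp
  then obtain \<eta> where \<eta>: "\<And>k. \<eta> k \<in> XK K" "\<And>k i. i<2*d \<Longrightarrow> Y1 (\<eta> k) i = x k i"
    "\<And>k i. i<2*d \<Longrightarrow> \<eta> k (PX i) = (if Suc i \<in> K then 0 else x k i)" by metis
  define \<zeta> where "\<zeta> = (\<lambda>k p. case p of PY t i \<Rightarrow> 0 | PD t i \<Rightarrow> 0 | PX i \<Rightarrow> x k i)"
  have \<zeta>X: "\<zeta> k \<in> XK K" for k
    unfolding XK_def adm_def by (simp add: \<zeta>_def primitive_on_const bdd_meas_const Y1_def x_def Kidx_def)
  obtain C where C: "C > 0" "\<And>c. Re (P.Hm \<mu> (lc Npos c \<eta>) (lc Npos c \<eta>)) \<le> C * (\<Sum>j\<in>Npos. (cmod (c j))\<^sup>2)"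
    using Hm.lc_bound[OF fin, of \<eta>] \<eta>(1) by blast
  \<comment> \<open>For coefficients of squared norm \<open>s\<close> the form is at most
    \<open>\<delta> * \<delta> * C * s - 2 * \<delta> * s\<close>; this \<delta> minimises the
    bound.\<close>
  define \<delta> where "\<delta> = 1 / C"
  have \<delta>: "\<delta> > 0" "\<delta> * \<delta> * C = \<delta>" using C by (auto simp: \<delta>_def)
  define v where "v = (\<lambda>k p. complex_of_real \<delta> * \<eta> k p + \<zeta> k p)"
  have vX: "v k \<in> XK K" for k unfolding v_def by (intro X.add_in X.scale_in \<eta>(1) \<zeta>X)
  show ?thesis
  proof (rule negdimI[OF fin vX])
    fix c :: "nat \<Rightarrow> complex" assume c: "\<exists>j\<in>Npos. c j \<noteq> 0"
    define s where "s = (\<Sum>j\<in>Npos. (cmod (c j))\<^sup>2)"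
    have s: "s > 0" unfolding s_def using c fin by (auto intro!: sum_pos2)
    define H where "H = lc Npos c \<eta>" define Z where "Z = lc Npos c \<zeta>"
    have HX: "H \<in> XK K" and ZX: "Z \<in> XK K" unfolding H_def Z_def using \<eta>(1) \<zeta>X fin by (auto intro: X.lc_in)
    have v: "lc Npos c v = (\<lambda>p. complex_of_real \<delta> * H p + Z p)"
      unfolding v_def lc_def H_def Z_def by (simp add: distrib_left sum.distrib sum_distrib_left mult_ac)
    define X where "X = (\<lambda>i. \<Sum>k\<in>Npos. c k * x k i)"
    have ZY: "Z (PY t i) = 0" "Z (PD t i) = 0" "Z (PX i) = X i" for t i by (simp_all add: Z_def lc_def \<zeta>_def X_def)
    have Y1Z: "Y1 Z i = 0" for i by (simp add: Y1_def ZY)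
    have HPX: "H (PX i) = 0" if "i \<in> ?I" for i
      unfolding H_def lc_def using that \<eta>(3) by (intro sum.neutral) (auto simp: Kidx_def)
    have HPX': "H (PX i) = 0" if "i < 2*d" for i
      unfolding H_def lc_def using that \<eta>(3) by (intro sum.neutral) (auto simp: Kidx_def x_def)
    have Y1H: "Y1 H i = X i" if "i < 2*d" for i
    proof -
      have "Y1 H i = (\<Sum>k\<in>Npos. c k * Y1 (\<eta> k) i)" unfolding H_def lc_def Y1_def by (simp add: sum_negf)
      then show ?thesis using \<eta>(2)[OF that] by (simp add: X_def)
    qed
    have XI: "X i = 0" if "i \<notin> ?I" for i using that by (simp add: X_def x_def)
    have Xcdot: "cdot ?I X (e k) = (if k \<in> Npos then c k else 0)" if k: "k < ?N" for k
    proof -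
      have "cdot ?I X (e k) = cdot ?I (lc Npos c e) (e k)"
        unfolding cdot_def X_def lc_def x_def by (intro sum.cong refl) auto
      also have "\<dots> = (\<Sum>j\<in>Npos. c j * (if j = k then 1 else 0))"
        unfolding cdot_lc_left[OF fin] using on k by (intro sum.cong refl) (auto simp: orthonormal_family_def Npos_def)
      also have "\<dots> = (if k \<in> Npos then c k else 0)" using fin by (simp add: if_distrib sum.delta cong: if_cong)
      finally show ?thesis .
    qed
    have nX: "(\<Sum>i\<in>?I. (cmod (X i))\<^sup>2) = s"
    proof -
      have "(\<Sum>i\<in>?I. (cmod (X i))\<^sup>2) = (\<Sum>k<?N. (cmod (cdot ?I X (e k)))\<^sup>2)"
        by (rule orthonormal_parseval[OF finite_Kidx(1) on, symmetric])
      also have "\<dots> = (\<Sum>k<?N. if k \<in> Npos then (cmod (c k))\<^sup>2 else 0)" using Xcdot by (intro sum.cong) auto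
      also have "\<dots> = s" unfolding s_def by (simp add: sum.If_cases) (intro sum.cong, auto simp: Npos_def)
      finally show ?thesis .
    qed
    have eZ: "eform \<mu> Z g = 0" for g unfolding eform_def set_lebesgue_integral_def by (simp add: en_def ZY)
    have ZZ: "Re (P.Hm \<mu> Z Z) \<le> 0"
    proof -
      have "(\<Sum>i<2*d. \<Sum>j<2*d. S i j * X j * cnj (X i)) = Kform X"
      proof -
        have "(\<Sum>i<2*d. \<Sum>j<2*d. S i j * X j * cnj (X i)) = (\<Sum>i\<in>?I. \<Sum>j<2*d. S i j * X j * cnj (X i))"
          by (rule sum.mono_neutral_right) (use finite_Kidx(2) XI in auto)
        also have "\<dots> = Kform X" unfolding Kform_def
          by (intro sum.cong refl sum.mono_neutral_right) (use finite_Kidx(2) XI in auto)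
        finally show ?thesis .
      qed
      then have "Re (P.Hm \<mu> Z Z) = (\<Sum>k<?N. ev k * (cmod (cdot ?I X (e k)))\<^sup>2)"
        unfolding Hm_eq[OF ZX ZX] eZ bform_def by (simp add: ZY Y1Z Kform_eq del: of_real_sum)
      also have "\<dots> \<le> 0" by (intro sum_nonpos) (auto simp: Xcdot Npos_def mult_nonpos_nonneg)
      finally show ?thesis .
    qed
    have ZH: "P.Hm \<mu> Z H = - complex_of_real s"
    proof -
      have "P.Hm \<mu> Z H = - (\<Sum>i\<in>?I. X i * cnj (X i))"
        unfolding Hm_eq[OF ZX HX] eZ bform_def using finite_Kidx(2)[of K]
        by (simp add: ZY Y1Z HPX' Y1H subset_iff)
      also have "(\<Sum>i\<in>?I. X i * cnj (X i)) = complex_of_real s" unfolding nX[symmetric] of_real_sum complex_norm_square ..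
      finally show ?thesis .
    qed
    have HZ: "P.Hm \<mu> H Z = - complex_of_real s" using Hm.H_sym[OF ZX HX] ZH by simp
    have dX: "(\<lambda>p. complex_of_real \<delta> * H p) \<in> XK K" by (rule X.scale_in[OF HX])
    have "P.Hm \<mu> (lc Npos c v) (lc Npos c v) =
       complex_of_real \<delta> * (complex_of_real \<delta> * P.Hm \<mu> H H) + complex_of_real \<delta> * P.Hm \<mu> H Z + (complex_of_real \<delta> * P.Hm \<mu> Z H + P.Hm \<mu> Z Z)"
      unfolding v using HX ZX dX X.add_in[OF dX ZX]
      by (simp add: Hm.H_add Hm.H_add_right Hm.H_scale Hm.H_scale_right distrib_left)
    then have "Re (P.Hm \<mu> (lc Npos c v) (lc Npos c v)) = \<delta> * (\<delta> * Re (P.Hm \<mu> H H)) - 2 * \<delta> * s + Re (P.Hm \<mu> Z Z)"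
      unfolding ZH HZ by simp
    also have "\<dots> \<le> \<delta> * (\<delta> * (C * s)) - 2 * \<delta> * s"
    proof -
      have "\<delta> * (\<delta> * Re (P.Hm \<mu> H H)) \<le> \<delta> * (\<delta> * (C * s))"
        using C(2)[of c] \<delta> unfolding H_def s_def by (intro mult_left_mono) auto
      then show ?thesis using ZZ by linarith
    qed
    also have "\<dots> = - \<delta> * s"
    proof -
      have "\<delta> * (\<delta> * (C * s)) = (\<delta> * \<delta> * C) * s" by (simp add: mult_ac)
      then show ?thesis unfolding \<delta>(2) by simp
    qed
    also have "\<dots> < 0" using \<delta> s by simp
    finally show "Re (P.Hm \<mu> (lc Npos c v) (lc Npos c v)) < 0" .
  qed
qed

text \<open>On the complement of the nonpositive eigenvectors \<open>S\<^sub>K\<close> is at least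
  some \<open>g > 0\<close>. The remaining boundary terms all contain a factor from
  \<open>Y1\<close>, so they split into a small multiple of the free coordinates, absorbed by
  \<open>g\<close>, and a multiple of the boundary values, absorbed by the energy through
  \<open>boundary_trace\<close>.\<close>

lemma negdim_le_at_bot: "\<exists>\<mu>0. \<forall>\<mu>\<le>\<mu>0. \<forall>k. negdim (XK K) (P.Hm \<mu>) k \<longrightarrow> k \<le> card Npos"
proof -
  let ?I = "Kidx K" and ?N = "card (Kidx K)"
  have fin: "finite Npos" unfolding Npos_def by auto
  obtain g where g: "g > 0" "\<And>k. k < ?N \<Longrightarrow> ev k > 0 \<Longrightarrow> g \<le> ev k"
  proof (cases "{k. k < ?N \<and> ev k > 0} = {}")
    case True then show ?thesis by (intro that[of 1]) auto
  next
    case False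
    let ?E = "ev ` {k. k < ?N \<and> ev k > 0}"
    have "finite ?E" by auto
    then show ?thesis using False by (intro that[of "Min ?E"]) (auto intro: Min_le)
  qed
  define s where "s = (\<Sum>i<2*d. \<Sum>j<2*d. cmod (S i j))"
  have s0: "s \<ge> 0" unfolding s_def by (intro sum_nonneg) auto
  \<comment> \<open>Total weight of the boundary terms outside \<open>S\<^sub>K\<close>:
    \<open>s\<close> covers the entries of \<open>S\<close>, the pairing occurs with factor 2, and
    the \<open>+ 1\<close> ensures positivity.\<close>
  define q where "q = s + 2 * real (card ?I) + 1"
  have q: "q > 0" unfolding q_def using s0 by simp
  \<comment> \<open>\<open>q * \<epsilon> = g\<close> spends all of the lower bound of
    \<open>S\<^sub>K\<close>; \<open>B\<close> is then the price in boundary values.\<close>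
  define \<epsilon> where "\<epsilon> = g / q"
  have \<epsilon>: "\<epsilon> > 0" "q * \<epsilon> = g" using g q by (auto simp: \<epsilon>_def)
  define B where "B = q * (\<epsilon> + 1 / \<epsilon>)"
  have B: "B > 0" unfolding B_def using q \<epsilon> by (simp add: add_pos_pos)
  \<comment> \<open>\<open>B * (2 * \<epsilon>') = \<kappa>\<close> spends all of the derivative
    energy; \<open>D\<close> is what \<open>- \<mu> * \<kappa> - \<Lambda> 0\<close> still has to
    cover, and this determines \<mu>0.\<close>
  define \<epsilon>' where "\<epsilon>' = \<kappa> / (2 * B)"
  have \<epsilon>': "\<epsilon>' > 0" "B * (2 * \<epsilon>') = \<kappa>" using \<kappa> B by (auto simp: \<epsilon>'_def)
  define D where "D = B * (2 * (1 / (b - a) + 1 / \<epsilon>'))"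
  have D: "D > 0" unfolding D_def using B \<epsilon>' ab by (simp add: add_pos_pos)
  define \<mu>0 where "\<mu>0 = - (\<Lambda> 0 + D) / \<kappa>"
  have \<mu>0: "\<mu>0 < 0" unfolding \<mu>0_def using \<kappa> D \<Lambda>_nonneg[of 0] by (simp add: divide_less_0_iff)
  define \<phi> where "\<phi> = (\<lambda>k \<xi>. cdot ?I (\<lambda>i. \<xi> (PX i)) (e k))"
  have "k \<le> card Npos" if \<mu>: "\<mu> \<le> \<mu>0" and k: "negdim (XK K) (P.Hm \<mu>) k" for \<mu> k
  proof (rule negdim_le_card[OF X.vsubspace_axioms k fin, where \<phi> = \<phi>])
    show "linfun (XK K) (\<phi> l)" for l
      unfolding linfun_def \<phi>_def cdot_def by (auto simp: distrib_right sum.distrib sum_distrib_left mult.assoc)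
    fix \<xi> assume \<xi>: "\<xi> \<in> XK K" and \<phi>0: "\<And>l. l \<in> Npos \<Longrightarrow> \<phi> l \<xi> = 0"
    define x where "x = (\<lambda>i. \<xi> (PX i))"
    define n where "n = (\<Sum>i\<in>?I. (cmod (x i))\<^sup>2)"
    define y where "y = (\<Sum>i<2*d. (cmod (Y1 \<xi> i))\<^sup>2)"
    have n0: "n \<ge> 0" "y \<ge> 0" unfolding n_def y_def by (auto intro: sum_nonneg)
    have kf: "g * n \<le> Re (Kform x)"
    proof -
      have "g * n = (\<Sum>k<?N. g * (cmod (cdot ?I x (e k)))\<^sup>2)"
        unfolding n_def orthonormal_parseval[OF finite_Kidx(1) on, symmetric] by (simp add: sum_distrib_left)
      also have "\<dots> \<le> (\<Sum>k<?N. ev k * (cmod (cdot ?I x (e k)))\<^sup>2)"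
      proof (rule sum_mono)
        fix k assume k: "k \<in> {..<?N}"
        show "g * (cmod (cdot ?I x (e k)))\<^sup>2 \<le> ev k * (cmod (cdot ?I x (e k)))\<^sup>2"
        proof (cases "ev k > 0")
          case True then show ?thesis using g(2)[of k] k by (intro mult_right_mono) auto
        next
          case False
          then have "k \<in> Npos" using k by (simp add: Npos_def)
          from \<phi>0[OF this] show ?thesis unfolding \<phi>_def x_def by simp
        qed
      qed
      finally show ?thesis unfolding Kform_eq by (simp del: of_real_sum)
    qed
    have xI: "(cmod (x i))\<^sup>2 \<le> n + y" and Yi: "(cmod (Y1 \<xi> i))\<^sup>2 \<le> y" if "i < 2*d" for i
    proof -
      show 1: "(cmod (Y1 \<xi> i))\<^sup>2 \<le> y" unfolding y_def using that by (intro member_le_sum) auto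
      show "(cmod (x i))\<^sup>2 \<le> n + y"
      proof (cases "i \<in> ?I")
        case True
        then have "(cmod (x i))\<^sup>2 \<le> n" unfolding n_def using finite_Kidx by (intro member_le_sum) auto
        then show ?thesis using n0 by simp
      next
        case False
        then have "x i = Y1 \<xi> i" using \<xi> that unfolding XK_def x_def Kidx_def by auto
        then show ?thesis using 1 n0 by simp
      qed
    qed
    have xy: "cmod (x i) * cmod (Y1 \<xi> j) \<le> \<epsilon> * n + (\<epsilon> + 1 / \<epsilon>) * y" if "i < 2*d" "j < 2*d" for i j
    proof -
      have "cmod (x i) * cmod (Y1 \<xi> j) \<le> \<epsilon> * (cmod (x i))\<^sup>2 + (cmod (Y1 \<xi> j))\<^sup>2 / \<epsilon>" by (rule mult_le_weighted[OF \<epsilon>(1)])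
      also have "\<dots> \<le> \<epsilon> * (n + y) + y / \<epsilon>"
        using xI[OF that(1)] Yi[OF that(2)] \<epsilon>(1) by (intro add_mono mult_left_mono divide_right_mono) auto
      finally show ?thesis by (simp add: algebra_simps)
    qed
    define m where "m = \<epsilon> * n + (\<epsilon> + 1 / \<epsilon>) * y"
    have m0: "m \<ge> 0" unfolding m_def using n0 \<epsilon>(1) by simp
    define T where "T = (\<Sum>i<2*d. \<Sum>j<2*d. S i j * x j * cnj (x i))"
    have T: "cmod (T - Kform x) \<le> s * m"
    proof -
      have Kf: "Kform x = (\<Sum>i<2*d. \<Sum>j<2*d. if i \<in> ?I \<and> j \<in> ?I then S i j * x j * cnj (x i) else 0)"
      proof -
        have "(\<Sum>i<2*d. \<Sum>j<2*d. if i \<in> ?I \<and> j \<in> ?I then S i j * x j * cnj (x i) else 0) =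
          (\<Sum>i\<in>?I. \<Sum>j<2*d. if i \<in> ?I \<and> j \<in> ?I then S i j * x j * cnj (x i) else 0)"
          by (rule sum.mono_neutral_right) (use finite_Kidx(2) in auto)
        also have "\<dots> = (\<Sum>i\<in>?I. \<Sum>j\<in>?I. if i \<in> ?I \<and> j \<in> ?I then S i j * x j * cnj (x i) else 0)"
          by (intro sum.cong refl sum.mono_neutral_right) (use finite_Kidx(2) in auto)
        also have "\<dots> = Kform x" unfolding Kform_def by (intro sum.cong refl) auto
        finally show ?thesis ..
      qed
      have TK: "T - Kform x = (\<Sum>i<2*d. \<Sum>j<2*d. if i \<in> ?I \<and> j \<in> ?I then 0 else S i j * x j * cnj (x i))"
        unfolding T_def Kf sum_subtractf[symmetric] by (intro sum.cong refl) auto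
      have "cmod (T - Kform x) \<le> (\<Sum>i<2*d. \<Sum>j<2*d. cmod (if i \<in> ?I \<and> j \<in> ?I then 0 else S i j * x j * cnj (x i)))"
        unfolding TK by (rule order.trans[OF norm_sum sum_mono[OF norm_sum]])
      also have "\<dots> \<le> (\<Sum>i<2*d. \<Sum>j<2*d. cmod (S i j) * m)"
      proof (intro sum_mono)
        fix i j assume ij: "i \<in> {..<2*d}" "j \<in> {..<2*d}"
        show "cmod (if i \<in> ?I \<and> j \<in> ?I then 0 else S i j * x j * cnj (x i)) \<le> cmod (S i j) * m"
        proof (cases "i \<in> ?I \<and> j \<in> ?I")
          case True then show ?thesis using m0 by simp
        next
          case False
          have xY: "x l = Y1 \<xi> l" if "l < 2*d" "l \<notin> ?I" for l using \<xi> that unfolding XK_def x_def Kidx_def by auto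
          have "cmod (x j) * cmod (x i) \<le> m"
          proof (cases "i \<in> ?I")
            case True
            then have "x j = Y1 \<xi> j" using False xY[of j] ij by simp
            then show ?thesis using xy[of i j] ij unfolding m_def by (simp add: mult.commute)
          next
            case False
            then have "x i = Y1 \<xi> i" using xY[of i] ij by simp
            then show ?thesis using xy[of j i] ij unfolding m_def by simp
          qed
          then have "cmod (S i j) * (cmod (x j) * cmod (x i)) \<le> cmod (S i j) * m" by (rule mult_left_mono) simp
          then show ?thesis using False by (auto simp: norm_mult mult.assoc)
        qed
      qed
      also have "\<dots> = s * m" unfolding s_def by (simp add: sum_distrib_right)
      finally show ?thesis .
    qed
    have pr: "cmod (\<Sum>i\<in>?I. x i * cnj (Y1 \<xi> i)) \<le> real (card ?I) * m"
    proof -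
      have "cmod (\<Sum>i\<in>?I. x i * cnj (Y1 \<xi> i)) \<le> (\<Sum>i\<in>?I. m)"
        using xy finite_Kidx(2) unfolding m_def
        by (intro order.trans[OF norm_sum sum_mono]) (auto simp: norm_mult subset_iff)
      then show ?thesis by simp
    qed
    have "Re (bform K S \<xi> \<xi>) = Re T - 2 * Re (\<Sum>i\<in>?I. x i * cnj (Y1 \<xi> i))"
      unfolding Re_bform_diag T_def x_def ..
    moreover have "Re T \<ge> Re (Kform x) - s * m" using T abs_Re_le_cmod[of "T - Kform x"] by simp
    moreover have "Re (\<Sum>i\<in>?I. x i * cnj (Y1 \<xi> i)) \<le> real (card ?I) * m"
      using pr complex_Re_le_cmod order_trans by blast
    ultimately have "Re (bform K S \<xi> \<xi>) \<ge> g * n - (s * m + 2 * (real (card ?I) * m))" using kf by linarith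
    moreover have "s * m + 2 * (real (card ?I) * m) \<le> q * m" unfolding q_def using m0 by (simp add: algebra_simps)
    moreover have "q * m = g * n + B * y"
    proof -
      have "q * m = (q * \<epsilon>) * n + B * y" unfolding m_def B_def by (simp add: algebra_simps)
      then show ?thesis using \<epsilon>(2) by simp
    qed
    ultimately have bf: "Re (bform K S \<xi> \<xi>) \<ge> - (B * y)" by linarith
    have "B * y \<le> B * (2 * (\<epsilon>' * nsq a b (df \<xi>) + (1 / (b - a) + 1 / \<epsilon>') * nsq a b (yf \<xi>)))"
      using boundary_trace[OF \<xi> \<epsilon>'(1)] B unfolding y_def by (intro mult_left_mono) auto
    also have "\<dots> = (B * (2 * \<epsilon>')) * nsq a b (df \<xi>) + D * nsq a b (yf \<xi>)"
    proof -
      have "B * (2 * (\<epsilon>' * u + c * v)) = (B * (2 * \<epsilon>')) * u + (B * (2 * c)) * v" for c u v :: real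
        by (simp add: algebra_simps)
      then show ?thesis unfolding D_def .
    qed
    finally have By: "B * y \<le> \<kappa> * nsq a b (df \<xi>) + D * nsq a b (yf \<xi>)" unfolding \<epsilon>'(2) .
    have "\<mu> < 0" "\<mu> \<le> 0" using \<mu> \<mu>0 by auto
    then have en: "\<kappa> * nsq a b (df \<xi>) + (- \<mu> * \<kappa> - \<Lambda> 0) * nsq a b (yf \<xi>) \<le> Re (eform \<mu> \<xi> \<xi>)"
      using energy_ge[OF XK_adm[OF \<xi>], of \<mu> 0] unfolding eform_def by simp
    have "\<mu> * \<kappa> \<le> \<mu>0 * \<kappa>" using \<mu> \<kappa> by simp
    then have "D \<le> - \<mu> * \<kappa> - \<Lambda> 0" using \<kappa> unfolding \<mu>0_def by simp
    then have "D * nsq a b (yf \<xi>) \<le> (- \<mu> * \<kappa> - \<Lambda> 0) * nsq a b (yf \<xi>)" using nsq_nonneg by (intro mult_right_mono)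
    then show "0 \<le> Re (P.Hm \<mu> \<xi> \<xi>)" unfolding Hm_eq[OF \<xi> \<xi>] using en By bf by simp
  qed
  then show ?thesis by blast
qed

lemma ind_at_bot: "\<exists>\<mu>0. \<forall>\<mu>\<le>\<mu>0. P.ind \<mu> = card Npos"
proof -
  obtain \<mu>0 where "\<forall>\<mu>\<le>\<mu>0. \<forall>k. negdim (XK K) (P.Hm \<mu>) k \<longrightarrow> k \<le> card Npos" using negdim_le_at_bot by blast
  then have "P.ind \<mu> = card Npos" if "\<mu> \<le> \<mu>0" for \<mu>
    using that negdim_ind[of \<mu>] negdim_le_ind[OF negdim_ge[of \<mu>]] by (intro antisym) auto
  then show ?thesis by blast
qed

theorem ind_eq_count:
  "finite {l. l < \<mu> \<and> 0 < P.nul l}" "card Npos + (\<Sum>l\<in>{l. l < \<mu> \<and> 0 < P.nul l}. P.nul l) = P.ind \<mu>"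
proof -
  obtain m where "bounded_pencil (XK K) (Aform K S) Wform (nodes K m) (nodal m) (\<mu> + 1)"
    using bounded_pencil_at by blast
  then interpret bounded_pencil "XK K" "Aform K S" Wform "nodes K m" "nodal m" "\<mu> + 1" .
  obtain \<mu>0 where "\<And>l. l \<le> \<mu>0 \<Longrightarrow> P.ind l = card Npos" using ind_at_bot by blast
  from ind_count[OF this] show "finite {l. l < \<mu> \<and> 0 < P.nul l}" "card Npos + (\<Sum>l\<in>{l. l < \<mu> \<and> 0 < P.nul l}. P.nul l) = P.ind \<mu>"
    by auto
qed

end

section \<open>Eigenfunctions as radical elements\<close>

lemma index_rep_K_mult:
  assumes S: "S \<in> carrier_mat (2*d) (2*d)" and v: "v \<in> carrier_vec (4*d)" and r: "r < 2*d"
  shows "(rep_K d K S *\<^sub>v v) $ r =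
    (\<Sum>c<2*d. (if Suc c \<in> K then - (if r = c then 1 else 0) else S $$ (r, c)) * v $ c) +
    (\<Sum>c<2*d. (if Suc c \<in> K then S $$ (r, c) else (if r = c then 1 else 0)) * v $ (2*d + c))"
proof -
  have "(rep_K d K S *\<^sub>v v) $ r = (\<Sum>c<2*(2*d). rep_K d K S $$ (r, c) * v $ c)"
    using v r by (simp add: scalar_prod_def rep_K_def atLeast0LessThan) 
  also have "\<dots> = (\<Sum>c<2*d. rep_K d K S $$ (r, c) * v $ c) + (\<Sum>c<2*d. rep_K d K S $$ (r, 2*d + c) * v $ (2*d + c))"
    by (rule sum_lessThan_double)
  also have "(\<Sum>c<2*d. rep_K d K S $$ (r, 2*d + c) * v $ (2*d + c)) =
    (\<Sum>c<2*d. (if Suc c \<in> K then S $$ (r, c) else (if r = c then 1 else 0)) * v $ (2*d + c))"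
    using r by (intro sum.cong refl) (auto simp: rep_K_def)
  also have "(\<Sum>c<2*d. rep_K d K S $$ (r, c) * v $ c) =
    (\<Sum>c<2*d. (if Suc c \<in> K then - (if r = c then 1 else 0) else S $$ (r, c)) * v $ c)"
    using r by (intro sum.cong refl) (auto simp: rep_K_def)
  finally show ?thesis .
qed

lemma rep_K_mult_zero_iff:
  assumes S: "S \<in> carrier_mat (2*d) (2*d)" and v: "v \<in> carrier_vec (4*d)"
  shows "rep_K d K S *\<^sub>v v = 0\<^sub>v (2*d) \<longleftrightarrow>
    (\<forall>r<2*d. (\<Sum>c<2*d. S $$ (r, c) * (if Suc c \<in> K then v $ (2*d + c) else v $ c)) =
       (if Suc r \<in> K then v $ r else - v $ (2*d + r)))"
proof -
  have "(rep_K d K S *\<^sub>v v) $ r =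
     (\<Sum>c<2*d. S $$ (r, c) * (if Suc c \<in> K then v $ (2*d + c) else v $ c)) - (if Suc r \<in> K then v $ r else - v $ (2*d + r))"
    if r: "r < 2*d" for r
  proof -
    have "(rep_K d K S *\<^sub>v v) $ r = (\<Sum>c<2*d. S $$ (r, c) * (if Suc c \<in> K then v $ (2*d + c) else v $ c) +
      (if c = r then (if Suc r \<in> K then - v $ r else v $ (2*d + r)) else 0))"
      unfolding index_rep_K_mult[OF assms r] sum.distrib[symmetric] by (intro sum.cong refl) auto
    also have "\<dots> = (\<Sum>c<2*d. S $$ (r, c) * (if Suc c \<in> K then v $ (2*d + c) else v $ c)) +
       (if Suc r \<in> K then - v $ r else v $ (2*d + r))"
      unfolding sum.distrib using r by (simp add: sum.delta)
    finally show ?thesis by auto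
  qed
  moreover have "rep_K d K S *\<^sub>v v = 0\<^sub>v (2*d) \<longleftrightarrow> (\<forall>r<2*d. (rep_K d K S *\<^sub>v v) $ r = 0)"
    by (auto simp: vec_eq_iff rep_K_def)
  ultimately show ?thesis by simp
qed

lemma GL_orbit_annihilates_iff:
  assumes M: "M \<in> carrier_mat (2*d) (4*d)" and v: "v \<in> carrier_vec (4*d)"
  shows "(\<forall>N\<in>GL_orbit d M. N *\<^sub>v v = 0\<^sub>v (2*d)) \<longleftrightarrow> M *\<^sub>v v = 0\<^sub>v (2*d)"
proof
  assume "\<forall>N\<in>GL_orbit d M. N *\<^sub>v v = 0\<^sub>v (2*d)"
  moreover have "1\<^sub>m (2*d) * M \<in> GL_orbit d M"
    unfolding GL_orbit_def by (auto intro!: exI[of _ "1\<^sub>m (2*d)"] simp: invertible_mat_def inverts_mat_def)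
  ultimately show "M *\<^sub>v v = 0\<^sub>v (2*d)" using M by simp
next
  assume 0: "M *\<^sub>v v = 0\<^sub>v (2*d)"
  show "\<forall>N\<in>GL_orbit d M. N *\<^sub>v v = 0\<^sub>v (2*d)"
  proof
    fix N assume "N \<in> GL_orbit d M"
    then obtain G where G: "G \<in> carrier_mat (2*d) (2*d)" "N = G * M" unfolding GL_orbit_def by blast
    have "N *\<^sub>v v = G *\<^sub>v (M *\<^sub>v v)" unfolding G(2) using G(1) M v by (rule assoc_mult_mat_vec)
    also have "\<dots> = 0\<^sub>v (2*d)" unfolding 0 using G(1) by (intro eq_vecI) (auto simp: scalar_prod_def)
    finally show "N *\<^sub>v v = 0\<^sub>v (2*d)" .
  qed
qed

context sl_problem
begin

text \<open>An eigenfunction extends to a radical element by the derivative \<open>R u\<close> and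
  the boundary vector; conversely \<open>radical_eigpair\<close> recovers \<open>u\<close>.
  Agreement is demanded only where \<open>eigfun\<close> looks at \<open>y\<close>.\<close>

lemma eigfun_radical_iff:
  assumes Sm: "Sm \<in> carrier_mat (2*d) (2*d)" "\<And>i j. i < 2*d \<Longrightarrow> j < 2*d \<Longrightarrow> Sm $$ (i, j) = S i j"
  shows "eigfun d a b P Q W (GL_orbit d (rep_K d K Sm)) (complex_of_real \<mu>) y \<longleftrightarrow>
    (\<exists>\<xi>\<in>XK K. (\<forall>\<eta>\<in>XK K. P.Hm \<mu> \<xi> \<eta> = 0) \<and> (\<forall>t\<in>{a..b}. \<forall>i<d. \<xi> (PY t i) = y t i))"
proof -
  have rc: "rep_K d K Sm \<in> carrier_mat (2*d) (4*d)" by (simp add: rep_K_def)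
  have bc: "(\<forall>M\<in>GL_orbit d (rep_K d K Sm). M *\<^sub>v bd_vec d a b y u = 0\<^sub>v (2*d)) \<longleftrightarrow>
    (\<forall>r<2*d. (\<Sum>c<2*d. S r c * (if Suc c \<in> K then Y2 u c else (if c < d then - y a c else y b (c - d)))) =
      (if Suc r \<in> K then (if r < d then - y a r else y b (r - d)) else - Y2 u r))" for y u
  proof -
    have v: "bd_vec d a b y u \<in> carrier_vec (4*d)" by (simp add: bd_vec_def)
    have i1: "bd_vec d a b y u $ c = (if c < d then - y a c else y b (c - d))" if "c < 2*d" for c
      using that by (simp add: bd_vec_def)
    have i2: "bd_vec d a b y u $ (2*d + c) = Y2 u c" if "c < 2*d" for c
      using that by (auto simp: bd_vec_def Y2_def)
    show ?thesis
      unfolding GL_orbit_annihilates_iff[OF rc v] rep_K_mult_zero_iff[OF Sm(1) v]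
      by (intro all_cong1 imp_cong refl arg_cong2[where f="(=)"] sum.cong)
        (auto simp: i1 i2 Sm(2))
  qed
  show ?thesis
  proof
    assume "eigfun d a b P Q W (GL_orbit d (rep_K d K Sm)) (complex_of_real \<mu>) y"
    then obtain y' u u' where
      int: "\<And>i. i < d \<Longrightarrow> set_integrable lborel {a..b} (\<lambda>s. y' s i)" "\<And>i. i < d \<Longrightarrow> set_integrable lborel {a..b} (\<lambda>s. u' s i)"
      and eqs: "\<And>i t. i < d \<Longrightarrow> t \<in> {a..b} \<Longrightarrow> y t i = y a i + (LINT s:{a..t}|lborel. y' s i)"
       "\<And>i t. i < d \<Longrightarrow> t \<in> {a..b} \<Longrightarrow> u t i = u a i + (LINT s:{a..t}|lborel. u' s i)"
      and ae: "AE s in lborel. s \<in> {a..b} \<longrightarrow> (\<forall>i<d. u s i = (\<Sum>j<d. complex_of_real (P s i j) * y' s j) \<and>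
                  u' s i = (\<Sum>j<d. (complex_of_real (Q s i j) - complex_of_real \<mu> * complex_of_real (W s i j)) * y s j))"
      and bcy: "\<forall>M\<in>GL_orbit d (rep_K d K Sm). M *\<^sub>v bd_vec d a b y u = 0\<^sub>v (2*d)"
      unfolding eigfun_def by blast
    \<comment> \<open>\<open>eigfun\<close> provides a merely integrable derivative;
      \<open>R u\<close> agrees with it almost everywhere and is bounded, as \<open>adm\<close>
      demands.\<close>
    define \<xi> where "\<xi> = (\<lambda>p. case p of PY t i \<Rightarrow> y t i | PD t i \<Rightarrow> (\<Sum>j<d. complex_of_real (R t i j) * u t j)
       | PX i \<Rightarrow> if Suc i \<in> K then Y2 u i else if i < d then - y a i else y b (i - d))"
    have py: "primitive_on a b (\<lambda>t. y t i) (\<lambda>t. y' t i)" and pu: "primitive_on a b (\<lambda>t. u t i) (\<lambda>t. u' t i)" if "i < d" for i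
      by (rule primitive_onI[OF int(1)[OF that]], rule eqs(1)[OF that], simp)
        (rule primitive_onI[OF int(2)[OF that]], rule eqs(2)[OF that], simp)
    have bD: "bdd_meas a b (\<lambda>t. \<Sum>j<d. complex_of_real (R t i j) * u t j)" if "i < d" for i
      using bdd_meas_primitive[OF pu] by (intro bdd_meas_sum bdd_meas_mult bdd_meas_coeff) auto
    have pyR: "primitive_on a b (\<lambda>t. y t i) (\<lambda>t. \<Sum>j<d. complex_of_real (R t i j) * u t j)" if i: "i < d" for i
    proof (rule primitive_on_cong_AE[OF py[OF i]])
      show "AE s in lborel. s \<in> {a..b} \<longrightarrow> y' s i = (\<Sum>j<d. complex_of_real (R s i j) * u s j)"
        using ae
      proof eventually_elim
        case (elim s)
        then show ?case using mult_R_P[OF i, of s "y' s"] by auto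
      qed
    qed (use bD[OF i] in \<open>auto simp: bdd_meas_def\<close>)
    have puV: "primitive_on a b (\<lambda>t. u t i) (\<lambda>t. \<Sum>j<d. V \<mu> t i j * y t j)" if i: "i < d" for i
    proof (rule primitive_on_cong_AE[OF pu[OF i]])
      show "AE s in lborel. s \<in> {a..b} \<longrightarrow> u' s i = (\<Sum>j<d. V \<mu> s i j * y s j)"
        using ae by eventually_elim (use i in \<open>auto simp: V_def\<close>)
      have "bdd_meas a b (\<lambda>t. \<Sum>j<d. V \<mu> t i j * y t j)"
        using bdd_meas_primitive[OF py] by (intro bdd_meas_sum bdd_meas_mult bdd_meas_V) auto
      then show "set_borel_measurable lborel {a..b} (\<lambda>t. \<Sum>j<d. V \<mu> t i j * y t j)" by (simp add: bdd_meas_def)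
    qed simp
    have Y1\<xi>: "Y1 \<xi> i = (if i < d then - y a i else y b (i - d))" for i by (simp add: Y1_def \<xi>_def)
    have PX: "\<xi> (PX i) = (if Suc i \<in> K then Y2 u i else Y1 \<xi> i)" for i unfolding Y1\<xi> by (simp add: \<xi>_def)
    have yd: "yf \<xi> = y" "df \<xi> = (\<lambda>t i. \<Sum>j<d. complex_of_real (R t i j) * u t j)" by (simp_all add: \<xi>_def)
    have PD: "\<xi> (PD t i) = (\<Sum>j<d. complex_of_real (R t i j) * u t j)" for t i by (simp add: \<xi>_def)
    have "adm a b (yf \<xi>) (df \<xi>)" unfolding yd adm_def using pyR bD by auto
    then have \<xi>X: "\<xi> \<in> XK K" unfolding XK_def using PX by auto
    have "eigpair \<mu> \<xi> u" unfolding eigpair_def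
    proof (intro conjI allI impI)
      fix i assume i: "i < d"
      show "primitive_on a b (\<lambda>t. u t i) (\<lambda>t. \<Sum>j<d. V \<mu> t i j * \<xi> (PY t j))" using puV[OF i] by (simp add: \<xi>_def)
    next
      show "AE t in lborel. t \<in> {a..b} \<longrightarrow> (\<forall>i<d. u t i = (\<Sum>j<d. complex_of_real (P t i j) * df \<xi> t j))"
        by (simp add: PD mult_P_R)
    next
      fix i assume i: "i < 2*d"
      have "(\<Sum>c<2*d. S i c * \<xi> (PX c)) = (if Suc i \<in> K then Y1 \<xi> i else - Y2 u i)"
        using bcy i unfolding bc Y1\<xi> PX by auto
      then show "if Suc i \<in> K then \<xi> (PX i) = Y2 u i \<and> (\<Sum>j<2*d. S i j * \<xi> (PX j)) = Y1 \<xi> i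
          else (\<Sum>j<2*d. S i j * \<xi> (PX j)) = - Y2 u i" using PX[of i] by auto
    qed
    then show "\<exists>\<xi>\<in>XK K. (\<forall>\<eta>\<in>XK K. P.Hm \<mu> \<xi> \<eta> = 0) \<and> (\<forall>t\<in>{a..b}. \<forall>i<d. \<xi> (PY t i) = y t i)"
      using \<xi>X eigpair_radical[OF \<xi>X] by (intro bexI[of _ \<xi>]) (auto simp: \<xi>_def)
  next
    assume "\<exists>\<xi>\<in>XK K. (\<forall>\<eta>\<in>XK K. P.Hm \<mu> \<xi> \<eta> = 0) \<and> (\<forall>t\<in>{a..b}. \<forall>i<d. \<xi> (PY t i) = y t i)"
    then obtain \<xi> where \<xi>: "\<xi> \<in> XK K" "\<And>\<eta>. \<eta> \<in> XK K \<Longrightarrow> P.Hm \<mu> \<xi> \<eta> = 0"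
      "\<And>t i. t \<in> {a..b} \<Longrightarrow> i < d \<Longrightarrow> \<xi> (PY t i) = y t i" by blast
    obtain u where u: "eigpair \<mu> \<xi> u" using radical_eigpair[OF \<xi>(1,2)] by blast
    have py: "primitive_on a b (\<lambda>t. y t i) (\<lambda>t. \<xi> (PD t i))" if "i < d" for i
      by (rule primitive_on_cong[OF admD(1)[OF XK_adm[OF \<xi>(1)] that]]) (use \<xi>(3) that in auto)
    have pu: "primitive_on a b (\<lambda>t. u t i) (\<lambda>t. \<Sum>j<d. V \<mu> t i j * y t j)" if "i < d" for i
      by (rule primitive_on_cong[of _ _ "\<lambda>t. u t i" "\<lambda>t. \<Sum>j<d. V \<mu> t i j * \<xi> (PY t j)"])
        (use u \<xi>(3) that in \<open>auto simp: eigpair_def\<close>)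
    have Y1\<xi>: "Y1 \<xi> i = (if i < d then - y a i else y b (i - d))" if "i < 2*d" for i
      using \<xi>(3) that ab by (auto simp: Y1_def)
    have PX: "\<xi> (PX i) = (if Suc i \<in> K then Y2 u i else (if i < d then - y a i else y b (i - d)))" if "i < 2*d" for i
      using u \<xi>(1) that Y1\<xi>[OF that] unfolding eigpair_def XK_def by auto
    show "eigfun d a b P Q W (GL_orbit d (rep_K d K Sm)) (complex_of_real \<mu>) y"
      unfolding eigfun_def
    proof (rule exI[of _ "\<lambda>t i. \<xi> (PD t i)"], rule exI[of _ u],
        rule exI[of _ "\<lambda>t i. \<Sum>j<d. V \<mu> t i j * y t j"], intro conjI)
      show "\<forall>i<d. set_integrable lborel {a..b} (\<lambda>s. \<xi> (PD s i)) \<and> set_integrable lborel {a..b} (\<lambda>s. \<Sum>j<d. V \<mu> s i j * y s j) \<and>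
         (\<forall>t\<in>{a..b}. y t i = y a i + (LINT s:{a..t}|lborel. \<xi> (PD s i)) \<and> u t i = u a i + (LINT s:{a..t}|lborel. (\<Sum>j<d. V \<mu> s i j * y s j)))"
        using py pu unfolding primitive_on_def by blast
      show "AE s in lborel. s \<in> {a..b} \<longrightarrow> (\<forall>i<d. u s i = (\<Sum>j<d. complex_of_real (P s i j) * \<xi> (PD s j)) \<and>
           (\<Sum>j<d. V \<mu> s i j * y s j) = (\<Sum>j<d. (complex_of_real (Q s i j) - complex_of_real \<mu> * complex_of_real (W s i j)) * y s j))"
        using u unfolding eigpair_def V_def by auto
      have "(\<Sum>c<2*d. S r c * (if Suc c \<in> K then Y2 u c else (if c < d then - y a c else y b (c - d)))) =
        (if Suc r \<in> K then (if r < d then - y a r else y b (r - d)) else - Y2 u r)" if r: "r < 2*d" for r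
      proof -
        have "(\<Sum>c<2*d. S r c * (if Suc c \<in> K then Y2 u c else (if c < d then - y a c else y b (c - d)))) = (\<Sum>c<2*d. S r c * \<xi> (PX c))"
          using PX by (intro sum.cong refl) auto
        then show ?thesis using u r Y1\<xi>[OF r] unfolding eigpair_def by (auto split: if_splits)
      qed
      then show "\<forall>M\<in>GL_orbit d (rep_K d K Sm). M *\<^sub>v bd_vec d a b y u = 0\<^sub>v (2*d)" unfolding bc by blast
    qed
  qed
qed

text \<open>As \<open>W\<close> is positive definite, \<open>Wform\<close> is nonzero on a
  combination iff its function does not vanish identically on \<open>[a, b]\<close>; so independence
  in \<open>raddim\<close> and in \<open>lin_indep_on\<close> is the same.\<close>

theorem eig_mult_eq_nul:
  assumes Sm: "Sm \<in> carrier_mat (2*d) (2*d)" "\<And>i j. i < 2*d \<Longrightarrow> j < 2*d \<Longrightarrow> Sm $$ (i, j) = S i j"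
  shows "eig_mult d a b P Q W (GL_orbit d (rep_K d K Sm)) (complex_of_real \<mu>) = P.nul \<mu>"
proof -
  let ?A = "GL_orbit d (rep_K d K Sm)"
  note iff = eigfun_radical_iff[OF Sm]
  have upper: "card F \<le> P.nul \<mu>"
    if F: "finite F" "F \<subseteq> {y. eigfun d a b P Q W ?A (complex_of_real \<mu>) y}" "lin_indep_on d a b F" for F
  proof -
    have "\<forall>f\<in>F. \<exists>\<xi>\<in>XK K. (\<forall>\<eta>\<in>XK K. P.Hm \<mu> \<xi> \<eta> = 0) \<and> (\<forall>t\<in>{a..b}. \<forall>i<d. \<xi> (PY t i) = f t i)"
      using F(2) iff by blast
    then obtain \<xi> where \<xi>: "\<And>f. f \<in> F \<Longrightarrow> \<xi> f \<in> XK K" "\<And>f \<eta>. f \<in> F \<Longrightarrow> \<eta> \<in> XK K \<Longrightarrow> P.Hm \<mu> (\<xi> f) \<eta> = 0"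
      "\<And>f t i. f \<in> F \<Longrightarrow> t \<in> {a..b} \<Longrightarrow> i < d \<Longrightarrow> \<xi> f (PY t i) = f t i" by metis
    obtain h where h: "bij_betw h {..<card F} F" using ex_bij_betw_nat_finite[OF F(1)] by (auto simp: atLeast0LessThan)
    then have hF: "h j \<in> F" if "j < card F" for j using that by (auto simp: bij_betw_def)
    have "P.raddim \<mu> (card F)" unfolding P.raddim_def
    proof (intro exI[of _ "\<xi> \<circ> h"] conjI allI impI ballI)
      fix c :: "nat \<Rightarrow> complex" assume c: "\<exists>j<card F. c j \<noteq> 0"
      have X: "lc {..<card F} c (\<xi> \<circ> h) \<in> XK K" using \<xi>(1) hF by (intro X.lc_in) auto
      show "Re (Wform (lc {..<card F} c (\<xi> \<circ> h)) (lc {..<card F} c (\<xi> \<circ> h))) \<noteq> 0"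
      proof
        assume "Re (Wform (lc {..<card F} c (\<xi> \<circ> h)) (lc {..<card F} c (\<xi> \<circ> h))) = 0"
        from Wform_zero[OF X this] have z: "(\<Sum>j<card F. c j * \<xi> (h j) (PY t i)) = 0" if "t \<in> {a..b}" "i < d" for t i
          using that by (simp add: lc_def)
        define g where "g = the_inv_into {..<card F} h"
        have g: "g (h j) = j" if "j < card F" for j
          unfolding g_def using h that by (simp add: the_inv_into_f_f bij_betw_def)
        have "(\<Sum>f\<in>F. c (g f) * f t i) = 0" if t: "t \<in> {a..b}" and i: "i < d" for t i
        proof -
          have "(\<Sum>f\<in>F. c (g f) * f t i) = (\<Sum>j<card F. c (g (h j)) * h j t i)"
            by (rule sum.reindex_bij_betw[OF h, symmetric])
          also have "\<dots> = (\<Sum>j<card F. c j * \<xi> (h j) (PY t i))" using g \<xi>(3)[OF hF t i] by (intro sum.cong) auto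
          finally show ?thesis using z[OF t i] by simp
        qed
        then have "\<forall>f\<in>F. c (g f) = 0" using F(3)[unfolded lin_indep_on_def, rule_format, of "\<lambda>f. c (g f)"] by blast
        then have "c j = 0" if "j < card F" for j using g[OF that] hF[OF that] by force
        then show False using c by blast
      qed
    qed (use \<xi> hF in auto)
    then show ?thesis by (rule raddim_le)
  qed
  obtain v where v: "\<And>j. j < P.nul \<mu> \<Longrightarrow> v j \<in> XK K" "\<And>j z. j < P.nul \<mu> \<Longrightarrow> z \<in> XK K \<Longrightarrow> P.Hm \<mu> (v j) z = 0"
    "\<And>c. (\<exists>j<P.nul \<mu>. c j \<noteq> 0) \<Longrightarrow> Re (Wform (lc {..<P.nul \<mu>} c v) (lc {..<P.nul \<mu>} c v)) \<noteq> 0"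
    using raddim_nul[of \<mu>] unfolding P.raddim_def by blast
  let ?n = "P.nul \<mu>"
  define y where "y = (\<lambda>j. yf (v j))"
  have indep: "\<forall>j<?n. c j = 0" if c: "\<And>t i. t \<in> {a..b} \<Longrightarrow> i < d \<Longrightarrow> (\<Sum>j<?n. c j * y j t i) = 0" for c
  proof (rule ccontr)
    assume "\<not> (\<forall>j<?n. c j = 0)"
    then have "Re (Wform (lc {..<?n} c v) (lc {..<?n} c v)) \<noteq> 0" by (intro v(3)) blast
    moreover have "Wform (lc {..<?n} c v) (lc {..<?n} c v) = 0"
      using c by (intro Wform_zeroI) (simp add: lc_def y_def)
    ultimately show False by simp
  qed
  \<comment> \<open>\<open>eig_mult\<close> counts sets while \<open>raddim\<close> uses families,
    so the functions have to be distinct for the cardinality to be right.\<close>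
  have inj: "inj_on y {..<?n}"
  proof (rule inj_onI, rule ccontr)
    fix j k assume jk: "j \<in> {..<?n}" "k \<in> {..<?n}" "y j = y k" "j \<noteq> k"
    define c where "c = (\<lambda>l. if l = j then 1 else if l = k then -1 else 0 :: complex)"
    have "(\<Sum>l<?n. c l * y l t i) = 0" for t i
    proof -
      have "(\<Sum>l<?n. c l * y l t i) = (\<Sum>l<?n. (if l = j then y j t i else 0) - (if l = k then y k t i else 0))"
        using jk(4) by (intro sum.cong refl) (auto simp: c_def)
      also have "\<dots> = 0" using jk by (simp add: sum_subtractf sum.delta)
      finally show ?thesis .
    qed
    then have "\<forall>l<?n. c l = 0" by (intro indep)
    then show False using jk(1) by (auto simp: c_def)
  qed
  define F where "F = y ` {..<?n}"
  have F: "finite F" "card F = ?n" "F \<subseteq> {f. eigfun d a b P Q W ?A (complex_of_real \<mu>) f}"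
    unfolding F_def using inj v by (auto simp: card_image iff y_def)
  have "lin_indep_on d a b F" unfolding lin_indep_on_def
  proof (intro allI impI)
    fix c assume c: "\<forall>t\<in>{a..b}. \<forall>i<d. (\<Sum>f\<in>F. c f * f t i) = 0"
    have "\<forall>j<?n. c (y j) = 0"
      by (rule indep) (use c inj in \<open>simp add: F_def sum.reindex\<close>)
    then show "\<forall>f\<in>F. c f = 0" unfolding F_def by auto
  qed
  then have "?n \<in> {card F | F. finite F \<and> F \<subseteq> {y. eigfun d a b P Q W ?A (complex_of_real \<mu>) y} \<and> lin_indep_on d a b F}"
    using F by (intro CollectI exI[of _ F]) simp
  then show ?thesis unfolding eig_mult_def by (rule cSup_eq_maximum) (use upper in auto)
qed

end

section \<open>Coefficients in \<open>L\<^sup>\<infinity>\<close>\<close>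

lemma measurable_det:
  fixes A :: "'a \<Rightarrow> real mat"
  assumes dim: "\<And>t. A t \<in> carrier_mat n n" and m: "\<And>i j. i < n \<Longrightarrow> j < n \<Longrightarrow> (\<lambda>t. A t $$ (i, j)) \<in> borel_measurable M"
  shows "(\<lambda>t. det (A t)) \<in> borel_measurable M"
proof -
  have "(\<lambda>t. det (A t)) = (\<lambda>t. \<Sum> p \<in> {p. p permutes {0..<n}}. signof p * (\<Prod> i = 0..<n. A t $$ (i, p i)))"
    using dim by (intro ext det_def') 
  also have "\<dots> \<in> borel_measurable M"
  proof (intro borel_measurable_sum borel_measurable_times borel_measurable_const borel_measurable_prod)
    fix p i assume "p \<in> {p. p permutes {0..<n}}" "i \<in> {0..<n}"
    then have "i < n" "p i < n" using permutes_in_image[of p "{0..<n}" i] by auto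
    then show "(\<lambda>t. A t $$ (i, p i)) \<in> borel_measurable M" by (rule m)
  qed
  finally show ?thesis .
qed

text \<open>The quotient of adjugate and determinant makes the inverse measurable. Its column
  \<open>r\<close> with index \<open>k\<close> satisfies \<open>\<kappa> |r|\<^sup>2 \<le> r\<^sup>T
  P r = r\<^sub>k \<le> |r|\<close>, which bounds the entries by
  \<open>1 / \<kappa>\<close>.\<close>

lemma symmetric_inverse_measurable:
  fixes P :: "real \<Rightarrow> nat \<Rightarrow> nat \<Rightarrow> real"
  assumes m: "\<And>i j. (\<lambda>t. P t i j) \<in> borel_measurable borel"
    and \<kappa>: "\<kappa> > 0" and ge: "\<And>t. loewner_ge d (P t) \<kappa>"
  shows "\<exists>R. (\<forall>i j. (\<lambda>t. R t i j) \<in> borel_measurable borel) \<and> (\<forall>t i j. \<bar>R t i j\<bar> \<le> 1 / \<kappa>) \<and>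
    (\<forall>t. \<forall>i<d. \<forall>k<d. (\<Sum>j<d. P t i j * R t j k) = (if i = k then 1 else 0)) \<and>
    (\<forall>t. \<forall>i<d. \<forall>k<d. (\<Sum>j<d. R t i j * P t j k) = (if i = k then 1 else 0))"
proof -
  define A where "A = (\<lambda>t. mat d d (\<lambda>(i,j). P t i j))"
  have A: "A t \<in> carrier_mat d d" for t by (simp add: A_def)
  have det0: "det (A t) \<noteq> 0" for t
  proof
    assume "det (A t) = 0"
    then obtain v where v: "v \<in> carrier_vec d" "v \<noteq> 0\<^sub>v d" "A t *\<^sub>v v = 0\<^sub>v d"
      using det_0_iff_vec_prod_zero_field[OF A] by blast
    have 0: "(\<Sum>j<d. P t i j * v $ j) = 0" if i: "i < d" for i
    proof -
      have "(A t *\<^sub>v v) $ i = (\<Sum>j<d. P t i j * v $ j)"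
        using v(1) i by (simp add: A_def scalar_prod_def atLeast0LessThan)
      then show ?thesis using v(3) i by simp
    qed
    have "\<kappa> * (\<Sum>i<d. (v $ i)\<^sup>2) \<le> (\<Sum>i<d. \<Sum>j<d. v $ i * P t i j * v $ j)"
      using ge[of t] unfolding loewner_ge_def by blast
    also have "\<dots> = (\<Sum>i<d. v $ i * (\<Sum>j<d. P t i j * v $ j))" by (simp add: sum_distrib_left mult.assoc)
    also have "\<dots> = 0" using 0 by simp
    finally have "(\<Sum>i<d. (v $ i)\<^sup>2) \<le> 0" using \<kappa> by (simp add: mult_le_0_iff)
    moreover have "(\<Sum>i<d. (v $ i)\<^sup>2) \<ge> 0" by (intro sum_nonneg) auto
    ultimately have "\<forall>i<d. v $ i = 0" by (subst (asm) antisym) (auto simp: sum_nonneg_eq_0_iff)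
    then have "v = 0\<^sub>v d" using v(1) by (intro eq_vecI) auto
    then show False using v(2) by simp
  qed
  define R where "R = (\<lambda>t i j. if i < d \<and> j < d then adj_mat (A t) $$ (i, j) / det (A t) else 0)"
  note adj = adj_mat[OF A]
  have PR: "(\<Sum>j<d. P t i j * R t j k) = (if i = k then 1 else 0)" if ik: "i < d" "k < d" for t i k
  proof -
    have "(\<Sum>j<d. P t i j * R t j k) = (\<Sum>j<d. A t $$ (i, j) * adj_mat (A t) $$ (j, k)) / det (A t)"
      using ik by (simp add: R_def A_def sum_divide_distrib)
    also have "(\<Sum>j<d. A t $$ (i, j) * adj_mat (A t) $$ (j, k)) = (A t * adj_mat (A t)) $$ (i, k)"
      using ik A[of t] adj(1)[of t] by (simp add: scalar_prod_def atLeast0LessThan)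
    also have "\<dots> = det (A t) * (if i = k then 1 else 0)" unfolding adj(2) using ik by simp
    finally show ?thesis using det0[of t] by simp
  qed
  have RP: "(\<Sum>j<d. R t i j * P t j k) = (if i = k then 1 else 0)" if ik: "i < d" "k < d" for t i k
  proof -
    have "(\<Sum>j<d. R t i j * P t j k) = (\<Sum>j<d. adj_mat (A t) $$ (i, j) * A t $$ (j, k)) / det (A t)"
      using ik by (simp add: R_def A_def sum_divide_distrib)
    also have "(\<Sum>j<d. adj_mat (A t) $$ (i, j) * A t $$ (j, k)) = (adj_mat (A t) * A t) $$ (i, k)"
      using ik A[of t] adj(1)[of t] by (simp add: scalar_prod_def atLeast0LessThan)
    also have "\<dots> = det (A t) * (if i = k then 1 else 0)" unfolding adj(3) using ik by simp
    finally show ?thesis using det0[of t] by simp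
  qed
  have Rb: "\<bar>R t i k\<bar> \<le> 1 / \<kappa>" for t i k
  proof (cases "i < d \<and> k < d")
    case False then show ?thesis using \<kappa> by (simp only: R_def if_False) simp
  next
    case True
    then have ik: "i < d" "k < d" by auto
    define s where "s = (\<Sum>i<d. (R t i k)\<^sup>2)"
    have Rs: "(R t j k)\<^sup>2 \<le> s" if "j < d" for j unfolding s_def using that by (intro member_le_sum) auto
    have "\<kappa> * s \<le> (\<Sum>i<d. \<Sum>j<d. R t i k * P t i j * R t j k)"
      unfolding s_def by (rule ge[unfolded loewner_ge_def, rule_format])
    also have "\<dots> = (\<Sum>i<d. R t i k * (\<Sum>j<d. P t i j * R t j k))" by (simp add: sum_distrib_left mult.assoc)
    also have "\<dots> = (\<Sum>i<d. R t i k * (if i = k then 1 else 0))" using PR ik by (intro sum.cong) auto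
    also have "\<dots> = R t k k" using ik by (simp add: if_distrib sum.delta cong: if_cong)
    finally have 1: "\<kappa> * s \<le> R t k k" .
    have s0: "s \<ge> 0" unfolding s_def by (intro sum_nonneg) auto
    have "(\<kappa> * s)\<^sup>2 \<le> (R t k k)\<^sup>2" using 1 s0 \<kappa> by (intro power_mono) auto
    also have "\<dots> \<le> s" using Rs ik by simp
    finally have "\<kappa>\<^sup>2 * s * s \<le> 1 * s" by (simp add: power2_eq_square mult_ac)
    then have "\<kappa>\<^sup>2 * s \<le> 1" using s0 by (cases "s = 0") (auto simp: mult_le_cancel_right)
    then have "s \<le> (1 / \<kappa>)\<^sup>2" using \<kappa> by (simp add: power_divide field_simps)
    then have "(R t i k)\<^sup>2 \<le> (1 / \<kappa>)\<^sup>2" using Rs[OF ik(1)] by simp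
    then show ?thesis using \<kappa> by (simp add: abs_le_square_iff[symmetric])
  qed
  have Rm: "(\<lambda>t. R t i j) \<in> borel_measurable borel" for i j
  proof (cases "i < d \<and> j < d")
    case False
    then have "(\<lambda>t. R t i j) = (\<lambda>t. 0)" by (auto simp: R_def)
    then show ?thesis by simp
  next
    case True
    have dm: "(\<lambda>t. det (A t)) \<in> borel_measurable borel"
      by (rule measurable_det[OF A]) (use m in \<open>simp add: A_def\<close>)
    have "(\<lambda>t. det (mat_delete (A t) j i)) \<in> borel_measurable borel"
    proof (rule measurable_det[of _ "d - 1"])
      show "mat_delete (A t) j i \<in> carrier_mat (d - 1) (d - 1)" for t using A by (rule mat_delete_carrier)
      show "(\<lambda>t. mat_delete (A t) j i $$ (i', j')) \<in> borel_measurable borel" if "i' < d - 1" "j' < d - 1" for i' j'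
      proof -
        have "(\<lambda>t. mat_delete (A t) j i $$ (i', j')) = (\<lambda>t. P t (if i' < j then i' else Suc i') (if j' < i then j' else Suc j'))"
          using that by (auto simp: mat_delete_def A_def)
        then show ?thesis using m by simp
      qed
    qed
    then have "(\<lambda>t. cofactor (A t) j i / det (A t)) \<in> borel_measurable borel"
      unfolding cofactor_def using dm by (intro borel_measurable_divide borel_measurable_times) auto
    moreover have "(\<lambda>t. R t i j) = (\<lambda>t. cofactor (A t) j i / det (A t))"
      using True A by (intro ext) (simp add: R_def adj_mat_def A_def)
    ultimately show ?thesis by simp
  qed
  show ?thesis using PR RP Rb Rm by (intro exI[of _ R]) blast
qed

lemma Linf_entry_borel_version:
  assumes "Linf_entry a b f"
  shows "\<exists>g C. g \<in> borel_measurable borel \<and> (AE t in lborel. t \<in> {a..b} \<longrightarrow> f t = g t \<and> \<bar>f t\<bar> \<le> C)"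
proof -
  have "(\<lambda>t. indicat_real {a..b} t *\<^sub>R f t) \<in> borel_measurable (completion lborel)"
    using assms unfolding Linf_entry_def set_borel_measurable_def by simp
  then obtain g where g: "g \<in> borel_measurable lborel" "AE t in lborel. indicat_real {a..b} t *\<^sub>R f t = g t"
    using completion_ex_borel_measurable_real by blast
  obtain C where "AE t in lebesgue. t \<in> {a..b} \<longrightarrow> \<bar>f t\<bar> \<le> C" using assms unfolding Linf_entry_def by blast
  then have "AE t in lborel. t \<in> {a..b} \<longrightarrow> \<bar>f t\<bar> \<le> C" by (simp only: AE_completion_iff)
  with g(2) have "AE t in lborel. t \<in> {a..b} \<longrightarrow> f t = g t \<and> \<bar>f t\<bar> \<le> C" by eventually_elim auto
  then show ?thesis using g(1) by auto
qed

lemma sym_Linf_borel_version: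
  assumes "sym_Linf d a b P"
  shows "\<exists>G C. (\<forall>i j. (\<lambda>t. G t i j) \<in> borel_measurable borel) \<and>
    (AE t in lborel. t \<in> {a..b} \<longrightarrow> (\<forall>i<d. \<forall>j<d. P t i j = G t i j \<and> \<bar>P t i j\<bar> \<le> C \<and> P t i j = P t j i))"
proof -
  have "\<exists>h. fst h \<in> borel_measurable borel \<and> (fst p < d \<and> snd p < d \<longrightarrow>
      (AE t in lborel. t \<in> {a..b} \<longrightarrow> P t (fst p) (snd p) = fst h t \<and> \<bar>P t (fst p) (snd p)\<bar> \<le> snd h))" (is "\<exists>h. ?F p h") for p
  proof (cases "fst p < d \<and> snd p < d")
    case True
    then obtain g C where "g \<in> borel_measurable borel" "AE t in lborel. t \<in> {a..b} \<longrightarrow> P t (fst p) (snd p) = g t \<and> \<bar>P t (fst p) (snd p)\<bar> \<le> C"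
      using assms Linf_entry_borel_version[of a b "\<lambda>t. P t (fst p) (snd p)"] unfolding sym_Linf_def by blast
    then show ?thesis by (intro exI[of _ "(g, C)"]) simp
  next
    case False
    then show ?thesis by (intro exI[of _ "(\<lambda>_. 0, 0)"]) auto
  qed
  then have "\<exists>h. \<forall>p. ?F p (h p)" by (intro choice allI)
  then obtain h where h: "\<And>p. ?F p (h p)" by blast
  define g where "g = (\<lambda>i j. fst (h (i, j)))"
  define C where "C = (\<lambda>i j. snd (h (i, j)))"
  have g: "\<And>i j. g i j \<in> borel_measurable borel"
    "\<And>i j. i < d \<Longrightarrow> j < d \<Longrightarrow> AE t in lborel. t \<in> {a..b} \<longrightarrow> P t i j = g i j t \<and> \<bar>P t i j\<bar> \<le> C i j"
    using h by (auto simp: g_def C_def)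
  define C' where "C' = (\<Sum>i<d. \<Sum>j<d. \<bar>C i j\<bar>)"
  have C': "C i j \<le> C'" if "i < d" "j < d" for i j
  proof -
    have "\<bar>C i j\<bar> \<le> (\<Sum>j<d. \<bar>C i j\<bar>)" using that by (intro member_le_sum) auto
    also have "\<dots> \<le> C'" unfolding C'_def using that by (intro member_le_sum) (auto intro: sum_nonneg)
    finally show ?thesis by linarith
  qed
  have "AE t in lborel. \<forall>p\<in>{..<d}\<times>{..<d}. t \<in> {a..b} \<longrightarrow> P t (fst p) (snd p) = g (fst p) (snd p) t \<and> \<bar>P t (fst p) (snd p)\<bar> \<le> C (fst p) (snd p)"
    by (rule AE_finite_allI) (use g(2) in auto)
  moreover have "AE t in lebesgue. t \<in> {a..b} \<longrightarrow> (\<forall>i<d. \<forall>j<d. P t i j = P t j i)" using assms unfolding sym_Linf_def by blast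
  then have "AE t in lborel. t \<in> {a..b} \<longrightarrow> (\<forall>i<d. \<forall>j<d. P t i j = P t j i)" by (simp only: AE_completion_iff)
  ultimately have "AE t in lborel. t \<in> {a..b} \<longrightarrow> (\<forall>i<d. \<forall>j<d. P t i j = g i j t \<and> \<bar>P t i j\<bar> \<le> C' \<and> P t i j = P t j i)"
  proof eventually_elim
    case (elim t)
    show ?case
    proof (intro impI allI)
      fix i j assume t: "t \<in> {a..b}" and ij: "i < d" "j < d"
      have 1: "P t i j = g i j t" "\<bar>P t i j\<bar> \<le> C i j" using elim(1) t ij by force+
      have 2: "P t i j = P t j i" using elim(2) t ij by blast
      show "P t i j = g i j t \<and> \<bar>P t i j\<bar> \<le> C' \<and> P t i j = P t j i"
        using 1 2 order_trans[OF 1(2) C'[OF ij]] by blast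
    qed
  qed
  then show ?thesis using g(1) by (intro exI[of _ "\<lambda>t i j. g i j t"] exI[of _ C']) simp
qed

lemma loewner_ge_mono: "loewner_ge d M c \<Longrightarrow> c' \<le> c \<Longrightarrow> loewner_ge d M c'"
  unfolding loewner_ge_def by (meson mult_right_mono order_trans sum_nonneg zero_le_power2)

lemma loewner_ge_scaled_identity: "loewner_ge d (\<lambda>i j. if i = j then c else 0) c"
proof -
  have "(\<Sum>i<d. \<Sum>j<d. x i * (if i = j then c else 0) * x j) = c * (\<Sum>i<d. (x i)\<^sup>2)" for x :: "nat \<Rightarrow> real"
  proof -
    have "(\<Sum>j<d. x i * (if i = j then c else 0) * x j) = c * (x i)\<^sup>2" if "i < d" for i
    proof -
      have "(\<Sum>j<d. x i * (if i = j then c else 0) * x j) = (\<Sum>j<d. if i = j then c * (x i)\<^sup>2 else 0)"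
        by (intro sum.cong refl) (auto simp: power2_eq_square)
      then show ?thesis using that by (simp add: sum.delta)
    qed
    then show ?thesis by (simp add: sum_distrib_left)
  qed
  then show ?thesis unfolding loewner_ge_def by simp
qed

text \<open>Outside a null set the coefficients agree with Borel functions; on the null set and outside
  of the interval they are replaced by multiples of the identity.\<close>

theorem in_Omega_regular_version:
  assumes "in_Omega d a b P Q W" "a < b"
  shows "\<exists>P' Q' W' R C \<kappa>. sl_coeffs d a b P' Q' W' R C \<kappa> \<and>
    (AE t in lborel. t \<in> {a..b} \<longrightarrow> (\<forall>i<d. \<forall>j<d. P t i j = P' t i j \<and> Q t i j = Q' t i j \<and> W t i j = W' t i j))"
proof -
  obtain \<mu>1 \<mu>2 where \<mu>: "\<mu>1 > 0" "\<mu>2 > 0" "AE t in lebesgue. t \<in> {a..b} \<longrightarrow> loewner_ge d (P t) \<mu>1"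
    "AE t in lebesgue. t \<in> {a..b} \<longrightarrow> loewner_ge d (W t) \<mu>2" and L: "sym_Linf d a b P" "sym_Linf d a b Q" "sym_Linf d a b W"
    using assms unfolding in_Omega_def by blast
  define \<kappa> where "\<kappa> = min \<mu>1 \<mu>2"
  have \<kappa>: "\<kappa> > 0" using \<mu> by (simp add: \<kappa>_def)
  obtain GP CP where GP: "\<And>i j. (\<lambda>t. GP t i j) \<in> borel_measurable borel"
    "AE t in lborel. t \<in> {a..b} \<longrightarrow> (\<forall>i<d. \<forall>j<d. P t i j = GP t i j \<and> \<bar>P t i j\<bar> \<le> CP \<and> P t i j = P t j i)"
    using sym_Linf_borel_version[OF L(1)] by blast
  obtain GQ CQ where GQ: "\<And>i j. (\<lambda>t. GQ t i j) \<in> borel_measurable borel"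
    "AE t in lborel. t \<in> {a..b} \<longrightarrow> (\<forall>i<d. \<forall>j<d. Q t i j = GQ t i j \<and> \<bar>Q t i j\<bar> \<le> CQ \<and> Q t i j = Q t j i)"
    using sym_Linf_borel_version[OF L(2)] by blast
  obtain GW CW where GW: "\<And>i j. (\<lambda>t. GW t i j) \<in> borel_measurable borel"
    "AE t in lborel. t \<in> {a..b} \<longrightarrow> (\<forall>i<d. \<forall>j<d. W t i j = GW t i j \<and> \<bar>W t i j\<bar> \<le> CW \<and> W t i j = W t j i)"
    using sym_Linf_borel_version[OF L(3)] by blast
  have lo: "AE t in lborel. t \<in> {a..b} \<longrightarrow> loewner_ge d (P t) \<mu>1" "AE t in lborel. t \<in> {a..b} \<longrightarrow> loewner_ge d (W t) \<mu>2"
    using \<mu>(3,4) by (simp_all only: AE_completion_iff)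
  define good where "good = (\<lambda>t. (\<forall>i<d. \<forall>j<d. P t i j = GP t i j \<and> \<bar>P t i j\<bar> \<le> CP \<and> P t i j = P t j i) \<and>
     (\<forall>i<d. \<forall>j<d. Q t i j = GQ t i j \<and> \<bar>Q t i j\<bar> \<le> CQ \<and> Q t i j = Q t j i) \<and>
     (\<forall>i<d. \<forall>j<d. W t i j = GW t i j \<and> \<bar>W t i j\<bar> \<le> CW \<and> W t i j = W t j i) \<and>
     loewner_ge d (P t) \<mu>1 \<and> loewner_ge d (W t) \<mu>2)"
  have "AE t in lborel. t \<in> {a..b} \<longrightarrow> good t"
    using GP(2) GQ(2) GW(2) lo by eventually_elim (unfold good_def, blast)
  then obtain N where N: "{t \<in> space lborel. \<not> (t \<in> {a..b} \<longrightarrow> good t)} \<subseteq> N" "emeasure lborel N = 0" "N \<in> sets lborel"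
    by (rule AE_E)
  \<comment> \<open>\<open>N\<close> is a Borel null set containing all bad points of the interval,
    so \<open>D\<close> is Borel although the set of good points need not be.\<close>
  define D where "D = {a..b} - N"
  have D: "D \<in> sets borel" using N(3) by (simp add: D_def)
  have Dg: "good t" if "t \<in> D" for t using N(1) that by (auto simp: D_def)
  define ext where "ext = (\<lambda>G c (t::real) i j. if t \<in> D \<and> i < d \<and> j < d then G t i j else (if i = j then c else (0::real)))"
  have ext_m: "(\<lambda>t. ext G c t i j) \<in> borel_measurable borel" if "\<And>i j. (\<lambda>t. G t i j) \<in> borel_measurable borel" for G c i j
  proof -
    have "(\<lambda>t. if t \<in> D then (if i < d \<and> j < d then G t i j else (if i = j then c else 0)) else (if i = j then c else 0)) \<in> borel_measurable borel"
      using D that by (intro measurable_If_set) auto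
    moreover have "(\<lambda>t. ext G c t i j) = (\<lambda>t. if t \<in> D then (if i < d \<and> j < d then G t i j else (if i = j then c else 0)) else (if i = j then c else 0))"
      by (auto simp: ext_def)
    ultimately show ?thesis by simp
  qed
  \<comment> \<open>The filler \<kappa> times the identity preserves the lower bounds of
    \<open>P\<close> and \<open>W\<close>; for \<open>Q\<close> it is 0.\<close>
  define P' where "P' = ext GP \<kappa>"
  define Q' where "Q' = ext GQ 0"
  define W' where "W' = ext GW \<kappa>"
  have eqs: "P' t i j = P t i j" "Q' t i j = Q t i j" "W' t i j = W t i j" if "t \<in> D" "i < d" "j < d" for t i j
    using Dg[OF that(1)] that by (auto simp: P'_def Q'_def W'_def ext_def good_def)
  have offD: "P' t i j = (if i = j then \<kappa> else 0)" "Q' t i j = (if i = j then 0 else 0)" "W' t i j = (if i = j then \<kappa> else 0)" if "\<not> (t \<in> D \<and> i < d \<and> j < d)" for t i j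
    using that by (auto simp: P'_def Q'_def W'_def ext_def)
  have P'm: "\<And>i j. (\<lambda>t. P' t i j) \<in> borel_measurable borel" unfolding P'_def by (rule ext_m[OF GP(1)])
  have lge: "loewner_ge d (P' t) \<kappa>" "loewner_ge d (W' t) \<kappa>" for t
  proof -
    have cong: "loewner_ge d M \<kappa> \<longleftrightarrow> loewner_ge d M' \<kappa>" if "\<And>i j. i < d \<Longrightarrow> j < d \<Longrightarrow> M i j = M' i j" for M M'
      unfolding loewner_ge_def using that by simp
    have "loewner_ge d (P' t) \<kappa> \<and> loewner_ge d (W' t) \<kappa>"
    proof (cases "t \<in> D")
      case True
      have "loewner_ge d (P t) \<kappa>" "loewner_ge d (W t) \<kappa>"
        using Dg[OF True] loewner_ge_mono[of d _ _ \<kappa>] unfolding good_def \<kappa>_def by auto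
      moreover have "loewner_ge d (P' t) \<kappa> \<longleftrightarrow> loewner_ge d (P t) \<kappa>" "loewner_ge d (W' t) \<kappa> \<longleftrightarrow> loewner_ge d (W t) \<kappa>"
        using eqs[OF True] by (intro cong; simp)+
      ultimately show ?thesis by blast
    next
      case False
      have "P' t = (\<lambda>i j. if i = j then \<kappa> else 0)" "W' t = (\<lambda>i j. if i = j then \<kappa> else 0)"
        using offD False by (intro ext; blast)+
      then show ?thesis using loewner_ge_scaled_identity[of d \<kappa>] by simp
    qed
    then show "loewner_ge d (P' t) \<kappa>" "loewner_ge d (W' t) \<kappa>" by auto
  qed
  obtain R where R: "\<And>i j. (\<lambda>t. R t i j) \<in> borel_measurable borel" "\<And>t i j. \<bar>R t i j\<bar> \<le> 1 / \<kappa>"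
    "\<And>t i k. i < d \<Longrightarrow> k < d \<Longrightarrow> (\<Sum>j<d. P' t i j * R t j k) = (if i = k then 1 else 0)"
    "\<And>t i k. i < d \<Longrightarrow> k < d \<Longrightarrow> (\<Sum>j<d. R t i j * P' t j k) = (if i = k then 1 else 0)"
    using symmetric_inverse_measurable[OF P'm \<kappa> lge(1)] by blast
  define C where "C = \<kappa> + 1 / \<kappa> + \<bar>CP\<bar> + \<bar>CQ\<bar> + \<bar>CW\<bar>"
  have C: "\<kappa> \<le> C" "1 / \<kappa> \<le> C" "CP \<le> C" "CQ \<le> C" "CW \<le> C" "0 \<le> C"   proof -
    have "0 < 1 / \<kappa>" using \<kappa> by simp
    then show "\<kappa> \<le> C" "1 / \<kappa> \<le> C" "CP \<le> C" "CQ \<le> C" "CW \<le> C" "0 \<le> C"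
      unfolding C_def using \<kappa> by linarith+
  qed
  have b: "\<bar>P' t i j\<bar> \<le> C" "\<bar>Q' t i j\<bar> \<le> C" "\<bar>W' t i j\<bar> \<le> C" for t i j
  proof -
    have "\<bar>P' t i j\<bar> \<le> C \<and> \<bar>Q' t i j\<bar> \<le> C \<and> \<bar>W' t i j\<bar> \<le> C"
    proof (cases "t \<in> D \<and> i < d \<and> j < d")
      case True
      then have "\<bar>P t i j\<bar> \<le> CP" "\<bar>Q t i j\<bar> \<le> CQ" "\<bar>W t i j\<bar> \<le> CW" using Dg[of t] unfolding good_def by blast+
      then show ?thesis using eqs[of t i j] True C by (metis order_trans)
    next
      case False
      then show ?thesis using offD[OF False] C \<kappa> by auto
    qed
    then show "\<bar>P' t i j\<bar> \<le> C" "\<bar>Q' t i j\<bar> \<le> C" "\<bar>W' t i j\<bar> \<le> C" by auto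
  qed
  have s: "P' t j i = P' t i j" "Q' t j i = Q' t i j" "W' t j i = W' t i j" for t i j
  proof -
    have "P' t j i = P' t i j \<and> Q' t j i = Q' t i j \<and> W' t j i = W' t i j"
    proof (cases "t \<in> D \<and> i < d \<and> j < d")
      case True
      then have "P t i j = P t j i" "Q t i j = Q t j i" "W t i j = W t j i" using Dg[of t] unfolding good_def by blast+
      then show ?thesis using eqs[of t i j] eqs[of t j i] True by simp
    next
      case False
      then have "\<not> (t \<in> D \<and> j < d \<and> i < d)" by blast
      from offD[OF False] offD[OF this] show ?thesis by auto
    qed
    then show "P' t j i = P' t i j" "Q' t j i = Q' t i j" "W' t j i = W' t i j" by auto
  qed
  have "sl_coeffs d a b P' Q' W' R C \<kappa>"
  proof
    show "\<And>i j. (\<lambda>t. Q' t i j) \<in> borel_measurable borel" unfolding Q'_def by (rule ext_m[OF GQ(1)])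
    show "\<And>i j. (\<lambda>t. W' t i j) \<in> borel_measurable borel" unfolding W'_def by (rule ext_m[OF GW(1)])
    show "\<bar>R t i j\<bar> \<le> C" for t i j using R(2)[of t i j] C(2) by linarith
  qed (fact assms(2) \<kappa> P'm R(1) b s lge R(3,4))+
  moreover have "AE t in lborel. t \<in> {a..b} \<longrightarrow> (\<forall>i<d. \<forall>j<d. P t i j = P' t i j \<and> Q t i j = Q' t i j \<and> W t i j = W' t i j)"
  proof (rule AE_I)
    show "{t \<in> space lborel. \<not> (t \<in> {a..b} \<longrightarrow> (\<forall>i<d. \<forall>j<d. P t i j = P' t i j \<and> Q t i j = Q' t i j \<and> W t i j = W' t i j))} \<subseteq> N"
    proof (rule subsetI, rule ccontr)
      fix t assume t: "t \<in> {t \<in> space lborel. \<not> (t \<in> {a..b} \<longrightarrow> (\<forall>i<d. \<forall>j<d. P t i j = P' t i j \<and> Q t i j = Q' t i j \<and> W t i j = W' t i j))}" "t \<notin> N"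
      then have "t \<in> D" by (simp add: D_def)
      then show False using t eqs by auto
    qed
  qed (use N in auto)
  ultimately show ?thesis by blast
qed

lemma eigfun_cong_AE:
  assumes "AE t in lborel. t \<in> {a..b} \<longrightarrow> (\<forall>i<d. \<forall>j<d. P t i j = P' t i j \<and> Q t i j = Q' t i j \<and> W t i j = W' t i j)"
  shows "eigfun d a b P Q W A lam y \<longleftrightarrow> eigfun d a b P' Q' W' A lam y"
proof -
  have "(AE s in lborel. s \<in> {a..b} \<longrightarrow>
           (\<forall>i<d. u s i = (\<Sum>j<d. complex_of_real (P s i j) * y' s j) \<and>
                  u' s i = (\<Sum>j<d. (complex_of_real (Q s i j) - lam * complex_of_real (W s i j)) * y s j))) \<longleftrightarrow>
      (AE s in lborel. s \<in> {a..b} \<longrightarrow>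
           (\<forall>i<d. u s i = (\<Sum>j<d. complex_of_real (P' s i j) * y' s j) \<and>
                  u' s i = (\<Sum>j<d. (complex_of_real (Q' s i j) - lam * complex_of_real (W' s i j)) * y s j)))" for u y' u'
  proof (rule eventually_subst)
    show "\<forall>\<^sub>F s in ae_filter lborel. (s \<in> {a..b} \<longrightarrow>
           (\<forall>i<d. u s i = (\<Sum>j<d. complex_of_real (P s i j) * y' s j) \<and>
                  u' s i = (\<Sum>j<d. (complex_of_real (Q s i j) - lam * complex_of_real (W s i j)) * y s j))) =
      (s \<in> {a..b} \<longrightarrow>
           (\<forall>i<d. u s i = (\<Sum>j<d. complex_of_real (P' s i j) * y' s j) \<and>
                  u' s i = (\<Sum>j<d. (complex_of_real (Q' s i j) - lam * complex_of_real (W' s i j)) * y s j)))"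
      using assms by eventually_elim auto
  qed
  then show ?thesis unfolding eigfun_def by simp
qed

lemma eigval_cong_AE:
  assumes "AE t in lborel. t \<in> {a..b} \<longrightarrow> (\<forall>i<d. \<forall>j<d. P t i j = P' t i j \<and> Q t i j = Q' t i j \<and> W t i j = W' t i j)"
  shows "eigval d a b P Q W = eigval d a b P' Q' W'"
  unfolding eigval_def eig_count_def eig_mult_def eigfun_cong_AE[OF assms] ..

section \<open>Inertia and eigenvalues of \<open>S\<^sub>K\<close>\<close>

lemma order_prod_linear:
  fixes c :: "nat \<Rightarrow> 'a::field"
  shows "Polynomial.order x (\<Prod>k<n. [:- c k, 1:]) = card {k. k < n \<and> c k = x}"
proof (induction n)
  case 0
  show ?case by (simp add: order_0I)
next
  case (Suc n)
  have nz: "(\<Prod>k<n. [:- c k, 1:]) \<noteq> 0" by simp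
  have o: "Polynomial.order x [:- c n, 1:] = (if c n = x then 1 else 0)"
    using order_power_n_n[of "c n" 1] by (auto intro: order_0I)
  have "Polynomial.order x (\<Prod>k<Suc n. [:- c k, 1:]) = Polynomial.order x (\<Prod>k<n. [:- c k, 1:]) + Polynomial.order x [:- c n, 1:]"
    using nz by (simp add: order_mult del: mult_pCons_right)
  also have "\<dots> = card {k. k < n \<and> c k = x} + (if c n = x then 1 else 0)" unfolding Suc.IH o ..
  also have "\<dots> = card {k. k < Suc n \<and> c k = x}"
  proof -
    have "{k. k < Suc n \<and> c k = x} = (if c n = x then insert n {k. k < n \<and> c k = x} else {k. k < n \<and> c k = x})"
      by (auto simp: less_Suc_eq)
    then show ?thesis by simp
  qed
  finally show ?case .
qed

lemma inertia_of_real_linear_factors: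
  fixes ev :: "nat \<Rightarrow> real"
  assumes p: "char_poly M = (\<Prod>k<n. [:- complex_of_real (ev k), 1:])"
  shows "inertia M = (card {k. k < n \<and> ev k = 0}, card {k. k < n \<and> ev k > 0}, card {k. k < n \<and> ev k < 0})"
proof -
  have root: "poly (char_poly M) x = 0 \<longleftrightarrow> (\<exists>k<n. x = complex_of_real (ev k))" for x
    unfolding p by (auto simp: poly_prod)
  have ord: "Polynomial.order (complex_of_real r) (char_poly M) = card {k. k < n \<and> ev k = r}" for r
    unfolding p order_prod_linear by simp
  have sums: "(\<Sum>x\<in>{x. poly (char_poly M) x = 0 \<and> Im x = 0 \<and> T (Re x)}. Polynomial.order x (char_poly M)) = card {k. k < n \<and> T (ev k)}" for T
  proof -
    have R: "{x. poly (char_poly M) x = 0 \<and> Im x = 0 \<and> T (Re x)} = complex_of_real ` (ev ` {k. k < n \<and> T (ev k)})"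
      unfolding root by auto
    have "(\<Sum>x\<in>{x. poly (char_poly M) x = 0 \<and> Im x = 0 \<and> T (Re x)}. Polynomial.order x (char_poly M)) =
       (\<Sum>r\<in>ev ` {k. k < n \<and> T (ev k)}. card {k. k < n \<and> ev k = r})"
      unfolding R by (subst sum.reindex) (auto simp: ord inj_on_def)
    also have "\<dots> = (\<Sum>r\<in>ev ` {k. k < n \<and> T (ev k)}. card {k \<in> {k. k < n \<and> T (ev k)}. ev k = r})"
      by (intro sum.cong refl arg_cong[where f = card]) auto
    also have "\<dots> = (\<Sum>r\<in>ev ` {k. k < n \<and> T (ev k)}. \<Sum>k\<in>{k \<in> {k. k < n \<and> T (ev k)}. ev k = r}. 1)" by simp
    also have "\<dots> = (\<Sum>k\<in>{k. k < n \<and> T (ev k)}. 1)" by (rule sum.image_gen[symmetric]) simp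
    finally show ?thesis by simp
  qed
  show ?thesis unfolding inertia_def Let_def
    using sums[of "\<lambda>x. 0 < x"] sums[of "\<lambda>x. x < 0"] ord[of 0] by simp
qed

lemma mat_adjoint_index:
  assumes "A \<in> carrier_mat n m" "i < m" "j < n"
  shows "mat_adjoint A $$ (i, j) = cnj (A $$ (j, i))"
  using assms unfolding mat_adjoint_def by (simp add: mat_of_rows_index)

lemma hermitian_mat_entry:
  assumes "S \<in> carrier_mat n n" "hermitian_mat S" "i < n" "j < n"
  shows "S $$ (j, i) = cnj (S $$ (i, j))"
  using mat_adjoint_index[OF assms(1,4,3)] assms(2) unfolding hermitian_mat_def by simp

lemma sub_K_bij:
  assumes "K \<subseteq> {1..2*d}"
  shows "bij_betw (\<lambda>k. sorted_list_of_set K ! k - 1) {..<card K} {i. i < 2*d \<and> Suc i \<in> K}"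
proof -
  have fin: "finite K" using assms finite_subset by blast
  have 1: "bij_betw (\<lambda>k. sorted_list_of_set K ! k) {..<card K} K"
    by (rule bij_betw_nth) (use fin in auto)
  have 2: "bij_betw (\<lambda>i. i - 1) K {i. i < 2*d \<and> Suc i \<in> K}"
    by (rule bij_betw_byWitness[of _ Suc]) (use assms in \<open>force+\<close>)
  show ?thesis using bij_betw_trans[OF 1 2] by (simp add: comp_def)
qed

text \<open>\<open>inertia\<close> is defined by root orders of the characteristic polynomial.
  Similarity to the diagonal matrix of the \<open>ev k\<close> turns it into counts of eigenvalues;
  \<beta> translates positions in \<open>sub_K\<close> into indices of \<open>S\<close>.\<close>

theorem sub_K_eigenbasis:
  assumes K: "K \<subseteq> {1..2*d}" and S: "S \<in> carrier_mat (2*d) (2*d)" "hermitian_mat S"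
  shows "\<exists>e ev. orthonormal_family {i. i < 2*d \<and> Suc i \<in> K} (card K) e \<and>
     (\<forall>k<card K. \<forall>i\<in>{i. i < 2*d \<and> Suc i \<in> K}. (\<Sum>j\<in>{i. i < 2*d \<and> Suc i \<in> K}. S $$ (i, j) * e k j) = complex_of_real (ev k) * e k i) \<and>
     inertia (sub_K K S) = (card {k. k < card K \<and> ev k = 0}, card {k. k < card K \<and> ev k > 0}, card {k. k < card K \<and> ev k < 0})"
proof -
  let ?I = "{i. i < 2*d \<and> Suc i \<in> K}"
  define n where "n = card K"
  define \<beta> where "\<beta> = (\<lambda>k. sorted_list_of_set K ! k - 1)"
  have \<beta>: "bij_betw \<beta> {..<n} ?I" unfolding \<beta>_def n_def by (rule sub_K_bij[OF K])
  have cI: "card ?I = n" using bij_betw_same_card[OF \<beta>] by simp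
  have \<beta>I: "\<beta> k \<in> ?I" if "k < n" for k using \<beta> that by (auto simp: bij_betw_def)
  have sum\<beta>: "(\<Sum>i\<in>?I. f i) = (\<Sum>k<n. f (\<beta> k))" for f :: "nat \<Rightarrow> complex"
    by (rule sum.reindex_bij_betw[OF \<beta>, symmetric])
  have "\<exists>e ev. orthonormal_family ?I (card ?I) e \<and>
     (\<forall>k<card ?I. \<forall>i\<in>?I. (\<Sum>j\<in>?I. S $$ (i, j) * e k j) = complex_of_real (ev k) * e k i)"
    by (rule hermitian_orthonormal_eigenbasis, simp, rule hermitian_mat_entry[OF S], auto)
  then obtain e ev where e: "orthonormal_family ?I n e"
    "\<And>k i. k < n \<Longrightarrow> i \<in> ?I \<Longrightarrow> (\<Sum>j\<in>?I. S $$ (i, j) * e k j) = complex_of_real (ev k) * e k i"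
    unfolding cI by blast
  define M where "M = sub_K K S"
  have Mi: "M = mat n n (\<lambda>(i,j). S $$ (\<beta> i, \<beta> j))" unfolding M_def sub_K_def n_def \<beta>_def Let_def ..
  define U where "U = mat n n (\<lambda>(i,k). e k (\<beta> i))"
  define Ui where "Ui = mat n n (\<lambda>(k,i). cnj (e k (\<beta> i)))"
  define D where "D = mat n n (\<lambda>(i,j). if i = j then complex_of_real (ev i) else 0)"
  have car: "M \<in> carrier_mat n n" "U \<in> carrier_mat n n" "Ui \<in> carrier_mat n n" "D \<in> carrier_mat n n"
    by (simp_all add: Mi U_def Ui_def D_def)
  have UiU: "Ui * U = 1\<^sub>m n"
  proof (rule eq_matI)
    fix k l assume "k < dim_row (1\<^sub>m n)" "l < dim_col (1\<^sub>m n)"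
    then have kl: "k < n" "l < n" by auto
    have "(Ui * U) $$ (k, l) = (\<Sum>i<n. cnj (e k (\<beta> i)) * e l (\<beta> i))"
      using kl by (simp add: Ui_def U_def scalar_prod_def atLeast0LessThan)
    also have "\<dots> = cdot ?I (e l) (e k)" unfolding cdot_def sum\<beta> by (simp add: mult.commute)
    also have "\<dots> = 1\<^sub>m n $$ (k, l)" using e(1) kl unfolding orthonormal_family_def by auto
    finally show "(Ui * U) $$ (k, l) = 1\<^sub>m n $$ (k, l)" .
  qed (simp_all add: Ui_def U_def)
  have UUi: "U * Ui = 1\<^sub>m n" by (rule mat_mult_left_right_inverse[OF car(3,2) UiU])
  have MU: "M * U = U * D"
  proof (rule eq_matI)
    fix i k assume "i < dim_row (U * D)" "k < dim_col (U * D)"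
    then have ik: "i < n" "k < n" by (auto simp: U_def D_def)
    have "(M * U) $$ (i, k) = (\<Sum>j<n. S $$ (\<beta> i, \<beta> j) * e k (\<beta> j))"
      using ik by (simp add: Mi U_def scalar_prod_def atLeast0LessThan)
    also have "\<dots> = complex_of_real (ev k) * e k (\<beta> i)" using e(2)[OF ik(2) \<beta>I[OF ik(1)]] unfolding sum\<beta> .
    also have "\<dots> = (\<Sum>j<n. e j (\<beta> i) * (if j = k then complex_of_real (ev j) else 0))"
      using ik by (simp add: if_distrib sum.delta cong: if_cong)
    also have "\<dots> = (U * D) $$ (i, k)" using ik by (simp add: U_def D_def scalar_prod_def atLeast0LessThan)
    finally show "(M * U) $$ (i, k) = (U * D) $$ (i, k)" .
  qed (simp_all add: Mi U_def D_def)
  have "M = M * (U * Ui)" unfolding UUi using car by simp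
  also have "\<dots> = (M * U) * Ui" using car by (simp add: assoc_mult_mat[of M n n U n Ui n])
  finally have "M = U * D * Ui" unfolding MU .
  then have "similar_mat_wit M D U Ui" using car UUi UiU unfolding similar_mat_wit_def Let_def by auto
  then have "similar_mat M D" unfolding similar_mat_def by blast
  then have "char_poly M = char_poly D" by (rule char_poly_similar)
  also have "\<dots> = (\<Prod>a\<leftarrow>diag_mat D. [:- a, 1:])"
    by (rule char_poly_upper_triangular[OF car(4)]) (simp add: D_def upper_triangular_def)
  also have "diag_mat D = map (\<lambda>k. complex_of_real (ev k)) [0..<n]"
    unfolding diag_mat_def by (simp add: D_def)
  also have "(\<Prod>a\<leftarrow>map (\<lambda>k. complex_of_real (ev k)) [0..<n]. [:- a, 1:]) = (\<Prod>k<n. [:- complex_of_real (ev k), 1:])"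
    by (simp add: comp_def atLeast0LessThan flip: prod.distinct_set_conv_list)
  finally have "inertia M = (card {k. k < n \<and> ev k = 0}, card {k. k < n \<and> ev k > 0}, card {k. k < n \<and> ev k < 0})"
    by (rule inertia_of_real_linear_factors)
  then show ?thesis using e unfolding M_def n_def by blast
qed

section \<open>Counting eigenvalues by the index\<close>

context sl_coeffs
begin

lemma Kidx_eq: "{i. i < 2*d \<and> Suc i \<in> K} = Kidx K" unfolding Kidx_def ..

text \<open>The index as a function of the coordinate matrix, whereas \<open>P.ind\<close> belongs
  to one fixed \<open>S\<close>; so different boundary conditions of a chart can be
  compared.\<close>

definition form_index :: "nat set \<Rightarrow> complex mat \<Rightarrow> real \<Rightarrow> nat" where
  "form_index K S \<mu> = negindex (XK K) (\<lambda>x y. Aform K (\<lambda>i j. S $$ (i, j)) x y - complex_of_real \<mu> * Wform x y)"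

abbreviation "orb K S \<equiv> GL_orbit d (rep_K d K S)"

text \<open>The difference \<open>#K - n\<^sup>+(S\<^sub>K)\<close> is the index of the form as \<open>\<mu>\<close> tends to \<open>-\<infinity>\<close>.\<close>

theorem eig_count_index:
  assumes K: "K \<subseteq> {1..2*d}" and S: "S \<in> carrier_mat (2*d) (2*d)" "hermitian_mat S"
  shows "finite {l. 0 < eig_mult d a b P Q W (orb K S) (complex_of_real l) \<and> l \<le> \<mu>}"
    "(card K - fst (snd (inertia (sub_K K S)))) + eig_count d a b P Q W (orb K S) \<mu> =
      form_index K S \<mu> + eig_mult d a b P Q W (orb K S) (complex_of_real \<mu>)"
proof -
  let ?S = "\<lambda>i j. S $$ (i, j)"
  interpret sl_problem d a b P Q W R C \<kappa> K ?S by unfold_locales (rule hermitian_mat_entry[OF S])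
  obtain e ev where e: "orthonormal_family (Kidx K) (card K) e"
     "\<And>k i. k < card K \<Longrightarrow> i\<in>Kidx K \<Longrightarrow> (\<Sum>j\<in>Kidx K. S $$ (i, j) * e k j) = complex_of_real (ev k) * e k i"
     "inertia (sub_K K S) = (card {k. k < card K \<and> ev k = 0}, card {k. k < card K \<and> ev k > 0}, card {k. k < card K \<and> ev k < 0})"
    using sub_K_eigenbasis[OF assms] unfolding Kidx_eq by blast
  have cK: "card (Kidx K) = card K" using bij_betw_same_card[OF sub_K_bij[OF K]] unfolding Kidx_eq by simp
  interpret sl_inertia d a b P Q W R C \<kappa> K ?S e ev by unfold_locales (use e cK in auto)
  have np: "card K - fst (snd (inertia (sub_K K S))) = card Npos"
  proof -
    have "{..<card K} = Npos \<union> {k. k < card K \<and> ev k > 0}" "Npos \<inter> {k. k < card K \<and> ev k > 0} = {}"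
      unfolding Npos_def cK by auto
    moreover have "finite Npos" unfolding Npos_def by auto
    ultimately have "card K = card Npos + card {k. k < card K \<and> ev k > 0}"
      using card_Un_disjoint[of Npos "{k. k < card K \<and> ev k > 0}"] by (metis (no_types, lifting) card_lessThan finite_Un finite_lessThan)
    then show ?thesis unfolding e(3) by simp
  qed
  have nul: "eig_mult d a b P Q W (orb K S) (complex_of_real l) = P.nul l" for l
    by (rule eig_mult_eq_nul[OF assms(2)]) simp
  have ind: "form_index K S \<mu> = P.ind \<mu>" unfolding form_index_def P.ind_def P.Hm_def ..
  have split: "{l. 0 < P.nul l \<and> l \<le> \<mu>} = {l. l < \<mu> \<and> 0 < P.nul l} \<union> (if 0 < P.nul \<mu> then {\<mu>} else {})"
    by (auto simp: le_less)
  show fin: "finite {l. 0 < eig_mult d a b P Q W (orb K S) (complex_of_real l) \<and> l \<le> \<mu>}"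
    unfolding nul split using ind_eq_count(1)[of \<mu>] by auto
  have "eig_count d a b P Q W (orb K S) \<mu> = (\<Sum>l\<in>{l. l < \<mu> \<and> 0 < P.nul l}. P.nul l) + P.nul \<mu>"
    unfolding eig_count_def nul split using ind_eq_count(1)[of \<mu>] by (subst sum.union_disjoint) auto
  then show "(card K - fst (snd (inertia (sub_K K S)))) + eig_count d a b P Q W (orb K S) \<mu> =
      form_index K S \<mu> + eig_mult d a b P Q W (orb K S) (complex_of_real \<mu>)"
    using ind_eq_count(2)[of \<mu>] unfolding np nul ind by simp
qed

theorem form_index_stable:
  assumes S: "S \<in> carrier_mat (2*d) (2*d)" "hermitian_mat S"
    and nul: "eig_mult d a b P Q W (orb K S) (complex_of_real \<mu>) = 0"
  shows "\<exists>\<delta>>0. \<forall>S'\<in>carrier_mat (2*d) (2*d). hermitian_mat S' \<and> (\<forall>i<2*d. \<forall>j<2*d. cmod (S' $$ (i, j) - S $$ (i, j)) \<le> \<delta>)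
     \<longrightarrow> form_index K S' \<mu> = form_index K S \<mu>"
proof -
  let ?S = "\<lambda>i j. S $$ (i, j)"
  interpret sl_problem d a b P Q W R C \<kappa> K ?S by unfold_locales (rule hermitian_mat_entry[OF S])
  have "P.nul \<mu> = 0" using eig_mult_eq_nul[OF assms(1), of \<mu>] nul by simp
  from ind_stable_S[OF this] obtain \<delta> where \<delta>: "\<delta> > 0"
    "\<And>S'. (\<forall>i<2*d. \<forall>j<2*d. S' j i = cnj (S' i j)) \<Longrightarrow> (\<forall>i<2*d. \<forall>j<2*d. cmod (S' i j - S $$ (i, j)) \<le> \<delta>) \<Longrightarrow>
     negindex (XK K) (\<lambda>x y. Aform K S' x y - complex_of_real \<mu> * Wform x y) = P.ind \<mu>" by blast
  show ?thesis
  proof (intro exI[of _ \<delta>] conjI ballI impI \<delta>(1))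
    fix S' assume S': "S' \<in> carrier_mat (2*d) (2*d)"
      "hermitian_mat S' \<and> (\<forall>i<2*d. \<forall>j<2*d. cmod (S' $$ (i, j) - S $$ (i, j)) \<le> \<delta>)"
    have "\<forall>i<2*d. \<forall>j<2*d. S' $$ (j, i) = cnj (S' $$ (i, j))" using hermitian_mat_entry[OF S'(1)] S'(2) by blast
    then show "form_index K S' \<mu> = form_index K S \<mu>"
      using \<delta>(2)[of "\<lambda>i j. S' $$ (i, j)"] S'(2) unfolding form_index_def P.ind_def P.Hm_def by blast
  qed
qed

text \<open>It yields infinitely many eigenvalues, so that the set whose infimum is
  \<open>eigval\<close> is nonempty for every \<open>n\<close>.\<close>

theorem form_index_growth:
  assumes "d > 0" and S: "S \<in> carrier_mat (2*d) (2*d)" "hermitian_mat S"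
  shows "\<exists>\<mu>0. \<forall>\<mu>\<ge>\<mu>0. n \<le> form_index K S \<mu>"
proof -
  let ?S = "\<lambda>i j. S $$ (i, j)"
  interpret sl_problem d a b P Q W R C \<kappa> K ?S by unfold_locales (rule hermitian_mat_entry[OF S])
  obtain \<mu>0 where "\<And>\<mu>. \<mu> \<ge> \<mu>0 \<Longrightarrow> negdim (XK K) (P.Hm \<mu>) n" using negdim_growth[OF assms(1)] by blast
  then show ?thesis using negdim_le_ind unfolding form_index_def P.ind_def P.Hm_def by blast
qed

end

section \<open>The space of boundary conditions\<close>

text \<open>Full row rank provides \<open>n\<close> independent columns. They form an invertible
  matrix, and a left null vector of \<open>M\<close> annihilates it as well.\<close>

lemma rank_full_left_kernel:
  fixes M :: "complex mat"
  assumes M: "M \<in> carrier_mat n m" and rk: "vec_space.rank n M = n"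
    and c: "\<And>j. j < m \<Longrightarrow> (\<Sum>i<n. c i * M $$ (i, j)) = 0" and i: "i < n"
  shows "c i = 0"
proof -
  interpret V: vec_space "TYPE(complex)" n .
  obtain T where T: "finite T" "maximal T (\<lambda>T. T \<subseteq> set (cols M) \<and> V.lin_indpt T)"
    using maximal_exists_superset[of "set (cols M)" "\<lambda>T. T \<subseteq> set (cols M) \<and> V.lin_indpt T" "{}"]
    by (auto simp: V.lin_dep_def)
  have cT: "card T = n" using V.rank_card_indpt[OF M T(2)] rk by simp
  have TM: "T \<subseteq> set (cols M)" "V.lin_indpt T" using T(2) unfolding maximal_def by auto
  have TV: "T \<subseteq> carrier_vec n" using TM(1) cols_dim[of M] M by auto
  obtain xs where xs: "set xs = T" "distinct xs" using finite_distinct_list[OF T(1)] by blast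
  have lx: "length xs = n" using xs cT distinct_card by force
  define N where "N = mat_of_cols n xs"
  have N: "N \<in> carrier_mat n n" unfolding N_def using lx by auto
  have cN: "cols N = xs" unfolding N_def using xs TV by (intro cols_mat_of_cols) auto
  have "V.rank N = n" by (rule V.lin_indpt_full_rank[OF N]) (use cN xs TM in auto)
  then have d: "det N \<noteq> 0" using V.det_rank_iff[OF N] by simp
  define v where "v = vec n c"
  have v: "v \<in> carrier_vec n" by (simp add: v_def)
  have "N\<^sup>T *\<^sub>v v = 0\<^sub>v n"
  proof (rule eq_vecI)
    fix j assume j: "j < dim_vec (0\<^sub>v n :: complex vec)"
    then have "xs ! j \<in> set (cols M)" using lx xs TM by auto
    then obtain l where l: "l < m" "xs ! j = col M l"
      using M by (metis carrier_matD(2) cols_length cols_nth in_set_conv_nth)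
    have "(N\<^sup>T *\<^sub>v v) $ j = (\<Sum>i<n. c i * M $$ (i, l))"
      using j lx l M by (simp add: N_def v_def scalar_prod_def mat_of_cols_def atLeast0LessThan mult.commute)
    then show "(N\<^sup>T *\<^sub>v v) $ j = 0\<^sub>v n $ j" using c[OF l(1)] j by simp
  qed (use N in simp)
  moreover have "det N\<^sup>T \<noteq> 0" using d det_transpose[OF N] by simp
  ultimately have "v = 0\<^sub>v n"
    using det_0_iff_vec_prod_zero_field[of "N\<^sup>T" n] N v by auto
  then show ?thesis using i unfolding v_def by (metis index_vec index_zero_vec(1))
qed

lemma rank_fullI:
  fixes M :: "complex mat"
  assumes M: "M \<in> carrier_mat n m"
    and u: "\<And>k. k < n \<Longrightarrow> \<exists>j<m. \<exists>s. s \<noteq> 0 \<and> col M j = s \<cdot>\<^sub>v unit_vec n k"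
  shows "vec_space.rank n M = n"
proof -
  interpret V: vec_space "TYPE(complex)" n .
  have car: "set (cols M) \<subseteq> carrier_vec n" using cols_dim[of M] M by auto
  have "set (unit_vecs n) \<subseteq> V.span (set (cols M))"
  proof
    fix x assume "x \<in> set (unit_vecs n :: complex vec list)"
    then obtain k where k: "k < n" "x = unit_vec n k" unfolding unit_vecs_def by auto
    obtain j s where js: "j < m" "s \<noteq> 0" "col M j = s \<cdot>\<^sub>v unit_vec n k" using u[OF k(1)] by blast
    have "col M j \<in> set (cols M)" using js M by (metis carrier_matD(2) cols_length cols_nth nth_mem)
    then have "col M j \<in> V.span (set (cols M))" using V.span_mem[OF car] by blast
    then have "inverse s \<cdot>\<^sub>v col M j \<in> V.span (set (cols M))" by (rule V.smult_in_span[OF car])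
    then show "x \<in> V.span (set (cols M))" using js k by (simp add: smult_smult_assoc)
  qed
  then have "carrier_vec n \<subseteq> V.span (set (cols M))"
    using V.span_subsetI[OF car] V.span_unit_vecs_is_carrier by metis
  then have span: "V.span (set (cols M)) = carrier_vec n" using V.span_closed[OF car] by auto
  have vs: "V.vs (carrier_vec n) = module_vec TYPE(complex) n" by (simp add: module_vec_def)
  show ?thesis unfolding V.rank_def span vs by (rule V.dim_is_n)
qed

text \<open>In a representative \<open>rep_K d K S\<close> the first block is the identity and the second one is \<open>S\<close>. Hence
  a class lies in the chart iff the first block is invertible, and Cramer's rule gives a coordinate
  that visibly depends continuously on the representative.\<close>

definition pivot_block :: "nat \<Rightarrow> nat set \<Rightarrow> complex mat \<Rightarrow> complex mat" where
  "pivot_block d K N = mat (2*d) (2*d) (\<lambda>(r, i). if Suc i \<in> K then - N $$ (r, i) else N $$ (r, i + 2*d))"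

definition chart_block :: "nat \<Rightarrow> nat set \<Rightarrow> complex mat \<Rightarrow> complex mat" where
  "chart_block d K N = mat (2*d) (2*d) (\<lambda>(r, i). if Suc i \<in> K then N $$ (r, i + 2*d) else N $$ (r, i))"

lemma block_carrier [simp]: "pivot_block d K N \<in> carrier_mat (2*d) (2*d)" "chart_block d K N \<in> carrier_mat (2*d) (2*d)"
  by (simp_all add: pivot_block_def chart_block_def)

lemma rep_K_carrier [simp]: "rep_K d K S \<in> carrier_mat (2*d) (4*d)"
  by (simp add: rep_K_def)

lemma eq_rep_K_iff:
  assumes N: "N \<in> carrier_mat (2*d) (4*d)" and S: "S \<in> carrier_mat (2*d) (2*d)"
  shows "N = rep_K d K S \<longleftrightarrow> pivot_block d K N = 1\<^sub>m (2*d) \<and> chart_block d K N = S"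
proof
  assume "N = rep_K d K S"
  then show "pivot_block d K N = 1\<^sub>m (2*d) \<and> chart_block d K N = S"
    using S by (auto simp: pivot_block_def chart_block_def rep_K_def intro!: eq_matI)
next
  assume A: "pivot_block d K N = 1\<^sub>m (2*d) \<and> chart_block d K N = S"
  have C: "pivot_block d K N $$ (r, i) = (if r = i then 1 else 0)" if "r < 2*d" "i < 2*d" for r i
    using A that by simp
  have D: "chart_block d K N $$ (r, i) = S $$ (r, i)" for r i using A by simp
  show "N = rep_K d K S"
  proof (rule eq_matI)
    fix r c assume "r < dim_row (rep_K d K S)" "c < dim_col (rep_K d K S)"
    then have rc: "r < 2*d" "c < 4*d" by (auto simp: rep_K_def)
    show "N $$ (r, c) = rep_K d K S $$ (r, c)"
    proof (cases "c < 2*d")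
      case True
      then show ?thesis using C[OF rc(1) True] D[of r c] rc
        by (auto simp: pivot_block_def chart_block_def rep_K_def minus_equation_iff split: if_splits)
    next
      case False
      then have c: "c - 2*d < 2*d" "c - 2*d + 2*d = c" using rc by auto
      show ?thesis using C[OF rc(1) c(1)] D[of r "c - 2*d"] rc c False
        by (auto simp: pivot_block_def chart_block_def rep_K_def split: if_splits)
    qed
  qed (use N in \<open>auto simp: rep_K_def\<close>)
qed

lemma index_mult_sum:
  assumes "A \<in> carrier_mat n m" "B \<in> carrier_mat m l" "i < n" "j < l"
  shows "(A * B) $$ (i, j) = (\<Sum>k<m. A $$ (i, k) * B $$ (k, j))"
  using assms by (simp add: scalar_prod_def atLeast0LessThan)

lemma block_mult:
  assumes G: "G \<in> carrier_mat (2*d) (2*d)" and N: "N \<in> carrier_mat (2*d) (4*d)"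
  shows "pivot_block d K (G * N) = G * pivot_block d K N" "chart_block d K (G * N) = G * chart_block d K N"
proof -
  show "pivot_block d K (G * N) = G * pivot_block d K N"
  proof (rule eq_matI)
    fix i j assume "i < dim_row (G * pivot_block d K N)" "j < dim_col (G * pivot_block d K N)"
    then have ij: "i < 2*d" "j < 2*d" using G by (auto simp: pivot_block_def)
    then show "pivot_block d K (G * N) $$ (i, j) = (G * pivot_block d K N) $$ (i, j)"
      unfolding index_mult_sum[OF G block_carrier(1) ij]
      by (simp add: pivot_block_def index_mult_sum[OF G N] sum_negf del: index_mult_mat)
  qed (use G in \<open>auto simp: pivot_block_def\<close>)
  show "chart_block d K (G * N) = G * chart_block d K N"
  proof (rule eq_matI)
    fix i j assume "i < dim_row (G * chart_block d K N)" "j < dim_col (G * chart_block d K N)"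
    then have ij: "i < 2*d" "j < 2*d" using G by (auto simp: chart_block_def)
    then show "chart_block d K (G * N) $$ (i, j) = (G * chart_block d K N) $$ (i, j)"
      unfolding index_mult_sum[OF G block_carrier(2) ij]
      by (simp add: chart_block_def index_mult_sum[OF G N] del: index_mult_mat)
  qed (use G in \<open>auto simp: chart_block_def\<close>)
qed

lemma invertible_iff_det:
  fixes G :: "complex mat"
  assumes G: "G \<in> carrier_mat n n"
  shows "invertible_mat G \<longleftrightarrow> det G \<noteq> 0"
proof
  assume "invertible_mat G"
  then obtain H where H: "inverts_mat G H" "inverts_mat H G" unfolding invertible_mat_def by blast
  have GH: "G * H = 1\<^sub>m n" "H * G = 1\<^sub>m (dim_row H)" using H G unfolding inverts_mat_def by auto
  have "dim_row H = n" using arg_cong[OF GH(2), of dim_col] G by simp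
  moreover have "dim_col H = n" using arg_cong[OF GH(1), of dim_col] by simp
  ultimately have "H \<in> carrier_mat n n" by auto
  then have "det G * det H = 1" using det_mult[OF G, of H] GH by simp
  then show "det G \<noteq> 0" by auto
next
  assume "det G \<noteq> 0"
  from det_non_zero_imp_unit[OF G this, of undefined]
  obtain H where "H \<in> carrier_mat n n" "H * G = 1\<^sub>m n" "G * H = 1\<^sub>m n"
    unfolding Units_def ring_mat_def by auto
  then show "invertible_mat G" using G unfolding invertible_mat_def inverts_mat_def by auto
qed

lemma det_nz_inverse:
  fixes G :: "complex mat"
  assumes G: "G \<in> carrier_mat n n" "det G \<noteq> 0"
  obtains H where "H \<in> carrier_mat n n" "H * G = 1\<^sub>m n" "G * H = 1\<^sub>m n" "det H \<noteq> 0"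
proof -
  from det_non_zero_imp_unit[OF G, of undefined]
  obtain H where H: "H \<in> carrier_mat n n" "H * G = 1\<^sub>m n" "G * H = 1\<^sub>m n"
    unfolding Units_def ring_mat_def by auto
  have "det G * det H = 1" using det_mult[OF G(1) H(1)] H by simp
  then have "det H \<noteq> 0" by auto
  then show thesis using H that by blast
qed

lemma GL_orbit_iff: "N \<in> GL_orbit d M \<longleftrightarrow> (\<exists>G\<in>carrier_mat (2*d) (2*d). det G \<noteq> 0 \<and> N = G * M)"
  unfolding GL_orbit_def using invertible_iff_det by auto

lemma GL_orbit_self: "M \<in> carrier_mat (2*d) (4*d) \<Longrightarrow> M \<in> GL_orbit d M"
  unfolding GL_orbit_iff by (rule bexI[of _ "1\<^sub>m (2*d)"]) auto

lemma GL_orbit_eq: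
  assumes M: "M \<in> carrier_mat (2*d) (4*d)" and N: "N \<in> GL_orbit d M"
  shows "GL_orbit d N = GL_orbit d M"
proof -
  obtain G where G: "G \<in> carrier_mat (2*d) (2*d)" "det G \<noteq> 0" "N = G * M" using N unfolding GL_orbit_iff by blast
  obtain H where H: "H \<in> carrier_mat (2*d) (2*d)" "H * G = 1\<^sub>m (2*d)" "det H \<noteq> 0" using det_nz_inverse[OF G(1,2)] by metis
  have HN: "M = H * N" using G H M by (simp add: assoc_mult_mat[symmetric, of H _ "2*d" G "2*d" M "4*d"])
  have 1: "X \<in> GL_orbit d M" if "X \<in> GL_orbit d N" for X
  proof -
    obtain F where F: "F \<in> carrier_mat (2*d) (2*d)" "det F \<noteq> 0" "X = F * N" using \<open>X \<in> GL_orbit d N\<close> unfolding GL_orbit_iff by blast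
    have "X = (F * G) * M" using F G M by (simp add: assoc_mult_mat[of F "2*d" "2*d" G "2*d" M "4*d"])
    moreover have "det (F * G) \<noteq> 0" using F G det_mult[of F "2*d" G] by simp
    ultimately show ?thesis unfolding GL_orbit_iff using F G by (intro bexI[of _ "F * G"]) auto
  qed
  have 2: "X \<in> GL_orbit d N" if "X \<in> GL_orbit d M" for X
  proof -
    obtain F where F: "F \<in> carrier_mat (2*d) (2*d)" "det F \<noteq> 0" "X = F * M" using \<open>X \<in> GL_orbit d M\<close> unfolding GL_orbit_iff by blast
    have Nc: "N \<in> carrier_mat (2*d) (4*d)" using G M by auto
    have "X = F * (H * N)" unfolding F(3) using HN by simp
    then have "X = (F * H) * N" using F H Nc by (simp add: assoc_mult_mat[of F "2*d" "2*d" H "2*d" N "4*d"])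
    moreover have "det (F * H) \<noteq> 0" using F H det_mult[of F "2*d" H] by simp
    ultimately show ?thesis unfolding GL_orbit_iff using F H by (intro bexI[of _ "F * H"]) auto
  qed
  show ?thesis using 1 2 by blast
qed

text \<open>The condition \<open>A B\<^sup>* = B A\<^sup>*\<close>, entry by entry.\<close>

definition sym_cond :: "nat \<Rightarrow> complex mat \<Rightarrow> bool" where
  "sym_cond d N \<longleftrightarrow> (\<forall>r<2*d. \<forall>s<2*d. (\<Sum>k<2*d. N $$ (r, k) * cnj (N $$ (s, k + 2*d))) =
      (\<Sum>k<2*d. N $$ (r, k + 2*d) * cnj (N $$ (s, k))))"

lemma sym_cond_iff:
  "Ablk d M * mat_adjoint (Bblk d M) = Bblk d M * mat_adjoint (Ablk d M) \<longleftrightarrow> sym_cond d M"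
proof -
  have c: "Ablk d M \<in> carrier_mat (2*d) (2*d)" "Bblk d M \<in> carrier_mat (2*d) (2*d)" by (auto simp: Ablk_def Bblk_def)
  have a: "mat_adjoint (Ablk d M) \<in> carrier_mat (2*d) (2*d)" "mat_adjoint (Bblk d M) \<in> carrier_mat (2*d) (2*d)"
    using c by (auto simp: mat_adjoint_def)
  have e: "(Ablk d M * mat_adjoint (Bblk d M)) $$ (r, s) = (\<Sum>k<2*d. M $$ (r, k) * cnj (M $$ (s, k + 2*d)))"
    "(Bblk d M * mat_adjoint (Ablk d M)) $$ (r, s) = (\<Sum>k<2*d. M $$ (r, k + 2*d) * cnj (M $$ (s, k)))"
    if "r < 2*d" "s < 2*d" for r s
    unfolding index_mult_sum[OF c(1) a(2) that] index_mult_sum[OF c(2) a(1) that]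
    using that by (simp_all add: mat_adjoint_index[OF c(1)] mat_adjoint_index[OF c(2)], simp_all add: Ablk_def Bblk_def)
  show ?thesis
  proof
    assume "Ablk d M * mat_adjoint (Bblk d M) = Bblk d M * mat_adjoint (Ablk d M)"
    then have "(Ablk d M * mat_adjoint (Bblk d M)) $$ (r, s) = (Bblk d M * mat_adjoint (Ablk d M)) $$ (r, s)" for r s by simp
    then show "sym_cond d M" unfolding sym_cond_def using e by simp
  next
    assume s: "sym_cond d M"
    show "Ablk d M * mat_adjoint (Bblk d M) = Bblk d M * mat_adjoint (Ablk d M)"
    proof (rule eq_matI)
      fix i j assume "i < dim_row (Bblk d M * mat_adjoint (Ablk d M))" "j < dim_col (Bblk d M * mat_adjoint (Ablk d M))"
      then have "i < 2*d" "j < 2*d" using c a by auto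
      then show "(Ablk d M * mat_adjoint (Bblk d M)) $$ (i, j) = (Bblk d M * mat_adjoint (Ablk d M)) $$ (i, j)"
        using e s unfolding sym_cond_def by simp
    qed (use c a in auto)
  qed
qed

lemma bc_repsD:
  assumes "M \<in> bc_reps d"
  shows "M \<in> carrier_mat (2*d) (4*d)" "vec_space.rank (2*d) M = 2*d" "sym_cond d M"
  using assms sym_cond_iff unfolding bc_reps_def by auto

text \<open>Under the left action \<open>A B\<^sup>*\<close> turns into
  \<open>G A B\<^sup>* G\<^sup>*\<close>, and likewise the other side.\<close>

lemma sym_cond_mult:
  assumes G: "G \<in> carrier_mat (2*d) (2*d)" and N: "N \<in> carrier_mat (2*d) (4*d)" and s: "sym_cond d N"
  shows "sym_cond d (G * N)"
  unfolding sym_cond_def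
proof (intro allI impI)
  fix r q assume rq: "r < 2*d" "q < 2*d"
  have "(\<Sum>k<2*d. (G * N) $$ (r, k) * cnj ((G * N) $$ (q, k + 2*d))) =
     (\<Sum>k<2*d. \<Sum>u<2*d. \<Sum>v<2*d. G $$ (r, u) * cnj (G $$ (q, v)) * (N $$ (u, k) * cnj (N $$ (v, k + 2*d))))"
    using rq by (intro sum.cong refl) (simp add: index_mult_sum[OF G N] del: index_mult_mat, unfold sum_product, simp add: mult_ac)
  also have "\<dots> = (\<Sum>u<2*d. \<Sum>v<2*d. \<Sum>k<2*d. G $$ (r, u) * cnj (G $$ (q, v)) * (N $$ (u, k) * cnj (N $$ (v, k + 2*d))))"
    by (subst sum.swap, rule sum.cong[OF refl], rule sum.swap)
  also have "\<dots> = (\<Sum>u<2*d. \<Sum>v<2*d. G $$ (r, u) * cnj (G $$ (q, v)) * (\<Sum>k<2*d. N $$ (u, k) * cnj (N $$ (v, k + 2*d))))"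
    by (simp add: sum_distrib_left)
  also have "\<dots> = (\<Sum>u<2*d. \<Sum>v<2*d. G $$ (r, u) * cnj (G $$ (q, v)) * (\<Sum>k<2*d. N $$ (u, k + 2*d) * cnj (N $$ (v, k))))"
    using s unfolding sym_cond_def by (intro sum.cong refl) simp
  also have "\<dots> = (\<Sum>u<2*d. \<Sum>v<2*d. \<Sum>k<2*d. G $$ (r, u) * cnj (G $$ (q, v)) * (N $$ (u, k + 2*d) * cnj (N $$ (v, k))))"
    by (simp add: sum_distrib_left)
  also have "\<dots> = (\<Sum>k<2*d. \<Sum>u<2*d. \<Sum>v<2*d. G $$ (r, u) * cnj (G $$ (q, v)) * (N $$ (u, k + 2*d) * cnj (N $$ (v, k))))"
    by (rule sym, subst sum.swap, rule sum.cong[OF refl], rule sum.swap)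
  also have "\<dots> = (\<Sum>k<2*d. (G * N) $$ (r, k + 2*d) * cnj ((G * N) $$ (q, k)))"
    using rq by (intro sum.cong refl) (simp add: index_mult_sum[OF G N] del: index_mult_mat, unfold sum_product, simp add: mult_ac)
  finally show "(\<Sum>k<2*d. (G * N) $$ (r, k) * cnj ((G * N) $$ (q, k + 2*d))) = (\<Sum>k<2*d. (G * N) $$ (r, k + 2*d) * cnj ((G * N) $$ (q, k)))" .
qed

text \<open>Each column index pairs a column of \<open>S\<close> with a unit vector; the minus sign
  of the unit vectors for indices in \<open>K\<close> makes the condition equivalent to Hermitian
  symmetry for every \<open>K\<close>.\<close>

lemma sym_cond_rep_K:
  assumes S: "S \<in> carrier_mat (2*d) (2*d)"
  shows "sym_cond d (rep_K d K S) \<longleftrightarrow> hermitian_mat S"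
proof -
  let ?N = "rep_K d K S"
  have 1: "(\<Sum>k<2*d. ?N $$ (r, k) * cnj (?N $$ (s, k + 2*d))) =
     (if Suc r \<in> K then - cnj (S $$ (s, r)) else 0) + (if Suc s \<in> K then 0 else S $$ (r, s))" (is "?L r s = ?R r s")
    if "r < 2*d" "s < 2*d" for r s
  proof -
    have "?L r s = (\<Sum>k<2*d. (if k = r then (if Suc r \<in> K then - cnj (S $$ (s, r)) else 0) else 0) + (if k = s then (if Suc s \<in> K then 0 else S $$ (r, s)) else 0))"
      using that by (intro sum.cong refl) (auto simp: rep_K_def)
    then show ?thesis using that by (simp add: sum.distrib)
  qed
  have 2: "(\<Sum>k<2*d. ?N $$ (r, k + 2*d) * cnj (?N $$ (s, k))) =
     (if Suc s \<in> K then - S $$ (r, s) else 0) + (if Suc r \<in> K then 0 else cnj (S $$ (s, r)))" (is "?L' r s = ?R' r s")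
    if "r < 2*d" "s < 2*d" for r s
  proof -
    have "?L' r s = (\<Sum>k<2*d. (if k = s then (if Suc s \<in> K then - S $$ (r, s) else 0) else 0) + (if k = r then (if Suc r \<in> K then 0 else cnj (S $$ (s, r))) else 0))"
      using that by (intro sum.cong refl) (auto simp: rep_K_def)
    then show ?thesis using that by (simp add: sum.distrib)
  qed
  have 3: "?R r s = ?R' r s \<longleftrightarrow> S $$ (r, s) = cnj (S $$ (s, r))" for r s
    by (auto simp: algebra_simps)
  have 4: "hermitian_mat S \<longleftrightarrow> (\<forall>r<2*d. \<forall>s<2*d. S $$ (r, s) = cnj (S $$ (s, r)))"
  proof
    assume "hermitian_mat S"
    then show "\<forall>r<2*d. \<forall>s<2*d. S $$ (r, s) = cnj (S $$ (s, r))" using hermitian_mat_entry[OF S] by blast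
  next
    assume h: "\<forall>r<2*d. \<forall>s<2*d. S $$ (r, s) = cnj (S $$ (s, r))"
    show "hermitian_mat S" unfolding hermitian_mat_def
    proof (rule eq_matI)
      fix i j assume ij: "i < dim_row S" "j < dim_col S"
      then have "i < 2*d" "j < 2*d" using S by auto
      then show "mat_adjoint S $$ (i, j) = S $$ (i, j)" using mat_adjoint_index[OF S, of i j] h by (metis (no_types))
    qed (use S in \<open>auto simp: mat_adjoint_def\<close>)
  qed
  show ?thesis unfolding sym_cond_def 4 using 1 2 3 by (metis (no_types, lifting))
qed

lemma rep_K_bc_reps:
  assumes S: "S \<in> carrier_mat (2*d) (2*d)" "hermitian_mat S"
  shows "rep_K d K S \<in> bc_reps d"
proof -
  have "vec_space.rank (2*d) (rep_K d K S) = 2*d"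
  proof (rule rank_fullI[OF rep_K_carrier])
    fix k assume k: "k < 2*d"
    show "\<exists>j<4*d. \<exists>s. s \<noteq> 0 \<and> col (rep_K d K S) j = s \<cdot>\<^sub>v unit_vec (2*d) k"
    proof (cases "Suc k \<in> K")
      case True
      then show ?thesis using k
        by (intro exI[of _ k] exI[of _ "-1"] conjI eq_vecI) (auto simp: rep_K_def unit_vec_def)
    next
      case False
      then show ?thesis using k
        by (intro exI[of _ "k + 2*d"] exI[of _ 1] conjI eq_vecI) (auto simp: rep_K_def unit_vec_def)
    qed
  qed
  then show ?thesis unfolding bc_reps_def using sym_cond_iff sym_cond_rep_K[OF S(1)] S(2) rep_K_carrier by blast
qed

definition chart_matrix :: "nat \<Rightarrow> nat set \<Rightarrow> complex mat \<Rightarrow> complex mat" where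
  "chart_matrix d K N = mat (2*d) (2*d) (\<lambda>(i, j). det (replace_col (pivot_block d K N) (col (chart_block d K N) j) i) / det (pivot_block d K N))"

lemma chart_matrix_cramer:
  assumes d: "det (pivot_block d K N) \<noteq> 0" and S: "S \<in> carrier_mat (2*d) (2*d)" and e: "pivot_block d K N * S = chart_block d K N"
  shows "chart_matrix d K N = S"
proof (rule eq_matI)
  fix i j assume "i < dim_row S" "j < dim_col S"
  then have ij: "i < 2*d" "j < 2*d" using S by auto
  have "col (chart_block d K N) j = pivot_block d K N *\<^sub>v col S j" unfolding e[symmetric] using S ij by (intro eq_vecI) (auto simp: pivot_block_def)
  then have "det (replace_col (pivot_block d K N) (col (chart_block d K N) j) i) = S $$ (i, j) * det (pivot_block d K N)"
    using cramer_lemma_mat[OF block_carrier(1), of "col S j" d i K N] S ij by simp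
  then show "chart_matrix d K N $$ (i, j) = S $$ (i, j)" using ij d by (simp add: chart_matrix_def)
qed (use S in \<open>auto simp: chart_matrix_def\<close>)

lemma rep_K_in_orbit:
  assumes N: "N \<in> carrier_mat (2*d) (4*d)" and S: "S \<in> carrier_mat (2*d) (2*d)" and r: "rep_K d K S \<in> GL_orbit d N"
  shows "det (pivot_block d K N) \<noteq> 0" "chart_matrix d K N = S"
proof -
  obtain G where G: "G \<in> carrier_mat (2*d) (2*d)" "det G \<noteq> 0" "rep_K d K S = G * N" using r unfolding GL_orbit_iff by blast
  have e: "G * pivot_block d K N = 1\<^sub>m (2*d)" "G * chart_block d K N = S"
    using eq_rep_K_iff[of "G * N" d S K] G N S block_mult[OF G(1) N] by auto
  have "det G * det (pivot_block d K N) = 1" using det_mult[OF G(1) block_carrier(1), of K N] e by simp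
  then show 1: "det (pivot_block d K N) \<noteq> 0" by auto
  have "pivot_block d K N * G = 1\<^sub>m (2*d)" by (rule mat_mult_left_right_inverse[OF G(1) block_carrier(1) e(1)])
  then have "pivot_block d K N * S = chart_block d K N" unfolding e(2)[symmetric]
    using assoc_mult_mat[OF block_carrier(1) G(1) block_carrier(2), of K N K N] by (simp add: left_mult_one_mat[OF block_carrier(2)])
  then show "chart_matrix d K N = S" by (rule chart_matrix_cramer[OF 1 S])
qed

lemma chart_matrix_in_orbit:
  assumes N: "N \<in> carrier_mat (2*d) (4*d)" "sym_cond d N" and d: "det (pivot_block d K N) \<noteq> 0"
  shows "chart_matrix d K N \<in> carrier_mat (2*d) (2*d)" "hermitian_mat (chart_matrix d K N)" "rep_K d K (chart_matrix d K N) \<in> GL_orbit d N"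
proof -
  show S: "chart_matrix d K N \<in> carrier_mat (2*d) (2*d)" by (simp add: chart_matrix_def)
  obtain G where G: "G \<in> carrier_mat (2*d) (2*d)" "G * pivot_block d K N = 1\<^sub>m (2*d)" "pivot_block d K N * G = 1\<^sub>m (2*d)" "det G \<noteq> 0"
    using det_nz_inverse[OF block_carrier(1) d] by metis
  have "pivot_block d K N * (G * chart_block d K N) = chart_block d K N"
    using assoc_mult_mat[OF block_carrier(1) G(1) block_carrier(2), of K N K N] G(3) by (simp add: left_mult_one_mat[OF block_carrier(2)])
  then have "chart_matrix d K N = G * chart_block d K N" by (intro chart_matrix_cramer[OF d]) (use G in auto)
  then have e: "G * N = rep_K d K (chart_matrix d K N)"
    using eq_rep_K_iff[of "G * N" d "chart_matrix d K N" K] S G N block_mult[OF G(1) N(1)] by auto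
  then show "rep_K d K (chart_matrix d K N) \<in> GL_orbit d N" unfolding GL_orbit_iff using G by metis
  show "hermitian_mat (chart_matrix d K N)" using sym_cond_mult[OF G(1) N] sym_cond_rep_K[OF S] e by simp
qed

section \<open>The quotient topology in charts\<close>

lemma openin_reps_top:
  "openin (reps_top d) U \<longleftrightarrow> U \<subseteq> bc_reps d \<and>
     (\<forall>M\<in>U. \<exists>e>0. \<forall>N\<in>bc_reps d. (\<forall>i<2*d. \<forall>j<4*d. cmod (N $$ (i,j) - M $$ (i,j)) < e) \<longrightarrow> N \<in> U)"
proof -
  have "istopology (\<lambda>U. U \<subseteq> bc_reps d \<and>
     (\<forall>M\<in>U. \<exists>e>0. \<forall>N\<in>bc_reps d. (\<forall>i<2*d. \<forall>j<4*d. cmod (N $$ (i,j) - M $$ (i,j)) < e) \<longrightarrow> N \<in> U))"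
    unfolding istopology_def
  proof (intro conjI allI impI)
    fix U V assume U: "U \<subseteq> bc_reps d \<and> (\<forall>M\<in>U. \<exists>e>0. \<forall>N\<in>bc_reps d. (\<forall>i<2*d. \<forall>j<4*d. cmod (N $$ (i,j) - M $$ (i,j)) < e) \<longrightarrow> N \<in> U)"
      and V: "V \<subseteq> bc_reps d \<and> (\<forall>M\<in>V. \<exists>e>0. \<forall>N\<in>bc_reps d. (\<forall>i<2*d. \<forall>j<4*d. cmod (N $$ (i,j) - M $$ (i,j)) < e) \<longrightarrow> N \<in> V)"
    show "U \<inter> V \<subseteq> bc_reps d" using U by blast
    show "\<forall>M\<in>U \<inter> V. \<exists>e>0. \<forall>N\<in>bc_reps d. (\<forall>i<2*d. \<forall>j<4*d. cmod (N $$ (i,j) - M $$ (i,j)) < e) \<longrightarrow> N \<in> U \<inter> V"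
    proof
      fix M assume M: "M \<in> U \<inter> V"
      obtain e1 where e1: "e1 > 0" "\<forall>N\<in>bc_reps d. (\<forall>i<2*d. \<forall>j<4*d. cmod (N $$ (i,j) - M $$ (i,j)) < e1) \<longrightarrow> N \<in> U"
        using U M by blast
      obtain e2 where e2: "e2 > 0" "\<forall>N\<in>bc_reps d. (\<forall>i<2*d. \<forall>j<4*d. cmod (N $$ (i,j) - M $$ (i,j)) < e2) \<longrightarrow> N \<in> V"
        using V M by blast
      show "\<exists>e>0. \<forall>N\<in>bc_reps d. (\<forall>i<2*d. \<forall>j<4*d. cmod (N $$ (i,j) - M $$ (i,j)) < e) \<longrightarrow> N \<in> U \<inter> V"
        using e1 e2 by (intro exI[of _ "min e1 e2"]) auto
    qed
  next
    fix \<K> :: "complex mat set set"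
    assume K: "\<forall>U\<in>\<K>. U \<subseteq> bc_reps d \<and> (\<forall>M\<in>U. \<exists>e>0. \<forall>N\<in>bc_reps d. (\<forall>i<2*d. \<forall>j<4*d. cmod (N $$ (i,j) - M $$ (i,j)) < e) \<longrightarrow> N \<in> U)"
    show "\<Union>\<K> \<subseteq> bc_reps d" using K by blast
    show "\<forall>M\<in>\<Union>\<K>. \<exists>e>0. \<forall>N\<in>bc_reps d. (\<forall>i<2*d. \<forall>j<4*d. cmod (N $$ (i,j) - M $$ (i,j)) < e) \<longrightarrow> N \<in> \<Union>\<K>"
    proof
      fix M assume "M \<in> \<Union>\<K>"
      then obtain U where U: "U \<in> \<K>" "M \<in> U" by blast
      then obtain e where "e > 0" "\<forall>N\<in>bc_reps d. (\<forall>i<2*d. \<forall>j<4*d. cmod (N $$ (i,j) - M $$ (i,j)) < e) \<longrightarrow> N \<in> U"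
        using K by blast
      then show "\<exists>e>0. \<forall>N\<in>bc_reps d. (\<forall>i<2*d. \<forall>j<4*d. cmod (N $$ (i,j) - M $$ (i,j)) < e) \<longrightarrow> N \<in> \<Union>\<K>"
        using U by blast
    qed
  qed
  from topology_inverse'[OF this] show ?thesis unfolding reps_top_def by simp
qed

lemma openin_bc_top:
  "openin (bc_top d) V \<longleftrightarrow> V \<subseteq> bc_space d \<and> openin (reps_top d) {M \<in> bc_reps d. GL_orbit d M \<in> V}"
proof -
  have "istopology (\<lambda>V. V \<subseteq> bc_space d \<and> openin (reps_top d) {M \<in> bc_reps d. GL_orbit d M \<in> V})"
    unfolding istopology_def
  proof (intro conjI allI impI)
    fix U V assume U: "U \<subseteq> bc_space d \<and> openin (reps_top d) {M \<in> bc_reps d. GL_orbit d M \<in> U}"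
      and V: "V \<subseteq> bc_space d \<and> openin (reps_top d) {M \<in> bc_reps d. GL_orbit d M \<in> V}"
    show "U \<inter> V \<subseteq> bc_space d" using U by blast
    have e: "{M \<in> bc_reps d. GL_orbit d M \<in> U \<inter> V} = {M \<in> bc_reps d. GL_orbit d M \<in> U} \<inter> {M \<in> bc_reps d. GL_orbit d M \<in> V}" by blast
    show "openin (reps_top d) {M \<in> bc_reps d. GL_orbit d M \<in> U \<inter> V}"
      unfolding e by (rule openin_Int) (use U V in simp_all)
  next
    fix \<K> :: "complex mat set set set"
    assume K: "\<forall>V\<in>\<K>. V \<subseteq> bc_space d \<and> openin (reps_top d) {M \<in> bc_reps d. GL_orbit d M \<in> V}"
    show "\<Union>\<K> \<subseteq> bc_space d" by (rule Union_least) (use K in simp)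
    have e: "{M \<in> bc_reps d. GL_orbit d M \<in> \<Union>\<K>} = (\<Union>V\<in>\<K>. {M \<in> bc_reps d. GL_orbit d M \<in> V})" by blast
    show "openin (reps_top d) {M \<in> bc_reps d. GL_orbit d M \<in> \<Union>\<K>}"
      unfolding e by (rule openin_Union) (use K in blast)
  qed
  from topology_inverse'[OF this] show ?thesis unfolding bc_top_def by simp
qed

lemma topspace_bc_top: "topspace (bc_top d) = bc_space d"
proof -
  have "{M \<in> bc_reps d. GL_orbit d M \<in> bc_space d} = bc_reps d" unfolding bc_space_def by blast
  moreover have "openin (reps_top d) (bc_reps d)" unfolding openin_reps_top by (auto intro: exI[of _ 1])
  ultimately have "openin (bc_top d) (bc_space d)" unfolding openin_bc_top by simp
  moreover have "openin (bc_top d) V \<Longrightarrow> V \<subseteq> bc_space d" for V unfolding openin_bc_top by blast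
  ultimately show ?thesis by (metis openin_subset openin_topspace subset_antisym)
qed

text \<open>Entrywise distance generates the topology, so it is enough to test the radii
  \<open>inverse (real (Suc k))\<close>. Sequences let openness follow from limits of
  determinants.\<close>

lemma openin_reps_top_sequentialI:
  assumes sub: "U \<subseteq> bc_reps d"
    and ev: "\<And>M f. M \<in> U \<Longrightarrow> (\<And>k. f k \<in> bc_reps d) \<Longrightarrow>
      (\<And>i j. i < 2*d \<Longrightarrow> j < 4*d \<Longrightarrow> (\<lambda>k. f k $$ (i, j)) \<longlonglongrightarrow> M $$ (i, j)) \<Longrightarrow> \<exists>k. f k \<in> U"
  shows "openin (reps_top d) U"
  unfolding openin_reps_top
proof (intro conjI ballI sub)
  fix M assume M: "M \<in> U"
  show "\<exists>e>0. \<forall>N\<in>bc_reps d. (\<forall>i<2*d. \<forall>j<4*d. cmod (N $$ (i,j) - M $$ (i,j)) < e) \<longrightarrow> N \<in> U"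
  proof (rule ccontr)
    assume "\<not> ?thesis"
    then have "\<forall>e>0. \<exists>N\<in>bc_reps d. (\<forall>i<2*d. \<forall>j<4*d. cmod (N $$ (i,j) - M $$ (i,j)) < e) \<and> N \<notin> U" by blast
    then have "\<forall>k::nat. \<exists>N\<in>bc_reps d. (\<forall>i<2*d. \<forall>j<4*d. cmod (N $$ (i,j) - M $$ (i,j)) < inverse (real (Suc k))) \<and> N \<notin> U"
      by (metis inverse_positive_iff_positive of_nat_0_less_iff zero_less_Suc)
    then obtain f where f: "\<And>k. f k \<in> bc_reps d" "\<And>k i j. i < 2*d \<Longrightarrow> j < 4*d \<Longrightarrow> cmod (f k $$ (i,j) - M $$ (i,j)) < inverse (real (Suc k))"
      "\<And>k. f k \<notin> U" by metis
    have "(\<lambda>k. f k $$ (i, j)) \<longlonglongrightarrow> M $$ (i, j)" if "i < 2*d" "j < 4*d" for i j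
    proof -
      have "(\<lambda>k. f k $$ (i, j) - M $$ (i, j)) \<longlonglongrightarrow> 0"
        by (rule Lim_null_comparison[OF _ LIMSEQ_inverse_real_of_nat])
          (use f(2)[OF that] in \<open>auto intro!: always_eventually less_imp_le\<close>)
      then show ?thesis by (simp add: LIM_zero_iff)
    qed
    then show False using ev[OF M, of f] f by blast
  qed
qed

lemma tendsto_det:
  fixes A :: "nat \<Rightarrow> complex mat"
  assumes c: "\<And>k. A k \<in> carrier_mat n n" "L \<in> carrier_mat n n"
    and l: "\<And>i j. i < n \<Longrightarrow> j < n \<Longrightarrow> (\<lambda>k. A k $$ (i, j)) \<longlonglongrightarrow> L $$ (i, j)"
  shows "(\<lambda>k. det (A k)) \<longlonglongrightarrow> det L"
  unfolding det_def'[OF c(1)] det_def'[OF c(2)]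
proof (intro tendsto_sum tendsto_mult tendsto_const tendsto_prod)
  fix p i assume "p \<in> {p. p permutes {0..<n}}" "i \<in> {0..<n}"
  then have "i < n" "p i < n" using permutes_in_image[of p "{0..<n}" i] by auto
  then show "(\<lambda>k. A k $$ (i, p i)) \<longlonglongrightarrow> L $$ (i, p i)" by (rule l)
qed

lemma tendsto_chart_matrix:
  assumes f: "\<And>i j. i < 2*d \<Longrightarrow> j < 4*d \<Longrightarrow> (\<lambda>k. f k $$ (i, j)) \<longlonglongrightarrow> M $$ (i, j)"
    and d: "det (pivot_block d K M) \<noteq> 0"
  shows "eventually (\<lambda>k. det (pivot_block d K (f k)) \<noteq> 0) sequentially"
    "i < 2*d \<Longrightarrow> j < 2*d \<Longrightarrow> (\<lambda>k. chart_matrix d K (f k) $$ (i, j)) \<longlonglongrightarrow> chart_matrix d K M $$ (i, j)"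
proof -
  have C: "(\<lambda>k. pivot_block d K (f k) $$ (i, j)) \<longlonglongrightarrow> pivot_block d K M $$ (i, j)" if "i < 2*d" "j < 2*d" for i j
    using that f[of i j] f[of i "j + 2*d"] by (auto simp: pivot_block_def intro!: tendsto_minus)
  have S: "(\<lambda>k. chart_block d K (f k) $$ (i, j)) \<longlonglongrightarrow> chart_block d K M $$ (i, j)" if "i < 2*d" "j < 2*d" for i j
    using that f[of i j] f[of i "j + 2*d"] by (auto simp: chart_block_def)
  have dC: "(\<lambda>k. det (pivot_block d K (f k))) \<longlonglongrightarrow> det (pivot_block d K M)"
    by (rule tendsto_det[OF block_carrier(1) block_carrier(1) C])
  show "eventually (\<lambda>k. det (pivot_block d K (f k)) \<noteq> 0) sequentially" by (rule tendsto_imp_eventually_ne[OF dC d])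
  assume ij: "i < 2*d" "j < 2*d"
  have rc: "replace_col (pivot_block d K N) v i \<in> carrier_mat (2*d) (2*d)" for N v by (simp add: replace_col_def pivot_block_def)
  have "(\<lambda>k. det (replace_col (pivot_block d K (f k)) (col (chart_block d K (f k)) j) i)) \<longlonglongrightarrow> det (replace_col (pivot_block d K M) (col (chart_block d K M) j) i)"
  proof (rule tendsto_det[OF rc rc])
    fix r s assume rs: "r < 2*d" "s < 2*d"
    have e: "replace_col (pivot_block d K N) (col (chart_block d K N) j) i $$ (r, s) = (if s = i then chart_block d K N $$ (r, j) else pivot_block d K N $$ (r, s))" for N
      using rs ij carrier_matD[OF block_carrier(1), of d K N] carrier_matD[OF block_carrier(2), of d K N] by (simp add: replace_col_def)
    show "(\<lambda>k. replace_col (pivot_block d K (f k)) (col (chart_block d K (f k)) j) i $$ (r, s)) \<longlonglongrightarrow> replace_col (pivot_block d K M) (col (chart_block d K M) j) i $$ (r, s)"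
      unfolding e using C[OF rs] S[OF rs(1) ij(2)] by auto
  qed
  then show "(\<lambda>k. chart_matrix d K (f k) $$ (i, j)) \<longlonglongrightarrow> chart_matrix d K M $$ (i, j)"
    using ij dC d by (auto simp: chart_matrix_def intro!: tendsto_divide)
qed

definition chart_nbhd :: "nat \<Rightarrow> nat set \<Rightarrow> complex mat \<Rightarrow> real \<Rightarrow> complex mat set set" where
  "chart_nbhd d K S0 \<epsilon> = {A \<in> bc_space d. \<exists>S\<in>carrier_mat (2*d) (2*d). hermitian_mat S \<and> rep_K d K S \<in> A \<and>
     (\<forall>i<2*d. \<forall>j<2*d. cmod (S $$ (i, j) - S0 $$ (i, j)) < \<epsilon>)}"

text \<open>By Cramer's rule the coordinates of convergent representatives converge. A sequentially
  open condition on the coordinate therefore defines an open set of classes.\<close>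

lemma openin_chart:
  assumes P: "\<And>S f. P S \<Longrightarrow> (\<And>i j. i < 2*d \<Longrightarrow> j < 2*d \<Longrightarrow> (\<lambda>k. f k $$ (i, j)) \<longlonglongrightarrow> S $$ (i, j)) \<Longrightarrow> eventually (\<lambda>k. P (f k)) sequentially"
  shows "openin (bc_top d) {A \<in> bc_space d. \<exists>S\<in>carrier_mat (2*d) (2*d). hermitian_mat S \<and> rep_K d K S \<in> A \<and> P S}"
    (is "openin _ ?V")
  unfolding openin_bc_top
proof (intro conjI openin_reps_top_sequentialI)
  fix M f assume M: "M \<in> {M \<in> bc_reps d. GL_orbit d M \<in> ?V}" and f: "\<And>k. f k \<in> bc_reps d"
    and lim: "\<And>i j. i < 2*d \<Longrightarrow> j < 4*d \<Longrightarrow> (\<lambda>k. f k $$ (i, j)) \<longlonglongrightarrow> M $$ (i, j)"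
  obtain S where S: "S \<in> carrier_mat (2*d) (2*d)" "hermitian_mat S" "rep_K d K S \<in> GL_orbit d M" "P S" using M by blast
  have Mc: "M \<in> carrier_mat (2*d) (4*d)" using M bc_repsD(1) by blast
  note r = rep_K_in_orbit[OF Mc S(1,3)]
  have "eventually (\<lambda>k. P (chart_matrix d K (f k))) sequentially"
    by (rule P[OF S(4)]) (use tendsto_chart_matrix(2)[OF lim r(1)] r(2) in auto)
  then have "eventually (\<lambda>k. P (chart_matrix d K (f k)) \<and> det (pivot_block d K (f k)) \<noteq> 0) sequentially"
    using tendsto_chart_matrix(1)[OF lim r(1)] by (rule eventually_conj)
  then obtain k where k: "P (chart_matrix d K (f k))" "det (pivot_block d K (f k)) \<noteq> 0"
    using eventually_happens' trivial_limit_sequentially by blast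
  have "GL_orbit d (f k) \<in> bc_space d" using f unfolding bc_space_def by blast
  then have "GL_orbit d (f k) \<in> ?V"
    using chart_matrix_in_orbit[OF bc_repsD(1,3)[OF f] k(2)] k(1) by blast
  then show "\<exists>k. f k \<in> {M \<in> bc_reps d. GL_orbit d M \<in> ?V}" using f by blast
qed auto

lemma openin_chart_nbhd: "openin (bc_top d) (chart_nbhd d K S0 \<epsilon>)"
  unfolding chart_nbhd_def
proof (rule openin_chart)
  fix S f assume S: "\<forall>i<2*d. \<forall>j<2*d. cmod (S $$ (i, j) - S0 $$ (i, j)) < \<epsilon>"
    and lim: "\<And>i j. i < 2*d \<Longrightarrow> j < 2*d \<Longrightarrow> (\<lambda>k. f k $$ (i, j)) \<longlonglongrightarrow> S $$ (i, j)"
  have "eventually (\<lambda>k. \<forall>i\<in>{..<2*d}. \<forall>j\<in>{..<2*d}. cmod (f k $$ (i, j) - S0 $$ (i, j)) < \<epsilon>) sequentially"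
  proof (intro eventually_ball_finite ballI finite_lessThan)
    fix i j assume "i \<in> {..<2*d}" "j \<in> {..<2*d}"
    then have "(\<lambda>k. cmod (f k $$ (i, j) - S0 $$ (i, j))) \<longlonglongrightarrow> cmod (S $$ (i, j) - S0 $$ (i, j))"
      by (intro tendsto_intros lim) auto
    then show "eventually (\<lambda>k. cmod (f k $$ (i, j) - S0 $$ (i, j)) < \<epsilon>) sequentially"
      by (rule order_tendstoD) (use \<open>i \<in> _\<close> \<open>j \<in> _\<close> S in auto)
  qed
  then show "eventually (\<lambda>k. \<forall>i<2*d. \<forall>j<2*d. cmod (f k $$ (i, j) - S0 $$ (i, j)) < \<epsilon>) sequentially" by (simp add: Ball_def)
qed

lemma bc_space_orbit:
  assumes A: "A \<in> bc_space d" and N: "N \<in> A"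
  shows "A = GL_orbit d N"
proof -
  obtain M where "M \<in> bc_reps d" "A = GL_orbit d M" using A unfolding bc_space_def by blast
  then show ?thesis using GL_orbit_eq[OF bc_repsD(1)] N by metis
qed

lemma chart_unique:
  assumes A: "A \<in> bc_space d" and S: "S \<in> carrier_mat (2*d) (2*d)" "rep_K d K S \<in> A"
    and S': "S' \<in> carrier_mat (2*d) (2*d)" "rep_K d K S' \<in> A"
  shows "S = S'"
proof -
  obtain M where "M \<in> bc_reps d" "A = GL_orbit d M" using A unfolding bc_space_def by blast
  then obtain M where M: "M \<in> carrier_mat (2*d) (4*d)" "A = GL_orbit d M" using bc_repsD(1) by blast
  show ?thesis using rep_K_in_orbit(2)[OF M(1) S(1), of K] rep_K_in_orbit(2)[OF M(1) S'(1), of K] S(2) S'(2) M(2) by simp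
qed

lemma orbit_rep_K_bc_space:
  assumes "S \<in> carrier_mat (2*d) (2*d)" "hermitian_mat S"
  shows "GL_orbit d (rep_K d K S) \<in> bc_space d"
  using rep_K_bc_reps[OF assms] unfolding bc_space_def by blast

text \<open>The entries of \<open>rep_K\<close> are entries of \<open>S\<close> or constants, so the
  class depends continuously on the coordinate. This produces boundary conditions inside a given
  neighbourhood.\<close>

lemma chart_continuous:
  assumes V: "openin (bc_top d) V" and S0: "S0 \<in> carrier_mat (2*d) (2*d)" "hermitian_mat S0"
    "GL_orbit d (rep_K d K S0) \<in> V"
  shows "\<exists>\<epsilon>>0. \<forall>S\<in>carrier_mat (2*d) (2*d). hermitian_mat S \<longrightarrow>
     (\<forall>i<2*d. \<forall>j<2*d. cmod (S $$ (i, j) - S0 $$ (i, j)) < \<epsilon>) \<longrightarrow> GL_orbit d (rep_K d K S) \<in> V"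
proof -
  have "rep_K d K S0 \<in> {M \<in> bc_reps d. GL_orbit d M \<in> V}" using rep_K_bc_reps[OF S0(1,2)] S0(3) by blast
  moreover have "openin (reps_top d) {M \<in> bc_reps d. GL_orbit d M \<in> V}" using V openin_bc_top by blast
  ultimately have "\<exists>e>0. \<forall>N\<in>bc_reps d. (\<forall>i<2*d. \<forall>j<4*d. cmod (N $$ (i,j) - rep_K d K S0 $$ (i,j)) < e) \<longrightarrow> N \<in> {M \<in> bc_reps d. GL_orbit d M \<in> V}"
    unfolding openin_reps_top by (elim conjE) (drule (1) bspec)
  then obtain e where e: "e > 0" "\<And>N. N \<in> bc_reps d \<Longrightarrow> (\<forall>i<2*d. \<forall>j<4*d. cmod (N $$ (i,j) - rep_K d K S0 $$ (i,j)) < e) \<Longrightarrow> GL_orbit d N \<in> V"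
    by auto
  show ?thesis
  proof (intro exI[of _ e] conjI ballI impI e(1) e(2))
    fix S assume S: "S \<in> carrier_mat (2*d) (2*d)" "hermitian_mat S" "\<forall>i<2*d. \<forall>j<2*d. cmod (S $$ (i, j) - S0 $$ (i, j)) < e"
    show "rep_K d K S \<in> bc_reps d" by (rule rep_K_bc_reps[OF S(1,2)])
    show "\<forall>i<2*d. \<forall>j<4*d. cmod (rep_K d K S $$ (i,j) - rep_K d K S0 $$ (i,j)) < e"
      using S(3) e(1) by (auto simp: rep_K_def)
  qed
qed

lemma kernel_dim_eq_0_iff:
  fixes B :: "complex mat"
  assumes B: "B \<in> carrier_mat n n"
  shows "kernel_dim B = 0 \<longleftrightarrow> det B \<noteq> 0"
proof
  interpret kernel n n B by unfold_locales (rule B)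
  assume "kernel_dim B = 0"
  then have dim: "dim = 0" by simp
  obtain X where X: "finite X" "basis X" using kernel_basis_exists[OF B] by blast
  have "X = {}" using Ker.dim_basis[OF X] X(1) dim by simp
  then have "mat_kernel B = span {}" using X(2) unfolding Ker.basis_def by simp
  then have k: "mat_kernel B = {0\<^sub>v n}" using Ker.span_empty by simp
  show "det B \<noteq> 0"
  proof
    assume "det B = 0"
    then obtain v where v: "v \<in> carrier_vec n" "v \<noteq> 0\<^sub>v n" "B *\<^sub>v v = 0\<^sub>v n"
      using det_0_iff_vec_prod_zero_field[OF B] by blast
    then have "v \<in> mat_kernel B" using B by (intro mat_kernelI) auto
    then show False using k v by simp
  qed
next
  assume "det B \<noteq> 0"
  then obtain H where H: "H \<in> carrier_mat n n" "H * B = 1\<^sub>m n" "B * H = 1\<^sub>m n"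
    using det_nz_inverse[OF B] by metis
  have "mat_kernel (B * 1\<^sub>m n) = mat_kernel (1\<^sub>m n)"
    by (rule mat_kernel_mult_eq[OF one_carrier_mat B H(1,2)])
  then have k: "mat_kernel B = mat_kernel (1\<^sub>m n)" using B by simp
  show "kernel_dim B = 0" unfolding kernel_dim_def using kernel_one_mat(1)[of n, where 'a=complex] B k by simp
qed

text \<open>For empty \<open>K\<close> the pivot block is \<open>B\<close> itself, so the condition
  says that the class lies in the chart of the empty set. The representative chosen by
  \<open>SOME\<close> changes the determinant only by a nonzero factor.\<close>

lemma n0B_eq_0_iff:
  assumes M: "M \<in> bc_reps d"
  shows "n0B d (GL_orbit d M) = 0 \<longleftrightarrow> det (pivot_block d {} M) \<noteq> 0"
proof -
  have B: "Bblk d N = pivot_block d {} N" for N by (simp add: Bblk_def pivot_block_def)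
  have Mc: "M \<in> carrier_mat (2*d) (4*d)" by (rule bc_repsD(1)[OF M])
  define M' where "M' = (SOME X. X \<in> GL_orbit d M)"
  have "M' \<in> GL_orbit d M" unfolding M'_def by (rule someI[of _ M]) (rule GL_orbit_self[OF Mc])
  then obtain G where G: "G \<in> carrier_mat (2*d) (2*d)" "det G \<noteq> 0" "M' = G * M" unfolding GL_orbit_iff by blast
  have "n0B d (GL_orbit d M) = kernel_dim (pivot_block d {} M')" unfolding n0B_def M'_def B ..
  moreover have "det (pivot_block d {} M') = det G * det (pivot_block d {} M)"
    unfolding G(3) block_mult[OF G(1) Mc] by (rule det_mult[OF G(1) block_carrier(1)])
  ultimately show ?thesis using kernel_dim_eq_0_iff[OF block_carrier(1)] G(2) by simp
qed

text \<open>The chart is centred on the boundary condition: pivot columns are taken from \<open>B\<close> as long as possible,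
  and completed by columns of \<open>A\<close>.\<close>

lemma chart_with_zero_block:
  assumes M: "M \<in> bc_reps d" and sing: "det (pivot_block d {} M) = 0"
  shows "\<exists>K S. K \<subseteq> {1..2*d} \<and> K \<noteq> {} \<and> S \<in> carrier_mat (2*d) (2*d) \<and> hermitian_mat S \<and> rep_K d K S \<in> GL_orbit d M \<and>
     (\<forall>i<2*d. \<forall>j<2*d. Suc i \<in> K \<longrightarrow> Suc j \<in> K \<longrightarrow> S $$ (i, j) = 0)"
proof -
  define n where "n = 2*d"
  have Mc: "M \<in> carrier_mat n (4*d)" using bc_repsD(1)[OF M] by (simp add: n_def)
  define b where "b = (\<lambda>r i. M $$ (r, i + n))"
  define a where "a = (\<lambda>r i. M $$ (r, i))"
  define indep where "indep = (\<lambda>T. \<forall>c::nat \<Rightarrow> complex. (\<forall>r<n. (\<Sum>i\<in>T. c i * b r i) = 0) \<longrightarrow> (\<forall>i\<in>T. c i = 0))"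
  have "\<exists>T. finite T \<and> maximal T (\<lambda>T. T \<subseteq> {..<n} \<and> indep T) \<and> {} \<subseteq> T"
    by (rule maximal_exists_superset[of "{..<n}"]) (auto simp: indep_def)
  then obtain T where mT: "maximal T (\<lambda>T. T \<subseteq> {..<n} \<and> indep T)" by blast
  have T: "T \<subseteq> {..<n}" "indep T" using mT unfolding maximal_def by auto
  have Tmax: "T' = T" if "T \<subseteq> T'" "T' \<subseteq> {..<n}" "indep T'" for T' using mT that unfolding maximal_def by simp
  have finT: "finite T" using T(1) finite_subset by blast
  have ex\<gamma>: "\<exists>\<gamma>. \<forall>r<n. b r j = (\<Sum>i\<in>T. \<gamma> i * b r i)" if j: "j < n" "j \<notin> T" for j
  proof -
    have "\<not> indep (insert j T)" using Tmax[of "insert j T"] j T by auto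
    then obtain c where c: "\<And>r. r < n \<Longrightarrow> (\<Sum>i\<in>insert j T. c i * b r i) = 0" "\<exists>i\<in>insert j T. c i \<noteq> 0"
      unfolding indep_def by blast
    have c': "c j * b r j + (\<Sum>i\<in>T. c i * b r i) = 0" if "r < n" for r using c(1)[OF that] finT j by simp
    have cj: "c j \<noteq> 0"
    proof
      assume 0: "c j = 0"
      then have "\<forall>r<n. (\<Sum>i\<in>T. c i * b r i) = 0" using c' by simp
      then have "\<forall>i\<in>T. c i = 0" using T(2)[unfolded indep_def, rule_format, of c] by blast
      then show False using c(2) 0 by auto
    qed
    show ?thesis
    proof (intro exI[of _ "\<lambda>i. - c i / c j"] allI impI)
      fix r assume r: "r < n"
      have "(\<Sum>i\<in>T. - c i / c j * b r i) = - (\<Sum>i\<in>T. c i * b r i) / c j"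
        by (simp add: sum_negf sum_divide_distrib)
      also have "\<dots> = b r j" using c'[OF r] cj by (simp add: field_simps add_eq_0_iff)
      finally show "b r j = (\<Sum>i\<in>T. - c i / c j * b r i)" by simp
    qed
  qed
  define K where "K = Suc ` ({..<n} - T)"
  have Kiff: "Suc i \<in> K \<longleftrightarrow> i < n \<and> i \<notin> T" for i unfolding K_def by auto
  have K: "K \<subseteq> {1..2*d}" unfolding K_def n_def by auto
  have C: "pivot_block d K M \<in> carrier_mat n n" unfolding n_def by simp
  have Centry: "pivot_block d K M $$ (r, i) = (if i \<in> T then b r i else - a r i)" if "r < n" "i < n" for r i
    using that Kiff[of i] by (auto simp: pivot_block_def a_def b_def n_def)
  have sc: "(\<Sum>k<n. a r k * cnj (b s k)) = (\<Sum>k<n. b r k * cnj (a s k))" if "r < n" "s < n" for r s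
    using bc_repsD(3)[OF M] that unfolding sym_cond_def a_def b_def n_def by simp
  \<comment> \<open>A row vector \<open>v\<close> annihilating the pivot block annihilates all
    columns of \<open>B\<close>, since those in \<open>T\<close> span them. Then \<open>v A\<close>
    is supported on \<open>T\<close>, and \<open>A B\<^sup>* = B A\<^sup>*\<close> turns its
    conjugate into a relation among the independent columns of \<open>B\<close> in \<open>T\<close>.
    So \<open>v A = 0\<close> too, and full rank gives \<open>v = 0\<close>.\<close>
  have inj: "v = 0\<^sub>v n" if v: "v \<in> carrier_vec n" "(pivot_block d K M)\<^sup>T *\<^sub>v v = 0\<^sub>v n" for v
  proof -
    have 0: "(\<Sum>r<n. v $ r * pivot_block d K M $$ (r, i)) = 0" if i: "i < n" for i
    proof -
      have "((pivot_block d K M)\<^sup>T *\<^sub>v v) $ i = (\<Sum>r<n. v $ r * pivot_block d K M $$ (r, i))"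
        using v(1) i C by (simp add: scalar_prod_def atLeast0LessThan mult.commute)
      then show ?thesis using v(2) i by simp
    qed
    have vbT: "(\<Sum>r<n. v $ r * b r i) = 0" if "i \<in> T" for i
    proof -
      have i: "i < n" using that T(1) by auto
      have "(\<Sum>r<n. v $ r * b r i) = (\<Sum>r<n. v $ r * pivot_block d K M $$ (r, i))"
        using Centry[OF _ i] that by (intro sum.cong refl) simp
      then show ?thesis using 0[OF i] by simp
    qed
    have va: "(\<Sum>r<n. v $ r * a r i) = 0" if "i < n" "i \<notin> T" for i
    proof -
      have "(\<Sum>r<n. v $ r * a r i) = (\<Sum>r<n. - (v $ r * pivot_block d K M $$ (r, i)))"
        using Centry[OF _ that(1)] that by (intro sum.cong refl) simp
      then show ?thesis using 0[OF that(1)] by (simp add: sum_negf)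
    qed
    have vb: "(\<Sum>r<n. v $ r * b r j) = 0" if j: "j < n" for j
    proof (cases "j \<in> T")
      case False
      then obtain \<gamma> where \<gamma>: "\<And>r. r < n \<Longrightarrow> b r j = (\<Sum>i\<in>T. \<gamma> i * b r i)" using ex\<gamma> j by blast
      have "(\<Sum>r<n. v $ r * b r j) = (\<Sum>r<n. \<Sum>i\<in>T. \<gamma> i * (v $ r * b r i))"
        by (intro sum.cong refl) (simp add: \<gamma> sum_distrib_left mult_ac)
      also have "\<dots> = (\<Sum>i\<in>T. \<gamma> i * (\<Sum>r<n. v $ r * b r i))" by (subst sum.swap) (simp add: sum_distrib_left)
      also have "\<dots> = 0" using vbT by simp
      finally show ?thesis .
    qed (rule vbT)
    define \<alpha> where "\<alpha> = (\<lambda>k. \<Sum>r<n. v $ r * a r k)"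
    have "(\<Sum>k\<in>T. cnj (\<alpha> k) * b s k) = 0" if s: "s < n" for s
    proof -
      have "(\<Sum>k\<in>T. \<alpha> k * cnj (b s k)) = (\<Sum>k<n. \<alpha> k * cnj (b s k))"
        by (rule sum.mono_neutral_left) (use T(1) va in \<open>auto simp: \<alpha>_def\<close>)
      also have "\<dots> = (\<Sum>k<n. \<Sum>r<n. v $ r * (a r k * cnj (b s k)))" unfolding \<alpha>_def sum_distrib_right by (simp add: mult.assoc)
      also have "\<dots> = (\<Sum>r<n. v $ r * (\<Sum>k<n. a r k * cnj (b s k)))" by (subst sum.swap) (simp add: sum_distrib_left)
      also have "\<dots> = (\<Sum>r<n. v $ r * (\<Sum>k<n. b r k * cnj (a s k)))" using sc s by simp
      also have "\<dots> = (\<Sum>k<n. \<Sum>r<n. v $ r * (b r k * cnj (a s k)))" by (subst sum.swap) (simp add: sum_distrib_left)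
      also have "\<dots> = (\<Sum>k<n. cnj (a s k) * (\<Sum>r<n. v $ r * b r k))" by (simp add: sum_distrib_left mult_ac)
      also have "\<dots> = 0" using vb by simp
      finally have "cnj (\<Sum>k\<in>T. \<alpha> k * cnj (b s k)) = 0" by simp
      then show ?thesis by simp
    qed
    then have "\<forall>k\<in>T. cnj (\<alpha> k) = 0" using T(2)[unfolded indep_def, rule_format, of "\<lambda>k. cnj (\<alpha> k)"] by blast
    then have \<alpha>T: "\<forall>k\<in>T. \<alpha> k = 0" by (simp only: complex_cnj_zero_iff)
    have va': "(\<Sum>r<n. v $ r * a r i) = 0" if "i < n" for i using va[OF that] \<alpha>T unfolding \<alpha>_def by (cases "i \<in> T") auto
    have "v $ r = 0" if "r < n" for r
    proof (rule rank_full_left_kernel[of M n "4*d"])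
      show "vec_space.rank n M = n" using bc_repsD(2)[OF M] by (simp add: n_def)
      fix j assume j: "j < 4*d"
      show "(\<Sum>i<n. v $ i * M $$ (i, j)) = 0"
      proof (cases "j < n")
        case True then show ?thesis using va' unfolding a_def by blast
      next
        case False
        then have "j - n < n" "j - n + n = j" using j by (auto simp: n_def)
        then show ?thesis using vb[of "j - n"] unfolding b_def by simp
      qed
    qed (use Mc that in auto)
    then show "v = 0\<^sub>v n" using v(1) by (intro eq_vecI) auto
  qed
  have dC: "det (pivot_block d K M) \<noteq> 0"
    using det_0_iff_vec_prod_zero_field[of "(pivot_block d K M)\<^sup>T" n] inj C det_transpose[OF C] by (metis transpose_carrier_mat)
  define S where "S = chart_matrix d K M"
  note S = chart_matrix_in_orbit[OF bc_repsD(1,3)[OF M] dC, folded S_def]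
  have "K \<noteq> {}"
  proof
    assume "K = {}"
    then show False using dC sing by simp
  qed
  \<comment> \<open>Column \<open>j\<close> of \<open>B\<close> is a combination of the columns in
    \<open>T\<close>, also after passing to \<open>rep_K\<close>; there these are unit vectors with
    index in \<open>T\<close>, whose entry \<open>i\<close> is zero.\<close>
  moreover have "S $$ (i, j) = 0" if ij: "i < 2*d" "j < 2*d" "Suc i \<in> K" "Suc j \<in> K" for i j
  proof -
    obtain G where G: "G \<in> carrier_mat n n" "rep_K d K S = G * M" using S(3) unfolding GL_orbit_iff n_def by blast
    have i: "i < n" "i \<notin> T" and j: "j < n" "j \<notin> T" using ij Kiff by auto
    obtain \<gamma> where \<gamma>: "\<And>r. r < n \<Longrightarrow> b r j = (\<Sum>l\<in>T. \<gamma> l * b r l)" using ex\<gamma> j by blast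
    have e: "rep_K d K S $$ (i, l + n) = (\<Sum>r<n. G $$ (i, r) * b r l)" if "l < n" for l
      unfolding G(2) b_def by (rule index_mult_sum[OF G(1) Mc]) (use i that in \<open>auto simp: n_def\<close>)
    have z: "rep_K d K S $$ (i, l + n) = 0" if "l \<in> T" for l
      using that T(1) i Kiff[of l] by (auto simp: rep_K_def n_def)
    have "S $$ (i, j) = rep_K d K S $$ (i, j + n)" using i j ij by (simp add: rep_K_def n_def)
    also have "\<dots> = (\<Sum>r<n. \<Sum>l\<in>T. \<gamma> l * (G $$ (i, r) * b r l))"
      unfolding e[OF j(1)] by (intro sum.cong refl) (simp add: \<gamma> sum_distrib_left mult_ac)
    also have "\<dots> = (\<Sum>l\<in>T. \<gamma> l * (\<Sum>r<n. G $$ (i, r) * b r l))" by (subst sum.swap) (simp add: sum_distrib_left)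
    also have "\<dots> = (\<Sum>l\<in>T. \<gamma> l * rep_K d K S $$ (i, l + n))"
      by (intro sum.cong refl) (use e T(1) in auto)
    also have "\<dots> = 0" using z by simp
    finally show ?thesis .
  qed
  ultimately show ?thesis using K S by blast
qed

lemma inertia_scalar_block:
  assumes K: "K \<subseteq> {1..2*d}"
    and S: "\<And>i j. i < 2*d \<Longrightarrow> j < 2*d \<Longrightarrow> Suc i \<in> K \<Longrightarrow> Suc j \<in> K \<Longrightarrow> S $$ (i, j) = (if i = j then complex_of_real \<epsilon> else 0)"
  shows "inertia (sub_K K S) = (if \<epsilon> = 0 then card K else 0, if \<epsilon> > 0 then card K else 0, if \<epsilon> < 0 then card K else 0)"
proof -
  define \<beta> where "\<beta> = (\<lambda>k. sorted_list_of_set K ! k - 1)"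
  have \<beta>: "bij_betw \<beta> {..<card K} {i. i < 2*d \<and> Suc i \<in> K}" unfolding \<beta>_def by (rule sub_K_bij[OF K])
  have b: "\<beta> i < 2*d" "Suc (\<beta> i) \<in> K" if "i < card K" for i using \<beta> that by (auto simp: bij_betw_def)
  have bi: "\<beta> i = \<beta> j \<longleftrightarrow> i = j" if "i < card K" "j < card K" for i j using \<beta> that by (auto simp: bij_betw_def inj_on_def)
  have "sub_K K S = mat (card K) (card K) (\<lambda>(i,j). S $$ (\<beta> i, \<beta> j))" unfolding sub_K_def \<beta>_def Let_def ..
  also have "\<dots> = mat (card K) (card K) (\<lambda>(i,j). if i = j then complex_of_real \<epsilon> else 0)"
    by (rule eq_matI) (auto simp: S b bi)
  finally have M: "sub_K K S = mat (card K) (card K) (\<lambda>(i,j). if i = j then complex_of_real \<epsilon> else 0)" (is "_ = ?D") .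
  have "char_poly ?D = (\<Prod>a\<leftarrow>diag_mat ?D. [:- a, 1:])"
    by (rule char_poly_upper_triangular[of _ "card K"]) (simp_all add: upper_triangular_def)
  also have "diag_mat ?D = map (\<lambda>k. complex_of_real \<epsilon>) [0..<card K]" unfolding diag_mat_def by simp
  also have "(\<Prod>a\<leftarrow>map (\<lambda>k. complex_of_real \<epsilon>) [0..<card K]. [:- a, 1:]) = (\<Prod>k<card K. [:- complex_of_real \<epsilon>, 1:])"
    by (simp add: comp_def atLeast0LessThan flip: prod.distinct_set_conv_list)
  finally show ?thesis unfolding M by (subst inertia_of_real_linear_factors[where n="card K" and ev="\<lambda>_. \<epsilon>"]) auto
qed

section \<open>Jumps of the eigenvalues\<close>

text \<open>The counting function is a step function with finitely many steps below any bound, and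
  \<open>n \<ge> 1\<close> keeps the set bounded below. This translates inequalities for the
  \<open>n\<close>-th eigenvalue into strict counts.\<close>

lemma Inf_count_less_iff:
  fixes m :: "real \<Rightarrow> nat" and z :: real
  assumes fin: "\<And>x. finite {l. 0 < m l \<and> l \<le> x}" and n: "n \<ge> 1"
    and ne: "n \<le> (\<Sum>l | 0 < m l \<and> l \<le> x0. m l)"
  shows "Inf {x. n \<le> (\<Sum>l | 0 < m l \<and> l \<le> x. m l)} < z \<longleftrightarrow> n \<le> (\<Sum>l | 0 < m l \<and> l < z. m l)"
proof
  let ?E = "{x. n \<le> (\<Sum>l | 0 < m l \<and> l \<le> x. m l)}"
  assume "Inf ?E < z"
  then obtain x where x: "n \<le> (\<Sum>l | 0 < m l \<and> l \<le> x. m l)" "x < z"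
    using cInf_lessD[of ?E z] ne by auto
  have "{l. 0 < m l \<and> l < z} \<subseteq> {l. 0 < m l \<and> l \<le> z}" by auto
  then have "(\<Sum>l | 0 < m l \<and> l \<le> x. m l) \<le> (\<Sum>l | 0 < m l \<and> l < z. m l)"
    using x(2) fin[of z] by (intro sum_mono2) (auto intro: finite_subset)
  then show "n \<le> (\<Sum>l | 0 < m l \<and> l < z. m l)" using x(1) by simp
next
  let ?E = "{x. n \<le> (\<Sum>l | 0 < m l \<and> l \<le> x. m l)}" and ?F = "{l. 0 < m l \<and> l < z}"
  assume l: "n \<le> (\<Sum>l | 0 < m l \<and> l < z. m l)"
  have finF: "finite ?F" by (rule finite_subset[OF _ fin[of z]]) auto
  have neF: "?F \<noteq> {}"
  proof
    assume "?F = {}"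
    then show False using l n by (simp only: sum.empty)
  qed
  have lz: "Max ?F < z" using Max_in[OF finF neF] by simp
  have F: "?F = {l. 0 < m l \<and> l \<le> Max ?F}"
  proof (rule Set.set_eqI)
    fix l show "l \<in> ?F \<longleftrightarrow> l \<in> {l. 0 < m l \<and> l \<le> Max ?F}"
      using lz Max_ge[OF finF, of l] by auto
  qed
  have "(\<Sum>l | 0 < m l \<and> l \<le> Max ?F. m l) = (\<Sum>l | 0 < m l \<and> l < z. m l)"
    by (rule sum.cong[OF F[symmetric] refl])
  then have "Max ?F \<in> ?E" using l by simp
  moreover have "bdd_below ?E"
  proof (rule bdd_belowI)
    fix x assume x: "x \<in> ?E"
    show "Min ?F \<le> x"
    proof (rule ccontr)
      assume "\<not> Min ?F \<le> x"
      then have *: "x < Min ?F" by simp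
      have "{l. 0 < m l \<and> l \<le> x} = {}"
      proof (rule ccontr)
        assume "{l. 0 < m l \<and> l \<le> x} \<noteq> {}"
        then obtain l where l: "0 < m l" "l \<le> x" by blast
        have "Min ?F < z" using Min_in[OF finF neF] by simp
        then have "l \<in> ?F" using l * by auto
        then show False using Min_le[OF finF] * l by fastforce
      qed
      then show False using x n by (simp only: sum.empty mem_Collect_eq)
    qed
  qed
  ultimately have "Inf ?E \<le> Max ?F" by (rule cInf_lower)
  then show "Inf ?E < z" using lz by simp
qed

context sl_coeffs
begin

abbreviation "emult A l \<equiv> eig_mult d a b P Q W A (complex_of_real l)"

text \<open>Strictly below \<mu>, because the index counts negative directions and an eigenvalue at
  \<mu> itself contributes null ones.\<close>

definition scount :: "complex mat set \<Rightarrow> real \<Rightarrow> nat" where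
  "scount A \<mu> = (\<Sum>l | 0 < emult A l \<and> l < \<mu>. emult A l)"

abbreviation "npos K S \<equiv> fst (snd (inertia (sub_K K S)))"

lemma npos_le:
  assumes "K \<subseteq> {1..2*d}" "S \<in> carrier_mat (2*d) (2*d)" "hermitian_mat S"
  shows "npos K S \<le> card K"
proof -
  obtain ev :: "nat \<Rightarrow> real" where "inertia (sub_K K S) =
     (card {k. k < card K \<and> ev k = 0}, card {k. k < card K \<and> ev k > 0}, card {k. k < card K \<and> ev k < 0})"
    using sub_K_eigenbasis[OF assms] by blast
  then have "npos K S = card {k. k < card K \<and> ev k > 0}" by simp
  also have "\<dots> \<le> card {..<card K}" by (rule card_mono) auto
  finally show ?thesis by simp
qed

lemma scount_index:
  assumes "K \<subseteq> {1..2*d}" "S \<in> carrier_mat (2*d) (2*d)" "hermitian_mat S"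
  shows "(card K - npos K S) + scount (orb K S) \<mu> = form_index K S \<mu>"
proof -
  note fin = eig_count_index(1)[OF assms, of \<mu>]
  let ?A = "orb K S"
  have e: "{l. 0 < emult ?A l \<and> l \<le> \<mu>} = {l. 0 < emult ?A l \<and> l < \<mu>} \<union> (if 0 < emult ?A \<mu> then {\<mu>} else {})"
    by (auto simp: le_less)
  have "finite {l. 0 < emult ?A l \<and> l < \<mu>}" by (rule finite_subset[OF _ fin]) auto
  then have "eig_count d a b P Q W ?A \<mu> = scount ?A \<mu> + emult ?A \<mu>"
    unfolding eig_count_def scount_def e by (subst sum.union_disjoint) auto
  then show ?thesis using eig_count_index(2)[OF assms, of \<mu>] by simp
qed

lemma eigval_less_iff:
  assumes d: "d > 0" and K: "K \<subseteq> {1..2*d}" and S: "S \<in> carrier_mat (2*d) (2*d)" "hermitian_mat S" and n: "n \<ge> 1"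
  shows "eigval d a b P Q W n (orb K S) < z \<longleftrightarrow> n \<le> scount (orb K S) z"
proof -
  note fin = eig_count_index(1)[OF K S]
  obtain \<mu>0 where "n + card K \<le> form_index K S \<mu>0" using form_index_growth[OF d S] by blast
  then have 1: "n \<le> scount (orb K S) \<mu>0" using scount_index[OF K S, of \<mu>0] by simp
  have "scount (orb K S) \<mu>0 \<le> (\<Sum>l | 0 < emult (orb K S) l \<and> l \<le> \<mu>0. emult (orb K S) l)"
    unfolding scount_def by (rule sum_mono2[OF fin]) auto
  then have "n \<le> (\<Sum>l | 0 < emult (orb K S) l \<and> l \<le> \<mu>0. emult (orb K S) l)" using 1 by simp
  from Inf_count_less_iff[OF fin n this] show ?thesis unfolding eigval_def eig_count_def scount_def .
qed

lemma non_eigenvalue_between: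
  assumes K: "K \<subseteq> {1..2*d}" and S: "S \<in> carrier_mat (2*d) (2*d)" "hermitian_mat S" and xy: "x < y"
  shows "\<exists>\<mu>. x < \<mu> \<and> \<mu> < y \<and> emult (orb K S) \<mu> = 0"
proof -
  have "infinite ({x<..<y} - {l. 0 < emult (orb K S) l \<and> l \<le> y})"
    using eig_count_index(1)[OF K S, of y] xy by (intro Diff_infinite_finite) (auto simp: infinite_Ioo)
  then obtain \<mu> where "\<mu> \<in> {x<..<y} - {l. 0 < emult (orb K S) l \<and> l \<le> y}" using infinite_imp_nonempty by blast
  then show ?thesis by (intro exI[of _ \<mu>]) auto
qed

text \<open>The index at \<mu> does not change near \<open>S0\<close>, while its part coming from
  -\<infinity>, the number of nonpositive eigenvalues of \<open>S\<^sub>K\<close>, drops by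
  \<open>k\<close>.\<close>

lemma scount_near:
  assumes K: "K \<subseteq> {1..2*d}" and S0: "S0 \<in> carrier_mat (2*d) (2*d)" "hermitian_mat S0"
    and \<mu>: "emult (orb K S0) \<mu> = 0"
  shows "\<exists>\<epsilon>>0. \<forall>S\<in>carrier_mat (2*d) (2*d). hermitian_mat S \<longrightarrow> (\<forall>i<2*d. \<forall>j<2*d. cmod (S $$ (i, j) - S0 $$ (i, j)) < \<epsilon>) \<longrightarrow>
     npos K S = npos K S0 + k \<longrightarrow> scount (orb K S) \<mu> = scount (orb K S0) \<mu> + k"
proof -
  obtain \<epsilon> where \<epsilon>: "\<epsilon> > 0" "\<forall>S\<in>carrier_mat (2*d) (2*d). hermitian_mat S \<and> (\<forall>i<2*d. \<forall>j<2*d. cmod (S $$ (i, j) - S0 $$ (i, j)) \<le> \<epsilon>) \<longrightarrow> form_index K S \<mu> = form_index K S0 \<mu>"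
    using form_index_stable[OF S0 \<mu>] by blast
  show ?thesis
  proof (intro exI[of _ \<epsilon>] conjI ballI impI \<epsilon>(1))
    fix S assume S: "S \<in> carrier_mat (2*d) (2*d)" "hermitian_mat S" "\<forall>i<2*d. \<forall>j<2*d. cmod (S $$ (i, j) - S0 $$ (i, j)) < \<epsilon>"
      and np: "npos K S = npos K S0 + k"
    have "form_index K S \<mu> = form_index K S0 \<mu>" using \<epsilon>(2) S by (simp add: less_imp_le)
    then have "(card K - npos K S) + scount (orb K S) \<mu> = (card K - npos K S0) + scount (orb K S0) \<mu>"
      using scount_index[OF K S(1,2)] scount_index[OF K S0] by simp
    \<comment> \<open>\<open>npos_le\<close> excludes truncation in the subtractions from
      \<open>card K\<close>.\<close>
    then show "scount (orb K S) \<mu> = scount (orb K S0) \<mu> + k"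
      using npos_le[OF K S(1,2)] np by simp
  qed
qed

text \<open>At an arbitrarily low \<mu> that is not an eigenvalue for \<open>S0\<close> the nearby
  count is at least \<open>k\<close>, wherever the spectrum for \<open>S0\<close> begins.\<close>

lemma eigval_jump_down:
  assumes d: "d > 0" and K: "K \<subseteq> {1..2*d}" and S0: "S0 \<in> carrier_mat (2*d) (2*d)" "hermitian_mat S0"
    and n: "n \<ge> 1" "n \<le> k"
  shows "\<exists>\<epsilon>>0. \<forall>S\<in>carrier_mat (2*d) (2*d). hermitian_mat S \<longrightarrow> (\<forall>i<2*d. \<forall>j<2*d. cmod (S $$ (i, j) - S0 $$ (i, j)) < \<epsilon>) \<longrightarrow>
     npos K S = npos K S0 + k \<longrightarrow> eigval d a b P Q W n (orb K S) < z"
proof -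
  obtain \<mu> where \<mu>: "\<mu> < z" "emult (orb K S0) \<mu> = 0" using non_eigenvalue_between[OF K S0, of "z - 1" z] by auto
  obtain \<epsilon> where \<epsilon>: "\<epsilon> > 0" "\<forall>S\<in>carrier_mat (2*d) (2*d). hermitian_mat S \<longrightarrow> (\<forall>i<2*d. \<forall>j<2*d. cmod (S $$ (i, j) - S0 $$ (i, j)) < \<epsilon>) \<longrightarrow>
     npos K S = npos K S0 + k \<longrightarrow> scount (orb K S) \<mu> = scount (orb K S0) \<mu> + k"
    using scount_near[OF K S0 \<mu>(2)] by blast
  show ?thesis
  proof (intro exI[of _ \<epsilon>] conjI ballI impI \<epsilon>(1))
    fix S assume S: "S \<in> carrier_mat (2*d) (2*d)" "hermitian_mat S" "\<forall>i<2*d. \<forall>j<2*d. cmod (S $$ (i, j) - S0 $$ (i, j)) < \<epsilon>"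
      and np: "npos K S = npos K S0 + k"
    have "n \<le> scount (orb K S) \<mu>" using \<epsilon>(2) S np n by simp
    then have "eigval d a b P Q W n (orb K S) < \<mu>" using eigval_less_iff[OF d K S(1,2) n(1)] by simp
    then show "eigval d a b P Q W n (orb K S) < z" using \<mu>(1) by simp
  qed
qed

text \<open>The limit value is enclosed between two numbers that are not eigenvalues for
  \<open>S0\<close>; the strict counts at both are shifted by exactly \<open>k\<close>, and this
  pins down the \<open>n\<close>-th eigenvalue.\<close>

lemma eigval_jump_shift:
  assumes d: "d > 0" and K: "K \<subseteq> {1..2*d}" and S0: "S0 \<in> carrier_mat (2*d) (2*d)" "hermitian_mat S0"
    and n: "n > k" and e: "e > 0"
  shows "\<exists>\<epsilon>>0. \<forall>S\<in>carrier_mat (2*d) (2*d). hermitian_mat S \<longrightarrow> (\<forall>i<2*d. \<forall>j<2*d. cmod (S $$ (i, j) - S0 $$ (i, j)) < \<epsilon>) \<longrightarrow>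
     npos K S = npos K S0 + k \<longrightarrow> \<bar>eigval d a b P Q W n (orb K S) - eigval d a b P Q W (n - k) (orb K S0)\<bar> < e"
proof -
  define L where "L = eigval d a b P Q W (n - k) (orb K S0)"
  have nk: "n - k \<ge> 1" "n \<ge> 1" using n by auto
  obtain \<mu>1 where \<mu>1: "L - e < \<mu>1" "\<mu>1 < L" "emult (orb K S0) \<mu>1 = 0" using non_eigenvalue_between[OF K S0, of "L - e" L] e by auto
  obtain \<mu>2 where \<mu>2: "L < \<mu>2" "\<mu>2 < L + e" "emult (orb K S0) \<mu>2 = 0" using non_eigenvalue_between[OF K S0, of L "L + e"] e by auto
  have s1: "\<not> n - k \<le> scount (orb K S0) \<mu>1" using eigval_less_iff[OF d K S0 nk(1), of \<mu>1] \<mu>1 unfolding L_def by simp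
  have s2: "n - k \<le> scount (orb K S0) \<mu>2" using eigval_less_iff[OF d K S0 nk(1), of \<mu>2] \<mu>2 unfolding L_def by simp
  obtain \<epsilon>1 where \<epsilon>1: "\<epsilon>1 > 0" "\<forall>S\<in>carrier_mat (2*d) (2*d). hermitian_mat S \<longrightarrow> (\<forall>i<2*d. \<forall>j<2*d. cmod (S $$ (i, j) - S0 $$ (i, j)) < \<epsilon>1) \<longrightarrow>
     npos K S = npos K S0 + k \<longrightarrow> scount (orb K S) \<mu>1 = scount (orb K S0) \<mu>1 + k"
    using scount_near[OF K S0 \<mu>1(3)] by blast
  obtain \<epsilon>2 where \<epsilon>2: "\<epsilon>2 > 0" "\<forall>S\<in>carrier_mat (2*d) (2*d). hermitian_mat S \<longrightarrow> (\<forall>i<2*d. \<forall>j<2*d. cmod (S $$ (i, j) - S0 $$ (i, j)) < \<epsilon>2) \<longrightarrow>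
     npos K S = npos K S0 + k \<longrightarrow> scount (orb K S) \<mu>2 = scount (orb K S0) \<mu>2 + k"
    using scount_near[OF K S0 \<mu>2(3)] by blast
  have "\<bar>eigval d a b P Q W n (orb K S) - L\<bar> < e"
    if S: "S \<in> carrier_mat (2*d) (2*d)" "hermitian_mat S" "\<forall>i<2*d. \<forall>j<2*d. cmod (S $$ (i, j) - S0 $$ (i, j)) < min \<epsilon>1 \<epsilon>2"
      and np: "npos K S = npos K S0 + k" for S
  proof -
    have "scount (orb K S) \<mu>1 = scount (orb K S0) \<mu>1 + k" "scount (orb K S) \<mu>2 = scount (orb K S0) \<mu>2 + k"
      using \<epsilon>1(2) \<epsilon>2(2) S np by auto
    then have "\<not> n \<le> scount (orb K S) \<mu>1" "n \<le> scount (orb K S) \<mu>2" using s1 s2 by auto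
    then have "\<not> eigval d a b P Q W n (orb K S) < \<mu>1" "eigval d a b P Q W n (orb K S) < \<mu>2"
      using eigval_less_iff[OF d K S(1,2) nk(2)] by auto
    then show ?thesis using \<mu>1 \<mu>2 by auto
  qed
  then show ?thesis using \<epsilon>1(1) \<epsilon>2(1) unfolding L_def by (intro exI[of _ "min \<epsilon>1 \<epsilon>2"]) auto
qed

text \<open>Chart neighbourhoods are open, so an estimate for coordinates near \<open>S0\<close>
  becomes a statement about the filter; the role of \<open>J\<close> is to fix the positive
  inertia.\<close>

lemma eventually_chart:
  assumes K: "K \<subseteq> {1..2*d}" and S0: "S0 \<in> carrier_mat (2*d) (2*d)" "hermitian_mat S0" and \<epsilon>: "\<epsilon> > 0"
    and Pr: "\<forall>S\<in>carrier_mat (2*d) (2*d). hermitian_mat S \<longrightarrow> (\<forall>i<2*d. \<forall>j<2*d. cmod (S $$ (i, j) - S0 $$ (i, j)) < \<epsilon>) \<longrightarrow>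
     npos K S = npos K S0 + k \<longrightarrow> Pr (orb K S)"
    and J: "\<And>B S. B \<in> J \<Longrightarrow> S \<in> carrier_mat (2*d) (2*d) \<Longrightarrow> hermitian_mat S \<Longrightarrow> rep_K d K S \<in> B \<Longrightarrow> B \<in> bc_space d \<Longrightarrow> npos K S = npos K S0 + k"
  shows "eventually Pr (atin_within (bc_top d) (orb K S0) J)"
proof -
  have orb: "orb K S0 \<in> bc_space d" by (rule orbit_rep_K_bc_space[OF S0])
  have in0: "orb K S0 \<in> chart_nbhd d K S0 \<epsilon>"
    unfolding chart_nbhd_def using orb S0 \<epsilon> GL_orbit_self[OF rep_K_carrier] by auto
  have "Pr B" if B: "B \<in> chart_nbhd d K S0 \<epsilon>" "B \<in> J" for B
  proof -
    obtain S where S: "S \<in> carrier_mat (2*d) (2*d)" "hermitian_mat S" "rep_K d K S \<in> B" "B \<in> bc_space d"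
      "\<forall>i<2*d. \<forall>j<2*d. cmod (S $$ (i, j) - S0 $$ (i, j)) < \<epsilon>" using B(1) unfolding chart_nbhd_def by blast
    have "Pr (orb K S)" using Pr S(1,2,5) J[OF B(2) S(1-4)] by blast
    then show ?thesis using bc_space_orbit[OF S(4,3)] by simp
  qed
  then show ?thesis unfolding eventually_atin_within
    by (intro disjI2 exI[of _ "chart_nbhd d K S0 \<epsilon>"]) (simp add: in0 openin_chart_nbhd)
qed

theorem eigval_continuous_chart_empty:
  assumes d: "d > 0" and n: "n \<ge> 1" and A: "A \<in> O_K d {}"
  shows "limitin euclideanreal (eigval d a b P Q W n) (eigval d a b P Q W n A) (atin (bc_top d) A)"
proof -
  obtain S0 where S0: "S0 \<in> carrier_mat (2*d) (2*d)" "hermitian_mat S0" "A = orb {} S0"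
    using A bc_space_orbit unfolding O_K_def by blast
  \<comment> \<open>With empty \<open>K\<close> there is no inertia to change, so the shift is by 0
    and no eigenvalue escapes.\<close>
  have np: "npos {} S = 0" if "S \<in> carrier_mat (2*d) (2*d)" "hermitian_mat S" for S
    using npos_le[OF _ that, of "{}"] by simp
  show ?thesis unfolding limitin_canonical_iff tendsto_iff dist_real_def S0(3)
  proof (intro allI impI)
    fix e :: real assume e: "e > 0"
    obtain \<epsilon> where "\<epsilon> > 0" "\<forall>S\<in>carrier_mat (2*d) (2*d). hermitian_mat S \<longrightarrow> (\<forall>i<2*d. \<forall>j<2*d. cmod (S $$ (i, j) - S0 $$ (i, j)) < \<epsilon>) \<longrightarrow>
     npos {} S = npos {} S0 + 0 \<longrightarrow> \<bar>eigval d a b P Q W n (orb {} S) - eigval d a b P Q W (n - 0) (orb {} S0)\<bar> < e"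
      using eigval_jump_shift[OF d _ S0(1,2) _ e, of "{}" 0 n] n by auto
    then show "eventually (\<lambda>B. \<bar>eigval d a b P Q W n B - eigval d a b P Q W n (orb {} S0)\<bar> < e) (atin (bc_top d) (orb {} S0))"
      using eventually_chart[OF _ S0(1,2), of "{}" \<epsilon> 0 "\<lambda>B. \<bar>eigval d a b P Q W n B - eigval d a b P Q W n (orb {} S0)\<bar> < e" UNIV] np S0(1,2) by simp
  qed
qed

theorem eigval_limit_J_K:
  assumes d: "d > 0" and K: "K \<subseteq> {1..2*d}" and n: "n \<ge> 1" and A: "A \<in> J_K d K n00 n0p n0m" and np: "n0p \<le> np"
  shows "n \<le> np - n0p \<Longrightarrow> filterlim (eigval d a b P Q W n) at_bot (atin_within (bc_top d) A (J_K d K n0 np nm))"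
    and "n > np - n0p \<Longrightarrow> limitin euclideanreal (eigval d a b P Q W n) (eigval d a b P Q W (n - (np - n0p)) A)
              (atin_within (bc_top d) A (J_K d K n0 np nm))"
proof -
  obtain S0 where S0: "S0 \<in> carrier_mat (2*d) (2*d)" "hermitian_mat S0" "A = orb K S0" and i0: "inertia (sub_K K S0) = (n00, n0p, n0m)"
    using A bc_space_orbit unfolding J_K_def O_K_def by blast
  define k where "k = np - n0p"
  have J: "npos K S = npos K S0 + k"
    if B: "B \<in> J_K d K n0 np nm" and S: "S \<in> carrier_mat (2*d) (2*d)" "rep_K d K S \<in> B" "B \<in> bc_space d" for B S
  proof -
    obtain S' where S': "S' \<in> carrier_mat (2*d) (2*d)" "rep_K d K S' \<in> B" "inertia (sub_K K S') = (n0, np, nm)"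
      using B unfolding J_K_def by blast
    have "S = S'" by (rule chart_unique[OF S(3) S(1,2) S'(1,2)])
    then show ?thesis using S'(3) i0 np unfolding k_def by simp
  qed
  show "filterlim (eigval d a b P Q W n) at_bot (atin_within (bc_top d) A (J_K d K n0 np nm))" if nk: "n \<le> np - n0p"
    unfolding filterlim_at_bot_dense S0(3)
  proof
    fix z
    obtain \<epsilon> where "\<epsilon> > 0" "\<forall>S\<in>carrier_mat (2*d) (2*d). hermitian_mat S \<longrightarrow> (\<forall>i<2*d. \<forall>j<2*d. cmod (S $$ (i, j) - S0 $$ (i, j)) < \<epsilon>) \<longrightarrow>
     npos K S = npos K S0 + k \<longrightarrow> eigval d a b P Q W n (orb K S) < z"
      using eigval_jump_down[OF d K S0(1,2) n nk[folded k_def]] by blast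
    then show "eventually (\<lambda>B. eigval d a b P Q W n B < z) (atin_within (bc_top d) (orb K S0) (J_K d K n0 np nm))"
      by (rule eventually_chart[OF K S0(1,2)]) (rule J)
  qed
  show "limitin euclideanreal (eigval d a b P Q W n) (eigval d a b P Q W (n - (np - n0p)) A) (atin_within (bc_top d) A (J_K d K n0 np nm))"
    if nk: "n > np - n0p"
    unfolding limitin_canonical_iff tendsto_iff dist_real_def S0(3) k_def[symmetric]
  proof (intro allI impI)
    fix e :: real assume e: "e > 0"
    obtain \<epsilon> where "\<epsilon> > 0" "\<forall>S\<in>carrier_mat (2*d) (2*d). hermitian_mat S \<longrightarrow> (\<forall>i<2*d. \<forall>j<2*d. cmod (S $$ (i, j) - S0 $$ (i, j)) < \<epsilon>) \<longrightarrow>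
     npos K S = npos K S0 + k \<longrightarrow> \<bar>eigval d a b P Q W n (orb K S) - eigval d a b P Q W (n - k) (orb K S0)\<bar> < e"
      using eigval_jump_shift[OF d K S0(1,2) nk[folded k_def] e] by blast
    then show "eventually (\<lambda>B. \<bar>eigval d a b P Q W n B - eigval d a b P Q W (n - k) (orb K S0)\<bar> < e) (atin_within (bc_top d) (orb K S0) (J_K d K n0 np nm))"
      by (rule eventually_chart[OF K S0(1,2)]) (rule J)
  qed
qed

theorem singular_set_eq:
  assumes d: "d > 0"
  shows "singular_set d a b P Q W = {A \<in> bc_space d. n0B d A > 0}"
proof (intro Set.set_eqI iffI)
  fix A assume A: "A \<in> singular_set d a b P Q W"
  then have Ab: "A \<in> bc_space d" unfolding singular_set_def by blast
  then obtain M where M: "M \<in> bc_reps d" "A = GL_orbit d M" unfolding bc_space_def by blast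
  have "n0B d A \<noteq> 0"
  proof
    assume "n0B d A = 0"
    then have "det (pivot_block d {} M) \<noteq> 0" using n0B_eq_0_iff[OF M(1)] M(2) by simp
    then have "A \<in> O_K d {}" using chart_matrix_in_orbit[OF bc_repsD(1,3)[OF M(1)]] Ab M(2) unfolding O_K_def by blast
    then show False using A eigval_continuous_chart_empty[OF d] unfolding singular_set_def by blast
  qed
  then show "A \<in> {A \<in> bc_space d. n0B d A > 0}" using Ab by simp
next
  fix A assume A: "A \<in> {A \<in> bc_space d. n0B d A > 0}"
  then obtain M where M: "M \<in> bc_reps d" "A = GL_orbit d M" unfolding bc_space_def by blast
  have "det (pivot_block d {} M) = 0" using n0B_eq_0_iff[OF M(1)] A M(2) by auto
  then obtain K S where K: "K \<subseteq> {1..2*d}" "K \<noteq> {}" and S: "S \<in> carrier_mat (2*d) (2*d)" "hermitian_mat S" "rep_K d K S \<in> A"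
     and S0: "\<And>i j. i < 2*d \<Longrightarrow> j < 2*d \<Longrightarrow> Suc i \<in> K \<Longrightarrow> Suc j \<in> K \<Longrightarrow> S $$ (i, j) = 0"
    using chart_with_zero_block[OF M(1)] M(2) by metis
  have AK: "A = orb K S" using bc_space_orbit[OF _ S(3)] A by blast
  have cK: "card K \<ge> 1" using K finite_subset[OF K(1)] by (simp add: Suc_leI card_gt_0_iff)
  have np0: "npos K S = 0" using inertia_scalar_block[OF K(1), of S 0] S0 by simp
  have "\<not> limitin euclideanreal (eigval d a b P Q W 1) (eigval d a b P Q W 1 A) (atin (bc_top d) A)"
  proof
    define L where "L = eigval d a b P Q W 1 A"
    assume "limitin euclideanreal (eigval d a b P Q W 1) (eigval d a b P Q W 1 A) (atin (bc_top d) A)"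
    then have "eventually (\<lambda>B. \<bar>eigval d a b P Q W 1 B - L\<bar> < 1) (atin (bc_top d) A)"
      unfolding limitin_canonical_iff tendsto_iff dist_real_def L_def by simp
    then obtain T where T: "openin (bc_top d) T" "A \<in> T" "\<And>B. B \<in> T \<Longrightarrow> B \<noteq> A \<Longrightarrow> \<bar>eigval d a b P Q W 1 B - L\<bar> < 1"
      unfolding eventually_atin topspace_bc_top using A by blast
    obtain \<epsilon>1 where \<epsilon>1: "\<epsilon>1 > 0" "\<forall>S'\<in>carrier_mat (2*d) (2*d). hermitian_mat S' \<longrightarrow>
       (\<forall>i<2*d. \<forall>j<2*d. cmod (S' $$ (i, j) - S $$ (i, j)) < \<epsilon>1) \<longrightarrow> orb K S' \<in> T"
      using chart_continuous[OF T(1) S(1,2)] T(2) AK by blast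
    obtain \<epsilon>2 where \<epsilon>2: "\<epsilon>2 > 0" "\<forall>S'\<in>carrier_mat (2*d) (2*d). hermitian_mat S' \<longrightarrow>
       (\<forall>i<2*d. \<forall>j<2*d. cmod (S' $$ (i, j) - S $$ (i, j)) < \<epsilon>2) \<longrightarrow>
       npos K S' = npos K S + card K \<longrightarrow> eigval d a b P Q W 1 (orb K S') < L - 1"
      using eigval_jump_down[OF d K(1) S(1,2) _ cK] by blast
    define \<epsilon> where "\<epsilon> = min \<epsilon>1 \<epsilon>2 / 2"
    have \<epsilon>: "\<epsilon> > 0" "\<epsilon> < \<epsilon>1" "\<epsilon> < \<epsilon>2" using \<epsilon>1(1) \<epsilon>2(1) unfolding \<epsilon>_def by auto
    define S' where "S' = mat (2*d) (2*d) (\<lambda>(i, j). S $$ (i, j) + (if i = j \<and> Suc i \<in> K then complex_of_real \<epsilon> else 0))"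
    have S': "S' \<in> carrier_mat (2*d) (2*d)" by (simp add: S'_def)
    have e: "S' $$ (i, j) = S $$ (i, j) + (if i = j \<and> Suc i \<in> K then complex_of_real \<epsilon> else 0)" if "i < 2*d" "j < 2*d" for i j
      using that by (simp add: S'_def)
    have h: "hermitian_mat S'" unfolding hermitian_mat_def
    proof (rule eq_matI)
      fix i j assume "i < dim_row S'" "j < dim_col S'"
      then have ij: "i < 2*d" "j < 2*d" using S' by auto
      show "mat_adjoint S' $$ (i, j) = S' $$ (i, j)"
        unfolding mat_adjoint_index[OF S' ij] e[OF ij] e[OF ij(2,1)] hermitian_mat_entry[OF S(1,2) ij] by (cases "i = j") auto
    qed (use S' in \<open>auto simp: mat_adjoint_def\<close>)
    have near: "cmod (S' $$ (i, j) - S $$ (i, j)) \<le> \<epsilon>" if "i < 2*d" "j < 2*d" for i j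
      using e[OF that] \<epsilon>(1) by simp
    have np: "npos K S' = npos K S + card K"
      using inertia_scalar_block[OF K(1), of S' \<epsilon>] e S0 \<epsilon>(1) np0 by simp
    have "\<forall>i<2*d. \<forall>j<2*d. cmod (S' $$ (i, j) - S $$ (i, j)) < \<epsilon>1" using near \<epsilon>(2) le_less_trans by blast
    then have 1: "orb K S' \<in> T" using \<epsilon>1(2) S' h by blast
    have "\<forall>i<2*d. \<forall>j<2*d. cmod (S' $$ (i, j) - S $$ (i, j)) < \<epsilon>2" using near \<epsilon>(3) le_less_trans by blast
    then have 2: "eigval d a b P Q W 1 (orb K S') < L - 1" using \<epsilon>2(2) S' h np by blast
    \<comment> \<open>The limit disregards \<open>A\<close> itself, so the nearby boundary condition
      must differ from it; its first eigenvalue shows that it does.\<close>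
    then have "orb K S' \<noteq> A" unfolding L_def by auto
    from T(3)[OF 1 this] 2 show False by simp
  qed
  then show "A \<in> singular_set d a b P Q W" using A unfolding singular_set_def by blast
qed

end

theorem theorem7p1:
  fixes d :: nat and a b :: real and P Q W :: "real \<Rightarrow> nat \<Rightarrow> nat \<Rightarrow> real"
  assumes "d \<ge> 2" and "a < b" and "in_Omega d a b P Q W"
  shows "(\<forall>n\<ge>1. continuous_map (subtopology (bc_top d) (O_K d {})) euclideanreal
                   (eigval d a b P Q W n))
    \<and> (\<forall>K n0 np nm n00 n0p n0m A n.
         K \<subseteq> {1..2*d} \<and> K \<noteq> {} \<and> n \<ge> 1 \<and>
         n0 + np + nm = card K \<and> n00 + n0p + n0m = card K \<and>
         n0 < n00 \<and> n00 \<le> card K \<and> np \<ge> n0p \<and> nm \<ge> n0m \<and>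
         A \<in> J_K d K n00 n0p n0m \<longrightarrow>
         (n \<le> np - n0p \<longrightarrow>
            filterlim (eigval d a b P Q W n) at_bot (atin_within (bc_top d) A (J_K d K n0 np nm))) \<and>
         (n > np - n0p \<longrightarrow>
            limitin euclideanreal (eigval d a b P Q W n) (eigval d a b P Q W (n - (np - n0p)) A)
              (atin_within (bc_top d) A (J_K d K n0 np nm))))
    \<and> singular_set d a b P Q W = {A \<in> bc_space d. n0B d A > 0}"
proof -
  obtain P' Q' W' R C \<kappa> where co: "sl_coeffs d a b P' Q' W' R C \<kappa>"
    and ae: "AE t in lborel. t\<in>{a..b} \<longrightarrow> (\<forall>i<d. \<forall>j<d. P t i j = P' t i j \<and> Q t i j = Q' t i j \<and> W t i j = W' t i j)"
    using in_Omega_regular_version[OF assms(3,2)] by blast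
  interpret sl_coeffs d a b P' Q' W' R C \<kappa> by (rule co)
  have d: "d > 0" using assms(1) by simp
  \<comment> \<open>Eigenfunctions see the coefficients only almost everywhere on
    \<open>[a, b]\<close>, so the regular versions have the same eigenvalues.\<close>
  have eq: "eigval d a b P Q W = eigval d a b P' Q' W'" by (rule eigval_cong_AE[OF ae])
  have sing: "singular_set d a b P Q W = singular_set d a b P' Q' W'" unfolding singular_set_def eq ..
  show ?thesis unfolding eq sing
  proof (intro conjI allI impI)
    fix n :: nat assume n: "n \<ge> 1"
    show "continuous_map (subtopology (bc_top d) (O_K d {})) euclideanreal (eigval d a b P' Q' W' n)"
      unfolding continuous_map_atin topspace_subtopology
    proof
      fix A assume "A \<in> topspace (bc_top d) \<inter> O_K d {}"
      then have A: "A \<in> O_K d {}" by simp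
      show "limitin euclideanreal (eigval d a b P' Q' W' n) (eigval d a b P' Q' W' n A) (atin (subtopology (bc_top d) (O_K d {})) A)"
        unfolding atin_subtopology_within[OF A]
        by (rule limit_within_subset[OF eigval_continuous_chart_empty[OF d n A] subset_UNIV])
    qed
  next
    fix K n0 np nm n00 n0p n0m A and n :: nat
    assume H: "K \<subseteq> {1..2*d} \<and> K \<noteq> {} \<and> n \<ge> 1 \<and>
         n0 + np + nm = card K \<and> n00 + n0p + n0m = card K \<and>
         n0 < n00 \<and> n00 \<le> card K \<and> np \<ge> n0p \<and> nm \<ge> n0m \<and>
         A \<in> J_K d K n00 n0p n0m"
    then have "K \<subseteq> {1..2*d}" "n \<ge> 1" "A \<in> J_K d K n00 n0p n0m" "n0p \<le> np" by auto
    note * = eigval_limit_J_K[OF d this]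
    show "filterlim (eigval d a b P' Q' W' n) at_bot (atin_within (bc_top d) A (J_K d K n0 np nm))" if "n \<le> np - n0p"
      by (rule *(1)[OF that])
    show "limitin euclideanreal (eigval d a b P' Q' W' n) (eigval d a b P' Q' W' (n - (np - n0p)) A)
              (atin_within (bc_top d) A (J_K d K n0 np nm))" if "n > np - n0p"
      by (rule *(2)[OF that])
  next
    show "singular_set d a b P' Q' W' = {A \<in> bc_space d. n0B d A > 0}" by (rule singular_set_eq[OF d])
  qed
qed

end
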